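(* Let $X$ and $Y$ be compact metric spaces and let $\mathcal{S}$ be a weak$^*$-compact convex subset of $\mathcal{P}(X)\times\mathcal{P}(Y)$. The following are equivalent: (1) $\mathcal{S}$ is a gambling house. (2) $\mathcal{S}$ is a standard backward transfer set. (3) $\mathcal{S}=\{(\mu,\nu)\in\mathcal{P}(X)\times\mathcal{P}(Y):\ \mu\prec_{\mathcal{A}}\nu\}$, where $\mathcal{A}$ is a balayage cone on the disjoint union $X\sqcup Y$. (4) $(\mu,\nu)\in\mathcal{S}$ if and only if there exists $\pi\in\mathcal{K}(\mu,\nu)$ such that $(\delta_x,\pi_x)\in\mathcal{S}$ for $\mu$-almost every $x\in X$. (5) $\mathcal{S}=\{(\mu,\nu)\in\mathcal{P}(X)\times\mathcal{P}(Y):\ \nu\le T_\#\mu\}$, where $T:C(Y)\to USC(X)$ is a positively $1$-homogenous backward Kantorovich operator and $T_\#\mu(g):=\int_X Tg\,d\mu$ for every $g\in C(Y)$.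
   Context: Notation. $\mathcal{M}(X)$ is the space of signed Radon measures and $\mathcal{P}(X)$ the set of probability measures on $X$, with the weak$^*$ topology. $USC(X)$ (resp. $LSC(X)$) is the set of bounded above, proper, upper semi-continuous functions $X\to[-\infty,\infty)$ (resp. bounded below, proper, lower semi-continuous functions $X\to(-\infty,\infty]$); proper means finite at some point. $\mathcal{K}(\mu,\nu)$ is the set of $\pi\in\mathcal{P}(X\times Y)$ with marginals $\mu$ and $\nu$; $(\pi_x)_{x\in X}$ is the disintegration of $\pi$ with respect to $\mu$. $\nu\le T_\#\mu$ means $\int_Y g\,d\nu\le\int_X Tg\,d\mu$ for all $g\in C(Y)$. Backward linear transfer: a functional $\mathcal{T}:\mathcal{M}(X)\times\mathcal{M}(Y)\to\mathbb{R}\cup\{+\infty\}$ such that (i) it is proper, convex, bounded below and weak$^*$ lower semi-continuous; (ii) its effective domain $D(\mathcal{T})=\{\mathcal{T}<+\infty\}$ is contained in $\mathcal{P}(X)\times\mathcal{P}(Y)$; (iii) there is a map $T^-$ from $C(Y)$ to the bounded above Borel functions on $X$ such that for all $\mu\in\mathcal{P}(X)$, $g\in C(Y)$: $\sup_{\sigma\in\mathcal{P}(Y)}\{\int_Y g\,d\sigma-\mathcal{T}(\mu,\sigma)\}=\int_X T^-g\,d\mu$. A set $\mathcal{S}\subset\mathcal{P}(X)\times\mathcal{P}(Y)$ is a backward transfer set if the functional equal to $0$ on $\mathcal{S}$ and $+\infty$ elsewhere is a backward linear transfer. $\mathcal{S}$ is standard, also called a gambling house, if for each $x\in X$ there is $\sigma\in\mathcal{P}(Y)$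 with $(\delta_x,\sigma)\in\mathcal{S}$. Balayage cone on a compact metric space $\Omega$: a closed (under uniform convergence) convex cone $\mathcal{A}\subset LSC(\Omega)$, stable under finite maxima and containing the non-negative constants. For a balayage cone $\mathcal{A}$ on $X\sqcup Y$ and $(\mu,\nu)\in\mathcal{P}(X)\times\mathcal{P}(Y)$, $\mu\prec_{\mathcal{A}}\nu$ means $\int_X\phi\,d\mu\le\int_Y\phi\,d\nu$ for all $\phi\in\mathcal{A}$. Backward Kantorovich operator: a map $T:C(Y)\to USC(X)$ that is monotone; satisfies $T(g+c)=Tg+c$ for constants $c\in\mathbb{R}$; is convex, i.e. $T(\lambda g_1+(1-\lambda)g_2)\le\lambda Tg_1+(1-\lambda)Tg_2$ for $\lambda\in[0,1]$; and is lower semi-continuous, i.e. $g_n\to g$ uniformly implies $\liminf_n Tg_n\ge Tg$ pointwise. $T$ is positively $1$-homogenous if $T(\lambda g)=\lambda Tg$ for all $\lambda\ge0$.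
   Formalization: As written the equivalence fails: standard compact convex sets need not be transfer sets, and (3), (4) hold for some non-standard sets. Here gambling house means standard backward transfer set, so (1) and (2) coincide, and (3), (4) are stated with S standard. *)

theory Defs
  imports "HOL-Probability.Probability"
begin

text \<open>
  A compact metric space is a type of class \<^class>\<open>metric_space\<close> whose universe is compact; compactness
  is a hypothesis of the theorem. On such a space \<open>C(X)\<close> is the Banach space \<open>'a \<Rightarrow>\<^sub>C real\<close> of
  bounded continuous functions (so convergence in norm is uniform convergence), and every finite
  Borel measure is Radon.
\<close>

section \<open>Measures and the weak-star topology\<close>

abbreviation Prob :: "'a::topological_space measure set"
  where "Prob \<equiv> space (prob_algebra borel)"

lemma Prob_iff: "\<mu> \<in> Prob \<longleftrightarrow> prob_space \<mu> \<and> sets \<mu> = sets borel"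
  by (auto simp: space_prob_algebra)

text \<open>
  Signed measures are set functions, namely the differences of two finite positive Borel measures.
  Since \<^const>\<open>measure\<close> is \<open>0\<close> on non-Borel sets, a probability measure \<open>\<mu>\<close> corresponds to
  the element \<open>measure \<mu>\<close> of this space.
\<close>

definition signed_measures :: "('a::topological_space set \<Rightarrow> real) set" where
  "signed_measures = {\<lambda>A. measure P A - measure N A | P N.
     finite_measure P \<and> sets P = sets borel \<and> finite_measure N \<and> sets N = sets borel}"

text \<open>Independent of the chosen decomposition, see \<open>signed_integral_diff\<close> below.\<close>

definition signed_integral ::
    "('a::topological_space set \<Rightarrow> real) \<Rightarrow> ('a \<Rightarrow>\<^sub>C real) \<Rightarrow> real" where
  "signed_integral m g = (THE c. \<exists>P N.
     finite_measure P \<and> sets P = sets borel \<and> finite_measure N \<and> sets N = sets borel \<and>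
     m = (\<lambda>A. measure P A - measure N A) \<and> c = (\<integral>x. g x \<partial>P) - (\<integral>x. g x \<partial>N))"

definition signed_weak_star :: "('a::topological_space set \<Rightarrow> real) topology" where
  "signed_weak_star = pullback_topology signed_measures signed_integral euclidean"

definition weak_star :: "'a::topological_space measure topology" where
  "weak_star = pullback_topology Prob (\<lambda>\<mu> (g :: 'a \<Rightarrow>\<^sub>C real). \<integral>x. g x \<partial>\<mu>) euclidean"

definition signed_pair ::
    "'a measure \<times> 'b measure \<Rightarrow> ('a set \<Rightarrow> real) \<times> ('b set \<Rightarrow> real)" where
  "signed_pair = map_prod measure measure"

definition mix :: "real \<Rightarrow> ('a set \<Rightarrow> real) \<times> ('b set \<Rightarrow> real) \<Rightarrow>
    ('a set \<Rightarrow> real) \<times> ('b set \<Rightarrow> real) \<Rightarrow> ('a set \<Rightarrow> real) \<times> ('b set \<Rightarrow> real)" where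
  "mix t p q = (\<lambda>A. (1 - t) * fst p A + t * fst q A, \<lambda>B. (1 - t) * snd p B + t * snd q B)"

definition convex_measures :: "('a measure \<times> 'b measure) set \<Rightarrow> bool" where
  "convex_measures S \<longleftrightarrow>
     (\<forall>p\<in>signed_pair ` S. \<forall>q\<in>signed_pair ` S. \<forall>t\<in>{0..1}. mix t p q \<in> signed_pair ` S)"

text \<open>
  The integral of an extended real function that is bounded above or bounded below, with values in
  \<open>[-\<infinity>,\<infinity>]\<close>. For such a function and a finite measure at most one of the two terms is infinite.
\<close>

definition eintegral :: "'a measure \<Rightarrow> ('a \<Rightarrow> ereal) \<Rightarrow> ereal" where
  "eintegral \<mu> f = enn2ereal (\<integral>\<^sup>+x. e2ennreal (f x) \<partial>\<mu>) - enn2ereal (\<integral>\<^sup>+x. e2ennreal (- f x) \<partial>\<mu>)"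

section \<open>Semicontinuous functions\<close>

definition lsc :: "'c topology \<Rightarrow> ('c \<Rightarrow> ereal) \<Rightarrow> bool" where
  "lsc \<Omega> f \<longleftrightarrow> (\<forall>a. openin \<Omega> {x \<in> topspace \<Omega>. a < f x})"

definition usc :: "'c topology \<Rightarrow> ('c \<Rightarrow> ereal) \<Rightarrow> bool" where
  "usc \<Omega> f \<longleftrightarrow> (\<forall>a. openin \<Omega> {x \<in> topspace \<Omega>. f x < a})"

definition LSC :: "'c topology \<Rightarrow> ('c \<Rightarrow> ereal) set" where
  "LSC \<Omega> = {f. (\<exists>c::real. \<forall>x\<in>topspace \<Omega>. ereal c \<le> f x) \<and>
                (\<exists>x\<in>topspace \<Omega>. \<bar>f x\<bar> \<noteq> \<infinity>) \<and> lsc \<Omega> f}"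

definition USC :: "'c topology \<Rightarrow> ('c \<Rightarrow> ereal) set" where
  "USC \<Omega> = {f. (\<exists>c::real. \<forall>x\<in>topspace \<Omega>. f x \<le> ereal c) \<and>
                (\<exists>x\<in>topspace \<Omega>. \<bar>f x\<bar> \<noteq> \<infinity>) \<and> usc \<Omega> f}"

section \<open>Transfers\<close>

text \<open>The values of the functional outside the signed measures are irrelevant.\<close>

definition backward_linear_transfer ::
    "(('a::metric_space set \<Rightarrow> real) \<times> ('b::metric_space set \<Rightarrow> real) \<Rightarrow> ereal) \<Rightarrow> bool" where
  "backward_linear_transfer F \<longleftrightarrow>
     (\<exists>p \<in> signed_measures \<times> signed_measures. F p < \<infinity>) \<and>
     (\<forall>p \<in> signed_measures \<times> signed_measures. \<forall>q \<in> signed_measures \<times> signed_measures.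
        \<forall>t::real\<in>{0..1}. F (mix t p q) \<le> ereal (1 - t) * F p + ereal t * F q) \<and>
     (\<exists>c::real. \<forall>p \<in> signed_measures \<times> signed_measures. ereal c \<le> F p) \<and>
     lsc (prod_topology signed_weak_star signed_weak_star) F \<and>
     (\<forall>p \<in> signed_measures \<times> signed_measures. F p < \<infinity> \<longrightarrow> p \<in> signed_pair ` (Prob \<times> Prob)) \<and>
     (\<exists>Tm :: ('b \<Rightarrow>\<^sub>C real) \<Rightarrow> 'a \<Rightarrow> ereal.
        (\<forall>g. Tm g \<in> borel_measurable borel \<and> (\<exists>c::real. \<forall>x. Tm g x \<le> ereal c)) \<and>
        (\<forall>\<mu>\<in>Prob. \<forall>g. (SUP \<sigma>\<in>Prob. ereal (\<integral>y. apply_bcontfun g y \<partial>\<sigma>) - F (signed_pair (\<mu>, \<sigma>)))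
                        = eintegral \<mu> (Tm g)))"

definition backward_transfer_set ::
    "('a::metric_space measure \<times> 'b::metric_space measure) set \<Rightarrow> bool" where
  "backward_transfer_set S \<longleftrightarrow>
     S \<subseteq> Prob \<times> Prob \<and> backward_linear_transfer (\<lambda>p. if p \<in> signed_pair ` S then 0 else \<infinity>)"

definition standard_set ::
    "('a::metric_space measure \<times> 'b::metric_space measure) set \<Rightarrow> bool" where
  "standard_set S \<longleftrightarrow> (\<forall>x. \<exists>\<sigma>\<in>Prob. (return borel x, \<sigma>) \<in> S)"

text \<open>
  \<^emph>\<open>Gambling house\<close> is another name for a backward transfer set that is standard. A compact convex set
  that merely satisfies \<^const>\<open>standard_set\<close> need not be a transfer set.
\<close>

definition gambling_house ::
    "('a::metric_space measure \<times> 'b::metric_space measure) set \<Rightarrow> bool" where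
  "gambling_house S \<longleftrightarrow> backward_transfer_set S \<and> standard_set S"

section \<open>Balayage cones\<close>

text \<open>
  Uniform convergence of functions with values in \<open>(-\<infinity>,\<infinity>]\<close>: written additively, so that the limit and
  the approximants are eventually infinite at the same points.
\<close>

definition euniform_limit ::
    "'c set \<Rightarrow> (nat \<Rightarrow> 'c \<Rightarrow> ereal) \<Rightarrow> ('c \<Rightarrow> ereal) \<Rightarrow> bool" where
  "euniform_limit A f l \<longleftrightarrow> (\<forall>e::real>0. \<forall>\<^sub>F n in sequentially.
     \<forall>x\<in>A. f n x \<le> l x + ereal e \<and> l x \<le> f n x + ereal e)"

definition balayage_cone :: "'c topology \<Rightarrow> ('c \<Rightarrow> ereal) set \<Rightarrow> bool" where
  "balayage_cone \<Omega> A \<longleftrightarrow>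
     A \<subseteq> LSC \<Omega> \<and>
     (\<forall>f l. (\<forall>n. f n \<in> A) \<and> euniform_limit (topspace \<Omega>) f l \<longrightarrow> l \<in> A) \<and>
     (\<forall>\<phi>\<in>A. \<forall>\<psi>\<in>A. (\<lambda>x. \<phi> x + \<psi> x) \<in> A) \<and>
     (\<forall>\<phi>\<in>A. \<forall>c::real\<ge>0. (\<lambda>x. ereal c * \<phi> x) \<in> A) \<and>
     (\<forall>\<phi>\<in>A. \<forall>\<psi>\<in>A. (\<lambda>x. max (\<phi> x) (\<psi> x)) \<in> A) \<and>
     (\<forall>c::real\<ge>0. (\<lambda>x. ereal c) \<in> A)"

definition disjoint_union_topology :: "('a::topological_space + 'b::topological_space) topology" where
  "disjoint_union_topology = topology (\<lambda>U. open (Inl -` U) \<and> open (Inr -` U))"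

definition balayage_order ::
    "('a::metric_space + 'b::metric_space \<Rightarrow> ereal) set \<Rightarrow> 'a measure \<Rightarrow> 'b measure \<Rightarrow> bool" where
  "balayage_order A \<mu> \<nu> \<longleftrightarrow>
     (\<forall>\<phi>\<in>A. eintegral \<mu> (\<lambda>x. \<phi> (Inl x)) \<le> eintegral \<nu> (\<lambda>y. \<phi> (Inr y)))"

section \<open>Couplings and disintegration\<close>

definition couplings ::
    "'a::metric_space measure \<Rightarrow> 'b::metric_space measure \<Rightarrow> ('a \<times> 'b) measure set" where
  "couplings \<mu> \<nu> = {\<pi> \<in> Prob. distr \<pi> borel fst = \<mu> \<and> distr \<pi> borel snd = \<nu>}"

definition disintegration ::
    "('a::metric_space \<times> 'b::metric_space) measure \<Rightarrow> 'a measure \<Rightarrow> ('a \<Rightarrow> 'b measure) \<Rightarrow> bool" where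
  "disintegration \<pi> \<mu> \<kappa> \<longleftrightarrow>
     \<kappa> \<in> borel \<rightarrow>\<^sub>M prob_algebra borel \<and>
     (\<forall>A\<in>sets borel. \<forall>B\<in>sets borel. emeasure \<pi> (A \<times> B) = (\<integral>\<^sup>+x\<in>A. emeasure (\<kappa> x) B \<partial>\<mu>))"

section \<open>Kantorovich operators\<close>

definition backward_Kantorovich_operator ::
    "(('b::metric_space \<Rightarrow>\<^sub>C real) \<Rightarrow> 'a::metric_space \<Rightarrow> ereal) \<Rightarrow> bool" where
  "backward_Kantorovich_operator T \<longleftrightarrow>
     (\<forall>g. T g \<in> USC euclidean) \<and>
     (\<forall>g h. (\<forall>y. apply_bcontfun g y \<le> apply_bcontfun h y) \<longrightarrow> (\<forall>x. T g x \<le> T h x)) \<and>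
     (\<forall>g c x. T (g + const_bcontfun c) x = T g x + ereal c) \<and>
     (\<forall>g h x. \<forall>t::real\<in>{0..1}.
        T (t *\<^sub>R g + (1 - t) *\<^sub>R h) x \<le> ereal t * T g x + ereal (1 - t) * T h x) \<and>
     (\<forall>gs g x. gs \<longlonglongrightarrow> g \<longrightarrow> T g x \<le> liminf (\<lambda>n. T (gs n) x))"

definition positively_1_homogenous ::
    "(('b::metric_space \<Rightarrow>\<^sub>C real) \<Rightarrow> 'a::metric_space \<Rightarrow> ereal) \<Rightarrow> bool" where
  "positively_1_homogenous T \<longleftrightarrow> (\<forall>g x. \<forall>c::real\<ge>0. T (c *\<^sub>R g) x = ereal c * T g x)"

definition dominated_by_push ::
    "(('b::metric_space \<Rightarrow>\<^sub>C real) \<Rightarrow> 'a::metric_space \<Rightarrow> ereal) \<Rightarrow> 'a measure \<Rightarrow> 'b measure \<Rightarrow> bool" where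
  "dominated_by_push T \<mu> \<nu> \<longleftrightarrow> (\<forall>g. ereal (\<integral>y. apply_bcontfun g y \<partial>\<nu>) \<le> eintegral \<mu> (T g))"

section \<open>Well-definedness\<close>

lemma openin_disjoint_union_topology:
  "openin disjoint_union_topology U \<longleftrightarrow> open (Inl -` U) \<and> open (Inr -` U)"
proof -
  have "istopology (\<lambda>U :: ('a + 'b) set. open (Inl -` U) \<and> open (Inr -` U))"
    unfolding istopology_def by (auto simp: vimage_Union)
  then show ?thesis
    unfolding disjoint_union_topology_def by (simp add: topology_inverse')
qed

lemma topspace_disjoint_union_topology [simp]: "topspace disjoint_union_topology = UNIV"
  unfolding topspace_def using openin_disjoint_union_topology[of UNIV] by auto

lemma nn_integral_add_measures_cong:
  assumes sets: "sets P = M" "sets N = M" "sets P' = M" "sets N' = M"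
    and eq: "\<And>A. A \<in> M \<Longrightarrow> emeasure P A + emeasure N' A = emeasure P' A + emeasure N A"
    and f: "f \<in> borel_measurable P"
  shows "(\<integral>\<^sup>+x. f x \<partial>P) + (\<integral>\<^sup>+x. f x \<partial>N') = (\<integral>\<^sup>+x. f x \<partial>P') + (\<integral>\<^sup>+x. f x \<partial>N)"
proof -
  have m: "measurable N' borel = measurable P (borel::ennreal measure)"
    "measurable P' borel = measurable P (borel::ennreal measure)"
    "measurable N borel = measurable P (borel::ennreal measure)"
    using sets by (auto intro!: measurable_cong_sets)
  have sp: "space N' = space P" "space P' = space P" "space N = space P"
    using sets by (auto intro!: sets_eq_imp_space_eq)
  show ?thesis
    using f
  proof (induction rule: borel_measurable_induct)
    case (cong f g)
    then have "(\<integral>\<^sup>+x. f x \<partial>Q) = (\<integral>\<^sup>+x. g x \<partial>Q)" if "space Q = space P" for Q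
      using that by (auto intro!: nn_integral_cong)
    with cong sp show ?case by auto
  next
    case (set A)
    then show ?case using eq sets by (simp add: sets)
  next
    case (mult u c)
    then show ?case by (simp add: nn_integral_cmult m distrib_left[symmetric])
  next
    case (add u v)
    then show ?case by (simp add: nn_integral_add m) (metis (no_types, lifting) add.assoc add.left_commute)
  next
    case (seq U)
    have *: "(\<integral>\<^sup>+x. (SUP i. U i) x \<partial>Q) = (SUP i. \<integral>\<^sup>+x. U i x \<partial>Q)"
      if "measurable Q borel = measurable P (borel::ennreal measure)" for Q
      unfolding SUP_apply by (rule nn_integral_monotone_convergence_SUP) (use seq that in auto)
    have inc: "incseq (\<lambda>i. \<integral>\<^sup>+x. U i x \<partial>Q)" for Q
      using \<open>incseq U\<close> by (auto simp: incseq_def le_fun_def intro!: nn_integral_mono)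
    show ?case
      by (subst (1 2 3 4) *) (auto simp: m ennreal_SUP_add[symmetric] inc seq.IH)
  qed
qed

lemma signed_integral_diff:
  assumes "finite_measure P" "sets P = sets borel" "finite_measure N" "sets N = sets borel"
  shows "signed_integral (\<lambda>A. measure P A - measure N A) g = (\<integral>x. g x \<partial>P) - (\<integral>x. g x \<partial>N)"
proof -
  have "(\<integral>x. g x \<partial>P) - (\<integral>x. g x \<partial>N) = (\<integral>x. g x \<partial>P') - (\<integral>x. g x \<partial>N')"
    if *: "finite_measure P'" "sets P' = sets borel" "finite_measure N'" "sets N' = sets borel"
      "(\<lambda>A. measure P A - measure N A) = (\<lambda>A. measure P' A - measure N' A)" for P' N'
  proof -
    note fin = assms(1,3) *(1,3)
    have meq: "measure P A + measure N' A = measure P' A + measure N A" for A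
      using fun_cong[OF *(5), of A] by simp
    have eq: "emeasure P A + emeasure N' A = emeasure P' A + emeasure N A" for A
      using meq[of A] fin by (simp add: finite_measure.emeasure_eq_measure ennreal_plus[symmetric] del: ennreal_plus)
    have [measurable]: "apply_bcontfun g \<in> borel_measurable Q" if "sets Q = sets borel" for Q
      using borel_measurable_continuous_onI[of "apply_bcontfun g"] that
      by (simp add: cong: measurable_cong_sets)
    have int: "integrable Q (apply_bcontfun g)" if "finite_measure Q" "sets Q = sets borel" for Q
    proof -
      interpret finite_measure Q by fact
      show ?thesis using that by (intro integrable_const_bound[of _ "norm g"])
          (auto simp: norm_bounded[of g, unfolded real_norm_def])
    qed
    define G where "G = (\<lambda>x. g x + norm g)"
    have G0: "G x \<ge> 0" for x
      using norm_bounded[of g x] by (auto simp: G_def)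
    have iG: "integrable Q G" and GQ: "(\<integral>x. G x \<partial>Q) = (\<integral>x. g x \<partial>Q) + norm g * measure Q UNIV"
      if "finite_measure Q" "sets Q = sets borel" for Q
    proof -
      interpret finite_measure Q by fact
      show "integrable Q G" "(\<integral>x. G x \<partial>Q) = (\<integral>x. g x \<partial>Q) + norm g * measure Q UNIV"
        using int[OF that] sets_eq_imp_space_eq[OF that(2)] by (auto simp: G_def)
    qed
    have nn: "(\<integral>\<^sup>+x. ennreal (G x) \<partial>Q) = ennreal (\<integral>x. G x \<partial>Q)" "0 \<le> (\<integral>x. G x \<partial>Q)"
      if "finite_measure Q" "sets Q = sets borel" for Q
      using iG[OF that] G0 by (auto intro!: nn_integral_eq_integral)
    have "(\<integral>\<^sup>+x. ennreal (G x) \<partial>P) + (\<integral>\<^sup>+x. ennreal (G x) \<partial>N')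
        = (\<integral>\<^sup>+x. ennreal (G x) \<partial>P') + (\<integral>\<^sup>+x. ennreal (G x) \<partial>N)"
      using iG[OF assms(1,2)] assms *(1-4)
      by (intro nn_integral_add_measures_cong[of _ "sets borel"]) (auto simp: eq)
    then have "(\<integral>x. G x \<partial>P) + (\<integral>x. G x \<partial>N') = (\<integral>x. G x \<partial>P') + (\<integral>x. G x \<partial>N)"
      using nn assms *(1-4) by (simp add: ennreal_plus[symmetric] del: ennreal_plus)
    moreover have "norm g * measure P UNIV + norm g * measure N' UNIV
        = norm g * measure P' UNIV + norm g * measure N UNIV"
      using meq[of UNIV] by (simp add: distrib_left[symmetric])
    ultimately show ?thesis
      using GQ assms *(1-4) by simp
  qed
  note unique = this
  show ?thesis
    unfolding signed_integral_def
  proof (rule the_equality, goal_cases)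
    case 1
    show ?case using assms by (intro exI[of _ P] exI[of _ N]) simp
  next
    case (2 c)
    then show ?case using unique by (elim exE conjE) simp
  qed
qed

lemma finite_null_measure: "finite_measure (null_measure M)"
  by (auto intro!: finite_measureI)

lemma measure_in_signed_measures:
  assumes "\<mu> \<in> Prob"
  shows "measure \<mu> \<in> signed_measures"
proof -
  have "measure \<mu> = (\<lambda>A. measure \<mu> A - measure (null_measure borel) A)"
    by simp
  then show ?thesis
    using assms finite_null_measure[of borel] unfolding signed_measures_def
    by (fastforce simp: Prob_iff prob_space_def)
qed

lemma signed_integral_measure:
  assumes "\<mu> \<in> Prob"
  shows "signed_integral (measure \<mu>) g = (\<integral>x. g x \<partial>\<mu>)"
  using signed_integral_diff[of \<mu> "null_measure borel" g] assms finite_null_measure[of borel]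
  by (auto simp: Prob_iff prob_space_def)

end

theory Submission
  imports Defs
begin

text \<open>
  Everything is compared with a real-valued positively homogeneous operator \<open>T\<close>. A gambling house
  \<open>S\<close> determines \<open>T g(x) = sup {\<integral> g d\<sigma> | (\<delta>\<^sub>x, \<sigma>) \<in> S}\<close>, and separation in the compact convex fibres
  of \<open>S\<close> identifies \<open>S\<close> with the pairs satisfying \<open>\<integral> g d\<nu> \<le> \<integral> T g d\<mu>\<close> for all \<open>g\<close>. Conversely, for any \<open>T\<close>
  the theorem of Hahn and Banach together with the Riesz representation theorem shows that
  \<open>\<integral> T g d\<mu>\<close> is attained, which is the transfer property. Applied on \<open>X \<times> Y\<close> the same tools give Strassen's
  theorem, which is the disintegration property.

  The cone belonging to \<open>T\<close> consists of the functions with \<open>\<phi>\<close> continuous on \<open>Y\<close> and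
  \<open>\<phi> \<le> - T (- \<phi>)\<close> on \<open>X\<close>. For an arbitrary balayage cone, stability under maxima allows one to split a pair
  \<open>(\<mu>, \<nu>)\<close> in \<open>S\<close> along a finite partition of \<open>X\<close>: the pieces respect all functions of the cone with
  finite \<open>\<nu>\<close>-integral, hence mixing them with a little of \<open>(\<mu>, \<nu>)\<close> respects the whole cone. Refining
  the partition and using that \<open>S\<close> is compact, the pieces concentrate near the fibres over Dirac measures.
\<close>

section \<open>The Mazur--Orlicz theorem\<close>

text \<open>The Mazur--Orlicz theorem is preferred to an extension theorem because each construction
  seeks a functional that lies below a sublinear one and also obeys lower bounds: attainment asks
  for one value, the coupling for a given second marginal, the splitting for one bound per cell and
  per function of the cone. The work then lies in checking that these bounds are compatible with the
  sublinear functional.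

  The obstacle in a general balayage cone is that its members are merely lower semicontinuous and
  may be infinite. The order therefore cannot be tested on countably many continuous functions and
  disintegrated directly, and a member whose integral against \<open>\<nu>\<close> is infinite says
  nothing about \<open>(\<mu>, \<nu>)\<close> although it may fail on a piece of it.

  Standardness is a separate conjunct of the cone condition and of the disintegration condition
  because the empty set satisfies both of these; for the former take the cone of all real-valued
  lower semicontinuous functions, which contains the indicator of \<open>X\<close>.\<close>

definition function_space :: "('i \<Rightarrow> real) set \<Rightarrow> bool" where
  "function_space V \<longleftrightarrow> (\<lambda>_. 0) \<in> V \<and> (\<forall>f\<in>V. \<forall>g\<in>V. (\<lambda>x. f x + g x) \<in> V) \<and>
     (\<forall>c. \<forall>f\<in>V. (\<lambda>x. c * f x) \<in> V)"

definition sublinear_on :: "('i \<Rightarrow> real) set \<Rightarrow> (('i \<Rightarrow> real) \<Rightarrow> real) \<Rightarrow> bool" where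
  "sublinear_on V p \<longleftrightarrow> (\<forall>f\<in>V. \<forall>g\<in>V. p (\<lambda>x. f x + g x) \<le> p f + p g) \<and>
     (\<forall>f\<in>V. \<forall>c\<ge>0. p (\<lambda>x. c * f x) = c * p f)"

definition linear_functional_on :: "('i \<Rightarrow> real) set \<Rightarrow> (('i \<Rightarrow> real) \<Rightarrow> real) \<Rightarrow> bool" where
  "linear_functional_on V L \<longleftrightarrow> (\<forall>f\<in>V. \<forall>g\<in>V. L (\<lambda>x. f x + g x) = L f + L g) \<and>
     (\<forall>f\<in>V. \<forall>c. L (\<lambda>x. c * f x) = c * L f)"

text \<open>A pair \<open>(v, b)\<close> stands for the demand \<open>b \<le> L v\<close> on a
  functional still to be found. Such demands add up and scale, so nothing is lost by closing them
  under both operations.\<close>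

definition bound_cone :: "(('i \<Rightarrow> real) \<times> real) set \<Rightarrow> bool" where
  "bound_cone C \<longleftrightarrow> (\<lambda>_. 0, 0) \<in> C \<and>
     (\<forall>v b w d. (v, b) \<in> C \<longrightarrow> (w, d) \<in> C \<longrightarrow> ((\<lambda>x. v x + w x), b + d) \<in> C) \<and>
     (\<forall>v b. \<forall>c\<ge>0. (v, b) \<in> C \<longrightarrow> ((\<lambda>x. c * v x), c * b) \<in> C)"

lemma function_spaceD:
  assumes "function_space V"
  shows "(\<lambda>_. 0) \<in> V" "f \<in> V \<Longrightarrow> g \<in> V \<Longrightarrow> (\<lambda>x. f x + g x) \<in> V"
    "f \<in> V \<Longrightarrow> (\<lambda>x. c * f x) \<in> V" "f \<in> V \<Longrightarrow> (\<lambda>x. - f x) \<in> V"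
    "f \<in> V \<Longrightarrow> g \<in> V \<Longrightarrow> (\<lambda>x. f x - g x) \<in> V"
proof -
  show a: "(\<lambda>_. 0) \<in> V" "\<And>f g. f \<in> V \<Longrightarrow> g \<in> V \<Longrightarrow> (\<lambda>x. f x + g x) \<in> V"
    "\<And>f c. f \<in> V \<Longrightarrow> (\<lambda>x. c * f x) \<in> V"
    using assms by (auto simp: function_space_def)
  show b: "\<And>f. f \<in> V \<Longrightarrow> (\<lambda>x. - f x) \<in> V" using a(3)[of _ "-1"] by simp
  show "f \<in> V \<Longrightarrow> g \<in> V \<Longrightarrow> (\<lambda>x. f x - g x) \<in> V" using a(2)[of f "\<lambda>x. - g x"] b by simp
qed

lemma sublinear_onD:
  assumes "sublinear_on V p"
  shows "f \<in> V \<Longrightarrow> g \<in> V \<Longrightarrow> p (\<lambda>x. f x + g x) \<le> p f + p g"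
    "f \<in> V \<Longrightarrow> c \<ge> 0 \<Longrightarrow> p (\<lambda>x. c * f x) = c * p f"
  using assms by (auto simp: sublinear_on_def)

lemma sublinear_on_zero:
  assumes "function_space V" "sublinear_on V p"
  shows "p (\<lambda>_. 0) = 0"
  using sublinear_onD(2)[OF assms(2), of "\<lambda>_. 0" 0] function_spaceD(1)[OF assms(1)] by simp

lemma linear_functional_onD:
  assumes "linear_functional_on V L"
  shows "f \<in> V \<Longrightarrow> g \<in> V \<Longrightarrow> L (\<lambda>x. f x + g x) = L f + L g"
    "f \<in> V \<Longrightarrow> L (\<lambda>x. c * f x) = c * L f"
    "f \<in> V \<Longrightarrow> L (\<lambda>x. - f x) = - L f"
proof -
  show "f \<in> V \<Longrightarrow> g \<in> V \<Longrightarrow> L (\<lambda>x. f x + g x) = L f + L g"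
    and *: "f \<in> V \<Longrightarrow> L (\<lambda>x. c * f x) = c * L f" for c
    using assms by (auto simp: linear_functional_on_def)
  show "f \<in> V \<Longrightarrow> L (\<lambda>x. - f x) = - L f" using *[of "-1"] by simp
qed

lemma linear_functional_on_diff:
  assumes "function_space V" "linear_functional_on V L" "f \<in> V" "g \<in> V"
  shows "L (\<lambda>x. f x - g x) = L f - L g"
  using linear_functional_onD(1)[OF assms(2,3), of "\<lambda>x. - g x"] linear_functional_onD(3)[OF assms(2,4)]
    function_spaceD(4)[OF assms(1,4)] by simp

text \<open>The infimal convolution of \<open>p\<close> with the demands. It is finite because
  \<open>b \<le> p v\<close> and subadditivity bound it below by \<open>- p (- f)\<close>, and the
  choice \<open>f = - v\<close> makes the term of \<open>(v, b)\<close> equal to \<open>- b\<close>: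
  every linear functional below \<open>q\<close> meets all demands.\<close>

lemma sublinear_on_reduce:
  assumes V: "function_space V" and p: "sublinear_on V p"
    and C: "bound_cone C" and Cle: "\<forall>v b. (v, b) \<in> C \<longrightarrow> v \<in> V \<and> b \<le> p v"
  shows "\<exists>q. sublinear_on V q \<and> (\<forall>f\<in>V. q f \<le> p f) \<and> (\<forall>v b. (v, b) \<in> C \<longrightarrow> q (\<lambda>x. - v x) \<le> - b)"
proof -
  note V' = function_spaceD[OF V] and p' = sublinear_onD[OF p]
  have CV: "v \<in> V" and le: "b \<le> p v" if "(v, b) \<in> C" for v b using Cle that by auto
  define q where "q f = (INF (v, b)\<in>C. p (\<lambda>x. f x + v x) - b)" for f
  have C0: "(\<lambda>_. 0, 0) \<in> C"
    and Cadd: "\<And>v b w d. (v, b) \<in> C \<Longrightarrow> (w, d) \<in> C \<Longrightarrow> ((\<lambda>x. v x + w x), b + d) \<in> C"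
    and Cmul: "\<And>v b c. c \<ge> 0 \<Longrightarrow> (v, b) \<in> C \<Longrightarrow> ((\<lambda>x. c * v x), c * b) \<in> C"
    using C unfolding bound_cone_def by blast+
  have lower: "- p (\<lambda>x. - f x) \<le> p (\<lambda>x. f x + v x) - b" if "f \<in> V" "(v, b) \<in> C" for f v b
  proof -
    have "p (\<lambda>x. (f x + v x) + (- f x)) \<le> p (\<lambda>x. f x + v x) + p (\<lambda>x. - f x)"
      using that CV by (intro p' V') auto
    with le[OF that(2)] show ?thesis by simp
  qed
  have bdd: "bdd_below ((\<lambda>(v, b). p (\<lambda>x. f x + v x) - b) ` C)" if "f \<in> V" for f
    using lower[OF that] by (intro bdd_belowI2[of _ "- p (\<lambda>x. - f x)"]) auto
  have q_le: "q f \<le> p (\<lambda>x. f x + v x) - b" if "f \<in> V" "(v, b) \<in> C" for f v b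
    unfolding q_def using cINF_lower[OF bdd[OF that(1)] that(2)] by simp
  have q_ge: "a \<le> q f" if "\<And>v b. (v, b) \<in> C \<Longrightarrow> a \<le> p (\<lambda>x. f x + v x) - b" for a f
    unfolding q_def using C0 that by (intro cINF_greatest) auto
  have qp: "q f \<le> p f" if "f \<in> V" for f
    using q_le[OF that C0] by simp
  have qC: "q (\<lambda>x. - v x) \<le> - b" if "(v, b) \<in> C" for v b
    using q_le[OF V'(4)[OF CV[OF that]] that] sublinear_on_zero[OF V p] by simp
  have add: "q (\<lambda>x. f x + g x) \<le> q f + q g" if fg: "f \<in> V" "g \<in> V" for f g
  proof -
    have "q (\<lambda>x. f x + g x) - (p (\<lambda>x. g x + w x) - d) \<le> q f" if wd: "(w, d) \<in> C" for w d
    proof (rule q_ge)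
      fix v b assume vb: "(v, b) \<in> C"
      have "q (\<lambda>x. f x + g x) \<le> p (\<lambda>x. (f x + g x) + (v x + w x)) - (b + d)"
        using fg wd vb by (intro q_le V' Cadd)
      also have "(\<lambda>x. (f x + g x) + (v x + w x)) = (\<lambda>x. (f x + v x) + (g x + w x))" by auto
      also have "p \<dots> \<le> p (\<lambda>x. f x + v x) + p (\<lambda>x. g x + w x)"
        using fg wd vb CV by (intro p' V') auto
      finally show "q (\<lambda>x. f x + g x) - (p (\<lambda>x. g x + w x) - d) \<le> p (\<lambda>x. f x + v x) - b" by simp
    qed
    then have "q (\<lambda>x. f x + g x) - q f \<le> q g" by (intro q_ge) (fastforce simp: algebra_simps)
    then show ?thesis by simp
  qed
  have mul_le: "q (\<lambda>x. c * f x) \<le> c * q f" if f: "f \<in> V" and c: "c > 0" for f c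
  proof -
    have "q (\<lambda>x. c * f x) / c \<le> q f"
    proof (rule q_ge)
      fix v b assume vb: "(v, b) \<in> C"
      have "q (\<lambda>x. c * f x) \<le> p (\<lambda>x. c * f x + c * v x) - c * b"
        using f vb c by (intro q_le V' Cmul) auto
      also have "(\<lambda>x. c * f x + c * v x) = (\<lambda>x. c * (f x + v x))" by (auto simp: algebra_simps)
      also have "p \<dots> = c * p (\<lambda>x. f x + v x)"
        using f vb c CV by (intro p' V') auto
      finally show "q (\<lambda>x. c * f x) / c \<le> p (\<lambda>x. f x + v x) - b" using c by (simp add: field_simps)
    qed
    then show ?thesis using c by (simp add: field_simps)
  qed
  have q0: "q (\<lambda>_. 0) = 0"
    using qp[OF V'(1)] sublinear_on_zero[OF V p] q_ge[of 0 "\<lambda>_. 0"] le by fastforce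
  have mul: "q (\<lambda>x. c * f x) = c * q f" if f: "f \<in> V" and c: "c \<ge> 0" for f c
  proof (cases "c = 0")
    case False
    with c have c: "c > 0" by simp
    have "q (\<lambda>x. inverse c * (c * f x)) \<le> inverse c * q (\<lambda>x. c * f x)"
      using f c by (intro mul_le V') auto
    moreover have "(\<lambda>x. inverse c * (c * f x)) = f" using c by (auto simp: field_simps)
    ultimately show ?thesis using mul_le[OF f c] c by (simp add: field_simps)
  qed (simp add: q0)
  show ?thesis by (rule exI[of _ q]) (use add mul qp qC in \<open>auto simp: sublinear_on_def\<close>)
qed

text \<open>A minimal sublinear functional is linear, since otherwise it could be lowered by
  \<open>sublinear_on_reduce\<close> along a single direction.\<close>

lemma sublinear_on_dominates_linear:
  assumes V: "function_space V" and p: "sublinear_on V p"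
  shows "\<exists>L. linear_functional_on V L \<and> (\<forall>f\<in>V. L f \<le> p f)"
proof -
  note V' = function_spaceD[OF V]
  \<comment> \<open>Functionals are frozen to 0 outside \<open>V\<close>, so that the order below,
    which compares at all functions, amounts to comparison on \<open>V\<close>. The order is
    reversed: the maximal element supplied by Zorn's lemma is a minimal functional.\<close>
  define Q where "Q = {q. sublinear_on V q \<and> (\<forall>f\<in>V. q f \<le> p f) \<and> (\<forall>f. f \<notin> V \<longrightarrow> q f = 0)}"
  define P where "P q r \<longleftrightarrow> (\<forall>f. r f \<le> q f)" for q r :: "('a \<Rightarrow> real) \<Rightarrow> real"
  have lower: "- p (\<lambda>x. - f x) \<le> q f" if "q \<in> Q" "f \<in> V" for q f
  proof -
    have q: "sublinear_on V q" "q (\<lambda>x. - f x) \<le> p (\<lambda>x. - f x)" using that V' by (auto simp: Q_def)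
    have "q (\<lambda>x. f x + - f x) \<le> q f + q (\<lambda>x. - f x)" using that V' q by (intro sublinear_onD) auto
    then show ?thesis using q sublinear_on_zero[OF V q(1)] by simp
  qed
  have "\<exists>m\<in>Q. \<forall>a\<in>Q. P m a \<longrightarrow> a = m"
  proof (rule predicate_Zorn)
    show "partial_order_on Q (relation_of P Q)"
      by (rule partial_order_on_relation_ofI) (auto simp: P_def intro: order_trans intro!: ext antisym)
  next
    fix C assume C: "C \<in> Chains (relation_of P Q)"
    then have CQ: "C \<subseteq> Q" by (auto simp: Chains_def relation_of_def)
    have tot: "P a b \<or> P b a" if "a \<in> C" "b \<in> C" for a b
      using C that by (auto simp: Chains_def relation_of_def)
    show "\<exists>u\<in>Q. \<forall>a\<in>C. P a u"
    proof (cases "C = {}")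
      case True
      have "(\<lambda>f. if f \<in> V then p f else 0) \<in> Q"
        using p V' by (auto simp: Q_def sublinear_on_def)
      with True show ?thesis by auto
    next
      case False
      define u where "u f = (if f \<in> V then INF q\<in>C. q f else 0)" for f
      have bdd: "bdd_below ((\<lambda>q. q f) ` C)" if "f \<in> V" for f
        using lower CQ that by (intro bdd_belowI2[of _ "- p (\<lambda>x. - f x)"]) auto
      have u_le: "u f \<le> q f" if "q \<in> C" "f \<in> V" for q f
        using cINF_lower[OF bdd[OF that(2)] that(1)] that by (simp add: u_def)
      have u_ge: "a \<le> u f" if "\<And>q. q \<in> C \<Longrightarrow> a \<le> q f" "f \<in> V" for a f
        using that False by (auto simp: u_def intro!: cINF_greatest)
      have sub: "sublinear_on V q" if "q \<in> C" for q using CQ that by (auto simp: Q_def)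
      have "u (\<lambda>x. f x + g x) \<le> u f + u g" if fg: "f \<in> V" "g \<in> V" for f g
      proof -
        \<comment> \<open>The two infima may be approached by different members of the chain; the
          smaller of the two members serves for both summands.\<close>
        have *: "u (\<lambda>x. f x + g x) \<le> q f + r g" if qr: "q \<in> C" "r \<in> C" for q r
        proof -
          consider "P q r" | "P r q" using tot[OF qr] by blast
          then show ?thesis
          proof cases
            case 1
            have "u (\<lambda>x. f x + g x) \<le> r (\<lambda>x. f x + g x)" by (rule u_le[OF qr(2) V'(2)[OF fg]])
            also have "\<dots> \<le> r f + r g" by (rule sublinear_onD(1)[OF sub[OF qr(2)] fg])
            finally show ?thesis using 1 by (auto simp: P_def intro: order_trans)
          next
            case 2
            have "u (\<lambda>x. f x + g x) \<le> q (\<lambda>x. f x + g x)" by (rule u_le[OF qr(1) V'(2)[OF fg]])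
            also have "\<dots> \<le> q f + q g" by (rule sublinear_onD(1)[OF sub[OF qr(1)] fg])
            finally show ?thesis using 2 by (auto simp: P_def intro: order_trans)
          qed
        qed
        have "u (\<lambda>x. f x + g x) - u f \<le> u g"
        proof (rule u_ge)
          fix r assume r: "r \<in> C"
          have "u (\<lambda>x. f x + g x) - r g \<le> u f" using * r fg by (intro u_ge) (auto simp: algebra_simps)
          then show "u (\<lambda>x. f x + g x) - u f \<le> r g" by simp
        qed fact
        then show ?thesis by simp
      qed
      moreover have "u (\<lambda>x. c * f x) = c * u f" if "f \<in> V" "c \<ge> 0" for f c
      proof (cases "c = 0")
        case True
        obtain q where q: "q \<in> C" using False by auto
        have "u (\<lambda>_. 0) \<le> 0" using u_le[OF q V'(1)] sublinear_on_zero[OF V sub[OF q]] by simp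
        moreover have "0 \<le> u (\<lambda>_. 0)" 
        proof (rule u_ge)
          fix q assume "q \<in> C"
          from sublinear_on_zero[OF V sub[OF this]] show "0 \<le> q (\<lambda>_. 0)" by simp
        qed (rule V'(1))
        ultimately show ?thesis using True by simp
      next
        case F: False
        with that have c: "c > 0" by simp
        have 1: "u (\<lambda>x. c * f x) \<le> c * q f" if "q \<in> C" for q
          using u_le[OF that, of "\<lambda>x. c * f x"] sublinear_onD(2)[OF sub[OF that] \<open>f \<in> V\<close>] c V'(3)[OF \<open>f \<in> V\<close>] by simp
        have "u (\<lambda>x. c * f x) / c \<le> u f"
          using 1 that c by (intro u_ge) (auto simp: field_simps)
        moreover have "c * u f \<le> u (\<lambda>x. c * f x)"
        proof (rule u_ge)
          fix q assume "q \<in> C"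
          with u_le[OF this that(1)] sublinear_onD(2)[OF sub[OF this] that] c
          show "c * u f \<le> q (\<lambda>x. c * f x)" by simp
        qed (use that V' in auto)
        ultimately show ?thesis using c by (simp add: field_simps)
      qed
      moreover have "u f \<le> p f" if "f \<in> V" for f
      proof -
        obtain q where "q \<in> C" using False by auto
        with u_le[OF this that] CQ that show ?thesis by (force simp: Q_def)
      qed
      ultimately have "u \<in> Q" by (auto simp: Q_def sublinear_on_def u_def)
      moreover have "P q u" if "q \<in> C" for q
        unfolding P_def using u_le[OF that] CQ that by (auto simp: Q_def u_def subset_iff)
      ultimately show ?thesis by auto
    qed
  qed
  then obtain m where m: "m \<in> Q" and min: "\<And>q. q \<in> Q \<Longrightarrow> P m q \<Longrightarrow> q = m" by auto
  have ms: "sublinear_on V m" using m by (simp add: Q_def)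
  note m' = sublinear_onD[OF ms]
  have neg: "m (\<lambda>x. - h x) = - m h" if h: "h \<in> V" for h
  proof -
    define C where "C = {((\<lambda>x. t * h x), t * m h) | t. t \<ge> 0}"
    have C1: "bound_cone C" unfolding bound_cone_def
    proof (intro conjI allI impI)
      show "(\<lambda>_. 0, 0) \<in> C" unfolding C_def by (intro CollectI exI[of _ 0]) auto
    next
      fix v b w d assume "(v, b) \<in> C" "(w, d) \<in> C"
      then obtain t s where "t \<ge> 0" "s \<ge> 0" "v = (\<lambda>x. t * h x)" "b = t * m h"
        "w = (\<lambda>x. s * h x)" "d = s * m h" by (auto simp: C_def)
      then show "(\<lambda>x. v x + w x, b + d) \<in> C"
        unfolding C_def by (intro CollectI exI[of _ "t + s"]) (auto simp: algebra_simps)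
    next
      fix v b and c :: real assume "c \<ge> 0" "(v, b) \<in> C"
      then obtain t where "t \<ge> 0" "v = (\<lambda>x. t * h x)" "b = t * m h" by (auto simp: C_def)
      then show "(\<lambda>x. c * v x, c * b) \<in> C"
        using \<open>c \<ge> 0\<close> unfolding C_def by (intro CollectI exI[of _ "c * t"]) auto
    qed
    have C2: "\<forall>v b. (v, b) \<in> C \<longrightarrow> v \<in> V \<and> b \<le> m v"
      using h V' m' by (auto simp: C_def)
    obtain q where q: "sublinear_on V q" "\<forall>f\<in>V. q f \<le> m f"
      "\<forall>v b. (v, b) \<in> C \<longrightarrow> q (\<lambda>x. - v x) \<le> - b"
      using sublinear_on_reduce[OF V ms C1 C2] by blast
    define q' where "q' f = (if f \<in> V then q f else 0)" for f
    have "sublinear_on V q'" using q(1) V' by (simp add: sublinear_on_def q'_def)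
    moreover have "\<forall>f\<in>V. q' f \<le> p f"
    proof
      fix f assume "f \<in> V"
      then show "q' f \<le> p f" using q(2) m by (force simp: Q_def q'_def intro: order_trans)
    qed
    ultimately have "q' \<in> Q" by (simp add: Q_def q'_def)
    moreover have "P m q'" using q m by (auto simp: P_def q'_def Q_def)
    ultimately have "q' = m" by (rule min)
    moreover have "(h, m h) \<in> C" unfolding C_def by (intro CollectI exI[of _ 1]) auto
    with q(3) have "q (\<lambda>x. - h x) \<le> - m h" by blast
    then have "q' (\<lambda>x. - h x) \<le> - m h" using V'(4)[OF h] by (simp add: q'_def)
    ultimately have "m (\<lambda>x. - h x) \<le> - m h" by simp
    moreover have "m (\<lambda>x. h x + - h x) \<le> m h + m (\<lambda>x. - h x)" using h V' by (intro m') auto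
    ultimately show ?thesis using sublinear_on_zero[OF V ms] by simp
  qed
  have "m (\<lambda>x. f x + g x) = m f + m g" if fg: "f \<in> V" "g \<in> V" for f g
  proof -
    have "m (\<lambda>x. - f x + - g x) \<le> m (\<lambda>x. - f x) + m (\<lambda>x. - g x)" using fg V' by (intro m') auto
    moreover have "(\<lambda>x. - f x + - g x) = (\<lambda>x. - (f x + g x))" by auto
    ultimately have "- m (\<lambda>x. f x + g x) \<le> - m f - m g"
      using neg[OF fg(1)] neg[OF fg(2)] neg[OF V'(2)[OF fg]] by simp
    with m'(1)[OF fg] show ?thesis by simp
  qed
  moreover have "m (\<lambda>x. c * f x) = c * m f" if f: "f \<in> V" for f c
  proof (cases "c \<ge> 0")
    case False
    then have "m (\<lambda>x. (- c) * f x) = (- c) * m f" using f by (intro m') auto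
    with neg[OF V'(3)[OF f], of "c"] show ?thesis by simp
  qed (use m' f in auto)
  ultimately have "linear_functional_on V m" by (auto simp: linear_functional_on_def)
  then show ?thesis using m by (auto simp: Q_def)
qed

text \<open>The demands are first built into the sublinear functional, and then any linear
  functional below the result will do. No subspace is involved, so the demands may be inequalities
  on a mere cone.\<close>

theorem Mazur_Orlicz:
  assumes V: "function_space V" and p: "sublinear_on V p"
    and C: "bound_cone C" and Cle: "\<forall>v b. (v, b) \<in> C \<longrightarrow> v \<in> V \<and> b \<le> p v"
  shows "\<exists>L. linear_functional_on V L \<and> (\<forall>f\<in>V. L f \<le> p f) \<and> (\<forall>v b. (v, b) \<in> C \<longrightarrow> b \<le> L v)"
proof -
  obtain q where q: "sublinear_on V q" "\<forall>f\<in>V. q f \<le> p f"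
    "\<forall>v b. (v, b) \<in> C \<longrightarrow> q (\<lambda>x. - v x) \<le> - b"
    using sublinear_on_reduce[OF assms] by blast
  obtain L where L: "linear_functional_on V L" "\<forall>f\<in>V. L f \<le> q f"
    using sublinear_on_dominates_linear[OF V q(1)] by blast
  have "b \<le> L v" if vb: "(v, b) \<in> C" for v b
  proof -
    have v: "v \<in> V" using Cle vb by blast
    have "- L v \<le> q (\<lambda>x. - v x)"
      using L(2) function_spaceD(4)[OF V v] linear_functional_onD(3)[OF L(1) v] by metis
    also have "\<dots> \<le> - b" using q(3) vb by blast
    finally show ?thesis by simp
  qed
  moreover have "\<forall>f\<in>V. L f \<le> p f" using L(2) q(2) by (meson order_trans)
  ultimately show ?thesis using L(1) by blast
qed

section \<open>Continuous approximation of open sets, and measures determined by continuous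
  functions\<close>

abbreviation continuous_functions :: "('a::topological_space \<Rightarrow> real) set" where
  "continuous_functions \<equiv> {f. continuous_on UNIV f}"

lemma function_space_continuous: "function_space (continuous_functions :: ('a::topological_space \<Rightarrow> real) set)"
  by (auto simp: function_space_def intro!: continuous_intros)

text \<open>Increases to the indicator of an open \<open>U\<close>. The whole space is a case of its
  own because the distance to the empty set is 0 by convention. The value 0 at \<open>n = 0\<close>
  lets the telescoping series in the Riesz construction start from nothing.\<close>

definition open_approx :: "'a::metric_space set \<Rightarrow> nat \<Rightarrow> 'a \<Rightarrow> real" where
  "open_approx U n x = (if U = UNIV then (if n = 0 then 0 else 1) else min 1 (real n * infdist x (- U)))"

lemma continuous_open_approx [continuous_intros]: "continuous_on A (open_approx U n)"
  unfolding open_approx_def by (cases "U = UNIV") (auto intro!: continuous_intros)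

lemma open_approx_range: "0 \<le> open_approx U n x" "open_approx U n x \<le> 1"
  by (auto simp: open_approx_def infdist_nonneg)

lemma open_approx_0 [simp]: "open_approx U 0 x = 0"
  by (auto simp: open_approx_def)

lemma open_approx_outside: "x \<notin> U \<Longrightarrow> open_approx U n x = 0"
  by (auto simp: open_approx_def)

lemma open_approx_mono: "m \<le> n \<Longrightarrow> open_approx U m x \<le> open_approx U n x"
  by (auto simp: open_approx_def infdist_nonneg min_def mult_right_mono intro: order_trans)

lemma open_approx_tendsto:
  assumes "open U"
  shows "(\<lambda>n. open_approx U n x) \<longlonglongrightarrow> indicator U x"
proof (cases "x \<in> U")
  case True
  have "eventually (\<lambda>n. open_approx U n x = 1) sequentially"
  proof (cases "U = UNIV")
    case True
    then show ?thesis by (auto simp: open_approx_def eventually_sequentially intro!: exI[of _ 1])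
  next
    case False
    then have pos: "infdist x (- U) > 0"
      using True assms infdist_pos_not_in_closed[of "- U" x] by auto
    obtain N :: nat where "real N * infdist x (- U) > 1"
      using reals_Archimedean3[OF pos] by blast
    then have "real n * infdist x (- U) > 1" if "n \<ge> N" for n
      using that pos by (meson less_le_trans mult_right_mono of_nat_mono less_imp_le)
    then have "open_approx U n x = 1" if "n \<ge> N" for n
      using that False by (simp add: open_approx_def min_absorb1 less_imp_le)
    then show ?thesis by (rule eventually_sequentiallyI)
  qed
  with True show ?thesis by (simp add: tendsto_eventually)
qed (simp add: open_approx_outside)

text \<open>Rewrites an increasing limit as a series of non-negative terms, the form in which it can
  be part of a cover.\<close>

lemma suminf_telescope_ennreal:
  fixes a :: "nat \<Rightarrow> real"
  assumes "incseq a" "a 0 = 0"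
  shows "(\<Sum>k. ennreal (a (Suc k) - a k)) = (SUP k. ennreal (a k))"
proof -
  have "(\<Sum>k<n. ennreal (a (Suc k) - a k)) = ennreal (a n)" for n
    using assms by (subst sum_ennreal) (auto simp: incseq_Suc_iff sum_lessThan_telescope)
  then show ?thesis by (simp add: suminf_eq_SUP)
qed

text \<open>The form \<open>P + N' = P' + N\<close> covers differences of measures while only
  adding. Open sets follow from \<open>open_approx\<close> by dominated convergence, Borel sets by
  Dynkin induction.\<close>

lemma measure_determined_by_continuous:
  fixes P N P' N' :: "'a::metric_space measure"
  assumes fin: "finite_measure P" "finite_measure N" "finite_measure P'" "finite_measure N'"
    and sets: "sets P = sets borel" "sets N = sets borel" "sets P' = sets borel" "sets N' = sets borel"
    and eq: "\<And>f :: 'a \<Rightarrow> real. continuous_on UNIV f \<Longrightarrow> (\<And>x. 0 \<le> f x) \<Longrightarrow> (\<And>x. f x \<le> 1) \<Longrightarrow>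
      (\<integral>x. f x \<partial>P) + (\<integral>x. f x \<partial>N') = (\<integral>x. f x \<partial>P') + (\<integral>x. f x \<partial>N)"
    and B: "B \<in> sets borel"
  shows "measure P B + measure N' B = measure P' B + measure N B"
proof -
  have op: "measure P U + measure N' U = measure P' U + measure N U" if U: "open U" for U
  proof -
    have lim: "(\<lambda>n. \<integral>x. open_approx U n x \<partial>M) \<longlonglongrightarrow> measure M U" if M: "finite_measure M" "sets M = sets borel" for M
    proof -
      interpret finite_measure M by fact
      have [measurable]: "U \<in> sets M" using U M by simp
      have [measurable]: "open_approx U n \<in> borel_measurable M" for n
        using M by (auto simp: measurable_cong_sets[OF M(2) refl] intro!: borel_measurable_continuous_onI continuous_intros)
      have "(\<lambda>n. \<integral>x. open_approx U n x \<partial>M) \<longlonglongrightarrow> (\<integral>x. indicator U x \<partial>M)"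
        by (rule integral_dominated_convergence[where w="\<lambda>_. 1"])
           (auto simp: open_approx_range intro!: open_approx_tendsto[OF U])
      then show ?thesis using U by (simp add: M sets_eq_imp_space_eq[OF M(2)])
    qed
    have "(\<lambda>n. (\<integral>x. open_approx U n x \<partial>P) + (\<integral>x. open_approx U n x \<partial>N')) \<longlonglongrightarrow> measure P U + measure N' U"
      by (intro tendsto_add lim fin sets)
    moreover have "(\<lambda>n. (\<integral>x. open_approx U n x \<partial>P') + (\<integral>x. open_approx U n x \<partial>N)) \<longlonglongrightarrow> measure P' U + measure N U"
      by (intro tendsto_add lim fin sets)
    moreover have "(\<integral>x. open_approx U n x \<partial>P) + (\<integral>x. open_approx U n x \<partial>N') =
        (\<integral>x. open_approx U n x \<partial>P') + (\<integral>x. open_approx U n x \<partial>N)" for n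
      by (intro eq continuous_intros open_approx_range)
    ultimately show ?thesis using LIMSEQ_unique by force
  qed
  have "B \<in> sigma_sets UNIV {S. open S}" using B by (simp add: borel_def)
  have "Int_stable {S :: 'a set. open S}" "{S :: 'a set. open S} \<subseteq> Pow UNIV" by (auto simp: Int_stable_def)
  then show ?thesis using \<open>B \<in> sigma_sets UNIV {S. open S}\<close>
  proof (induction rule: sigma_sets_induct_disjoint)
    case (basic A) then show ?case using op by simp
  next
    case (compl A)
    have A: "A \<in> sets borel" using compl(1) by (simp add: borel_def)
    have "measure M (UNIV - A) = measure M UNIV - measure M A" if "finite_measure M" "sets M = sets borel" for M
      using finite_measure.finite_measure_compl[OF that(1), of A] A that sets_eq_imp_space_eq[OF that(2)] by simp
    with compl op[of UNIV] fin sets show ?case by simp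
  next
    case (union A)
    have A: "range A \<subseteq> sets borel" using union(2) by (auto simp: borel_def)
    have sums: "(\<lambda>i. measure M (A i)) sums measure M (\<Union>i. A i)" if "finite_measure M" "sets M = sets borel" for M
      using finite_measure.finite_measure_UNION[OF that(1)] A that union(1) by simp
    have "(\<lambda>i. measure P (A i) + measure N' (A i)) sums (measure P (\<Union>i. A i) + measure N' (\<Union>i. A i))"
      "(\<lambda>i. measure P' (A i) + measure N (A i)) sums (measure P' (\<Union>i. A i) + measure N (\<Union>i. A i))"
      by (intro sums_add sums fin sets)+
    with union(3) show ?case by (simp add: sums_unique2)
  qed auto
qed

lemma Prob_eqI:
  fixes \<mu> \<nu> :: "'a::metric_space measure"
  assumes "\<mu> \<in> Prob" "\<nu> \<in> Prob"
    and "\<And>f :: 'a \<Rightarrow> real. continuous_on UNIV f \<Longrightarrow> (\<And>x. 0 \<le> f x) \<Longrightarrow> (\<And>x. f x \<le> 1) \<Longrightarrow>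
      (\<integral>x. f x \<partial>\<mu>) = (\<integral>x. f x \<partial>\<nu>)"
  shows "\<mu> = \<nu>"
proof (rule measure_eqI)
  show "sets \<mu> = sets \<nu>" using assms by (simp add: Prob_iff)
  interpret \<mu>: prob_space \<mu> using assms by (simp add: Prob_iff)
  interpret \<nu>: prob_space \<nu> using assms by (simp add: Prob_iff)
  fix B assume "B \<in> sets \<mu>"
  then have "measure \<mu> B + measure (null_measure borel) B = measure \<nu> B + measure (null_measure borel) B"
    using assms finite_null_measure[of borel]
    by (intro measure_determined_by_continuous) (auto simp: Prob_iff \<mu>.finite_measure_axioms \<nu>.finite_measure_axioms)
  then show "emeasure \<mu> B = emeasure \<nu> B" by (simp add: \<mu>.emeasure_eq_measure \<nu>.emeasure_eq_measure)
qed

section \<open>The Riesz representation theorem on a compact metric space\<close>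

locale positive_functional =
  fixes L :: "('a::metric_space \<Rightarrow> real) \<Rightarrow> real"
  assumes compact_space: "compact (UNIV :: 'a set)"
    and linear: "linear_functional_on continuous_functions L"
    and nonneg: "\<And>f. continuous_on UNIV f \<Longrightarrow> (\<And>x. 0 \<le> f x) \<Longrightarrow> 0 \<le> L f"
    and normalized: "L (\<lambda>_. 1) = 1"
begin

lemma L_add: "continuous_on UNIV f \<Longrightarrow> continuous_on UNIV g \<Longrightarrow> L (\<lambda>x. f x + g x) = L f + L g"
  using linear_functional_onD(1)[OF linear] by simp

lemma L_cmult: "continuous_on UNIV f \<Longrightarrow> L (\<lambda>x. c * f x) = c * L f"
  using linear_functional_onD(2)[OF linear] by simp

lemma L_diff: "continuous_on UNIV f \<Longrightarrow> continuous_on UNIV g \<Longrightarrow> L (\<lambda>x. f x - g x) = L f - L g"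
  using linear_functional_on_diff[OF function_space_continuous linear] by simp

lemma L_const: "L (\<lambda>_. c) = c"
  using L_cmult[of "\<lambda>_. 1" c] normalized by simp

lemma L_mono: "continuous_on UNIV f \<Longrightarrow> continuous_on UNIV g \<Longrightarrow> (\<And>x. f x \<le> g x) \<Longrightarrow> L f \<le> L g"
  using nonneg[of "\<lambda>x. g x - f x"] L_diff[of g f] by (auto intro!: continuous_intros)

lemma L_sum:
  "(\<And>i. i < (n::nat) \<Longrightarrow> continuous_on UNIV (f i)) \<Longrightarrow> L (\<lambda>x. \<Sum>i<n. f i x) = (\<Sum>i<n. L (f i))"
proof (induction n)
  case 0 show ?case using L_const[of 0] by simp
next
  case (Suc n)
  have "continuous_on UNIV (\<lambda>x. \<Sum>i<n. f i x)" by (intro continuous_on_sum) (use Suc.prems in auto)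
  from L_add[OF this, of "f n"] Suc show ?case by simp
qed

definition covers :: "'a set \<Rightarrow> (nat \<Rightarrow> 'a \<Rightarrow> real) \<Rightarrow> bool" where
  "covers A f \<longleftrightarrow> (\<forall>n. continuous_on UNIV (f n)) \<and> (\<forall>n x. 0 \<le> f n x) \<and> (\<forall>x\<in>A. 1 \<le> (\<Sum>n. ennreal (f n x)))"

text \<open>Daniell's upper integral of an indicator. Admitting countable series of continuous
  functions instead of single ones makes countable subadditivity a matter of rearrangement.\<close>

definition outer :: "'a set \<Rightarrow> ennreal" where
  "outer A = (INF f\<in>{f. covers A f}. \<Sum>n. ennreal (L (f n)))"

lemma outer_le: "covers A f \<Longrightarrow> outer A \<le> (\<Sum>n. ennreal (L (f n)))"
  unfolding outer_def by (rule INF_lower) simp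

lemma outer_le1:
  assumes "continuous_on UNIV f" "\<And>x. 0 \<le> f x" "\<And>x. x \<in> A \<Longrightarrow> 1 \<le> f x"
  shows "outer A \<le> ennreal (L f)"
proof -
  define F where "F n = (if n = 0 then f else (\<lambda>_. 0))" for n :: nat
  have "(\<Sum>n. ennreal (F n x)) = (\<Sum>n\<in>{0}. ennreal (F n x))" for x
    by (rule suminf_finite) (auto simp: F_def)
  then have "covers A F" using assms by (auto simp: covers_def F_def)
  moreover have "(\<Sum>n. ennreal (L (F n))) = (\<Sum>n\<in>{0}. ennreal (L (F n)))"
    by (rule suminf_finite) (auto simp: F_def L_const)
  ultimately show ?thesis using outer_le[of A F] by (simp add: F_def)
qed

lemma outer_cover:
  assumes "\<And>f. covers A f \<Longrightarrow> c \<le> (\<Sum>n. ennreal (L (f n)))"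
  shows "c \<le> outer A"
  unfolding outer_def using assms by (intro INF_greatest) auto

text \<open>Doubly indexed covers are enumerated into one sequence. This is used for a countable
  union of sets and for the telescoped products \<open>f n * h k\<close>.\<close>

lemma covers_prod_decode:
  assumes c: "\<And>i n. continuous_on UNIV (f i n)" "\<And>i n x. 0 \<le> f i n x"
    and A: "\<And>x. x \<in> A \<Longrightarrow> 1 \<le> (\<Sum>i. \<Sum>n. ennreal (f i n x))"
  shows "outer A \<le> (\<Sum>i. \<Sum>n. ennreal (L (f i n)))"
proof -
  define g where "g k = f (fst (prod_decode k)) (snd (prod_decode k))" for k
  have eq: "(\<Sum>k. h (fst (prod_decode k)) (snd (prod_decode k))) = (\<Sum>i. \<Sum>n. h i n)" for h :: "nat \<Rightarrow> nat \<Rightarrow> ennreal"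
    using suminf_ennreal_2dimen[of "\<lambda>i. \<Sum>n. h i n" "\<lambda>p. h (fst p) (snd p)"] by simp
  have "covers A g"
    unfolding covers_def g_def using c A eq[of "\<lambda>i n. ennreal (f i n _)"] by auto
  from outer_le[OF this] show ?thesis
    unfolding g_def using eq[of "\<lambda>i n. ennreal (L (f i n))"] by simp
qed

lemma outer_measure_space: "outer_measure_space UNIV outer"
  unfolding outer_measure_space_def
proof (intro conjI)
  have "outer {} \<le> ennreal (L (\<lambda>_. 0))" by (rule outer_le1) auto
  then show "positive UNIV outer" by (simp add: positive_def L_const)
  show "increasing UNIV outer"
    unfolding increasing_def outer_def covers_def by (auto intro!: INF_superset_mono)
  show "countably_subadditive UNIV outer"
    unfolding countably_subadditive_def
  proof (intro allI impI)
    fix A :: "nat \<Rightarrow> 'a set"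
    show "outer (\<Union>i. A i) \<le> (\<Sum>i. outer (A i))"
    proof (rule ennreal_le_epsilon)
      fix e :: real assume fin: "(\<Sum>i. outer (A i)) < top" and e: "0 < e"
      have "\<exists>f. covers (A i) f \<and> (\<Sum>n. ennreal (L (f n))) < outer (A i) + ennreal (e * (1 / 2) ^ Suc i)" for i
      proof -
        have "outer (A i) \<noteq> top" using fin ennreal_suminf_lessD[of "\<lambda>i. outer (A i)" top i] by auto
        then have "outer (A i) < outer (A i) + ennreal (e * (1 / 2) ^ Suc i)"
          using e by (cases "outer (A i)" rule: ennreal_cases) (auto simp: ennreal_less_iff simp flip: ennreal_plus)
        then show ?thesis unfolding outer_def[of "A i"] INF_less_iff by auto
      qed
      then obtain f where f: "\<And>i. covers (A i) (f i)"
        "\<And>i. (\<Sum>n. ennreal (L (f i n))) < outer (A i) + ennreal (e * (1 / 2) ^ Suc i)" by metis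
      have "outer (\<Union>i. A i) \<le> (\<Sum>i. \<Sum>n. ennreal (L (f i n)))"
      proof (rule covers_prod_decode)
        show "1 \<le> (\<Sum>i. \<Sum>n. ennreal (f i n x))" if x: "x \<in> (\<Union>i. A i)" for x
        proof -
          obtain i where "x \<in> A i" using x by auto
          then have "1 \<le> (\<Sum>n. ennreal (f i n x))" using f(1) by (auto simp: covers_def)
          also have "\<dots> \<le> (\<Sum>i. \<Sum>n. ennreal (f i n x))"
            using sum_le_suminf[of "\<lambda>i. \<Sum>n. ennreal (f i n x)" "{i}"] by simp
          finally show ?thesis .
        qed
      qed (use f(1) in \<open>auto simp: covers_def\<close>)
      also have "\<dots> \<le> (\<Sum>i. outer (A i) + ennreal (e * (1 / 2) ^ Suc i))"
        by (intro suminf_le less_imp_le f) auto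
      also have "\<dots> = (\<Sum>i. outer (A i)) + (\<Sum>i. ennreal (e * (1 / 2) ^ Suc i))"
        by (rule suminf_add[symmetric]) auto
      also have "(\<Sum>i. ennreal (e * (1 / 2) ^ Suc i)) = ennreal e"
        using e sums_mult[OF power_half_series, of e]
        by (intro suminf_ennreal_eq) auto
      finally show "outer (\<Union>i. A i) \<le> (\<Sum>i. outer (A i)) + ennreal e" .
    qed
  qed
qed

text \<open>Given a cover \<open>f\<close> of \<open>A\<close>, let \<open>h k\<close> increase to
  the indicator of \<open>U\<close>. The increments in \<open>k\<close> of \<open>f n * h k\<close>
  cover \<open>A \<inter> U\<close>, and \<open>f n * (1 - h k)\<close> covers \<open>A - U\<close>
  for each fixed \<open>k\<close>, because \<open>h k\<close> vanishes off \<open>U\<close>. The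
  costs of the two factors add up to \<open>L (f n)\<close> for every \<open>k\<close>, and the
  supremum over \<open>k\<close> is taken last.\<close>

lemma open_in_lambda_system:
  assumes U: "open U"
  shows "U \<in> lambda_system UNIV UNIV outer"
proof -
  interpret algebra UNIV "UNIV :: 'a set set" by (metis Pow_UNIV algebra_Pow)
  have "outer (A \<inter> U) + outer (A - U) \<le> outer A" for A
  proof (rule outer_cover)
    fix f assume f: "covers A f"
    have cf[continuous_intros]: "continuous_on S (f n)" for n S
      using f by (auto simp: covers_def intro: continuous_on_subset)
    have f0: "0 \<le> f n x" for n x using f by (auto simp: covers_def)
    have fA: "1 \<le> (\<Sum>n. ennreal (f n x))" if "x \<in> A" for x using f that by (auto simp: covers_def)
    define h where "h = open_approx U"
    have ch[continuous_intros]: "continuous_on S (h n)" for n S by (auto simp: h_def intro: continuous_intros)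
    note h_simps = open_approx_range[of U, folded h_def] open_approx_mono[of _ _ U, folded h_def]
    have split: "ennreal (L (f n)) = ennreal (L (\<lambda>x. f n x * h k x)) + ennreal (L (\<lambda>x. f n x * (1 - h k x)))" for n k
    proof -
      have "L (\<lambda>x. f n x * h k x + f n x * (1 - h k x)) = L (\<lambda>x. f n x * h k x) + L (\<lambda>x. f n x * (1 - h k x))"
        by (intro L_add continuous_intros)
      moreover have "0 \<le> L (\<lambda>x. f n x * h k x)" "0 \<le> L (\<lambda>x. f n x * (1 - h k x))"
        using h_simps f0 by (auto intro!: nonneg continuous_intros)
      ultimately show ?thesis by (simp add: algebra_simps flip: ennreal_plus)
    qed
    have inc: "incseq (\<lambda>k. L (\<lambda>x. f n x * h k x))" for n
      by (intro incseq_SucI L_mono continuous_intros mult_left_mono h_simps f0) auto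
    have AU: "outer (A \<inter> U) \<le> (\<Sum>n. SUP k. ennreal (L (\<lambda>x. f n x * h k x)))"
    proof -
      have "outer (A \<inter> U) \<le> (\<Sum>n. \<Sum>k. ennreal (L (\<lambda>x. f n x * h (Suc k) x - f n x * h k x)))"
      proof (rule covers_prod_decode)
        fix x assume x: "x \<in> A \<inter> U"
        have "(\<Sum>k. ennreal (f n x * h (Suc k) x - f n x * h k x)) = ennreal (f n x)" for n
        proof -
          have inc: "incseq (\<lambda>k. f n x * h k x)" by (intro incseq_SucI mult_left_mono h_simps f0) auto
          have "(\<lambda>k. f n x * h k x) \<longlonglongrightarrow> f n x * indicator U x"
            unfolding h_def by (intro tendsto_intros open_approx_tendsto U)
          then have "(\<lambda>k. ennreal (f n x * h k x)) \<longlonglongrightarrow> ennreal (f n x)"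
            using x by (intro tendsto_ennrealI) auto
          moreover have "(\<lambda>k. ennreal (f n x * h k x)) \<longlonglongrightarrow> (SUP k. ennreal (f n x * h k x))"
            using inc by (intro LIMSEQ_SUP) (auto simp: incseq_def intro: ennreal_leI)
          ultimately have "(SUP k. ennreal (f n x * h k x)) = ennreal (f n x)" by (metis LIMSEQ_unique)
          with suminf_telescope_ennreal[OF inc] show ?thesis by (simp add: h_def)
        qed
        with fA[of x] x show "1 \<le> (\<Sum>n. \<Sum>k. ennreal (f n x * h (Suc k) x - f n x * h k x))" by simp
      next
        show "0 \<le> f n x * h (Suc k) x - f n x * h k x" for n k x
          using mult_left_mono[OF h_simps(3) f0, of k "Suc k"] by simp
      qed (auto intro!: continuous_intros)
      also have "(\<lambda>n. \<Sum>k. ennreal (L (\<lambda>x. f n x * h (Suc k) x - f n x * h k x))) =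
          (\<lambda>n. SUP k. ennreal (L (\<lambda>x. f n x * h k x)))"
      proof
        fix n
        have "L (\<lambda>x. f n x * h (Suc k) x - f n x * h k x) = L (\<lambda>x. f n x * h (Suc k) x) - L (\<lambda>x. f n x * h k x)" for k
          by (intro L_diff continuous_intros)
        then show "(\<Sum>k. ennreal (L (\<lambda>x. f n x * h (Suc k) x - f n x * h k x))) = (SUP k. ennreal (L (\<lambda>x. f n x * h k x)))"
          using suminf_telescope_ennreal[OF inc, of n] by (simp add: h_def L_const)
      qed
      finally show ?thesis .
    qed
    have AmU: "outer (A - U) \<le> (\<Sum>n. ennreal (L (\<lambda>x. f n x * (1 - h k x))))" for k
      using h_simps f0 fA
      by (intro outer_le) (auto simp: covers_def h_def open_approx_outside intro!: continuous_intros)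
    have "outer (A \<inter> U) + outer (A - U) \<le> (\<Sum>n. SUP k. ennreal (L (\<lambda>x. f n x * h k x))) + outer (A - U)"
      by (intro add_right_mono AU)
    also have "\<dots> = (SUP k. \<Sum>n. ennreal (L (\<lambda>x. f n x * h k x))) + outer (A - U)"
      using inc by (subst ennreal_suminf_SUP_eq) (auto simp: incseq_def intro: ennreal_leI)
    also have "\<dots> = (SUP k. (\<Sum>n. ennreal (L (\<lambda>x. f n x * h k x))) + outer (A - U))"
      by (rule ennreal_SUP_add_left[symmetric]) simp
    also have "\<dots> \<le> (\<Sum>n. ennreal (L (f n)))"
    proof (rule SUP_least)
      fix k
      have "(\<Sum>n. ennreal (L (\<lambda>x. f n x * h k x))) + outer (A - U) \<le>
          (\<Sum>n. ennreal (L (\<lambda>x. f n x * h k x))) + (\<Sum>n. ennreal (L (\<lambda>x. f n x * (1 - h k x))))"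
        by (intro add_left_mono AmU)
      also have "\<dots> = (\<Sum>n. ennreal (L (\<lambda>x. f n x * h k x)) + ennreal (L (\<lambda>x. f n x * (1 - h k x))))"
        by (rule suminf_add) auto
      also have "\<dots> = (\<Sum>n. ennreal (L (f n)))" by (simp add: split[symmetric])
      finally show "(\<Sum>n. ennreal (L (\<lambda>x. f n x * h k x))) + outer (A - U) \<le> (\<Sum>n. ennreal (L (f n)))" .
    qed
    finally show "outer (A \<inter> U) + outer (A - U) \<le> (\<Sum>n. ennreal (L (f n)))" .
  qed
  moreover have "outer A \<le> outer (A \<inter> U) + outer (A - U)" for A
  proof -
    have "subadditive UNIV outer"
      using outer_measure_space countably_subadditive_subadditive
      by (auto simp: outer_measure_space_def)
    then have "outer ((A \<inter> U) \<union> (A - U)) \<le> outer (A \<inter> U) + outer (A - U)"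
      by (rule subadditiveD) auto
    then show ?thesis by (simp add: Int_Diff_Un)
  qed
  ultimately show ?thesis by (auto simp: lambda_system_eq intro: antisym)
qed

definition riesz_measure :: "'a measure" where
  "riesz_measure = measure_of UNIV (sets borel) outer"

lemma sets_riesz_measure [simp]: "sets riesz_measure = sets borel"
  by (metis riesz_measure_def sigma_algebra.sets_measure_of_eq sets.sigma_algebra_axioms space_borel)

lemma emeasure_riesz_measure:
  assumes "A \<in> sets borel"
  shows "emeasure riesz_measure A = outer A"
proof -
  interpret sigma_algebra UNIV "UNIV :: 'a set set" by (metis Pow_UNIV sigma_algebra_Pow)
  let ?L = "lambda_system UNIV UNIV outer"
  have ms: "measure_space UNIV ?L outer" by (rule caratheodory_lemma[OF outer_measure_space])
  then interpret L: sigma_algebra UNIV ?L by (simp add: measure_space_def)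
  have "sigma_sets UNIV {S :: 'a set. open S} \<subseteq> ?L"
    by (rule L.sigma_sets_subset) (use open_in_lambda_system in auto)
  then have sub: "sets borel \<subseteq> ?L" by (simp add: borel_def)
  show ?thesis unfolding riesz_measure_def
  proof (rule emeasure_measure_of_sigma)
    show "sigma_algebra UNIV (sets borel :: 'a set set)" using sets.sigma_algebra_axioms[of borel] by simp
    show "positive (sets borel) outer" using ms by (simp add: measure_space_def positive_def)
    show "countably_additive (sets borel) outer"
      using ms sub unfolding measure_space_def countably_additive_def by blast
  qed fact
qed

text \<open>A Dini argument: the open sets on which a partial sum exceeds \<open>1 - e\<close>
  increase to the whole space, so by compactness one partial sum exceeds it everywhere, and
  monotonicity of \<open>L\<close> compares that sum with the constant.\<close>

lemma one_le_outer: "1 \<le> outer UNIV"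
proof (rule outer_cover)
  fix f assume f: "covers UNIV f"
  have cf[continuous_intros]: "continuous_on S (f n)" for n S
    using f by (auto simp: covers_def intro: continuous_on_subset)
  have f0: "0 \<le> f n x" for n x using f by (auto simp: covers_def)
  have lower: "ennreal (1 - e) \<le> (\<Sum>n. ennreal (L (f n)))" if e: "0 < e" "e < 1" for e :: real
  proof -
    define D where "D N = {x. 1 - e < (\<Sum>n<N. f n x)}" for N
    have op: "open (D N)" for N unfolding D_def by (intro open_Collect_less continuous_intros)
    have mono: "D M \<subseteq> D N" if "M \<le> N" for M N
    proof
      fix x assume "x \<in> D M"
      moreover have "(\<Sum>n<M. f n x) \<le> (\<Sum>n<N. f n x)" by (rule sum_mono2) (use that f0 in auto)
      ultimately show "x \<in> D N" by (simp add: D_def)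
    qed
    have cov: "UNIV \<subseteq> (\<Union>N. D N)"
    proof
      fix x
      have "ennreal (1 - e) < 1" using e by (simp add: ennreal_less_one_iff)
      also have "1 \<le> (\<Sum>n. ennreal (f n x))" using f by (simp add: covers_def)
      finally obtain N where "ennreal (1 - e) < (\<Sum>n<N. ennreal (f n x))"
        unfolding suminf_eq_SUP less_SUP_iff by auto
      then have "1 - e < (\<Sum>n<N. f n x)" using f0 e by (simp add: ennreal_less_iff)
      then show "x \<in> (\<Union>N. D N)" by (auto simp: D_def)
    qed
    obtain F where F: "finite F" "UNIV \<subseteq> (\<Union>N\<in>F. D N)"
      using compactE_image[OF compact_space, of UNIV D] op cov by auto
    define N where "N = Max (insert 0 F)"
    have "x \<in> D N" for x
    proof -
      obtain M where "M \<in> F" "x \<in> D M" using F(2) by auto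
      then show ?thesis using mono[of M N] F(1) by (auto simp: N_def)
    qed
    then have "L (\<lambda>_. 1 - e) \<le> L (\<lambda>x. \<Sum>n<N. f n x)"
      by (intro L_mono continuous_intros) (auto simp: D_def intro: less_imp_le)
    then have "1 - e \<le> (\<Sum>n<N. L (f n))" by (simp add: L_const L_sum cf)
    then have "ennreal (1 - e) \<le> (\<Sum>n<N. ennreal (L (f n)))"
      using f0 by (subst sum_ennreal) (auto intro!: ennreal_leI nonneg continuous_intros)
    also have "\<dots> \<le> (\<Sum>n. ennreal (L (f n)))" by (rule sum_le_suminf) auto
    finally show ?thesis .
  qed
  show "1 \<le> (\<Sum>n. ennreal (L (f n)))"
  proof (cases "(\<Sum>n. ennreal (L (f n)))" rule: ennreal_cases)
    case (real r)
    have "1 \<le> r + e" if e: "0 < e" for e :: real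
    proof (cases "e < 1")
      case True
      then show ?thesis using lower[OF e True] real by simp
    qed (use real in simp)
    then have "1 \<le> r" by (rule field_le_epsilon)
    with real show ?thesis by simp
  qed simp
qed

lemma riesz_measure_Prob: "riesz_measure \<in> Prob"
proof -
  have "outer UNIV \<le> ennreal (L (\<lambda>_. 1))" by (rule outer_le1) auto
  with one_le_outer have "outer UNIV = 1" by (simp add: normalized)
  then have "emeasure riesz_measure (space riesz_measure) = 1"
    using emeasure_riesz_measure[of UNIV] sets_eq_imp_space_eq[OF sets_riesz_measure] by simp
  then show ?thesis by (simp add: Prob_iff prob_spaceI)
qed

lemma continuous_bounded:
  assumes "continuous_on UNIV (f :: 'a \<Rightarrow> real)"
  obtains B where "B > 0" "\<And>x. \<bar>f x\<bar> \<le> B"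
proof -
  have "bounded (range f)" using compact_continuous_image[OF assms compact_space] by (rule compact_imp_bounded)
  then show thesis using that by (auto simp: bounded_pos)
qed

text \<open>Cut \<open>h\<close> into horizontal layers \<open>s i\<close> of height 1. A layer
  equals 1 on \<open>E i\<close>, so the measure of \<open>E i\<close> is at most
  \<open>L (s i)\<close>, and \<open>h\<close> exceeds the number of sets \<open>E i\<close>
  containing a point by at most 1. This crude error disappears later by scaling.\<close>

lemma nn_integral_riesz_le:
  assumes h: "continuous_on UNIV h" "\<And>x. 0 \<le> h x"
  shows "(\<integral>\<^sup>+x. ennreal (h x) \<partial>riesz_measure) \<le> 1 + ennreal (L h)"
proof -
  interpret prob_space riesz_measure using riesz_measure_Prob by (simp add: Prob_iff)
  obtain B where B: "\<And>x. \<bar>h x\<bar> \<le> B" using continuous_bounded[OF h(1)] by auto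
  define m where "m = nat \<lceil>B\<rceil>"
  have hm: "h x \<le> real m" for x
    using B[of x] h(2)[of x] unfolding m_def by linarith
  define s where "s i x = min (max (h x - real i) 0) 1" for i x
  have cs[continuous_intros]: "continuous_on S (s i)" for i S
    unfolding s_def using h(1) by (intro continuous_intros) (auto intro: continuous_on_subset)
  have s0: "0 \<le> s i x" for i x by (simp add: s_def)
  have sum_s: "(\<Sum>i<n. s i x) = min (h x) (real n)" for n x
  proof (induction n)
    case 0 then show ?case using h(2)[of x] by simp
  next
    case (Suc n) then show ?case using h(2)[of x] by (auto simp: s_def min_def max_def)
  qed
  have Lh: "L h = (\<Sum>i<m. L (s i))"
  proof -
    have "h = (\<lambda>x. \<Sum>i<m. s i x)" using sum_s hm by (auto simp: min_def)
    then show ?thesis using L_sum[of m s] by (simp add: cs)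
  qed
  have [measurable]: "h \<in> borel_measurable borel" using h(1) by (rule borel_measurable_continuous_onI)
  define E where "E i = {x. real (Suc i) \<le> h x}" for i
  have E[measurable]: "E i \<in> sets borel" "E i \<in> sets riesz_measure" for i unfolding E_def by auto
  have pt: "ennreal (h x) \<le> 1 + (\<Sum>i<m. indicator (E i) x)" for x
  proof -
    have *: "min (h x) (real n) \<le> 1 + (\<Sum>i<n. indicator (E i) x)" for n
    proof (induction n)
      case 0 then show ?case by simp
    next
      case (Suc n)
      show ?case
      proof (cases "real (Suc n) \<le> h x")
        case True
        have "(\<Sum>i<n. indicator (E i) x) = (\<Sum>i<n. 1::real)"
          using True by (intro sum.cong) (auto simp: E_def)
        with True show ?thesis by (simp add: E_def)
      next
        case False
        show ?thesis
        proof (cases "real n \<le> h x")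
          case True
          then have "(\<Sum>i<n. indicator (E i) x) = (\<Sum>i<n. 1::real)"
            by (intro sum.cong) (auto simp: E_def)
          with False show ?thesis by (simp add: E_def)
        next
          case F2: False
          with Suc False show ?thesis by (simp add: E_def)
        qed
      qed
    qed
    have "ennreal (h x) \<le> ennreal (1 + (\<Sum>i<m. indicator (E i) x))"
      using *[of m] hm[of x] by (intro ennreal_leI) simp
    also have "\<dots> = 1 + (\<Sum>i<m. indicator (E i) x)"
      by (subst ennreal_plus) (auto simp: sum_nonneg simp flip: sum_ennreal ennreal_indicator)
    finally show ?thesis .
  qed
  have "(\<integral>\<^sup>+x. ennreal (h x) \<partial>riesz_measure) \<le>
      (\<integral>\<^sup>+x. 1 + (\<Sum>i<m. indicator (E i) x) \<partial>riesz_measure)"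
    by (intro nn_integral_mono pt)
  also have "\<dots> = 1 + (\<Sum>i<m. outer (E i))"
    using sets_eq_imp_space_eq[OF sets_riesz_measure] emeasure_space_1
    by (subst nn_integral_add) (auto simp: nn_integral_sum emeasure_riesz_measure)
  also have "(\<Sum>i<m. outer (E i)) \<le> (\<Sum>i<m. ennreal (L (s i)))"
    by (intro sum_mono outer_le1 cs s0) (auto simp: s_def E_def)
  also have "(\<Sum>i<m. ennreal (L (s i))) = ennreal (L h)"
    unfolding Lh by (intro sum_ennreal nonneg cs s0)
  finally show ?thesis by (simp add: add_left_mono)
qed

text \<open>The layer estimate for \<open>(n + 1) * g\<close> leaves an error of
  \<open>1 / (n + 1)\<close> for \<open>g\<close>. This yields only \<open>\<le>\<close>; the other
  direction is the same bound for \<open>B - f\<close>.\<close>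

lemma riesz_integral:
  assumes f: "continuous_on UNIV f"
  shows "(\<integral>x. f x \<partial>riesz_measure) = L f"
proof -
  interpret prob_space riesz_measure using riesz_measure_Prob by (simp add: Prob_iff)
  have int: "integrable riesz_measure g" if g: "continuous_on UNIV g" for g :: "'a \<Rightarrow> real"
  proof -
    obtain B where "\<And>x. \<bar>g x\<bar> \<le> B" using continuous_bounded[OF g] by auto
    then show ?thesis using borel_measurable_continuous_onI[OF g]
      by (intro integrable_const_bound[of _ B]) (auto simp: measurable_cong_sets[OF sets_riesz_measure refl])
  qed
  have le: "(\<integral>x. g x \<partial>riesz_measure) \<le> L g" if g: "continuous_on UNIV g" "\<And>x. 0 \<le> g x" for g
  proof -
    have "(\<integral>x. g x \<partial>riesz_measure) \<le> L g + inverse (real (Suc n))" for n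
    proof -
      let ?c = "real (Suc n)"
      have "(\<integral>\<^sup>+x. ennreal (?c * g x) \<partial>riesz_measure) \<le> 1 + ennreal (L (\<lambda>x. ?c * g x))"
        using g by (intro nn_integral_riesz_le) (auto intro!: continuous_intros)
      also have "(\<integral>\<^sup>+x. ennreal (?c * g x) \<partial>riesz_measure) = ennreal (\<integral>x. ?c * g x \<partial>riesz_measure)"
        using g by (intro nn_integral_eq_integral int continuous_intros) auto
      also have "1 + ennreal (L (\<lambda>x. ?c * g x)) = ennreal (1 + ?c * L g)"
        using nonneg[OF g] g(1) by (simp add: L_cmult)
      finally have "?c * (\<integral>x. g x \<partial>riesz_measure) \<le> 1 + ?c * L g"
        using nonneg[OF g] by (subst (asm) ennreal_le_iff) (auto intro!: add_nonneg_nonneg mult_nonneg_nonneg)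
      then show ?thesis by (simp add: field_simps)
    qed
    moreover have "(\<lambda>n. L g + inverse (real (Suc n))) \<longlonglongrightarrow> L g"
      using tendsto_add[OF tendsto_const LIMSEQ_inverse_real_of_nat, of "L g"] by simp
    ultimately show ?thesis by (intro LIMSEQ_le_const) auto
  qed
  obtain B where B: "\<And>x. \<bar>f x\<bar> \<le> B" using continuous_bounded[OF f] by auto
  have "0 \<le> f x + B" "0 \<le> B - f x" for x using B[of x] by auto
  then have "(\<integral>x. f x + B \<partial>riesz_measure) \<le> L (\<lambda>x. f x + B)" "(\<integral>x. B - f x \<partial>riesz_measure) \<le> L (\<lambda>x. B - f x)"
    using f by (auto intro!: le continuous_intros)
  then show ?thesis
    using int[OF f] f by (simp add: L_add L_diff L_const prob_space)
qed

end

theorem Riesz_representation: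
  fixes L :: "('a::metric_space \<Rightarrow> real) \<Rightarrow> real"
  assumes "compact (UNIV :: 'a set)" "linear_functional_on continuous_functions L"
    and "\<And>f. continuous_on UNIV f \<Longrightarrow> (\<And>x. 0 \<le> f x) \<Longrightarrow> 0 \<le> L f" and "L (\<lambda>_. 1) = 1"
  obtains \<mu> where "\<mu> \<in> Prob" "\<And>f. continuous_on UNIV f \<Longrightarrow> (\<integral>x. f x \<partial>\<mu>) = L f"
proof -
  interpret positive_functional L by unfold_locales (use assms in auto)
  show thesis using that riesz_measure_Prob riesz_integral by blast
qed

section \<open>The weak-star topology\<close>

lemma bcontfun_measurable [measurable]: "apply_bcontfun (g :: 'a::topological_space \<Rightarrow>\<^sub>C real) \<in> borel_measurable borel"
  by (rule borel_measurable_continuous_onI) simp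

lemma integrable_Prob_bounded:
  fixes f :: "'a::topological_space \<Rightarrow> real"
  assumes "\<mu> \<in> Prob" "f \<in> borel_measurable borel" "\<And>x. \<bar>f x\<bar> \<le> B"
  shows "integrable \<mu> f"
proof -
  interpret prob_space \<mu> using assms by (simp add: Prob_iff)
  show ?thesis using assms
    by (intro integrable_const_bound[of _ B]) (auto simp: Prob_iff cong: measurable_cong_sets)
qed

lemma abs_bcontfun_le: "\<bar>apply_bcontfun (g :: 'a::topological_space \<Rightarrow>\<^sub>C real) x\<bar> \<le> norm g"
  using norm_bounded[of g x] by simp

lemma integrable_bcontfun: "\<mu> \<in> Prob \<Longrightarrow> integrable \<mu> (apply_bcontfun (g :: 'a::topological_space \<Rightarrow>\<^sub>C real))"
  by (rule integrable_Prob_bounded[OF _ bcontfun_measurable abs_bcontfun_le])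

lemma Prob_measure_space [simp]: "\<mu> \<in> Prob \<Longrightarrow> measure \<mu> (space \<mu>) = 1"
  by (simp add: Prob_iff prob_space.prob_space)

lemma integral_bcontfun_le:
  assumes "\<mu> \<in> Prob" "\<And>x. apply_bcontfun g x \<le> (c::real)"
  shows "(\<integral>x. apply_bcontfun g x \<partial>\<mu>) \<le> c"
proof -
  interpret prob_space \<mu> using assms by (simp add: Prob_iff)
  have "(\<integral>x. apply_bcontfun g x \<partial>\<mu>) \<le> (\<integral>x. c \<partial>\<mu>)"
    using assms by (intro integral_mono integrable_bcontfun) auto
  then show ?thesis by (simp add: prob_space)
qed

lemma abs_integral_bcontfun_le:
  assumes "\<mu> \<in> Prob"
  shows "\<bar>\<integral>x. apply_bcontfun g x \<partial>\<mu>\<bar> \<le> norm g"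
proof -
  have "(\<integral>x. apply_bcontfun g x \<partial>\<mu>) \<le> norm g" "(\<integral>x. apply_bcontfun (- g) x \<partial>\<mu>) \<le> norm g"
    by (rule integral_bcontfun_le[OF assms], use abs_bcontfun_le[of g] in \<open>simp add: abs_le_iff\<close>)+
  then show ?thesis using integrable_bcontfun[OF assms, of g] by simp
qed

lemma return_Prob: "return borel x \<in> Prob"
  by (simp add: Prob_iff prob_space_return)

lemma integral_return_bcontfun [simp]: "(\<integral>y. apply_bcontfun g y \<partial>return borel x) = (apply_bcontfun g x :: real)"
  by (rule integral_return) auto

lemma integral_return_real:
  fixes f :: "'a::topological_space \<Rightarrow> real"
  assumes "f \<in> borel_measurable borel"
  shows "(\<integral>y. f y \<partial>return borel x) = f x"
  using assms by (intro integral_return) auto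

lemma bcontfun_compact:
  fixes f :: "'a::metric_space \<Rightarrow> real"
  assumes "compact (UNIV :: 'a set)" "continuous_on UNIV f"
  shows "f \<in> bcontfun"
  using compact_imp_bounded[OF compact_continuous_image[OF assms(2,1)]] assms(2) by (simp add: bcontfun_def)

lemma Prob_eqI_bcontfun:
  fixes \<mu> \<nu> :: "'a::metric_space measure"
  assumes "\<mu> \<in> Prob" "\<nu> \<in> Prob"
    and "\<And>g :: 'a \<Rightarrow>\<^sub>C real. (\<integral>x. apply_bcontfun g x \<partial>\<mu>) = (\<integral>x. apply_bcontfun g x \<partial>\<nu>)"
  shows "\<mu> = \<nu>"
proof (rule Prob_eqI[OF assms(1,2)])
  fix f :: "'a \<Rightarrow> real" assume f: "continuous_on UNIV f" "\<And>x. 0 \<le> f x" "\<And>x. f x \<le> 1"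
  then have "f \<in> bcontfun" by (intro bcontfun_normI[where b=1]) auto
  then show "(\<integral>x. f x \<partial>\<mu>) = (\<integral>x. f x \<partial>\<nu>)" using assms(3)[of "Bcontfun f"] by (simp add: Bcontfun_inverse)
qed

section \<open>Continuity of integrals and compactness in the weak-star topology\<close>

lemma topspace_weak_star [simp]: "topspace weak_star = Prob"
  by (simp add: weak_star_def topspace_pullback_topology)

lemma continuous_map_weak_star_integrals:
  "continuous_map weak_star euclidean (\<lambda>\<mu> (g :: 'a::topological_space \<Rightarrow>\<^sub>C real). \<integral>x. apply_bcontfun g x \<partial>\<mu>)"
  using continuous_map_pullback[of euclidean euclidean id Prob "\<lambda>\<mu> (g :: 'a \<Rightarrow>\<^sub>C real). \<integral>x. apply_bcontfun g x \<partial>\<mu>"]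
  by (simp add: weak_star_def o_def id_def)

lemma continuous_map_integral:
  "continuous_map weak_star euclideanreal (\<lambda>\<mu>. \<integral>x. apply_bcontfun g x \<partial>\<mu>)"
  using continuous_map_weak_star_integrals
  unfolding euclidean_product_topology[symmetric] continuous_map_componentwise_UNIV by blast

lemma continuous_map_integral_fst:
  "continuous_map (prod_topology weak_star W) euclideanreal (\<lambda>p. \<integral>x. apply_bcontfun g x \<partial>fst p)"
  using continuous_map_compose[OF continuous_map_fst continuous_map_integral] by (simp add: o_def)

lemma continuous_map_integral_snd:
  "continuous_map (prod_topology W weak_star) euclideanreal (\<lambda>p. \<integral>x. apply_bcontfun g x \<partial>snd p)"
  using continuous_map_compose[OF continuous_map_snd continuous_map_integral] by (simp add: o_def)

text \<open>Compactness in the form suited to systems of inequalities; an equation enters as a pair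
  of them.\<close>

lemma compactin_fip_nonneg:
  assumes S: "compactin W S" and F: "\<And>f. f \<in> F \<Longrightarrow> continuous_map W euclideanreal f"
    and fip: "\<And>G. finite G \<Longrightarrow> G \<subseteq> F \<Longrightarrow> \<exists>p\<in>S. \<forall>f\<in>G. 0 \<le> f p"
  shows "\<exists>p\<in>S. \<forall>f\<in>F. 0 \<le> f p"
proof -
  define C where "C f = {p \<in> topspace W. f p \<in> {0::real..}}" for f
  have cl: "closedin W D" if D: "D \<in> C ` F" for D
  proof -
    obtain f where f: "f \<in> F" "D = C f" using D by auto
    show ?thesis unfolding f(2) C_def by (rule closedin_continuous_map_preimage[OF F[OF f(1)]]) simp
  qed
  have fi: "S \<inter> \<Inter>\<F> \<noteq> {}" if \<F>: "finite \<F>" "\<F> \<subseteq> C ` F" for \<F>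
  proof -
    obtain G where G: "G \<subseteq> F" "finite G" "\<F> = C ` G" using finite_subset_image[OF \<F>] by blast
    obtain p where "p \<in> S" "\<forall>f\<in>G. 0 \<le> f p" using fip[OF G(2,1)] by blast
    moreover have "p \<in> topspace W" using S \<open>p \<in> S\<close> compactin_subset_topspace by blast
    ultimately show ?thesis unfolding G by (auto simp: C_def)
  qed
  have "S \<inter> \<Inter>(C ` F) \<noteq> {}"
    by (rule S[unfolded compactin_fip, THEN conjunct2, rule_format]) (use cl fi in blast)
  then show ?thesis by (auto simp: C_def)
qed

lemma compactin_attains_min:
  assumes "compactin W K" "K \<noteq> {}" "continuous_map W euclideanreal f"
  shows "\<exists>p\<in>K. \<forall>q\<in>K. f p \<le> (f q :: real)"
proof -
  have "compact (f ` K)" using image_compactin[OF assms(1,3)] by simp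
  from compact_attains_inf[OF this] assms(2) show ?thesis by auto
qed

text \<open>The fibre is cut out by closed conditions, since the integrals of continuous functions
  determine \<open>\<mu>\<close>.\<close>

lemma compactin_fibre:
  fixes S :: "('a::metric_space measure \<times> 'b::metric_space measure) set"
  assumes S: "S \<subseteq> Prob \<times> Prob" "compactin (prod_topology weak_star weak_star) S" and \<mu>: "\<mu> \<in> Prob"
  shows "compactin (prod_topology weak_star weak_star) {p \<in> S. fst p = \<mu>}"
proof -
  let ?W = "prod_topology weak_star weak_star :: ('a measure \<times> 'b measure) topology"
  define C where "C g = {p \<in> topspace ?W. (\<integral>x. apply_bcontfun g x \<partial>fst p) \<in> {\<integral>x. apply_bcontfun g x \<partial>\<mu>}}"
    for g :: "'a \<Rightarrow>\<^sub>C real"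
  have "closedin ?W (\<Inter>g. C g)"
    unfolding C_def by (intro closedin_INT closedin_continuous_map_preimage[OF continuous_map_integral_fst]) auto
  then have "compactin ?W (S \<inter> (\<Inter>g. C g))" using S(2) compact_Int_closedin by blast
  moreover have "S \<inter> (\<Inter>g. C g) = {p \<in> S. fst p = \<mu>}"
    using S \<mu> by (auto simp: C_def intro!: Prob_eqI_bcontfun)
  ultimately show ?thesis by simp
qed

text \<open>The integral of \<open>dist x\<close> against \<open>m\<close> measures how far
  \<open>m\<close> is from the Dirac measure at \<open>x\<close>: it is continuous in
  \<open>m\<close> and vanishes only there. On the compact part of \<open>S\<close> where the
  integral of \<open>g\<close> is at least \<open>a\<close> it therefore has a positive minimum,
  half of which serves as \<open>e\<close>.\<close>

lemma near_dirac:
  fixes S :: "('a::metric_space measure \<times> 'b::metric_space measure) set"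
  assumes X: "compact (UNIV :: 'a set)"
    and S: "S \<subseteq> Prob \<times> Prob" "compactin (prod_topology weak_star weak_star) S"
    and a: "\<And>\<sigma>. (return borel x, \<sigma>) \<in> S \<Longrightarrow> (\<integral>y. apply_bcontfun g y \<partial>\<sigma>) < (a::real)"
  shows "\<exists>e>0. \<forall>m s. (m, s) \<in> S \<longrightarrow> (\<integral>y. dist x y \<partial>m) \<le> e \<longrightarrow> (\<integral>y. apply_bcontfun g y \<partial>s) < a"
proof -
  let ?W = "prod_topology weak_star weak_star :: ('a measure \<times> 'b measure) topology"
  define d where "d = Bcontfun (dist x)"
  have d: "apply_bcontfun d = dist x" unfolding d_def
    by (intro Bcontfun_inverse bcontfun_compact[OF X] continuous_intros)
  define K where "K = S \<inter> {p \<in> topspace ?W. (\<integral>y. apply_bcontfun g y \<partial>snd p) \<in> {a..}}"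
  have K: "compactin ?W K" unfolding K_def
    by (intro compact_Int_closedin S closedin_continuous_map_preimage[OF continuous_map_integral_snd]) auto
  have KI: "(m, s) \<in> K" if "(m, s) \<in> S" "a \<le> (\<integral>y. apply_bcontfun g y \<partial>s)" for m s
    using that S by (auto simp: K_def)
  show ?thesis
  proof (cases "K = {}")
    case True
    then show ?thesis using KI by (intro exI[of _ 1]) force
  next
    case False
    obtain p where p: "p \<in> K" and min: "\<And>q. q \<in> K \<Longrightarrow> (\<integral>y. dist x y \<partial>fst p) \<le> (\<integral>y. dist x y \<partial>fst q)"
      using compactin_attains_min[OF K False continuous_map_integral_fst[of _ d]] by (auto simp: d)
    define e where "e = (\<integral>y. dist x y \<partial>fst p)"
    have p': "p \<in> S" "a \<le> (\<integral>y. apply_bcontfun g y \<partial>snd p)" "fst p \<in> Prob" using p S by (auto simp: K_def)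
    have "e \<noteq> 0"
    proof
      assume "e = 0"
      then have "AE y in fst p. dist x y = 0"
        using integral_nonneg_eq_0_iff_AE[OF integrable_bcontfun[OF p'(3), of d]] by (simp add: e_def d)
      then have AE: "AE y in fst p. y = x" by eventually_elim simp
      have "fst p = return borel x"
      proof (rule Prob_eqI_bcontfun[OF p'(3) return_Prob])
        fix h :: "'a \<Rightarrow>\<^sub>C real"
        have "(\<integral>y. apply_bcontfun h y \<partial>fst p) = (\<integral>y. apply_bcontfun h x \<partial>fst p)"
          using AE p'(3) by (intro integral_cong_AE) (auto simp: Prob_iff cong: measurable_cong_sets)
        then show "(\<integral>y. apply_bcontfun h y \<partial>fst p) = (\<integral>y. apply_bcontfun h y \<partial>return borel x)"
          using p'(3) by (simp add: Prob_iff prob_space.prob_space)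
      qed
      then show False using a[of "snd p"] p' by (metis not_le prod.collapse)
    qed
    moreover have "e \<ge> 0" unfolding e_def by (rule Bochner_Integration.integral_nonneg) simp
    ultimately have e: "e > 0" by simp
    show ?thesis
    proof (intro exI[of _ "e / 2"] conjI allI impI)
      fix m s assume ms: "(m, s) \<in> S" "(\<integral>y. dist x y \<partial>m) \<le> e / 2"
      show "(\<integral>y. apply_bcontfun g y \<partial>s) < a"
      proof (rule ccontr)
        assume "\<not> ?thesis"
        then have "e \<le> (\<integral>y. dist x y \<partial>m)" using min[OF KI[OF ms(1)]] by (simp add: e_def)
        with ms(2) e show False by simp
      qed
    qed (use e in simp)
  qed
qed

section \<open>Mixtures of probability measures\<close>

lemma nn_integral_bind_Prob:
  assumes "\<mu> \<in> space (prob_algebra M)" "\<kappa> \<in> M \<rightarrow>\<^sub>M prob_algebra N" "f \<in> borel_measurable N"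
  shows "(\<integral>\<^sup>+y. f y \<partial>(\<mu> \<bind> \<kappa>)) = (\<integral>\<^sup>+x. \<integral>\<^sup>+y. f y \<partial>\<kappa> x \<partial>\<mu>)"
proof (rule nn_integral_bind[OF assms(3)])
  have "sets \<mu> = sets M" using assms(1) by (simp add: space_prob_algebra)
  then show "\<kappa> \<in> \<mu> \<rightarrow>\<^sub>M subprob_algebra N"
    using measurable_prob_algebraD[OF assms(2)] by (simp cong: measurable_cong_sets)
qed

lemma bind_Prob:
  assumes "\<mu> \<in> space (prob_algebra M)" "\<kappa> \<in> M \<rightarrow>\<^sub>M prob_algebra borel"
  shows "\<mu> \<bind> \<kappa> \<in> Prob"
  using prob_space_bind'[OF assms] sets_bind'[OF assms] by (simp add: Prob_iff)

lemma integral_bind_Prob: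
  fixes f :: "'b::topological_space \<Rightarrow> real"
  assumes \<mu>: "\<mu> \<in> space (prob_algebra M)" and \<kappa>: "\<kappa> \<in> M \<rightarrow>\<^sub>M prob_algebra borel"
    and f: "f \<in> borel_measurable borel" "\<And>y. \<bar>f y\<bar> \<le> B"
  shows "(\<lambda>x. \<integral>y. f y \<partial>\<kappa> x) \<in> borel_measurable M"
    and "(\<integral>y. f y \<partial>(\<mu> \<bind> \<kappa>)) = (\<integral>x. \<integral>y. f y \<partial>\<kappa> x \<partial>\<mu>)"
proof -
  have \<mu>': "prob_space \<mu>" "sets \<mu> = sets M" using \<mu> by (auto simp: space_prob_algebra)
  then interpret prob_space \<mu> by simp
  have \<kappa>P: "\<kappa> x \<in> Prob" if "x \<in> space M" for x using \<kappa> that by (rule measurable_space)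
  have sp: "space \<mu> = space M" using \<mu>'(2) by (rule sets_eq_imp_space_eq)
  \<comment> \<open>Shifting by the bound \<open>B\<close> makes the integrand non-negative, where
    the formula for \<open>nn_integral\<close> applies; since all masses are 1, the shift cancels at
    the end.\<close>
  define F where "F y = f y + B" for y
  have F: "F \<in> borel_measurable borel" "0 \<le> F y" "\<bar>F y\<bar> \<le> 2 * B" for y
    using f(1) f(2)[of y] by (auto simp: F_def[abs_def])
  have intF: "integrable \<sigma> F" "integrable \<sigma> f" if "\<sigma> \<in> Prob" for \<sigma>
    using integrable_Prob_bounded that F f by blast+
  have IF: "(\<integral>y. F y \<partial>\<sigma>) = (\<integral>y. f y \<partial>\<sigma>) + B" if "\<sigma> \<in> Prob" for \<sigma>
  proof -
    interpret S: prob_space \<sigma> using that by (simp add: Prob_iff)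
    show ?thesis using intF[OF that] by (simp add: F_def S.prob_space)
  qed
  have m: "(\<lambda>x. \<integral>y. h y \<partial>\<kappa> x) \<in> borel_measurable M" if "h \<in> borel_measurable borel" for h :: "'b \<Rightarrow> real"
    using measurable_compose[OF measurable_prob_algebraD[OF \<kappa>] integral_measurable_subprob_algebra[OF that]] .
  from m[OF f(1)] show "(\<lambda>x. \<integral>y. f y \<partial>\<kappa> x) \<in> borel_measurable M" .
  then have m': "(\<lambda>x. \<integral>y. f y \<partial>\<kappa> x) \<in> borel_measurable \<mu>" using \<mu>'(2) by (simp cong: measurable_cong_sets)
  have bd: "\<bar>\<integral>y. f y \<partial>\<kappa> x\<bar> \<le> B" if "x \<in> space M" for x
  proof -
    interpret K: prob_space "\<kappa> x" using \<kappa>P[OF that] by (simp add: Prob_iff)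
    have "norm (\<integral>y. f y \<partial>\<kappa> x) \<le> (\<integral>y. norm (f y) \<partial>\<kappa> x)" by (rule integral_norm_bound)
    also have "\<dots> \<le> (\<integral>y. B \<partial>\<kappa> x)" using intF(2)[OF \<kappa>P[OF that]] f(2) by (intro integral_mono) auto
    finally show ?thesis by (simp add: K.prob_space)
  qed
  have intk: "integrable \<mu> (\<lambda>x. \<integral>y. f y \<partial>\<kappa> x)"
    using bd sp m' by (intro integrable_const_bound[of _ B]) auto
  have "ennreal (\<integral>y. F y \<partial>(\<mu> \<bind> \<kappa>)) = (\<integral>\<^sup>+y. ennreal (F y) \<partial>(\<mu> \<bind> \<kappa>))"
    using F(2) intF(1)[OF bind_Prob[OF \<mu> \<kappa>]] by (intro nn_integral_eq_integral[symmetric]) auto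
  also have "\<dots> = (\<integral>\<^sup>+x. \<integral>\<^sup>+y. ennreal (F y) \<partial>\<kappa> x \<partial>\<mu>)"
    using F(1) by (intro nn_integral_bind_Prob[OF \<mu> \<kappa>]) auto
  also have "\<dots> = (\<integral>\<^sup>+x. ennreal ((\<integral>y. f y \<partial>\<kappa> x) + B) \<partial>\<mu>)"
    using F(2) intF(1)[OF \<kappa>P] IF[OF \<kappa>P] sp by (intro nn_integral_cong) (simp add: nn_integral_eq_integral)
  also have "\<dots> = ennreal (\<integral>x. (\<integral>y. f y \<partial>\<kappa> x) + B \<partial>\<mu>)"
    using intk bd sp by (intro nn_integral_eq_integral) (force simp: abs_le_iff)+
  finally have "ennreal (\<integral>y. F y \<partial>(\<mu> \<bind> \<kappa>)) = ennreal (\<integral>x. (\<integral>y. f y \<partial>\<kappa> x) + B \<partial>\<mu>)" .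
  moreover have "0 \<le> (\<integral>x. (\<integral>y. f y \<partial>\<kappa> x) + B \<partial>\<mu>)"
    using bd sp by (intro integral_nonneg_AE AE_I2) (force simp: abs_le_iff)
  moreover have "0 \<le> (\<integral>y. F y \<partial>(\<mu> \<bind> \<kappa>))" using F(2) by (intro Bochner_Integration.integral_nonneg) auto
  ultimately have "(\<integral>y. F y \<partial>(\<mu> \<bind> \<kappa>)) = (\<integral>x. (\<integral>y. f y \<partial>\<kappa> x) + B \<partial>\<mu>)" by simp
  then show "(\<integral>y. f y \<partial>(\<mu> \<bind> \<kappa>)) = (\<integral>x. \<integral>y. f y \<partial>\<kappa> x \<partial>\<mu>)"
    using IF[OF bind_Prob[OF \<mu> \<kappa>]] intk by (simp add: prob_space)
qed

text \<open>The measure \<open>(1 - t) \<mu> + t \<nu>\<close>, with weight \<open>t\<close> on the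
  second argument. Written as a Bernoulli choice between the two, it inherits its integral formulas
  from \<open>bind\<close>.\<close>

definition mixture :: "real \<Rightarrow> 'a::topological_space measure \<Rightarrow> 'a measure \<Rightarrow> 'a measure" where
  "mixture t \<mu> \<nu> = measure_pmf (bernoulli_pmf t) \<bind> (\<lambda>b. if b then \<nu> else \<mu>)"

context
  fixes \<mu> \<nu> :: "'a::topological_space measure" and t :: real
  assumes P: "\<mu> \<in> Prob" "\<nu> \<in> Prob" and t: "0 \<le> t" "t \<le> 1"
begin

lemma mixture_aux:
  "measure_pmf (bernoulli_pmf t) \<in> space (prob_algebra (count_space UNIV))"
  "(\<lambda>b. if b then \<nu> else \<mu>) \<in> count_space UNIV \<rightarrow>\<^sub>M prob_algebra borel"
  using P by (auto simp: space_prob_algebra measure_pmf.prob_space_axioms)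

lemma mixture_Prob: "mixture t \<mu> \<nu> \<in> Prob"
  unfolding mixture_def by (rule bind_Prob[OF mixture_aux])

lemma nn_integral_mixture:
  "f \<in> borel_measurable borel \<Longrightarrow>
    (\<integral>\<^sup>+x. f x \<partial>mixture t \<mu> \<nu>) = ennreal (1 - t) * (\<integral>\<^sup>+x. f x \<partial>\<mu>) + ennreal t * (\<integral>\<^sup>+x. f x \<partial>\<nu>)"
  unfolding mixture_def using t by (subst nn_integral_bind_Prob[OF mixture_aux]) (auto simp: ac_simps)

lemma integral_mixture:
  fixes f :: "'a \<Rightarrow> real"
  assumes "f \<in> borel_measurable borel" "\<And>x. \<bar>f x\<bar> \<le> B"
  shows "(\<integral>x. f x \<partial>mixture t \<mu> \<nu>) = (1 - t) * (\<integral>x. f x \<partial>\<mu>) + t * (\<integral>x. f x \<partial>\<nu>)"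
  unfolding mixture_def using t by (subst integral_bind_Prob(2)[OF mixture_aux assms]) (auto simp: ac_simps)

lemma measure_mixture: "measure (mixture t \<mu> \<nu>) A = (1 - t) * measure \<mu> A + t * measure \<nu> A"
proof (cases "A \<in> sets borel")
  case True
  have *: "measure \<sigma> A = (\<integral>x. indicator A x \<partial>\<sigma>)" if "\<sigma> \<in> Prob" for \<sigma>
    using True that sets_eq_imp_space_eq[of \<sigma> borel] by (simp add: Prob_iff)
  show ?thesis unfolding *[OF P(1)] *[OF P(2)] *[OF mixture_Prob]
    by (rule integral_mixture[where B=1]) (use True in auto)
next
  case False
  then have "measure \<sigma> A = 0" if "\<sigma> \<in> Prob" for \<sigma> using that by (simp add: Prob_iff measure_notin_sets)
  then show ?thesis using P mixture_Prob by simp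
qed

end

section \<open>Passage between pairs of probability measures and pairs of set functions\<close>

lemma inj_signed_pair:
  assumes "p \<in> Prob \<times> Prob" "q \<in> Prob \<times> Prob" "signed_pair p = signed_pair q"
  shows "p = q"
proof -
  have *: "\<mu> = \<nu>" if "\<mu> \<in> Prob" "\<nu> \<in> Prob" "measure \<mu> = measure \<nu>" for \<mu> \<nu> :: "'c::topological_space measure"
    using that by (intro measure_eqI)
      (auto simp: Prob_iff finite_measure.emeasure_eq_measure prob_space.finite_measure)
  show ?thesis using assms
    by (cases p; cases q) (auto simp: signed_pair_def intro!: *)
qed

lemma signed_pair_mem_iff:
  assumes "S \<subseteq> Prob \<times> Prob" "p \<in> Prob \<times> Prob"
  shows "signed_pair p \<in> signed_pair ` S \<longleftrightarrow> p \<in> S"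
  using assms inj_signed_pair by blast

lemma mix_signed_pair:
  assumes "(\<mu>, \<nu>) \<in> Prob \<times> Prob" "(\<mu>', \<nu>') \<in> Prob \<times> Prob" "0 \<le> t" "t \<le> 1"
  shows "mix t (signed_pair (\<mu>, \<nu>)) (signed_pair (\<mu>', \<nu>')) = signed_pair (mixture t \<mu> \<mu>', mixture t \<nu> \<nu>')"
  using assms by (auto simp: mix_def signed_pair_def measure_mixture fun_eq_iff)

lemma convex_measuresD:
  assumes "convex_measures S" "S \<subseteq> Prob \<times> Prob" "(\<mu>, \<nu>) \<in> S" "(\<mu>', \<nu>') \<in> S" "0 \<le> t" "t \<le> 1"
  shows "(mixture t \<mu> \<mu>', mixture t \<nu> \<nu>') \<in> S"
proof -
  have "mix t (signed_pair (\<mu>, \<nu>)) (signed_pair (\<mu>', \<nu>')) \<in> signed_pair ` S"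
    using assms unfolding convex_measures_def by auto
  moreover have P: "(\<mu>, \<nu>) \<in> Prob \<times> Prob" "(\<mu>', \<nu>') \<in> Prob \<times> Prob" using assms by blast+
  ultimately show ?thesis
    using assms mixture_Prob[of \<mu> \<mu>' t] mixture_Prob[of \<nu> \<nu>' t]
    by (simp add: mix_signed_pair signed_pair_mem_iff)
qed

text \<open>Keeps the first marginal in place, so that convexity of \<open>S\<close> can be used
  inside one fibre.\<close>

lemma mixture_self: "\<mu> \<in> Prob \<Longrightarrow> 0 \<le> t \<Longrightarrow> t \<le> 1 \<Longrightarrow> mixture t \<mu> \<mu> = (\<mu> :: 'a::metric_space measure)"
  using integral_mixture[of \<mu> \<mu> t "apply_bcontfun g" "norm g" for g]
  by (intro Prob_eqI_bcontfun mixture_Prob) (auto simp: abs_bcontfun_le algebra_simps)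

section \<open>Separation\<close>

text \<open>If \<open>\<nu>\<close> is outside the compact convex fibre, some finitely many test functions separate it, and
  the fibre point nearest to \<open>\<nu>\<close> with respect to them yields the separating function.\<close>

lemma fibre_separation:
  fixes S :: "('a::metric_space measure \<times> 'b::metric_space measure) set"
  assumes S: "S \<subseteq> Prob \<times> Prob" "compactin (prod_topology weak_star weak_star) S" "convex_measures S"
    and \<mu>: "\<mu> \<in> Prob" and \<nu>: "\<nu> \<in> Prob"
    and sup: "\<And>g :: 'b \<Rightarrow>\<^sub>C real. \<And>e::real. e > 0 \<Longrightarrow>
      \<exists>\<sigma>. (\<mu>, \<sigma>) \<in> S \<and> (\<integral>y. apply_bcontfun g y \<partial>\<nu>) < (\<integral>y. apply_bcontfun g y \<partial>\<sigma>) + e"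
  shows "(\<mu>, \<nu>) \<in> S"
proof -
  let ?W = "prod_topology weak_star weak_star :: ('a measure \<times> 'b measure) topology"
  define K where "K = {p \<in> S. fst p = \<mu>}"
  have K: "compactin ?W K" unfolding K_def by (rule compactin_fibre[OF S(1,2) \<mu>])
  have KP: "snd p \<in> Prob" if "p \<in> K" for p using that S by (auto simp: K_def)
  have Kmem: "(\<mu>, \<sigma>) \<in> K \<longleftrightarrow> (\<mu>, \<sigma>) \<in> S" for \<sigma> by (simp add: K_def)
  define I where "I g \<sigma> = (\<integral>y. apply_bcontfun g y \<partial>\<sigma>)" for g :: "'b \<Rightarrow>\<^sub>C real" and \<sigma>
  have K0: "K \<noteq> {}" using sup[of 1 0] Kmem by auto
  have fin: "\<exists>p\<in>K. \<forall>g\<in>G. I g (snd p) = I g \<nu>" if G: "finite G" for G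
  proof -
    \<comment> \<open>Squared distance between the vectors of tested integrals of a fibre point and
      of \<open>\<nu>\<close>.\<close>
    define Q where "Q p = (\<Sum>g\<in>G. (I g (snd p) - I g \<nu>)\<^sup>2)" for p :: "'a measure \<times> 'b measure"
    have "continuous_map ?W euclideanreal Q" unfolding Q_def I_def
      by (intro continuous_map_sum continuous_map_real_pow continuous_map_diff continuous_map_integral_snd G) auto
    from compactin_attains_min[OF K K0 this] obtain p where p: "p \<in> K" "\<And>q. q \<in> K \<Longrightarrow> Q p \<le> Q q" by auto
    \<comment> \<open>The vector from the nearest point to \<open>\<nu>\<close>. The combination
      \<open>h\<close> of the test functions with these coefficients is the normal direction, and by
      \<open>Qp\<close> it separates the two points by exactly \<open>Q p\<close>.\<close>
    define c where "c g = I g \<nu> - I g (snd p)" for g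
    define h where "h = (\<Sum>g\<in>G. c g *\<^sub>R g)"
    have Ih: "I h \<sigma> = (\<Sum>g\<in>G. c g * I g \<sigma>)" if "\<sigma> \<in> Prob" for \<sigma>
    proof -
      have "apply_bcontfun h y = (\<Sum>g\<in>G. c g * apply_bcontfun g y)" for y
        unfolding h_def using G by (induction G) auto
      then have "apply_bcontfun h = (\<lambda>y. \<Sum>g\<in>G. c g * apply_bcontfun g y)" by auto
      then show ?thesis unfolding I_def using integrable_bcontfun[OF that] by simp
    qed
    have Qp: "I h \<nu> - I h (snd p) = Q p"
      unfolding Ih[OF \<nu>] Ih[OF KP[OF p(1)]] Q_def c_def
      by (simp add: power2_eq_square algebra_simps sum_subtractf sum.distrib flip: sum_subtractf)
    have le: "I h \<sigma> \<le> I h (snd p)" if "(\<mu>, \<sigma>) \<in> S" for \<sigma>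
    proof (rule ccontr)
      assume neg: "\<not> ?thesis"
      define a where "a = I h \<sigma> - I h (snd p)"
      have a: "a > 0" using neg by (simp add: a_def)
      define b where "b = (\<Sum>g\<in>G. (I g \<sigma> - I g (snd p))\<^sup>2)"
      have b: "b \<ge> 0" by (auto simp: b_def intro!: sum_nonneg)
      have \<sigma>P: "\<sigma> \<in> Prob" using that S by auto
      \<comment> \<open>Moving from \<open>p\<close> towards \<open>\<sigma>\<close> by
        \<open>t\<close> changes \<open>Q\<close> by \<open>- 2 * t * a + t\<^sup>2 * b\<close>.
        This step size keeps \<open>t * b\<close> at most \<open>a\<close>, so \<open>Q\<close>
        would drop below its minimum.\<close>
      define t where "t = min 1 (a / (b + 1))"
      have t: "0 < t" "t \<le> 1" using a b by (auto simp: t_def)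
      have pS: "(\<mu>, snd p) \<in> S" using p(1) by (cases p) (auto simp: K_def)
      have "(mixture t \<mu> \<mu>, mixture t (snd p) \<sigma>) \<in> S"
        using convex_measuresD[OF S(3,1) pS that] t by simp
      then have mem: "(\<mu>, mixture t (snd p) \<sigma>) \<in> K" using \<mu> t by (simp add: mixture_self K_def)
      have I: "I g (mixture t (snd p) \<sigma>) = (1 - t) * I g (snd p) + t * I g \<sigma>" for g
        unfolding I_def using KP[OF p(1)] \<sigma>P t abs_bcontfun_le by (intro integral_mixture) auto
      have "Q (\<mu>, mixture t (snd p) \<sigma>) = (\<Sum>g\<in>G. (I g (snd p) - I g \<nu>)\<^sup>2
          - 2 * t * (c g * I g \<sigma> - c g * I g (snd p)) + t\<^sup>2 * (I g \<sigma> - I g (snd p))\<^sup>2)"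
        unfolding Q_def by (intro sum.cong) (auto simp: I c_def power2_eq_square algebra_simps)
      also have "\<dots> = Q p - 2 * t * a + t\<^sup>2 * b"
        unfolding a_def Ih[OF \<sigma>P] Ih[OF KP[OF p(1)]] Q_def b_def
        by (simp add: sum.distrib sum_subtractf sum_distrib_left right_diff_distrib)
      finally have "Q p \<le> Q p - 2 * t * a + t\<^sup>2 * b" using p(2)[OF mem] by simp
      then have "2 * t * a \<le> t * (t * b)" by (simp add: power2_eq_square)
      then have "2 * a \<le> t * b" using t by simp
      also have "t * b \<le> a / (b + 1) * b" using b by (intro mult_right_mono) (auto simp: t_def)
      also have "\<dots> \<le> a" using a b by (simp add: field_simps)
      finally show False using a by simp
    qed
    have "Q p \<le> 0"
    proof (rule ccontr)
      assume "\<not> Q p \<le> 0"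
      then obtain \<sigma> where \<sigma>: "(\<mu>, \<sigma>) \<in> S" "I h \<nu> < I h \<sigma> + Q p" using sup[of "Q p" h] by (auto simp: I_def)
      with le[OF \<sigma>(1)] Qp show False by simp
    qed
    then have "Q p = 0" unfolding Q_def by (intro antisym sum_nonneg) auto
    then have "\<forall>g\<in>G. I g (snd p) = I g \<nu>" unfolding Q_def using G by (subst (asm) sum_nonneg_eq_0_iff) auto
    with p(1) show ?thesis by blast
  qed
  \<comment> \<open>Agreement on every finite set of test functions becomes agreement on all of them
    by the finite intersection property, each equation being two inequalities.\<close>
  define R1 where "R1 g p = I g \<nu> - I g (snd p)" for g and p :: "'a measure \<times> 'b measure"
  define R2 where "R2 g p = I g (snd p) - I g \<nu>" for g and p :: "'a measure \<times> 'b measure"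
  define F where "F = R1 ` UNIV \<union> R2 ` UNIV"
  have "\<exists>p\<in>K. \<forall>f\<in>F. 0 \<le> f p"
  proof (rule compactin_fip_nonneg[OF K])
    fix f assume "f \<in> F"
    then show "continuous_map ?W euclideanreal f"
      unfolding F_def R1_def[abs_def] R2_def[abs_def] I_def
      by (auto intro!: continuous_map_diff continuous_map_integral_snd)
  next
    fix H assume H: "finite H" "H \<subseteq> F"
    have "\<exists>C\<subseteq>UNIV. finite C \<and> H \<inter> R1 ` UNIV = R1 ` C" by (rule finite_subset_image) (use H in auto)
    then obtain G1 where G1: "finite G1" "H \<inter> R1 ` UNIV = R1 ` G1" by blast
    have "\<exists>C\<subseteq>UNIV. finite C \<and> H \<inter> R2 ` UNIV = R2 ` C" by (rule finite_subset_image) (use H in auto)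
    then obtain G2 where G2: "finite G2" "H \<inter> R2 ` UNIV = R2 ` G2" by blast
    obtain p where p: "p \<in> K" "\<forall>g\<in>G1 \<union> G2. I g (snd p) = I g \<nu>" using fin[of "G1 \<union> G2"] G1 G2 by auto
    have "0 \<le> f p" if "f \<in> H" for f
    proof -
      have "f \<in> R1 ` G1 \<union> R2 ` G2"
        using that H(2) G1(2) G2(2) unfolding F_def by blast
      then show ?thesis using p(2) by (auto simp: R1_def R2_def)
    qed
    with p(1) show "\<exists>p\<in>K. \<forall>f\<in>H. 0 \<le> f p" by blast
  qed
  then obtain p where p: "p \<in> K" "\<forall>f\<in>F. 0 \<le> f p" by blast
  have "I g (snd p) = I g \<nu>" for g
  proof -
    have "0 \<le> R1 g p" "0 \<le> R2 g p" using p(2) unfolding F_def by blast+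
    then show ?thesis by (simp add: R1_def R2_def)
  qed
  then have "snd p = \<nu>" using KP[OF p(1)] \<nu> by (intro Prob_eqI_bcontfun) (auto simp: I_def)
  with p(1) show ?thesis by (cases p) (auto simp: K_def)
qed

section \<open>Closedness in the space of pairs of signed measures\<close>

lemma topspace_signed_weak_star [simp]: "topspace signed_weak_star = signed_measures"
  by (simp add: signed_weak_star_def topspace_pullback_topology)

lemma continuous_map_measure: "continuous_map weak_star signed_weak_star measure"
  unfolding signed_weak_star_def
proof (rule continuous_map_pullback')
  show "continuous_map weak_star euclidean (signed_integral \<circ> measure)"
    by (rule continuous_map_eq[OF continuous_map_weak_star_integrals]) (auto simp: signed_integral_measure fun_eq_iff)
qed (auto simp: measure_in_signed_measures)

lemma Hausdorff_space_euclidean_fun: "Hausdorff_space (euclidean :: ('i \<Rightarrow> real) topology)"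
  unfolding euclidean_product_topology[symmetric] by (simp add: Hausdorff_space_product_topology)

lemma inj_signed_integral: "inj_on signed_integral (signed_measures :: ('a::metric_space set \<Rightarrow> real) set)"
proof (rule inj_onI)
  fix m m' :: "'a set \<Rightarrow> real"
  assume "m \<in> signed_measures" "m' \<in> signed_measures" and eq: "signed_integral m = signed_integral m'"
  then obtain P N P' N' where
    fin: "finite_measure P" "finite_measure N" "finite_measure P'" "finite_measure N'"
    and sets: "sets P = sets borel" "sets N = sets borel" "sets P' = sets borel" "sets N' = sets borel"
    and m: "m = (\<lambda>A. measure P A - measure N A)" "m' = (\<lambda>A. measure P' A - measure N' A)"
    unfolding signed_measures_def by auto
  have "measure P B + measure N' B = measure P' B + measure N B" if "B \<in> sets borel" for B
  proof (rule measure_determined_by_continuous[OF fin sets _ that])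
    fix f :: "'a \<Rightarrow> real" assume f: "continuous_on UNIV f" "\<And>x. 0 \<le> f x" "\<And>x. f x \<le> 1"
    then have "f \<in> bcontfun" by (intro bcontfun_normI[where b=1]) auto
    then have ap: "apply_bcontfun (Bcontfun f) = f" by (rule Bcontfun_inverse)
    have "signed_integral m (Bcontfun f) = signed_integral m' (Bcontfun f)" using eq by simp
    then show "(\<integral>x. f x \<partial>P) + (\<integral>x. f x \<partial>N') = (\<integral>x. f x \<partial>P') + (\<integral>x. f x \<partial>N)"
      unfolding m using fin sets by (simp add: signed_integral_diff ap)
  qed
  moreover have "measure M B = 0" if "sets M = sets borel" "B \<notin> sets borel" for M :: "'a measure" and B
    using that by (simp add: measure_notin_sets)
  ultimately have "m B = m' B" for B
    unfolding m using sets by (cases "B \<in> sets borel") (auto simp: algebra_simps)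
  then show "m = m'" by auto
qed

lemma Hausdorff_signed_weak_star: "Hausdorff_space (signed_weak_star :: ('a::metric_space set \<Rightarrow> real) topology)"
proof (rule Hausdorff_space_injective_preimage[OF Hausdorff_space_euclidean_fun])
  show "continuous_map signed_weak_star euclidean (signed_integral :: ('a set \<Rightarrow> real) \<Rightarrow> _)"
    using continuous_map_pullback[of euclidean euclidean id signed_measures "signed_integral :: ('a set \<Rightarrow> real) \<Rightarrow> _"]
    by (simp add: signed_weak_star_def)
  show "inj_on (signed_integral :: ('a set \<Rightarrow> real) \<Rightarrow> _) (topspace signed_weak_star)"
    using inj_signed_integral by simp
qed

text \<open>The indicator functional of \<open>S\<close> has to be lower semicontinuous on all pairs
  of signed measures, so \<open>S\<close> must be closed there and not only among probability
  measures. The larger space is Hausdorff because integrals separate signed measures, and compact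
  subsets of it are closed.\<close>

lemma closedin_signed_pair_image:
  fixes S :: "('a::metric_space measure \<times> 'b::metric_space measure) set"
  assumes "compactin (prod_topology weak_star weak_star) S"
  shows "closedin (prod_topology signed_weak_star signed_weak_star) (signed_pair ` S)"
proof (rule compactin_imp_closedin)
  show "Hausdorff_space (prod_topology signed_weak_star signed_weak_star :: (('a set \<Rightarrow> real) \<times> ('b set \<Rightarrow> real)) topology)"
    by (simp add: Hausdorff_space_prod_topology Hausdorff_signed_weak_star)
  have "continuous_map (prod_topology weak_star weak_star) (prod_topology signed_weak_star signed_weak_star)
      (signed_pair :: 'a measure \<times> 'b measure \<Rightarrow> _)"
    unfolding signed_pair_def map_prod_def case_prod_beta
    by (intro continuous_map_pairedI)
       (use continuous_map_compose[OF continuous_map_fst continuous_map_measure]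
          continuous_map_compose[OF continuous_map_snd continuous_map_measure] in \<open>simp_all add: o_def\<close>)
  from image_compactin[OF assms this]
  show "compactin (prod_topology signed_weak_star signed_weak_star) (signed_pair ` S)" .
qed

section \<open>Real-valued Kantorovich operators\<close>

text \<open>Real-valued form of a positively 1-homogenous backward Kantorovich operator. Homogeneity
  turns convexity into subadditivity and translation by constants into preservation of constants;
  lower semicontinuity in \<open>g\<close> reappears as the Lipschitz bound
  \<open>operator_lipschitz\<close>.\<close>

definition sublinear_operator :: "(('b::metric_space \<Rightarrow>\<^sub>C real) \<Rightarrow> 'a::metric_space \<Rightarrow> real) \<Rightarrow> bool" where
  "sublinear_operator t \<longleftrightarrow>
     (\<forall>g h x. t (g + h) x \<le> t g x + t h x) \<and>
     (\<forall>g x. \<forall>c\<ge>0. t (c *\<^sub>R g) x = c * t g x) \<and>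
     (\<forall>g h. (\<forall>y. apply_bcontfun g y \<le> apply_bcontfun h y) \<longrightarrow> (\<forall>x. t g x \<le> t h x)) \<and>
     (\<forall>c x. t (const_bcontfun c) x = c) \<and>
     (\<forall>g a. open {x. t g x < a})"

definition dominated ::
    "(('b::metric_space \<Rightarrow>\<^sub>C real) \<Rightarrow> 'a::metric_space \<Rightarrow> real) \<Rightarrow> 'a measure \<Rightarrow> 'b measure \<Rightarrow> bool" where
  "dominated t \<mu> \<nu> \<longleftrightarrow> (\<forall>g. (\<integral>y. apply_bcontfun g y \<partial>\<nu>) \<le> (\<integral>x. t g x \<partial>\<mu>))"

context
  fixes t :: "('b::metric_space \<Rightarrow>\<^sub>C real) \<Rightarrow> 'a::metric_space \<Rightarrow> real"
  assumes t: "sublinear_operator t"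
begin

lemma operator_add: "t (g + h) x \<le> t g x + t h x"
  and operator_scale: "0 \<le> c \<Longrightarrow> t (c *\<^sub>R g) x = c * t g x"
  and operator_mono: "(\<And>y. apply_bcontfun g y \<le> apply_bcontfun h y) \<Longrightarrow> t g x \<le> t h x"
  and operator_const: "t (const_bcontfun c) x = c"
  and operator_open: "open {x. t g x < a}"
  using t by (auto simp: sublinear_operator_def)

lemma operator_le_const: "(\<And>y. apply_bcontfun g y \<le> c) \<Longrightarrow> t g x \<le> c"
  using operator_mono[of g "const_bcontfun c" x] by (simp add: operator_const)

lemma operator_ge_const: "(\<And>y. c \<le> apply_bcontfun g y) \<Longrightarrow> c \<le> t g x"
  using operator_mono[of "const_bcontfun c" g x] by (simp add: operator_const)

lemma operator_abs_le: "\<bar>t g x\<bar> \<le> norm g"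
proof -
  have "apply_bcontfun g y \<le> norm g" "- norm g \<le> apply_bcontfun g y" for y
    using abs_bcontfun_le[of g y] by auto
  then show ?thesis using operator_le_const[of g "norm g" x] operator_ge_const[of "- norm g" g x] by simp
qed

lemma operator_lipschitz: "t g x \<le> t h x + norm (g - h)"
  using operator_add[of h "g - h" x] operator_abs_le[of "g - h" x] by simp

lemma operator_add_const: "t (g + const_bcontfun c) x = t g x + c"
proof (rule antisym)
  show "t (g + const_bcontfun c) x \<le> t g x + c"
    using operator_add[of g "const_bcontfun c" x] by (simp add: operator_const)
  have eq: "g + const_bcontfun c + const_bcontfun (- c) = g" by (rule bcontfun_eqI) simp
  have "t g x \<le> t (g + const_bcontfun c) x + t (const_bcontfun (- c)) x"
    using operator_add[of "g + const_bcontfun c" "const_bcontfun (- c)" x] unfolding eq .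
  then show "t g x + c \<le> t (g + const_bcontfun c) x" by (simp add: operator_const)
qed

lemma operator_measurable: "t g \<in> borel_measurable borel"
  unfolding borel_measurable_iff_less using operator_open by (auto intro: borel_open)

lemma operator_integrable: "\<mu> \<in> Prob \<Longrightarrow> integrable \<mu> (t g)"
  by (rule integrable_Prob_bounded[OF _ operator_measurable operator_abs_le])

lemma dominated_return:
  "dominated t (return borel x) \<sigma> \<longleftrightarrow> (\<forall>g. (\<integral>y. apply_bcontfun g y \<partial>\<sigma>) \<le> t g x)"
  unfolding dominated_def by (simp add: integral_return_real operator_measurable)

end

subsection \<open>Extended real integrals\<close>

lemma e2ennreal_ereal: "e2ennreal (ereal r) = ennreal r"
  by (simp add: ennreal.rep_eq ennreal_def e2ennreal_def)

lemma eintegral_ereal: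
  assumes "integrable \<mu> f"
  shows "eintegral \<mu> (\<lambda>x. ereal (f x)) = ereal (\<integral>x. f x \<partial>\<mu>)"
proof -
  have fin: "(\<integral>\<^sup>+x. ennreal (f x) \<partial>\<mu>) < \<infinity>" "(\<integral>\<^sup>+x. ennreal (- f x) \<partial>\<mu>) < \<infinity>"
    using assms real_integrable_def[of \<mu> f] by (auto simp: less_top)
  then obtain a b where ab: "(\<integral>\<^sup>+x. ennreal (f x) \<partial>\<mu>) = ennreal a" "0 \<le> a"
    "(\<integral>\<^sup>+x. ennreal (- f x) \<partial>\<mu>) = ennreal b" "0 \<le> b"
    by (auto simp: less_top_ennreal)
  show ?thesis
    using ab real_lebesgue_integral_def[OF assms]
    by (simp add: eintegral_def e2ennreal_ereal)
qed

lemma eintegral_return: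
  assumes "f \<in> borel_measurable borel"
  shows "eintegral (return borel x) f = f x"
proof -
  have "eintegral (return borel x) f = enn2ereal (e2ennreal (f x)) - enn2ereal (e2ennreal (- f x))"
    unfolding eintegral_def using assms by (subst (1 2) nn_integral_return) auto
  also have "\<dots> = f x"
  proof (cases "f x")
    case (real r)
    then show ?thesis by (cases "0 \<le> r") (auto simp: ennreal_neg zero_ennreal.rep_eq)
  qed (auto simp: e2ennreal_neg zero_ennreal.rep_eq)
  finally show ?thesis .
qed

subsection \<open>Correspondence with backward Kantorovich operators\<close>

lemma USC_ereal:
  assumes "\<And>x. \<bar>f x\<bar> \<le> B" "\<And>a. open {x. f x < (a::real)}"
  shows "(\<lambda>x::'a::metric_space. ereal (f x)) \<in> USC euclidean"
proof -
  have "openin euclidean {x \<in> topspace euclidean. ereal (f x) < a}" for a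
    using assms(2) by (cases a) auto
  moreover have "ereal (f x) \<le> ereal B" for x using assms(1)[of x] by simp
  ultimately show ?thesis unfolding USC_def usc_def by auto
qed

lemma sublinear_operator_Kantorovich:
  assumes t: "sublinear_operator t"
  shows "backward_Kantorovich_operator (\<lambda>g x. ereal (t g x))" "positively_1_homogenous (\<lambda>g x. ereal (t g x))"
proof -
  show "positively_1_homogenous (\<lambda>g x. ereal (t g x))"
    using operator_scale[OF t] by (simp add: positively_1_homogenous_def)
  have conv: "t (c *\<^sub>R g + (1 - c) *\<^sub>R h) x \<le> c * t g x + (1 - c) * t h x" if "c \<in> {0..1}" for c g h x
    using operator_add[OF t, of "c *\<^sub>R g" "(1 - c) *\<^sub>R h" x] operator_scale[OF t] that by simp
  have lim: "ereal (t g x) \<le> liminf (\<lambda>n. ereal (t (gs n) x))" if gs: "gs \<longlonglongrightarrow> g" for gs g x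
  proof -
    have "\<forall>\<^sub>F n in sequentially. norm (t (gs n) x - t g x) \<le> norm (gs n - g)"
    proof (rule always_eventually, rule allI)
      fix n
      show "norm (t (gs n) x - t g x) \<le> norm (gs n - g)"
        using operator_lipschitz[OF t, of "gs n" x g] operator_lipschitz[OF t, of g x "gs n"]
        by (simp add: norm_minus_commute abs_le_iff)
    qed
    moreover have "(\<lambda>n. norm (gs n - g)) \<longlonglongrightarrow> 0" using gs by (simp add: LIM_zero_iff tendsto_norm_zero)
    ultimately have "(\<lambda>n. t (gs n) x - t g x) \<longlonglongrightarrow> 0" by (rule Lim_null_comparison)
    then have "(\<lambda>n. ereal (t (gs n) x)) \<longlonglongrightarrow> ereal (t g x)" by (simp add: LIM_zero_iff)
    from lim_imp_Liminf[OF trivial_limit_sequentially this] show ?thesis by simp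
  qed
  show "backward_Kantorovich_operator (\<lambda>g x. ereal (t g x))"
    unfolding backward_Kantorovich_operator_def
    using USC_ereal[OF operator_abs_le[OF t] operator_open[OF t]] operator_mono[OF t]
      operator_add_const[OF t] conv lim by simp
qed

text \<open>The point is finiteness. Homogeneity with factor 0 gives \<open>T 0 = 0\<close>, since 0
  times an infinite value is 0; translation then determines \<open>T\<close> on constants, and
  monotonicity traps \<open>T g\<close> between two of them.\<close>

lemma Kantorovich_sublinear_operator:
  fixes T :: "('b::metric_space \<Rightarrow>\<^sub>C real) \<Rightarrow> 'a::metric_space \<Rightarrow> ereal"
  assumes "backward_Kantorovich_operator T" "positively_1_homogenous T"
  shows "\<exists>t. sublinear_operator t \<and> T = (\<lambda>g x. ereal (t g x))"
proof -
  have usc: "T g \<in> USC euclidean"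
    and mono: "(\<And>y. apply_bcontfun g y \<le> apply_bcontfun h y) \<Longrightarrow> T g x \<le> T h x"
    and const: "T (g + const_bcontfun c) x = T g x + ereal c"
    and conv: "s \<in> {0..1} \<Longrightarrow> T (s *\<^sub>R g + (1 - s) *\<^sub>R h) x \<le> ereal s * T g x + ereal (1 - s) * T h x"
    for g h x c and s :: real
    using assms(1) unfolding backward_Kantorovich_operator_def by blast+
  have hom: "0 \<le> c \<Longrightarrow> T (c *\<^sub>R g) x = ereal c * T g x" for c g x
    using assms(2) by (simp add: positively_1_homogenous_def)
  have T0: "T 0 x = 0" for x using hom[of 0 0 x] by (simp add: zero_ereal_def[symmetric])
  have Tc: "T (const_bcontfun c) x = ereal c" for c x using const[of 0 c x] T0 by simp
  have fin: "\<bar>T g x\<bar> \<noteq> \<infinity>" for g x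
  proof -
    have "apply_bcontfun g y \<le> norm g" "- norm g \<le> apply_bcontfun g y" for y
      using abs_bcontfun_le[of g y] by auto
    then have "T g x \<le> ereal (norm g)" "ereal (- norm g) \<le> T g x"
      using mono[of g "const_bcontfun (norm g)" x] mono[of "const_bcontfun (- norm g)" g x] by (auto simp: Tc)
    then show ?thesis by auto
  qed
  define t where "t g x = real_of_ereal (T g x)" for g x
  have Tt: "T g x = ereal (t g x)" for g x using fin[of g x] by (simp add: t_def ereal_real)
  have scale: "t (c *\<^sub>R g) x = c * t g x" if "0 \<le> c" for c g x using hom[OF that, of g x] by (simp add: Tt)
  have "t (g + h) x \<le> t g x + t h x" for g h x
  proof -
    \<comment> \<open>Subadditivity is convexity at the midpoint of \<open>2 g\<close> and
      \<open>2 h\<close>.\<close>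
    have "g + h = (1/2) *\<^sub>R (2 *\<^sub>R g) + (1 - 1/2) *\<^sub>R (2 *\<^sub>R h)" by simp
    then have "T (g + h) x \<le> ereal (1/2) * T (2 *\<^sub>R g) x + ereal (1 - 1/2) * T (2 *\<^sub>R h) x"
      using conv[of "1/2" "2 *\<^sub>R g" "2 *\<^sub>R h" x] by simp
    then show ?thesis by (simp add: Tt scale)
  qed
  moreover have "open {x. t g x < a}" for g a
    using usc[of g] unfolding USC_def usc_def by (auto simp: Tt dest!: spec[of _ "ereal a"])
  moreover have "t (const_bcontfun c) x = c" for c x using Tc[of c x] by (simp add: Tt)
  moreover have "t g x \<le> t h x" if "\<forall>y. apply_bcontfun g y \<le> apply_bcontfun h y" for g h x
    using mono[of g h x] that by (simp add: Tt)
  ultimately have "sublinear_operator t" unfolding sublinear_operator_def using scale by blast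
  then show ?thesis using Tt by (intro exI[of _ t]) auto
qed

lemma dominated_by_push_iff:
  assumes "sublinear_operator t" "\<mu> \<in> Prob"
  shows "dominated_by_push (\<lambda>g x. ereal (t g x)) \<mu> \<nu> \<longleftrightarrow> dominated t \<mu> \<nu>"
  by (simp add: dominated_by_push_def dominated_def eintegral_ereal operator_integrable[OF assms])

definition dominated_pairs ::
    "(('b::metric_space \<Rightarrow>\<^sub>C real) \<Rightarrow> 'a::metric_space \<Rightarrow> real) \<Rightarrow> ('a measure \<times> 'b measure) set" where
  "dominated_pairs t = {(\<mu>, \<nu>) \<in> Prob \<times> Prob. dominated t \<mu> \<nu>}"

lemma dominated_pairs_iff: "(\<mu>, \<nu>) \<in> dominated_pairs t \<longleftrightarrow> \<mu> \<in> Prob \<and> \<nu> \<in> Prob \<and> dominated t \<mu> \<nu>"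
  by (auto simp: dominated_pairs_def)

text \<open>From here on only real-valued operators and ordinary integrals are needed.\<close>

lemma Kantorovich_pairs_iff:
  fixes S :: "('a::metric_space measure \<times> 'b::metric_space measure) set"
  shows "(\<exists>T. backward_Kantorovich_operator T \<and> positively_1_homogenous T \<and>
      S = {(\<mu>, \<nu>) \<in> Prob \<times> Prob. dominated_by_push T \<mu> \<nu>}) \<longleftrightarrow>
    (\<exists>t. sublinear_operator t \<and> S = dominated_pairs t)"
proof -
  have eq: "{(\<mu>, \<nu>) \<in> Prob \<times> Prob. dominated_by_push (\<lambda>g x. ereal (t g x)) \<mu> \<nu>} = dominated_pairs t"
    if "sublinear_operator t" for t :: "('b \<Rightarrow>\<^sub>C real) \<Rightarrow> 'a \<Rightarrow> real"
    using dominated_by_push_iff[OF that] by (auto simp: dominated_pairs_def)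
  show ?thesis
  proof
    assume "\<exists>T. backward_Kantorovich_operator T \<and> positively_1_homogenous T \<and>
      S = {(\<mu>, \<nu>) \<in> Prob \<times> Prob. dominated_by_push T \<mu> \<nu>}"
    then obtain T where T: "backward_Kantorovich_operator T" "positively_1_homogenous T"
      "S = {(\<mu>, \<nu>) \<in> Prob \<times> Prob. dominated_by_push T \<mu> \<nu>}" by blast
    from Kantorovich_sublinear_operator[OF T(1,2)] obtain t where
      t: "sublinear_operator t" "T = (\<lambda>g x. ereal (t g x))" by blast
    from T(3) have "S = dominated_pairs t" unfolding t(2) eq[OF t(1)] .
    with t(1) show "\<exists>t. sublinear_operator t \<and> S = dominated_pairs t" by blast
  next
    assume "\<exists>t. sublinear_operator t \<and> S = dominated_pairs t"
    then obtain t where t: "sublinear_operator t" "S = dominated_pairs t" by blast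
    show "\<exists>T. backward_Kantorovich_operator T \<and> positively_1_homogenous T \<and>
      S = {(\<mu>, \<nu>) \<in> Prob \<times> Prob. dominated_by_push T \<mu> \<nu>}"
      unfolding t(2)
      by (intro exI[of _ "\<lambda>g x. ereal (t g x)"] conjI sublinear_operator_Kantorovich t(1) eq[OF t(1), symmetric])
  qed
qed

section \<open>Attainment\<close>

lemma Bcontfun_simps:
  fixes f g :: "'b::metric_space \<Rightarrow> real"
  assumes "compact (UNIV :: 'b set)" "continuous_on UNIV f"
  shows "apply_bcontfun (Bcontfun f) = f"
    "continuous_on UNIV g \<Longrightarrow> Bcontfun (\<lambda>x. f x + g x) = Bcontfun f + Bcontfun g"
    "Bcontfun (\<lambda>x. c * f x) = c *\<^sub>R Bcontfun f"
proof -
  have *: "apply_bcontfun (Bcontfun h) = h" if "continuous_on UNIV h" for h :: "'b \<Rightarrow> real"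
    by (intro Bcontfun_inverse bcontfun_compact assms that)
  show "apply_bcontfun (Bcontfun f) = f" by (rule *) fact
  show "Bcontfun (\<lambda>x. f x + g x) = Bcontfun f + Bcontfun g" if "continuous_on UNIV g"
    using that assms(2) by (intro bcontfun_eqI) (simp add: * continuous_intros)
  show "Bcontfun (\<lambda>x. c * f x) = c *\<^sub>R Bcontfun f"
    using assms(2) by (intro bcontfun_eqI) (simp add: * continuous_intros)
qed

text \<open>A linear functional below \<open>f \<mapsto> \<integral> t f d\<mu>\<close> comes from a
  probability measure dominated by \<open>\<mu>\<close>; a demand in the single direction
  \<open>g\<close> turns the supremum into a maximum.\<close>

lemma dominated_attained:
  fixes t :: "('b::metric_space \<Rightarrow>\<^sub>C real) \<Rightarrow> 'a::metric_space \<Rightarrow> real"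
  assumes Y: "compact (UNIV :: 'b set)" and t: "sublinear_operator t" and \<mu>: "\<mu> \<in> Prob"
  shows "\<exists>\<nu>\<in>Prob. dominated t \<mu> \<nu> \<and>
    (\<integral>y. apply_bcontfun g y \<partial>\<nu>) = (\<integral>x. t g x \<partial>\<mu>)"
proof -
  define V where "V = (continuous_functions :: ('b \<Rightarrow> real) set)"
  have V: "function_space V" unfolding V_def by (rule function_space_continuous)
  define p where "p f = (\<integral>x. t (Bcontfun f) x \<partial>\<mu>)" for f :: "'b \<Rightarrow> real"
  note int = operator_integrable[OF t \<mu>]
  note B = Bcontfun_simps[OF Y]
  have p: "sublinear_on V p"
    unfolding sublinear_on_def
  proof (intro conjI ballI allI impI)
    fix f h assume "f \<in> V" "h \<in> V"
    then have "p (\<lambda>x. f x + h x) \<le> (\<integral>x. t (Bcontfun f) x + t (Bcontfun h) x \<partial>\<mu>)"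
      unfolding p_def by (intro integral_mono) (auto simp: int V_def B operator_add[OF t])
    then show "p (\<lambda>x. f x + h x) \<le> p f + p h" by (simp add: p_def int)
  next
    fix f and c :: real assume "f \<in> V" "0 \<le> c"
    then show "p (\<lambda>x. c * f x) = c * p f" by (simp add: p_def V_def B operator_scale[OF t])
  qed
  define g0 where "g0 = apply_bcontfun g"
  have g0: "g0 \<in> V" by (simp add: V_def g0_def)
  \<comment> \<open>The ray of \<open>g\<close> with its own value under \<open>p\<close>: the
    demand \<open>p g0 \<le> L g0\<close> and the bound \<open>L \<le> p\<close> give
    equality.\<close>
  define C where "C = {((\<lambda>x. c * g0 x), c * p g0) | c. c \<ge> 0}"
  have C1: "bound_cone C" unfolding bound_cone_def
  proof (intro conjI allI impI)
    show "(\<lambda>_. 0, 0) \<in> C" unfolding C_def by (intro CollectI exI[of _ 0]) auto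
  next
    fix v b w d assume "(v, b) \<in> C" "(w, d) \<in> C"
    then obtain r s where "r \<ge> 0" "s \<ge> 0" "v = (\<lambda>x. r * g0 x)" "b = r * p g0"
      "w = (\<lambda>x. s * g0 x)" "d = s * p g0" by (auto simp: C_def)
    then show "(\<lambda>x. v x + w x, b + d) \<in> C"
      unfolding C_def by (intro CollectI exI[of _ "r + s"]) (auto simp: algebra_simps)
  next
    fix v b and c :: real assume "c \<ge> 0" "(v, b) \<in> C"
    then obtain r where "r \<ge> 0" "v = (\<lambda>x. r * g0 x)" "b = r * p g0" by (auto simp: C_def)
    then show "(\<lambda>x. c * v x, c * b) \<in> C"
      using \<open>c \<ge> 0\<close> unfolding C_def by (intro CollectI exI[of _ "c * r"]) auto
  qed
  have C2: "\<forall>v b. (v, b) \<in> C \<longrightarrow> v \<in> V \<and> b \<le> p v"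
    using g0 function_spaceD(3)[OF V] sublinear_onD(2)[OF p] by (auto simp: C_def)
  obtain L where L: "linear_functional_on V L" "\<forall>f\<in>V. L f \<le> p f" "\<forall>v b. (v, b) \<in> C \<longrightarrow> b \<le> L v"
    using Mazur_Orlicz[OF V p C1 C2] by blast
  \<comment> \<open>This one bound gives positivity, applied to \<open>- f\<close>, and total mass
    1, applied to the constants 1 and - 1.\<close>
  have le_const: "p f \<le> c" if "f \<in> V" "\<And>y. f y \<le> c" for f c
  proof -
    interpret prob_space \<mu> using \<mu> by (simp add: Prob_iff)
    have "p f \<le> (\<integral>x. c \<partial>\<mu>)" unfolding p_def using that
      by (intro integral_mono int operator_le_const[OF t]) (auto simp: V_def B)
    then show ?thesis by (simp add: prob_space)
  qed
  have L_le: "L f \<le> c" if "f \<in> V" "\<And>y. f y \<le> c" for f c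
    using L(2) le_const that by (meson order_trans)
  have nonneg: "0 \<le> L f" if "continuous_on UNIV f" "\<And>x. 0 \<le> f x" for f
    using L_le[of "\<lambda>x. - f x" 0] linear_functional_onD(3)[OF L(1), of f] that
    by (simp add: V_def continuous_on_minus)
  have "L (\<lambda>_. 1) \<le> 1" "L (\<lambda>_. - 1) \<le> - 1" using L_le by (auto simp: V_def)
  then have one: "L (\<lambda>_. 1) = 1" using linear_functional_onD(3)[OF L(1), of "\<lambda>_. 1"] by (simp add: V_def)
  obtain \<nu> where \<nu>: "\<nu> \<in> Prob" "\<And>f. continuous_on UNIV f \<Longrightarrow> (\<integral>x. f x \<partial>\<nu>) = L f"
    using Riesz_representation[OF Y L(1)[unfolded V_def] nonneg one] by blast
  have Bg: "Bcontfun (apply_bcontfun h) = h" for h :: "'b \<Rightarrow>\<^sub>C real" by (rule apply_bcontfun_inverse)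
  have "(\<integral>y. apply_bcontfun h y \<partial>\<nu>) \<le> (\<integral>x. t h x \<partial>\<mu>)" for h
  proof -
    have "L (apply_bcontfun h) \<le> p (apply_bcontfun h)" using L(2) by (simp add: V_def)
    then show ?thesis using \<nu>(2)[of "apply_bcontfun h"] by (simp add: p_def Bg)
  qed
  moreover have "(g0, p g0) \<in> C" unfolding C_def by (intro CollectI exI[of _ 1]) auto
  then have "p g0 \<le> L g0" using L(3) by blast
  then have "(\<integral>x. t g x \<partial>\<mu>) \<le> (\<integral>y. apply_bcontfun g y \<partial>\<nu>)"
    using \<nu>(2)[of g0] by (simp add: p_def g0_def Bg)
  ultimately show ?thesis using \<nu>(1) unfolding dominated_def by (intro bexI[of _ \<nu>]) (auto intro: antisym)
qed

section \<open>The operator of a standard compact set\<close>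

text \<open>Support function of the fibre of \<open>S\<close> over the Dirac measure at
  \<open>x\<close>.\<close>

definition hull_operator ::
    "('a::metric_space measure \<times> 'b::metric_space measure) set \<Rightarrow> ('b \<Rightarrow>\<^sub>C real) \<Rightarrow> 'a \<Rightarrow> real" where
  "hull_operator S g x = (SUP \<sigma>\<in>{\<sigma>. (return borel x, \<sigma>) \<in> S}. \<integral>y. apply_bcontfun g y \<partial>\<sigma>)"

context
  fixes S :: "('a::metric_space measure \<times> 'b::metric_space measure) set"
  assumes SP: "S \<subseteq> Prob \<times> Prob" and std: "standard_set S"
begin

lemma hull_nonempty: "{\<sigma>. (return borel x, \<sigma>) \<in> S} \<noteq> {}"
  using std by (auto simp: standard_set_def)

lemma hull_upper:
  assumes "(return borel x, \<sigma>) \<in> S"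
  shows "(\<integral>y. apply_bcontfun g y \<partial>\<sigma>) \<le> hull_operator S g x"
  unfolding hull_operator_def
proof (rule cSUP_upper)
  have "(\<integral>y. apply_bcontfun g y \<partial>\<sigma>) \<le> norm g" if "(return borel x, \<sigma>) \<in> S" for \<sigma>
    using abs_integral_bcontfun_le[of \<sigma> g] that SP by (auto dest: subsetD)
  then show "bdd_above ((\<lambda>\<sigma>. \<integral>y. apply_bcontfun g y \<partial>\<sigma>) ` {\<sigma>. (return borel x, \<sigma>) \<in> S})"
    by (intro bdd_aboveI2[of _ _ "norm g"]) auto
qed (use assms in simp)

lemma hull_least:
  "(\<And>\<sigma>. (return borel x, \<sigma>) \<in> S \<Longrightarrow> (\<integral>y. apply_bcontfun g y \<partial>\<sigma>) \<le> a) \<Longrightarrow> hull_operator S g x \<le> a"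
  unfolding hull_operator_def using hull_nonempty by (intro cSUP_least) auto

lemma hull_approx:
  assumes "e > 0"
  shows "\<exists>\<sigma>. (return borel x, \<sigma>) \<in> S \<and> hull_operator S g x < (\<integral>y. apply_bcontfun g y \<partial>\<sigma>) + e"
proof (rule ccontr)
  assume "\<not> ?thesis"
  then have "hull_operator S g x \<le> hull_operator S g x - e" by (intro hull_least) force
  with assms show False by simp
qed

lemma hull_Prob: "(return borel x, \<sigma>) \<in> S \<Longrightarrow> \<sigma> \<in> Prob"
  using SP by auto

lemma sublinear_operator_hull:
  assumes X: "compact (UNIV :: 'a set)" and S: "compactin (prod_topology weak_star weak_star) S"
  shows "sublinear_operator (hull_operator S)"
proof -
  note int = integrable_bcontfun[OF hull_Prob]
  have add: "hull_operator S (g + h) x \<le> hull_operator S g x + hull_operator S h x" for g h x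
    using int by (intro hull_least) (auto intro!: add_mono hull_upper)
  have scale: "hull_operator S (c *\<^sub>R g) x = c * hull_operator S g x" if c: "0 \<le> c" for c g x
  proof (cases "c = 0")
    case True
    have "hull_operator S 0 x \<le> 0" by (rule hull_least) simp
    moreover obtain \<sigma> where "(return borel x, \<sigma>) \<in> S" using hull_nonempty by blast
    from hull_upper[OF this, of 0] have "0 \<le> hull_operator S 0 x" by simp
    ultimately show ?thesis using True by simp
  next
    case False
    have le: "hull_operator S (d *\<^sub>R f) x \<le> d * hull_operator S f x" if "0 < d" for d f
      using that by (intro hull_least) (auto intro!: mult_left_mono hull_upper)
    have "hull_operator S (inverse c *\<^sub>R (c *\<^sub>R g)) x \<le> inverse c * hull_operator S (c *\<^sub>R g) x"
      using c False by (intro le) auto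
    then have "c * hull_operator S g x \<le> hull_operator S (c *\<^sub>R g) x" using c False by (simp add: field_simps)
    with le[of c g] c False show ?thesis by simp
  qed
  have mono: "hull_operator S g x \<le> hull_operator S h x" if "\<forall>y. apply_bcontfun g y \<le> apply_bcontfun h y" for g h x
  proof (rule hull_least)
    fix \<sigma> assume \<sigma>: "(return borel x, \<sigma>) \<in> S"
    have "(\<integral>y. apply_bcontfun g y \<partial>\<sigma>) \<le> (\<integral>y. apply_bcontfun h y \<partial>\<sigma>)"
      using that by (intro integral_mono int[OF \<sigma>]) auto
    also have "\<dots> \<le> hull_operator S h x" by (rule hull_upper[OF \<sigma>])
    finally show "(\<integral>y. apply_bcontfun g y \<partial>\<sigma>) \<le> hull_operator S h x" .
  qed
  have const: "hull_operator S (const_bcontfun c) x = c" for c x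
  proof (rule antisym)
    show "hull_operator S (const_bcontfun c) x \<le> c"
      by (rule hull_least) (simp add: hull_Prob integral_bcontfun_le)
    obtain \<sigma> where \<sigma>: "(return borel x, \<sigma>) \<in> S" using hull_nonempty by blast
    from hull_upper[OF \<sigma>, of "const_bcontfun c"] show "c \<le> hull_operator S (const_bcontfun c) x"
      by (simp add: hull_Prob[OF \<sigma>])
  qed
  \<comment> \<open>The Dirac measure at \<open>z\<close> integrates \<open>dist x\<close> to
    \<open>dist x z\<close>, so by \<open>near_dirac\<close> the fibres over nearby points obey the
    strict bound \<open>b\<close>. Passing to the supremum weakens this to \<open>\<le> b\<close>,
    which the gap between \<open>b\<close> and \<open>a\<close> absorbs.\<close>
  have op: "open {x. hull_operator S g x < a}" for g a
    unfolding open_dist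
  proof safe
    fix x assume "hull_operator S g x < a"
    then obtain b where b: "hull_operator S g x < b" "b < a" using dense by blast
    have "(\<integral>y. apply_bcontfun g y \<partial>\<sigma>) < b" if "(return borel x, \<sigma>) \<in> S" for \<sigma>
      using hull_upper[OF that, of g] b by simp
    from near_dirac[OF X SP S this] obtain e where e: "e > 0"
      "\<And>m s. (m, s) \<in> S \<Longrightarrow> (\<integral>y. dist x y \<partial>m) \<le> e \<Longrightarrow> (\<integral>y. apply_bcontfun g y \<partial>s) < b" by blast
    have "hull_operator S g z < a" if "dist z x < e" for z
    proof -
      have "(\<integral>y. dist x y \<partial>return borel z) \<le> e"
        using that by (subst integral_return_real)
          (auto simp: dist_commute intro!: borel_measurable_continuous_onI continuous_intros)
      then have "hull_operator S g z \<le> b" using e(2) by (intro hull_least) (auto intro: less_imp_le)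
      with b show ?thesis by simp
    qed
    with e(1) show "\<exists>e>0. \<forall>z. dist z x < e \<longrightarrow> z \<in> {x. hull_operator S g x < a}" by auto
  qed
  show ?thesis unfolding sublinear_operator_def using add scale mono const op by blast
qed

text \<open>A compact convex fibre is recovered from its support function.\<close>

lemma dominated_hull_return:
  assumes X: "compact (UNIV :: 'a set)" and S: "compactin (prod_topology weak_star weak_star) S" "convex_measures S"
    and \<sigma>: "\<sigma> \<in> Prob"
  shows "dominated (hull_operator S) (return borel x) \<sigma> \<longleftrightarrow> (return borel x, \<sigma>) \<in> S"
  unfolding dominated_return[OF sublinear_operator_hull[OF X S(1)]]
proof
  assume dom: "\<forall>g. (\<integral>y. apply_bcontfun g y \<partial>\<sigma>) \<le> hull_operator S g x"
  show "(return borel x, \<sigma>) \<in> S"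
  proof (rule fibre_separation[OF SP S return_Prob \<sigma>])
    fix g :: "'b \<Rightarrow>\<^sub>C real" and e :: real assume "e > 0"
    from hull_approx[OF this] obtain \<tau> where
      "(return borel x, \<tau>) \<in> S" "hull_operator S g x < (\<integral>y. apply_bcontfun g y \<partial>\<tau>) + e" by blast
    then show "\<exists>\<tau>. (return borel x, \<tau>) \<in> S \<and> (\<integral>y. apply_bcontfun g y \<partial>\<sigma>) < (\<integral>y. apply_bcontfun g y \<partial>\<tau>) + e"
      using dom by (intro exI[of _ \<tau>]) (auto intro: le_less_trans)
  qed
qed (auto intro: hull_upper)

end

section \<open>Gambling houses are the sets given by operators\<close>

text \<open>Tested at Dirac measures, the transfer identity shows that the transfer map is the hull
  operator. Hence over every \<open>\<mu>\<close> the support function of the fibre of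
  \<open>S\<close> is \<open>\<integral> hull_operator S g d\<mu>\<close>, and separation in that
  fibre identifies its members.\<close>

lemma gambling_house_dominated_pairs:
  fixes S :: "('a::metric_space measure \<times> 'b::metric_space measure) set"
  assumes X: "compact (UNIV :: 'a set)" and S: "S \<subseteq> Prob \<times> Prob"
    "compactin (prod_topology weak_star weak_star) S" "convex_measures S"
    and gh: "gambling_house S"
  shows "S = dominated_pairs (hull_operator S)"
proof -
  have std: "standard_set S" and bt: "backward_transfer_set S" using gh by (auto simp: gambling_house_def)
  let ?t = "hull_operator S"
  note t = sublinear_operator_hull[OF S(1) std X S(2)]
  obtain Tm :: "('b \<Rightarrow>\<^sub>C real) \<Rightarrow> 'a \<Rightarrow> ereal" where Tm: "\<And>g. Tm g \<in> borel_measurable borel"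
    and sup: "\<And>\<mu> g. \<mu> \<in> Prob \<Longrightarrow> (SUP \<sigma>\<in>Prob. ereal (\<integral>y. apply_bcontfun g y \<partial>\<sigma>) -
        (if signed_pair (\<mu>, \<sigma>) \<in> signed_pair ` S then 0 else \<infinity>)) = eintegral \<mu> (Tm g)"
    using bt unfolding backward_transfer_set_def backward_linear_transfer_def by blast
  \<comment> \<open>A pair outside \<open>S\<close> contributes \<open>- \<infinity>\<close>, so the
    supremum over all probability measures is a supremum over the fibre.\<close>
  have sup': "(SUP \<sigma>\<in>{\<sigma>. (\<mu>, \<sigma>) \<in> S}. ereal (\<integral>y. apply_bcontfun g y \<partial>\<sigma>)) = eintegral \<mu> (Tm g)"
    if \<mu>: "\<mu> \<in> Prob" for \<mu> g
    unfolding sup[OF \<mu>, symmetric]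
  proof (rule antisym)
    show "(SUP \<sigma>\<in>{\<sigma>. (\<mu>, \<sigma>) \<in> S}. ereal (\<integral>y. apply_bcontfun g y \<partial>\<sigma>)) \<le>
      (SUP \<sigma>\<in>Prob. ereal (\<integral>y. apply_bcontfun g y \<partial>\<sigma>) - (if signed_pair (\<mu>, \<sigma>) \<in> signed_pair ` S then 0 else \<infinity>))"
    proof (rule SUP_mono)
      fix \<sigma> assume "\<sigma> \<in> {\<sigma>. (\<mu>, \<sigma>) \<in> S}"
      then show "\<exists>\<tau>\<in>Prob. ereal (\<integral>y. apply_bcontfun g y \<partial>\<sigma>) \<le> ereal (\<integral>y. apply_bcontfun g y \<partial>\<tau>) -
          (if signed_pair (\<mu>, \<tau>) \<in> signed_pair ` S then 0 else \<infinity>)"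
        using S(1) by (intro bexI[of _ \<sigma>]) auto
    qed
    show "(SUP \<sigma>\<in>Prob. ereal (\<integral>y. apply_bcontfun g y \<partial>\<sigma>) - (if signed_pair (\<mu>, \<sigma>) \<in> signed_pair ` S then 0 else \<infinity>))
      \<le> (SUP \<sigma>\<in>{\<sigma>. (\<mu>, \<sigma>) \<in> S}. ereal (\<integral>y. apply_bcontfun g y \<partial>\<sigma>))"
      using \<mu> by (intro SUP_least) (auto simp: signed_pair_mem_iff[OF S(1)] intro: SUP_upper)
  qed
  have "Tm g x = ereal (?t g x)" for g x
  proof -
    have "Tm g x = (SUP \<sigma>\<in>{\<sigma>. (return borel x, \<sigma>) \<in> S}. ereal (\<integral>y. apply_bcontfun g y \<partial>\<sigma>))"
      using sup'[OF return_Prob] eintegral_return[OF Tm] by simp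
    also have "\<dots> = ereal (?t g x)"
    proof (rule antisym)
      show "(SUP \<sigma>\<in>{\<sigma>. (return borel x, \<sigma>) \<in> S}. ereal (\<integral>y. apply_bcontfun g y \<partial>\<sigma>)) \<le> ereal (?t g x)"
        using hull_upper[OF S(1) std] by (intro SUP_least) auto
      show "ereal (?t g x) \<le> (SUP \<sigma>\<in>{\<sigma>. (return borel x, \<sigma>) \<in> S}. ereal (\<integral>y. apply_bcontfun g y \<partial>\<sigma>))"
      proof (rule ereal_le_epsilon2)
        fix e :: real assume "0 < e"
        from hull_approx[OF S(1) std this] obtain \<sigma> where
          \<sigma>: "(return borel x, \<sigma>) \<in> S" "?t g x < (\<integral>y. apply_bcontfun g y \<partial>\<sigma>) + e" by blast
        have "ereal (?t g x) \<le> ereal (\<integral>y. apply_bcontfun g y \<partial>\<sigma>) + ereal e" using \<sigma>(2) by simp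
        also have "\<dots> \<le> (SUP \<sigma>\<in>{\<sigma>. (return borel x, \<sigma>) \<in> S}. ereal (\<integral>y. apply_bcontfun g y \<partial>\<sigma>)) + ereal e"
          using \<sigma>(1) by (intro add_right_mono SUP_upper) auto
        finally show "ereal (?t g x) \<le> (SUP \<sigma>\<in>{\<sigma>. (return borel x, \<sigma>) \<in> S}. ereal (\<integral>y. apply_bcontfun g y \<partial>\<sigma>)) + ereal e" .
      qed
    qed
    finally show ?thesis .
  qed
  then have Tt: "Tm g = (\<lambda>x. ereal (?t g x))" for g by auto
  have key: "(SUP \<sigma>\<in>{\<sigma>. (\<mu>, \<sigma>) \<in> S}. ereal (\<integral>y. apply_bcontfun g y \<partial>\<sigma>)) = ereal (\<integral>x. ?t g x \<partial>\<mu>)"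
    if \<mu>: "\<mu> \<in> Prob" for \<mu> g
    unfolding sup'[OF \<mu>] Tt by (rule eintegral_ereal[OF operator_integrable[OF t \<mu>]])
  show ?thesis
  proof (rule set_eqI)
    fix p :: "'a measure \<times> 'b measure"
    obtain \<mu> \<nu> where p: "p = (\<mu>, \<nu>)" by (cases p)
    have "(\<mu>, \<nu>) \<in> S \<longleftrightarrow> \<mu> \<in> Prob \<and> \<nu> \<in> Prob \<and> dominated ?t \<mu> \<nu>"
    proof (intro iffI conjI)
      assume mem: "(\<mu>, \<nu>) \<in> S"
      then show \<mu>: "\<mu> \<in> Prob" and "\<nu> \<in> Prob" using S(1) by auto
      show "dominated ?t \<mu> \<nu>" unfolding dominated_def
      proof
        fix g :: "'b \<Rightarrow>\<^sub>C real"
        have "ereal (\<integral>y. apply_bcontfun g y \<partial>\<nu>) \<le> (SUP \<sigma>\<in>{\<sigma>. (\<mu>, \<sigma>) \<in> S}. ereal (\<integral>y. apply_bcontfun g y \<partial>\<sigma>))"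
          using mem by (intro SUP_upper) auto
        then show "(\<integral>y. apply_bcontfun g y \<partial>\<nu>) \<le> (\<integral>x. ?t g x \<partial>\<mu>)" unfolding key[OF \<mu>] by simp
      qed
    next
      assume dom: "\<mu> \<in> Prob \<and> \<nu> \<in> Prob \<and> dominated ?t \<mu> \<nu>"
      show "(\<mu>, \<nu>) \<in> S"
      proof (rule fibre_separation[OF S])
        fix g :: "'b \<Rightarrow>\<^sub>C real" and e :: real assume "e > 0"
        then have "(\<integral>y. apply_bcontfun g y \<partial>\<nu>) - e < (\<integral>x. ?t g x \<partial>\<mu>)"
          using dom by (auto simp: dominated_def intro: less_le_trans[rotated])
        then have "ereal ((\<integral>y. apply_bcontfun g y \<partial>\<nu>) - e) < (SUP \<sigma>\<in>{\<sigma>. (\<mu>, \<sigma>) \<in> S}. ereal (\<integral>y. apply_bcontfun g y \<partial>\<sigma>))"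
          using dom by (subst key) auto
        then show "\<exists>\<sigma>. (\<mu>, \<sigma>) \<in> S \<and> (\<integral>y. apply_bcontfun g y \<partial>\<nu>) < (\<integral>y. apply_bcontfun g y \<partial>\<sigma>) + e"
          by (auto simp: less_SUP_iff algebra_simps)
      qed (use dom in auto)
    qed
    then show "p \<in> S \<longleftrightarrow> p \<in> dominated_pairs ?t" by (simp add: p dominated_pairs_iff)
  qed
qed

lemma dominated_pairs_standard:
  fixes t :: "('b::metric_space \<Rightarrow>\<^sub>C real) \<Rightarrow> 'a::metric_space \<Rightarrow> real"
  assumes Y: "compact (UNIV :: 'b set)" and t: "sublinear_operator t"
  shows "standard_set (dominated_pairs t)"
  using dominated_attained[OF Y t return_Prob] unfolding standard_set_def dominated_pairs_iff
  by (blast intro: return_Prob)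

text \<open>The operator itself serves as transfer map, by \<open>dominated_attained\<close>.
  Compactness of \<open>S\<close> supplies lower semicontinuity of the indicator functional,
  convexity of \<open>S\<close> its convexity.\<close>

lemma dominated_pairs_gambling_house:
  fixes t :: "('b::metric_space \<Rightarrow>\<^sub>C real) \<Rightarrow> 'a::metric_space \<Rightarrow> real"
  assumes Y: "compact (UNIV :: 'b set)" and t: "sublinear_operator t" and St: "S = dominated_pairs t"
    and S: "compactin (prod_topology weak_star weak_star) S" "convex_measures S"
  shows "gambling_house S"
proof -
  have SP: "S \<subseteq> Prob \<times> Prob" by (auto simp: St dominated_pairs_def)
  have std: "standard_set S" unfolding St by (rule dominated_pairs_standard[OF Y t])
  let ?Q = "signed_pair ` S"
  define F where "F p = (if p \<in> ?Q then 0 else \<infinity> :: ereal)" for p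
  have QP: "?Q \<subseteq> signed_measures \<times> signed_measures"
    using SP by (auto simp: signed_pair_def measure_in_signed_measures)
  obtain \<sigma> where "(return borel undefined, \<sigma>) \<in> S" using std by (auto simp: standard_set_def)
  then obtain q where q: "q \<in> ?Q" by blast
  have mix01: "mix 0 p q = p" "mix 1 p q = q" for p q :: "('a set \<Rightarrow> real) \<times> ('b set \<Rightarrow> real)"
    by (auto simp: mix_def)
  \<comment> \<open>At the end points \<open>0 * \<infinity> = 0\<close>, so the mixture must return
    the remaining point exactly; strictly in between, one infinite term makes the right-hand side
    infinite.\<close>
  have conv: "F (mix c p r) \<le> ereal (1 - c) * F p + ereal c * F r" if "c \<in> {0..1}" for c p r
  proof (cases "c = 0 \<or> c = 1")
    case True then show ?thesis by (auto simp: mix01 F_def)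
  next
    case False
    with that have "0 < c" "c < 1" by auto
    moreover have "mix c p r \<in> ?Q" if "p \<in> ?Q" "r \<in> ?Q"
      using S(2) that \<open>c \<in> {0..1}\<close> unfolding convex_measures_def by blast
    ultimately show ?thesis by (auto simp: F_def)
  qed
  have cl: "closedin (prod_topology signed_weak_star signed_weak_star) ?Q"
    by (rule closedin_signed_pair_image[OF S(1)])
  have "lsc (prod_topology signed_weak_star signed_weak_star) F" unfolding lsc_def
  proof
    \<comment> \<open>The superlevel sets of an indicator functional are the whole space, the
      complement of the set, and the empty set.\<close>
    fix a :: ereal
    let ?W = "prod_topology signed_weak_star signed_weak_star :: (('a set \<Rightarrow> real) \<times> ('b set \<Rightarrow> real)) topology"
    consider "a < 0" | "0 \<le> a" "a < \<infinity>" | "a = \<infinity>" by force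
    then show "openin ?W {p \<in> topspace ?W. a < F p}"
    proof cases
      case 1
      then have "{p \<in> topspace ?W. a < F p} = topspace ?W" by (auto simp: F_def intro: less_trans[of a 0])
      then show ?thesis by (simp only: openin_topspace)
    next
      case 2
      then have "{p \<in> topspace ?W. a < F p} = topspace ?W - ?Q" by (auto simp: F_def)
      then show ?thesis using cl by (simp only: openin_diff openin_topspace)
    qed (simp add: F_def)
  qed
  moreover have "\<exists>Tm :: ('b \<Rightarrow>\<^sub>C real) \<Rightarrow> 'a \<Rightarrow> ereal.
        (\<forall>g. Tm g \<in> borel_measurable borel \<and> (\<exists>c::real. \<forall>x. Tm g x \<le> ereal c)) \<and>
        (\<forall>\<mu>\<in>Prob. \<forall>g. (SUP \<sigma>\<in>Prob. ereal (\<integral>y. apply_bcontfun g y \<partial>\<sigma>) - F (signed_pair (\<mu>, \<sigma>))) = eintegral \<mu> (Tm g))"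
  proof (intro exI[of _ "\<lambda>g x. ereal (t g x)"] conjI allI ballI)
    fix g
    show "(\<lambda>x. ereal (t g x)) \<in> borel_measurable borel" using operator_measurable[OF t] by simp
    show "\<exists>c::real. \<forall>x. ereal (t g x) \<le> ereal c"
      using operator_abs_le[OF t, of g] by (intro exI[of _ "norm g"]) (auto simp: abs_le_iff)
  next
    fix \<mu> :: "'a measure" and g assume \<mu>: "\<mu> \<in> Prob"
    have FS: "F (signed_pair (\<mu>, \<sigma>)) = (if (\<mu>, \<sigma>) \<in> S then 0 else \<infinity>)" if "\<sigma> \<in> Prob" for \<sigma>
      using signed_pair_mem_iff[OF SP, of "(\<mu>, \<sigma>)"] \<mu> that by (simp add: F_def)
    have "(SUP \<sigma>\<in>Prob. ereal (\<integral>y. apply_bcontfun g y \<partial>\<sigma>) - F (signed_pair (\<mu>, \<sigma>))) = ereal (\<integral>x. t g x \<partial>\<mu>)"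
    proof (rule antisym)
      show "(SUP \<sigma>\<in>Prob. ereal (\<integral>y. apply_bcontfun g y \<partial>\<sigma>) - F (signed_pair (\<mu>, \<sigma>))) \<le> ereal (\<integral>x. t g x \<partial>\<mu>)"
        by (rule SUP_least) (auto simp: FS St dominated_pairs_iff dominated_def)
      obtain \<nu> where \<nu>: "\<nu> \<in> Prob" "dominated t \<mu> \<nu>" "(\<integral>y. apply_bcontfun g y \<partial>\<nu>) = (\<integral>x. t g x \<partial>\<mu>)"
        using dominated_attained[OF Y t \<mu>, of g] by blast
      have "(\<mu>, \<nu>) \<in> S" using \<nu> \<mu> by (simp add: St dominated_pairs_iff)
      then have "ereal (\<integral>x. t g x \<partial>\<mu>) = ereal (\<integral>y. apply_bcontfun g y \<partial>\<nu>) - F (signed_pair (\<mu>, \<nu>))"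
        using \<nu> by (simp add: FS)
      also have "\<dots> \<le> (SUP \<sigma>\<in>Prob. ereal (\<integral>y. apply_bcontfun g y \<partial>\<sigma>) - F (signed_pair (\<mu>, \<sigma>)))"
        using \<nu>(1) by (rule SUP_upper)
      finally show "ereal (\<integral>x. t g x \<partial>\<mu>) \<le> (SUP \<sigma>\<in>Prob. ereal (\<integral>y. apply_bcontfun g y \<partial>\<sigma>) - F (signed_pair (\<mu>, \<sigma>)))" .
    qed
    then show "(SUP \<sigma>\<in>Prob. ereal (\<integral>y. apply_bcontfun g y \<partial>\<sigma>) - F (signed_pair (\<mu>, \<sigma>))) =
        eintegral \<mu> (\<lambda>x. ereal (t g x))"
      by (simp add: eintegral_ereal operator_integrable[OF t \<mu>])
  qed
  moreover have "\<exists>p \<in> signed_measures \<times> signed_measures. F p < \<infinity>"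
    using q QP by (intro bexI[of _ q]) (auto simp: F_def)
  moreover have "ereal 0 \<le> F p" for p by (simp add: F_def)
  moreover have "p \<in> signed_pair ` (Prob \<times> Prob)" if "F p < \<infinity>" for p
    using that SP by (auto simp: F_def split: if_splits)
  ultimately have "backward_linear_transfer F"
    unfolding backward_linear_transfer_def using conv by blast
  then have "backward_transfer_set S"
    using SP unfolding backward_transfer_set_def F_def[abs_def] by blast
  with std show ?thesis by (simp add: gambling_house_def)
qed

section \<open>Approximation by continuous functions\<close>

text \<open>Functions with a common modulus of continuity that agree up to \<open>1 / k\<close> on a finite net are close,
  so it suffices to pick one function for each table of rounded values.\<close>

lemma separable_bcontfun:
  assumes Y: "compact (UNIV :: 'b::metric_space set)"
  shows "\<exists>D :: ('b \<Rightarrow>\<^sub>C real) set. countable D \<and> (\<forall>f. \<forall>e>0. \<exists>d\<in>D. norm (d - f) < e)"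
proof -
  have "\<exists>ys :: 'b list. \<forall>x. \<exists>y\<in>set ys. dist x y < inverse (real (Suc n))" for n
  proof -
    obtain K :: "'b set" where K: "finite K" "UNIV \<subseteq> (\<Union>x\<in>K. ball x (inverse (real (Suc n))))"
      using seq_compact_imp_totally_bounded[OF compact_imp_seq_compact[OF Y]] by (metis inverse_positive_iff_positive of_nat_0_less_iff zero_less_Suc)
    obtain ys where "set ys = K" using finite_list[OF K(1)] by blast
    with K(2) show ?thesis by (intro exI[of _ ys]) (force simp: dist_commute subset_iff)
  qed
  then obtain ys :: "nat \<Rightarrow> 'b list" where ys: "\<And>n x. \<exists>y\<in>set (ys n). dist x y < inverse (real (Suc n))" by metis
  define good where "good f n k \<longleftrightarrow> (\<forall>x y. dist x y < inverse (real (Suc n)) \<longrightarrow>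
      \<bar>apply_bcontfun f x - apply_bcontfun f y\<bar> < inverse (real (Suc k)))" for f :: "'b \<Rightarrow>\<^sub>C real" and n k
  define table where "table f n k = map (\<lambda>y. \<lfloor>real (Suc k) * apply_bcontfun f y\<rfloor>) (ys n)" for f :: "'b \<Rightarrow>\<^sub>C real" and n k
  \<comment> \<open>The indices run through a countable type. For the table of a function with the
    given modulus the choice is never vacuous, as that function is itself a candidate.\<close>
  define pick where "pick = (\<lambda>(n, k, v). SOME d. good d n k \<and> table d n k = v)"
  have "countable (range pick)" by simp
  moreover have "\<exists>d\<in>range pick. norm (d - f) < e" if e: "e > 0" for f :: "'b \<Rightarrow>\<^sub>C real" and e
  proof -
    obtain k where k: "inverse (real (Suc k)) < e / 3" using reals_Archimedean[of "e / 3"] e by auto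
    have "uniformly_continuous_on UNIV (apply_bcontfun f)"
      by (rule compact_uniformly_continuous[OF _ Y]) simp
    then obtain r where r: "r > 0" "\<And>x y. dist x y < r \<Longrightarrow> dist (apply_bcontfun f x) (apply_bcontfun f y) < inverse (real (Suc k))"
      unfolding uniformly_continuous_on_def by (metis UNIV_I dist_commute inverse_positive_iff_positive of_nat_0_less_iff zero_less_Suc)
    obtain n where n: "inverse (real (Suc n)) < r" using reals_Archimedean[OF r(1)] by auto
    have gf: "good f n k" unfolding good_def using r(2) n by (auto simp: dist_real_def)
    define d where "d = pick (n, k, table f n k)"
    have "good d n k \<and> table d n k = table f n k"
      unfolding d_def pick_def prod.case by (rule someI[of _ f]) (simp add: gf)
    then have gd: "good d n k" and eq: "table d n k = table f n k" by auto
    \<comment> \<open>One error each for moving \<open>d\<close> and \<open>f\<close> to the net,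
      and one for the rounding.\<close>
    have "norm (d - f) \<le> 3 * inverse (real (Suc k))"
    proof (rule norm_bound)
      fix x
      obtain y where y: "y \<in> set (ys n)" "dist x y < inverse (real (Suc n))" using ys by blast
      have "\<bar>apply_bcontfun f x - apply_bcontfun f y\<bar> < inverse (real (Suc k))"
        "\<bar>apply_bcontfun d x - apply_bcontfun d y\<bar> < inverse (real (Suc k))"
        using gf gd y(2) by (auto simp: good_def)
      moreover have "\<lfloor>real (Suc k) * apply_bcontfun d y\<rfloor> = \<lfloor>real (Suc k) * apply_bcontfun f y\<rfloor>"
        using eq y(1) by (auto simp: table_def)
      then have "\<bar>real (Suc k) * apply_bcontfun d y - real (Suc k) * apply_bcontfun f y\<bar> < 1" by linarith
      then have "\<bar>real (Suc k) * (apply_bcontfun d y - apply_bcontfun f y)\<bar> < 1" by (simp only: right_diff_distrib)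
      then have "\<bar>apply_bcontfun d y - apply_bcontfun f y\<bar> < inverse (real (Suc k))"
        unfolding abs_mult abs_of_nat
        by (simp add: inverse_eq_divide pos_less_divide_eq mult.commute del: of_nat_Suc)
      ultimately show "norm (apply_bcontfun (d - f) x) \<le> 3 * inverse (real (Suc k))" by simp
    qed
    with k have "norm (d - f) < e" by simp
    then show ?thesis unfolding d_def by blast
  qed
  ultimately show ?thesis by blast
qed

text \<open>Dynkin induction from open sets. The values stay in [0, 1] so that the approximation may
  later be pulled out of a positively homogeneous operator.\<close>

lemma indicator_approx_continuous:
  fixes \<mu> :: "'a::metric_space measure"
  assumes \<mu>: "\<mu> \<in> Prob" and A: "A \<in> sets borel" and e: "(e::real) > 0"
  shows "\<exists>h. continuous_on UNIV h \<and> (\<forall>x. 0 \<le> h x \<and> h x \<le> 1) \<and> (\<integral>x. \<bar>h x - indicator A x\<bar> \<partial>\<mu>) < e"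
proof -
  interpret prob_space \<mu> using \<mu> by (simp add: Prob_iff)
  have sets_eq[measurable_cong]: "sets \<mu> = sets borel" using \<mu> by (simp add: Prob_iff)
  have sp: "space \<mu> = UNIV" using sets_eq_imp_space_eq[OF sets_eq] by simp
  have int: "integrable \<mu> (\<lambda>x. \<bar>h x - indicator B x\<bar>)"
    if "continuous_on UNIV h" "\<And>x. 0 \<le> h x" "\<And>x. h x \<le> 1" "B \<in> sets borel" for h :: "'a \<Rightarrow> real" and B :: "'a set"
  proof -
    have [measurable]: "h \<in> borel_measurable borel" "B \<in> sets borel" using that by (auto intro: borel_measurable_continuous_onI)
    have pt: "\<bar>\<bar>h x - indicator B x\<bar>\<bar> \<le> 1" for x
      using that(2,3)[of x] by (cases "x \<in> B") (simp_all add: abs_le_iff)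
    show ?thesis by (rule integrable_Prob_bounded[OF \<mu> _ pt]) measurable
  qed
  have "A \<in> sigma_sets UNIV {S. open S}" using A by (simp add: borel_def)
  have "Int_stable {S :: 'a set. open S}" "{S :: 'a set. open S} \<subseteq> Pow UNIV" by (auto simp: Int_stable_def)
  then show ?thesis using \<open>A \<in> sigma_sets UNIV {S. open S}\<close> e
  proof (induction arbitrary: e rule: sigma_sets_induct_disjoint)
    case (basic U)
    then have U: "open U" by simp
    have [measurable]: "open_approx U n \<in> borel_measurable borel" for n
      by (intro borel_measurable_continuous_onI continuous_intros)
    have [measurable]: "U \<in> sets borel" using U by simp
    have "(\<lambda>n. \<integral>x. \<bar>open_approx U n x - indicator U x\<bar> \<partial>\<mu>) \<longlonglongrightarrow> (\<integral>x. \<bar>indicator U x - indicator U x\<bar> \<partial>\<mu>)"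
    proof (rule integral_dominated_convergence[where w="\<lambda>_. 1"])
      show "AE x in \<mu>. (\<lambda>n. \<bar>open_approx U n x - indicator U x\<bar>) \<longlonglongrightarrow> \<bar>indicator U x - indicator U x\<bar>"
        by (intro AE_I2 tendsto_rabs tendsto_diff open_approx_tendsto U tendsto_const)
      show "AE x in \<mu>. norm \<bar>open_approx U n x - indicator U x\<bar> \<le> 1" for n
        using open_approx_range[of U n] by (intro AE_I2) (auto simp: indicator_def)
    qed auto
    then have "eventually (\<lambda>n. (\<integral>x. \<bar>open_approx U n x - indicator U x\<bar> \<partial>\<mu>) < e) sequentially"
      using basic(2) by (intro order_tendstoD(2)) auto
    then obtain n where "(\<integral>x. \<bar>open_approx U n x - indicator U x\<bar> \<partial>\<mu>) < e"
      by (auto simp: eventually_sequentially)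
    then show ?case by (intro exI[of _ "open_approx U n"]) (auto simp: open_approx_range continuous_open_approx)
  next
    case empty
    then show ?case by (intro exI[of _ "\<lambda>_. 0"]) auto
  next
    case (compl A)
    obtain h where h: "continuous_on UNIV h" "\<And>x. 0 \<le> h x \<and> h x \<le> 1" "(\<integral>x. \<bar>h x - indicator A x\<bar> \<partial>\<mu>) < e"
      using compl.IH[OF compl.prems] by blast
    have "\<bar>(1 - h x) - indicator (UNIV - A) x\<bar> = \<bar>h x - indicator A x\<bar>" for x by (auto simp: indicator_def)
    with h show ?case by (intro exI[of _ "\<lambda>x. 1 - h x"]) (auto intro!: continuous_intros)
  next
    case (union A)
    have A: "A i \<in> sets borel" for i using union(2) by (auto simp: borel_def)
    have "(\<lambda>i. measure \<mu> (A i)) sums measure \<mu> (\<Union>i. A i)"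
      using A union(1) by (intro finite_measure_UNION) auto
    then have "(\<lambda>N. \<Sum>i<N. measure \<mu> (A i)) \<longlonglongrightarrow> measure \<mu> (\<Union>i. A i)" by (simp add: sums_def)
    then have "eventually (\<lambda>N. (\<Sum>i<N. measure \<mu> (A i)) > measure \<mu> (\<Union>i. A i) - e / 2) sequentially"
      using union.prems by (intro order_tendstoD(1)) auto
    then obtain N where N: "measure \<mu> (\<Union>i. A i) - e / 2 < (\<Sum>i<N. measure \<mu> (A i))"
      by (auto simp: eventually_sequentially)
    \<comment> \<open>The tail of the union costs less than \<open>e / 2\<close>, and
      \<open>N\<close> approximations of error \<open>d\<close> cost at most \<open>e / 2\<close>;
      \<open>Suc N\<close> avoids a division by zero when \<open>N = 0\<close>.\<close>
    define d where "d = e / (2 * real (Suc N))"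
    have d: "d > 0" using union.prems by (simp add: d_def)
    obtain h where h: "\<And>i. continuous_on UNIV (h i)" "\<And>i x. 0 \<le> h i x \<and> h i x \<le> 1"
      "\<And>i. (\<integral>x. \<bar>h i x - indicator (A i) x\<bar> \<partial>\<mu>) < d"
      using union.IH[OF d] by metis
    \<comment> \<open>Truncation at 1 restores the range without increasing the distance to an
      indicator.\<close>
    define H where "H x = min 1 (\<Sum>i<N. h i x)" for x
    define R where "R = (\<Union>i. A i) - (\<Union>i<N. A i)"
    have R: "R \<in> sets borel" unfolding R_def using A by auto
    have H: "continuous_on UNIV H" "\<And>x. 0 \<le> H x" "\<And>x. H x \<le> 1"
      unfolding H_def using h by (auto intro!: continuous_intros sum_nonneg)
    have pt: "\<bar>H x - indicator (\<Union>i. A i) x\<bar> \<le> (\<Sum>i<N. \<bar>h i x - indicator (A i) x\<bar>) + indicator R x" for x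
    proof -
      have ds: "disjoint_family_on A {..<N}" using union(1) by (rule disjoint_family_on_mono[rotated]) simp
      have i: "indicator (\<Union>i<N. A i) x = (\<Sum>i<N. indicator (A i) x :: real)"
        using indicator_UN_disjoint[OF _ ds] by simp
      have "\<bar>H x - indicator (\<Union>i<N. A i) x\<bar> \<le> \<bar>(\<Sum>i<N. h i x) - indicator (\<Union>i<N. A i) x\<bar>"
        by (auto simp: H_def indicator_def min_def)
      also have "\<dots> = \<bar>\<Sum>i<N. h i x - indicator (A i) x\<bar>" unfolding i by (simp add: sum_subtractf)
      also have "\<dots> \<le> (\<Sum>i<N. \<bar>h i x - indicator (A i) x\<bar>)" by (rule sum_abs)
      finally have "\<bar>H x - indicator (\<Union>i<N. A i) x\<bar> \<le> (\<Sum>i<N. \<bar>h i x - indicator (A i) x\<bar>)" .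
      moreover have "indicator (\<Union>i. A i) x = indicator (\<Union>i<N. A i) x + (indicator R x :: real)"
        by (auto simp: R_def indicator_def)
      moreover have "0 \<le> (indicator R x :: real)" by simp
      ultimately show ?thesis by linarith
    qed
    have int_h: "integrable \<mu> (\<lambda>x. \<bar>h i x - indicator (A i) x\<bar>)" for i using h A by (intro int) auto
    have int_R: "integrable \<mu> (indicator R :: 'a \<Rightarrow> real)" using R by (intro integrable_Prob_bounded[OF \<mu>, of _ 1]) auto
    have "(\<integral>x. \<bar>H x - indicator (\<Union>i. A i) x\<bar> \<partial>\<mu>) \<le> (\<integral>x. (\<Sum>i<N. \<bar>h i x - indicator (A i) x\<bar>) + indicator R x \<partial>\<mu>)"
      using H A int_h int_R by (intro integral_mono pt int) auto
    also have "\<dots> = (\<Sum>i<N. \<integral>x. \<bar>h i x - indicator (A i) x\<bar> \<partial>\<mu>) + measure \<mu> R"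
      using int_h int_R R by (simp add: sp)
    also have "(\<Sum>i<N. \<integral>x. \<bar>h i x - indicator (A i) x\<bar> \<partial>\<mu>) \<le> (\<Sum>i<N. d)"
      by (intro sum_mono less_imp_le h)
    also have "(\<Sum>i<N. d) \<le> e / 2" using union.prems by (simp add: d_def field_simps)
    also have "measure \<mu> R = measure \<mu> (\<Union>i. A i) - measure \<mu> (\<Union>i<N. A i)"
      unfolding R_def using A by (intro finite_measure_Diff) auto
    also have "measure \<mu> (\<Union>i<N. A i) = (\<Sum>i<N. measure \<mu> (A i))"
      using A disjoint_family_on_mono[OF _ union(1), of "{..<N}"] by (intro finite_measure_finite_Union) auto
    finally have "(\<integral>x. \<bar>H x - indicator (\<Union>i. A i) x\<bar> \<partial>\<mu>) < e" using N by simp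
    with H show ?case by blast
  qed
qed

text \<open>Test on the set where the inequality fails.\<close>

lemma AE_le_if_integral_le:
  fixes u v :: "'a \<Rightarrow> real"
  assumes u: "integrable M u" and v: "integrable M v"
    and le: "\<And>A. A \<in> sets M \<Longrightarrow> (\<integral>x. indicator A x * u x \<partial>M) \<le> (\<integral>x. indicator A x * v x \<partial>M)"
  shows "AE x in M. u x \<le> v x"
proof -
  have [measurable]: "u \<in> borel_measurable M" "v \<in> borel_measurable M" using u v by auto
  define A where "A = {x \<in> space M. v x < u x}"
  have A: "A \<in> sets M" unfolding A_def by measurable
  have int: "integrable M (\<lambda>x. indicator A x * u x)" "integrable M (\<lambda>x. indicator A x * v x)"
    using integrable_real_mult_indicator[OF A] u v by (auto simp: mult.commute)
  define w where "w x = indicator A x * u x - indicator A x * v x" for x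
  have w0: "AE x in M. 0 \<le> w x" by (auto simp: w_def A_def indicator_def)
  have wi: "integrable M w" unfolding w_def by (intro Bochner_Integration.integrable_diff int)
  have "(\<integral>x. w x \<partial>M) \<le> 0" unfolding w_def using le[OF A] int by simp
  moreover have "0 \<le> (\<integral>x. w x \<partial>M)" by (rule integral_nonneg_AE[OF w0])
  ultimately have "AE x in M. w x = 0" using integral_nonneg_eq_0_iff_AE[OF wi w0] by simp
  then show ?thesis using AE_space by eventually_elim (auto simp: w_def A_def indicator_def split: if_splits)
qed

section \<open>Disintegration\<close>

lemma measurable_fst_borel [measurable]: "fst \<in> (borel :: ('a::topological_space \<times> 'b::topological_space) measure) \<rightarrow>\<^sub>M borel"
  and measurable_snd_borel [measurable]: "snd \<in> (borel :: ('a \<times> 'b) measure) \<rightarrow>\<^sub>M borel"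
  by (auto intro!: borel_measurable_continuous_onI continuous_intros)

lemma Times_borel:
  assumes "A \<in> sets borel" "B \<in> sets borel"
  shows "A \<times> B \<in> sets (borel :: ('a::topological_space \<times> 'b::topological_space) measure)"
proof -
  have "fst -` A \<inter> space borel \<inter> (snd -` B \<inter> space borel) \<in> sets (borel :: ('a \<times> 'b) measure)"
    using assms by (intro sets.Int measurable_sets[OF measurable_fst_borel] measurable_sets[OF measurable_snd_borel])
  also have "fst -` A \<inter> space borel \<inter> (snd -` B \<inter> space borel) = A \<times> B" by auto
  finally show ?thesis .
qed

text \<open>\<open>r\<close> is the conditional expectation of \<open>g (snd z)\<close> given
  \<open>fst z\<close>, obtained as a Radon-Nikodym derivative with respect to the first marginal.
  Adding \<open>norm g\<close> beforehand makes the measure to be differentiated positive.\<close>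

lemma marginal_derivative:
  fixes \<pi> :: "('a::metric_space \<times> 'b::metric_space) measure" and g :: "'b \<Rightarrow>\<^sub>C real"
  assumes \<pi>: "\<pi> \<in> Prob"
  shows "\<exists>r. integrable (distr \<pi> borel fst) r \<and> (\<forall>A\<in>sets borel.
    (\<integral>x. indicator A x * r x \<partial>distr \<pi> borel fst) = (\<integral>z. indicator A (fst z) * apply_bcontfun g (snd z) \<partial>\<pi>))"
proof -
  interpret \<pi>: prob_space \<pi> using \<pi> by (simp add: Prob_iff)
  have sets_eq[measurable_cong]: "sets \<pi> = sets borel" using \<pi> by (simp add: Prob_iff)
  define \<mu> where "\<mu> = distr \<pi> borel fst"
  interpret \<mu>: prob_space \<mu> unfolding \<mu>_def by (rule \<pi>.prob_space_distr) measurable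
  have sets_\<mu>[measurable_cong]: "sets \<mu> = sets borel" by (simp add: \<mu>_def)
  define G where "G z = apply_bcontfun g (snd z) + norm g" for z :: "'a \<times> 'b"
  have G0: "0 \<le> G z" for z using abs_bcontfun_le[of g "snd z"] by (auto simp: G_def)
  have [measurable]: "G \<in> borel_measurable borel" unfolding G_def by measurable
  have G2: "\<bar>G z\<bar> \<le> 2 * norm g" for z using abs_bcontfun_le[of g "snd z"] by (auto simp: G_def)
  define N where "N = distr (density \<pi> (\<lambda>z. ennreal (G z))) borel fst"
  have N: "emeasure N A = (\<integral>\<^sup>+z. ennreal (indicator A (fst z) * G z) \<partial>\<pi>)" if "A \<in> sets borel" for A
  proof -
    have [measurable]: "A \<in> sets borel" by fact
    have "emeasure N A = emeasure (density \<pi> (\<lambda>z. ennreal (G z))) (fst -` A \<inter> space \<pi>)"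
      unfolding N_def by (subst emeasure_distr) auto
    also have "\<dots> = (\<integral>\<^sup>+z. ennreal (G z) * indicator (fst -` A \<inter> space \<pi>) z \<partial>\<pi>)"
      by (rule emeasure_density) auto
    also have "\<dots> = (\<integral>\<^sup>+z. ennreal (indicator A (fst z) * G z) \<partial>\<pi>)"
      by (intro nn_integral_cong) (auto simp: indicator_def)
    finally show ?thesis .
  qed
  have int: "integrable \<pi> (\<lambda>z. indicator A (fst z) * G z)" if "A \<in> sets borel" for A
    using that G0 G2 by (intro integrable_Prob_bounded[OF \<pi>, of _ "2 * norm g"]) (auto simp: indicator_def intro: order_trans[OF abs_ge_zero])
  have N': "emeasure N A = ennreal (\<integral>z. indicator A (fst z) * G z \<partial>\<pi>)" if "A \<in> sets borel" for A
    unfolding N[OF that] using G0 by (intro nn_integral_eq_integral int that) auto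
  have ac: "absolutely_continuous \<mu> N"
    unfolding absolutely_continuous_def
  proof
    fix A assume "A \<in> null_sets \<mu>"
    then have A: "A \<in> sets borel" "emeasure \<mu> A = 0" by (auto simp: null_sets_def \<mu>_def)
    have "emeasure \<pi> (fst -` A \<inter> space \<pi>) = 0" using A unfolding \<mu>_def by (subst (asm) emeasure_distr) auto
    then have "AE z in \<pi>. fst z \<notin> A"
      using A(1) by (intro AE_I[of _ _ "fst -` A \<inter> space \<pi>"]) auto
    then have "AE z in \<pi>. ennreal (indicator A (fst z) * G z) = 0" by eventually_elim simp
    then have "(\<integral>\<^sup>+z. ennreal (indicator A (fst z) * G z) \<partial>\<pi>) = (\<integral>\<^sup>+z. 0 \<partial>\<pi>)" by (rule nn_integral_cong_AE)
    then have "emeasure N A = 0" using N[OF A(1)] by simp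
    with A(1) show "A \<in> null_sets N" by (auto simp: null_sets_def N_def)
  qed
  have sN: "sets N = sets \<mu>" by (simp add: N_def \<mu>_def)
  define f where "f = RN_deriv \<mu> N"
  have [measurable]: "f \<in> borel_measurable \<mu>" by (simp add: f_def)
  have dens: "density \<mu> f = N" unfolding f_def by (rule \<mu>.density_RN_deriv[OF ac sN])
  have ind: "(\<integral>\<^sup>+x. f x * indicator A x \<partial>\<mu>) = ennreal (\<integral>z. indicator A (fst z) * G z \<partial>\<pi>)" if A: "A \<in> sets borel" for A
    using emeasure_density[of f \<mu> A] A N'[OF A] by (simp add: dens sets_\<mu>)
  have "(\<integral>\<^sup>+x. f x * indicator UNIV x \<partial>\<mu>) < \<infinity>" by (subst ind) auto
  then have ffin: "(\<integral>\<^sup>+x. f x \<partial>\<mu>) < \<infinity>" by simp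
  then have fin: "AE x in \<mu>. f x \<noteq> \<infinity>" by (intro nn_integral_PInf_AE) auto
  define s where "s x = enn2real (f x)" for x
  have [measurable]: "s \<in> borel_measurable \<mu>" unfolding s_def by measurable
  have sA: "(\<integral>\<^sup>+x. ennreal (indicator A x * s x) \<partial>\<mu>) = ennreal (\<integral>z. indicator A (fst z) * G z \<partial>\<pi>)" if A: "A \<in> sets borel" for A
    unfolding ind[OF A, symmetric]
    by (rule nn_integral_cong_AE) (use fin in \<open>eventually_elim, auto simp: s_def indicator_def less_top\<close>)
  have ints: "integrable \<mu> (\<lambda>x. indicator A x * s x)" and Is: "(\<integral>x. indicator A x * s x \<partial>\<mu>) = (\<integral>z. indicator A (fst z) * G z \<partial>\<pi>)"
    if A: "A \<in> sets borel" for A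
  proof -
    have [measurable]: "A \<in> sets borel" by fact
    show "integrable \<mu> (\<lambda>x. indicator A x * s x)"
      using sA[OF A] by (intro integrableI_nonneg) (auto simp: s_def)
    show "(\<integral>x. indicator A x * s x \<partial>\<mu>) = (\<integral>z. indicator A (fst z) * G z \<partial>\<pi>)"
      using sA[OF A] G0 by (subst integral_eq_nn_integral) (auto simp: s_def intro!: Bochner_Integration.integral_nonneg)
  qed
  define r where "r x = s x - norm g" for x
  have "integrable \<mu> s" using ints[of UNIV] by simp
  then have "integrable \<mu> r" unfolding r_def by simp
  moreover have "(\<integral>x. indicator A x * r x \<partial>\<mu>) = (\<integral>z. indicator A (fst z) * apply_bcontfun g (snd z) \<partial>\<pi>)"
    if A: "A \<in> sets borel" for A
  proof -
    have [measurable]: "A \<in> sets borel" by fact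
    have iA: "integrable \<mu> (\<lambda>x. norm g * indicator A x)" "integrable \<pi> (\<lambda>z. norm g * indicator A (fst z))"
      by (intro integrable_mult_right integrable_Prob_bounded[of _ _ 1]; simp add: Prob_iff \<mu>.prob_space_axioms sets_\<mu> \<pi>.prob_space_axioms sets_eq)+
    have "(\<integral>x. indicator A x * r x \<partial>\<mu>) = (\<integral>x. indicator A x * s x - norm g * indicator A x \<partial>\<mu>)"
      by (intro Bochner_Integration.integral_cong) (auto simp: r_def algebra_simps)
    also have "\<dots> = (\<integral>z. indicator A (fst z) * G z \<partial>\<pi>) - (\<integral>x. norm g * indicator A x \<partial>\<mu>)"
      using ints[OF A] iA Is[OF A] by simp
    also have "(\<integral>x. norm g * indicator A x \<partial>\<mu>) = (\<integral>z. norm g * indicator A (fst z) \<partial>\<pi>)"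
      unfolding \<mu>_def by (rule integral_distr) auto
    also have "(\<integral>z. indicator A (fst z) * G z \<partial>\<pi>) - (\<integral>z. norm g * indicator A (fst z) \<partial>\<pi>) =
        (\<integral>z. indicator A (fst z) * G z - norm g * indicator A (fst z) \<partial>\<pi>)"
      using int[OF A] iA by simp
    also have "\<dots> = (\<integral>z. indicator A (fst z) * apply_bcontfun g (snd z) \<partial>\<pi>)"
      by (intro Bochner_Integration.integral_cong) (auto simp: G_def algebra_simps)
    finally show ?thesis .
  qed
  ultimately show ?thesis unfolding \<mu>_def by blast
qed

text \<open>Each conditional expectation \<open>r g\<close> is fixed only up to a null set depending
  on \<open>g\<close>. Countably many relations between them hold off one common null set; there
  \<open>g \<mapsto> r g x\<close> extends by continuity to a positive normalised functional on all
  continuous functions, and the Riesz theorem turns it into \<open>\<kappa> x\<close>. The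
  additional integral formula is what Strassen's theorem is tested against.\<close>

lemma disintegration_exists:
  fixes \<pi> :: "('a::metric_space \<times> 'b::metric_space) measure"
  assumes Y: "compact (UNIV :: 'b set)" and \<pi>: "\<pi> \<in> Prob"
  shows "\<exists>\<kappa>. disintegration \<pi> (distr \<pi> borel fst) \<kappa> \<and> (\<forall>g :: 'b \<Rightarrow>\<^sub>C real. \<forall>A\<in>sets borel.
    (\<integral>x. indicator A x * (\<integral>y. apply_bcontfun g y \<partial>\<kappa> x) \<partial>distr \<pi> borel fst) =
    (\<integral>z. indicator A (fst z) * apply_bcontfun g (snd z) \<partial>\<pi>))"
proof -
  interpret \<pi>: prob_space \<pi> using \<pi> by (simp add: Prob_iff)
  have sets_eq[measurable_cong]: "sets \<pi> = sets borel" using \<pi> by (simp add: Prob_iff)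
  define \<mu> where "\<mu> = distr \<pi> borel fst"
  interpret \<mu>: prob_space \<mu> unfolding \<mu>_def by (rule \<pi>.prob_space_distr) measurable
  have sets_\<mu>[measurable_cong]: "sets \<mu> = sets borel" by (simp add: \<mu>_def)
  have \<mu>: "\<mu> \<in> Prob" using \<mu>.prob_space_axioms by (simp add: Prob_iff sets_\<mu>)
  have "\<exists>r. \<forall>g :: 'b \<Rightarrow>\<^sub>C real. integrable \<mu> (r g) \<and> (\<forall>A\<in>sets borel.
      (\<integral>x. indicator A x * r g x \<partial>\<mu>) = (\<integral>z. indicator A (fst z) * apply_bcontfun g (snd z) \<partial>\<pi>))"
    unfolding \<mu>_def by (intro choice allI marginal_derivative[OF \<pi>])
  then obtain r :: "('b \<Rightarrow>\<^sub>C real) \<Rightarrow> 'a \<Rightarrow> real" where ri: "\<And>g. integrable \<mu> (r g)"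
    and rA: "\<And>g A. A \<in> sets borel \<Longrightarrow> (\<integral>x. indicator A x * r g x \<partial>\<mu>) = (\<integral>z. indicator A (fst z) * apply_bcontfun g (snd z) \<partial>\<pi>)"
    by blast
  have rm: "r g \<in> borel_measurable borel" for g
    using borel_measurable_integrable[OF ri[of g]] by (simp cong: measurable_cong_sets)
  have rA_int: "integrable \<mu> (\<lambda>x. indicator A x * r g x)" if "A \<in> sets borel" for A g
    using integrable_real_mult_indicator[of A \<mu> "r g"] that ri by (simp add: sets_\<mu> mult.commute)
  have gA_int: "integrable \<pi> (\<lambda>z. indicator A (fst z) * apply_bcontfun g (snd z))" if "A \<in> sets borel" for A and g :: "'b \<Rightarrow>\<^sub>C real"
  proof (rule integrable_Prob_bounded[OF \<pi>])
    have [measurable]: "A \<in> sets borel" by fact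
    show "(\<lambda>z. indicator A (fst z) * apply_bcontfun g (snd z)) \<in> borel_measurable borel" by measurable
    show "\<bar>indicator A (fst z) * apply_bcontfun g (snd z)\<bar> \<le> norm g" for z
      using abs_bcontfun_le[of g "snd z"] by (auto simp: indicator_def)
  qed
  \<comment> \<open>Pointwise inequalities between linear combinations pass to conditional
    expectations. With three functions and two coefficients, one statement yields linearity and norm
    bounds alike.\<close>
  have rle: "AE x in \<mu>. p * r f x + q * r g x - r h x \<le> c"
    if c: "\<And>y. p * apply_bcontfun f y + q * apply_bcontfun g y - apply_bcontfun h y \<le> c" for p q c :: real and f g h
  proof (rule AE_le_if_integral_le)
    fix A assume "A \<in> sets \<mu>"
    then have A[measurable]: "A \<in> sets borel" by (simp add: sets_\<mu>)
    have iA: "integrable \<mu> (\<lambda>x. indicator A x * c)" "integrable \<pi> (\<lambda>z. indicator A (fst z) * c)"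
      by (intro integrable_mult_left integrable_Prob_bounded[OF \<mu>, of _ 1] integrable_Prob_bounded[OF \<pi>, of _ 1]; simp)+
    have "(\<integral>x. indicator A x * (p * r f x + q * r g x - r h x) \<partial>\<mu>) =
        (\<integral>x. p * (indicator A x * r f x) + q * (indicator A x * r g x) - indicator A x * r h x \<partial>\<mu>)"
      by (intro Bochner_Integration.integral_cong) (auto simp: algebra_simps)
    also have "\<dots> = p * (\<integral>x. indicator A x * r f x \<partial>\<mu>) + q * (\<integral>x. indicator A x * r g x \<partial>\<mu>) - (\<integral>x. indicator A x * r h x \<partial>\<mu>)"
      using rA_int[OF A] by simp
    also have "\<dots> = (\<integral>z. p * (indicator A (fst z) * apply_bcontfun f (snd z)) + q * (indicator A (fst z) * apply_bcontfun g (snd z))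
        - indicator A (fst z) * apply_bcontfun h (snd z) \<partial>\<pi>)"
      using gA_int[OF A] by (simp add: rA[OF A])
    also have "\<dots> \<le> (\<integral>z. indicator A (fst z) * c \<partial>\<pi>)"
    proof (rule integral_mono)
      show "p * (indicator A (fst z) * apply_bcontfun f (snd z)) + q * (indicator A (fst z) * apply_bcontfun g (snd z))
        - indicator A (fst z) * apply_bcontfun h (snd z) \<le> indicator A (fst z) * c" for z
        using c[of "snd z"] by (auto simp: indicator_def)
    qed (use gA_int[OF A] iA in auto)
    also have "\<dots> = (\<integral>x. indicator A x * c \<partial>\<mu>)" unfolding \<mu>_def by (rule integral_distr[symmetric]) auto
    finally show "(\<integral>x. indicator A x * (p * r f x + q * r g x - r h x) \<partial>\<mu>) \<le> (\<integral>x. indicator A x * c \<partial>\<mu>)" .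
  qed (use ri in auto)
  have rbound: "AE x in \<mu>. \<bar>p * r f x + q * r g x - r h x\<bar> \<le> norm (p *\<^sub>R f + q *\<^sub>R g - h)"
    for p q :: real and f g h
  proof -
    let ?n = "norm (p *\<^sub>R f + q *\<^sub>R g - h)"
    have b: "\<bar>p * apply_bcontfun f y + q * apply_bcontfun g y - apply_bcontfun h y\<bar> \<le> ?n" for y
      using abs_bcontfun_le[of "p *\<^sub>R f + q *\<^sub>R g - h" y] by simp
    have "AE x in \<mu>. p * r f x + q * r g x - r h x \<le> ?n"
      using b by (intro rle) (simp add: abs_le_iff)
    moreover have "AE x in \<mu>. (- p) * r f x + (- q) * r g x - (- 1) * r h x \<le> ?n"
    proof -
      have "AE x in \<mu>. (- p) * r f x + (- q) * r g x - r (- h) x \<le> ?n"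
      proof (rule rle)
        show "(- p) * apply_bcontfun f y + (- q) * apply_bcontfun g y - apply_bcontfun (- h) y \<le> ?n" for y
          using b[of y] by (simp add: abs_le_iff)
      qed
      \<comment> \<open>As \<open>r\<close> is chosen function by function, oddness has to be
        derived: this instance gives \<open>r (- h) + r h \<le> r 0\<close>, and
        \<open>2 * r 0 - r 0 \<le> 0\<close> below gives \<open>r 0 \<le> 0\<close>.\<close>
      moreover have "AE x in \<mu>. 1 * r (- h) x + 1 * r h x - r 0 x \<le> 0" by (rule rle) simp
      moreover have "AE x in \<mu>. 0 * r h x + 0 * r h x - r 0 x \<le> 0" by (rule rle) simp
      moreover have "AE x in \<mu>. 1 * r 0 x + 0 * r h x - r (2 *\<^sub>R 0) x \<le> 0" by (rule rle) simp
      moreover have "AE x in \<mu>. 2 * r 0 x + 0 * r h x - r 0 x \<le> 0" by (rule rle) simp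
      ultimately show ?thesis by eventually_elim simp
    qed
    ultimately show ?thesis by eventually_elim (simp add: abs_le_iff)
  qed
  have r1: "AE x in \<mu>. r (const_bcontfun 1) x = 1"
  proof -
    have "(\<integral>x. indicator A x * r (const_bcontfun 1) x \<partial>\<mu>) = (\<integral>x. indicator A x * 1 \<partial>\<mu>)" if "A \<in> sets borel" for A
    proof -
      have [measurable]: "A \<in> sets borel" by fact
      have "(\<integral>x. indicator A x * (1::real) \<partial>\<mu>) = (\<integral>z. indicator A (fst z) * 1 \<partial>\<pi>)"
        unfolding \<mu>_def by (rule integral_distr) auto
      then show ?thesis using rA[OF that, of "const_bcontfun 1"] by simp
    qed
    then have "AE x in \<mu>. r (const_bcontfun 1) x \<le> 1" "AE x in \<mu>. 1 \<le> r (const_bcontfun 1) x"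
      using ri by (auto intro!: AE_le_if_integral_le simp: sets_\<mu>)
    then show ?thesis by eventually_elim simp
  qed
  obtain D :: "('b \<Rightarrow>\<^sub>C real) set" where D: "countable D" "\<And>f e. e > 0 \<Longrightarrow> \<exists>d\<in>D. norm (d - f) < e"
    using separable_bcontfun[OF Y] by blast
  \<comment> \<open>\<open>D\<close> need not contain the constant 1, at which the normalisation is
    read off.\<close>
  define E where "E = insert (const_bcontfun 1) D"
  have E: "countable E" using D(1) by (simp add: E_def)
  \<comment> \<open>Rational coefficients keep the family of relations countable. Linearity is only
    approximate on \<open>E\<close>, since a combination of its members need not lie in
    \<open>E\<close>; it becomes exact in the limit, as \<open>h\<close> approaches the
    combination.\<close>
  define good where "good x \<longleftrightarrow> r (const_bcontfun 1) x = 1 \<and> (\<forall>(f, g, h, p, q) \<in> E \<times> E \<times> E \<times> \<rat> \<times> \<rat>.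
      \<bar>p * r f x + q * r g x - r h x\<bar> \<le> norm (p *\<^sub>R f + q *\<^sub>R g - h))" for x
  have "AE x in \<mu>. good x"
    unfolding good_def
  proof (rule AE_conjI[OF r1])
    have "countable (E \<times> E \<times> E \<times> (\<rat>::real set) \<times> (\<rat>::real set))" using E countable_rat by (intro countable_SIGMA) auto
    then show "AE x in \<mu>. \<forall>(f, g, h, p, q) \<in> E \<times> E \<times> E \<times> \<rat> \<times> \<rat>.
      \<bar>p * r f x + q * r g x - r h x\<bar> \<le> norm (p *\<^sub>R f + q *\<^sub>R g - h)"
      by (subst AE_ball_countable) (auto intro: rbound)
  qed
  then obtain N where N: "N \<in> null_sets \<mu>" "{x \<in> space \<mu>. \<not> good x} \<subseteq> N"
    by (auto elim!: AE_E simp: null_sets_def)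
  have goodN: "good x" if "x \<notin> N" for x using N that by (auto simp: \<mu>_def)
  have NB[measurable]: "N \<in> sets borel" using N(1) by (auto simp: null_sets_def sets_\<mu>)
  have "\<exists>d. d \<in> D \<and> norm (d - f) < inverse (real (Suc n))" for f n using D(2)[of "inverse (real (Suc n))" f] by auto
  then obtain d where d: "\<And>f n. d f n \<in> D" "\<And>f n. norm (d f n - f) < inverse (real (Suc n))" by metis
  have dlim: "d f \<longlonglongrightarrow> f" for f
  proof -
    have "(\<lambda>n. norm (d f n - f)) \<longlonglongrightarrow> 0"
      by (rule tendsto_sandwich[OF _ _ tendsto_const LIMSEQ_inverse_real_of_nat])
         (intro always_eventually allI norm_ge_zero less_imp_le[OF d(2)])+
    then show ?thesis by (simp add: tendsto_norm_zero_iff LIM_zero_cancel)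
  qed
  \<comment> \<open>At a good point \<open>r\<close> is 1-Lipschitz on \<open>E\<close>, so its
    values along a sequence from \<open>D\<close> tending to \<open>f\<close> converge.\<close>
  define Lx where "Lx x f = lim (\<lambda>n. r (d f n) x)" for x f
  have dE: "d f n \<in> E" for f n using d(1) by (simp add: E_def)
  have goodD: "\<bar>p * r f x + q * r g x - r h x\<bar> \<le> norm (p *\<^sub>R f + q *\<^sub>R g - h)"
    if "good x" "f \<in> E" "g \<in> E" "h \<in> E" "p \<in> \<rat>" "q \<in> \<rat>" for x f g h p q
    using that unfolding good_def by blast
  have conv: "(\<lambda>n. r (d f n) x) \<longlonglongrightarrow> Lx x f" if g: "good x" for x f
  proof -
    have dist: "dist (r (d f m) x) (r (d f n) x) \<le> dist (d f m) (d f n)" for m n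
      using goodD[OF g dE dE dE, of 1 0 f m f m f n] by (simp add: dist_norm)
    have "Cauchy (d f)" using dlim by (intro LIMSEQ_imp_Cauchy)
    then have "Cauchy (\<lambda>n. r (d f n) x)"
      unfolding Cauchy_def using dist by (meson le_less_trans)
    then show ?thesis unfolding Lx_def by (simp add: Cauchy_convergent_iff convergent_LIMSEQ_iff)
  qed
  \<comment> \<open>Real coefficients are reached through rational ones while \<open>f\<close>,
    \<open>g\<close> and their combination are reached from \<open>D\<close>.\<close>
  have lin: "Lx x (p *\<^sub>R f + q *\<^sub>R g) = p * Lx x f + q * Lx x g" if gx: "good x" for x f g p q
  proof -
    have ex: "\<exists>c. (\<forall>n. c n \<in> \<rat>) \<and> c \<longlonglongrightarrow> a" for a :: real
    proof -
      have "\<exists>q\<in>\<rat>. a < q \<and> q < a + inverse (real (Suc n))" for n by (rule Rats_dense_in_real) simp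
      then obtain c where c: "\<And>n. c n \<in> \<rat>" "\<And>n. a < c n" "\<And>n. c n < a + inverse (real (Suc n))" by metis
      have "c \<longlonglongrightarrow> a"
        by (rule tendsto_sandwich[OF _ _ tendsto_const, of _ _ _ "\<lambda>n. a + inverse (real (Suc n))"])
           (use c tendsto_add[OF tendsto_const LIMSEQ_inverse_real_of_nat, of a] in \<open>auto intro!: always_eventually less_imp_le\<close>)
      with c(1) show ?thesis by blast
    qed
    obtain ps where ps: "\<And>n. ps n \<in> \<rat>" "ps \<longlonglongrightarrow> p" using ex by blast
    obtain qs where qs: "\<And>n. qs n \<in> \<rat>" "qs \<longlonglongrightarrow> q" using ex by blast
    let ?h = "p *\<^sub>R f + q *\<^sub>R g"
    have "(\<lambda>n. ps n *\<^sub>R d f n + qs n *\<^sub>R d g n - d ?h n) \<longlonglongrightarrow> ?h - ?h"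
      by (intro tendsto_intros ps qs dlim)
    then have "(\<lambda>n. norm (ps n *\<^sub>R d f n + qs n *\<^sub>R d g n - d ?h n)) \<longlonglongrightarrow> 0" by (simp add: tendsto_norm_zero)
    moreover have "\<forall>\<^sub>F n in sequentially. norm (ps n * r (d f n) x + qs n * r (d g n) x - r (d ?h n) x)
        \<le> norm (ps n *\<^sub>R d f n + qs n *\<^sub>R d g n - d ?h n)"
      using goodD[OF gx dE dE dE ps(1) qs(1)] by (intro always_eventually) auto
    ultimately have "(\<lambda>n. ps n * r (d f n) x + qs n * r (d g n) x - r (d ?h n) x) \<longlonglongrightarrow> 0"
      by (rule Lim_null_comparison[rotated])
    moreover have "(\<lambda>n. ps n * r (d f n) x + qs n * r (d g n) x - r (d ?h n) x) \<longlonglongrightarrow> p * Lx x f + q * Lx x g - Lx x ?h"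
      by (intro tendsto_intros ps qs conv gx)
    ultimately have "p * Lx x f + q * Lx x g - Lx x ?h = 0" by (rule LIMSEQ_unique[rotated])
    then show ?thesis by simp
  qed
  have Lbound: "\<bar>Lx x f - r h x\<bar> \<le> norm (f - h)" if gx: "good x" and h: "h \<in> E" for x f h
  proof -
    have "(\<lambda>n. \<bar>r (d f n) x - r h x\<bar>) \<longlonglongrightarrow> \<bar>Lx x f - r h x\<bar>" by (intro tendsto_intros conv gx)
    moreover have "(\<lambda>n. norm (d f n - h)) \<longlonglongrightarrow> norm (f - h)" by (intro tendsto_intros dlim)
    moreover have "\<bar>r (d f n) x - r h x\<bar> \<le> norm (d f n - h)" for n
      using goodD[OF gx dE[of f n] dE[of f n] h, of 1 0] by simp
    ultimately show ?thesis by (intro LIMSEQ_le) auto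
  qed
  have L1: "Lx x (const_bcontfun 1) = 1" if gx: "good x" for x
    using Lbound[OF gx, of "const_bcontfun 1" "const_bcontfun 1"] gx by (simp add: good_def E_def)
  have Labs: "\<bar>Lx x f\<bar> \<le> norm f" if gx: "good x" for x f
  proof -
    have "\<bar>r (d f n) x\<bar> \<le> norm (d f n)" for n
    proof -
      have "\<bar>0 * r (d f n) x + 0 * r (d f n) x - r (d f n) x\<bar> \<le> norm (0 *\<^sub>R d f n + 0 *\<^sub>R d f n - d f n)"
        by (rule goodD[OF gx dE dE dE]) auto
      then show ?thesis by simp
    qed
    moreover have "(\<lambda>n. \<bar>r (d f n) x\<bar>) \<longlonglongrightarrow> \<bar>Lx x f\<bar>" by (intro tendsto_intros conv gx)
    moreover have "(\<lambda>n. norm (d f n)) \<longlonglongrightarrow> norm f" by (intro tendsto_intros dlim)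
    ultimately show ?thesis by (intro LIMSEQ_le) auto
  qed
  \<comment> \<open>A functional of norm at most 1 that takes the value 1 at the constant 1 is
    positive: for \<open>f \<ge> 0\<close> the function \<open>norm f - f\<close> has norm at most
    \<open>norm f\<close>.\<close>
  have Lnonneg: "0 \<le> Lx x f" if gx: "good x" and f: "\<And>y. 0 \<le> apply_bcontfun f y" for x f
  proof -
    let ?g = "norm f *\<^sub>R const_bcontfun 1 + (- 1) *\<^sub>R f"
    have "Lx x ?g = norm f - Lx x f" using lin[OF gx, of "norm f" "const_bcontfun 1" "- 1" f] L1[OF gx] by simp
    moreover have "norm ?g \<le> norm f"
    proof (rule norm_bound)
      fix y show "norm (apply_bcontfun ?g y) \<le> norm f" using f[of y] abs_bcontfun_le[of f y] by simp
    qed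
    ultimately show ?thesis using Labs[OF gx, of ?g] by simp
  qed
  have "\<exists>\<sigma>. \<sigma> \<in> Prob \<and> (\<forall>f. (\<integral>y. apply_bcontfun f y \<partial>\<sigma>) = Lx x f)" if gx: "good x" for x
  proof -
    define L where "L f = Lx x (Bcontfun f)" for f
    note B = Bcontfun_simps[OF Y]
    have "linear_functional_on continuous_functions L"
      unfolding linear_functional_on_def L_def
      using lin[OF gx, of 1 _ 1] lin[OF gx, of _ _ 0] by (auto simp: B)
    moreover have "0 \<le> L f" if "continuous_on UNIV f" "\<And>y. 0 \<le> f y" for f
      unfolding L_def using that by (intro Lnonneg[OF gx]) (simp add: B)
    moreover have "L (\<lambda>_. 1) = 1"
    proof -
      have "Bcontfun (\<lambda>_ :: 'b. 1) = const_bcontfun (1::real)" by (rule bcontfun_eqI) (simp add: B)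
      then show ?thesis using L1[OF gx] by (simp add: L_def)
    qed
    ultimately obtain \<sigma> where \<sigma>: "\<sigma> \<in> Prob" "\<And>f. continuous_on UNIV f \<Longrightarrow> (\<integral>y. f y \<partial>\<sigma>) = L f"
      using Riesz_representation[OF Y, of L] by blast
    have "(\<integral>y. apply_bcontfun f y \<partial>\<sigma>) = Lx x f" for f
      using \<sigma>(2)[of "apply_bcontfun f"] by (simp add: L_def apply_bcontfun_inverse)
    with \<sigma>(1) show ?thesis by blast
  qed
  then obtain \<kappa>0 where \<kappa>0: "\<And>x. good x \<Longrightarrow> \<kappa>0 x \<in> Prob" "\<And>x f. good x \<Longrightarrow> (\<integral>y. apply_bcontfun f y \<partial>\<kappa>0 x) = Lx x f"
    by metis
  \<comment> \<open>A fixed Dirac measure on the null set keeps \<open>\<kappa>\<close> measurable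
    and makes it probability-valued everywhere.\<close>
  define \<kappa> where "\<kappa> x = (if x \<in> N then return borel undefined else \<kappa>0 x)" for x
  have \<kappa>P: "\<kappa> x \<in> Prob" for x using \<kappa>0(1)[OF goodN] by (simp add: \<kappa>_def return_Prob)
  have \<kappa>L: "(\<integral>y. apply_bcontfun f y \<partial>\<kappa> x) = Lx x f" if "x \<notin> N" for x f
    using \<kappa>0(2)[OF goodN[OF that]] that by (simp add: \<kappa>_def)
  have meas: "(\<lambda>x. \<integral>y. apply_bcontfun f y \<partial>\<kappa> x) \<in> borel_measurable borel" for f :: "'b \<Rightarrow>\<^sub>C real"
  proof -
    have [measurable]: "r g \<in> borel_measurable borel" for g by (rule rm)
    have "(\<lambda>x. if x \<in> N then apply_bcontfun f undefined else lim (\<lambda>n. r (d f n) x)) \<in> borel_measurable borel"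
      by measurable
    also have "(\<lambda>x. if x \<in> N then apply_bcontfun f undefined else lim (\<lambda>n. r (d f n) x)) = (\<lambda>x. \<integral>y. apply_bcontfun f y \<partial>\<kappa> x)"
      using \<kappa>L by (auto simp: fun_eq_iff \<kappa>_def[of "_ :: 'a"] Lx_def)
    finally show ?thesis .
  qed
  have formula: "(\<integral>x. indicator A x * (\<integral>y. apply_bcontfun g y \<partial>\<kappa> x) \<partial>\<mu>) = (\<integral>z. indicator A (fst z) * apply_bcontfun g (snd z) \<partial>\<pi>)"
    if A: "A \<in> sets borel" for g :: "'b \<Rightarrow>\<^sub>C real" and A
  proof -
    \<comment> \<open>For a \<open>g\<close> outside \<open>E\<close> the extended functional agrees
      with \<open>r g\<close> only almost everywhere. The exceptional set depends on
      \<open>g\<close>, which is harmless under the integral.\<close>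
    have "AE x in \<mu>. \<forall>n. \<bar>1 * r (d g n) x + 0 * r (d g n) x - r g x\<bar> \<le> norm (1 *\<^sub>R d g n + 0 *\<^sub>R d g n - g)"
      unfolding AE_all_countable by (intro allI rbound)
    moreover have "AE x in \<mu>. x \<notin> N" using N(1) by (rule AE_not_in)
    ultimately have "AE x in \<mu>. (\<integral>y. apply_bcontfun g y \<partial>\<kappa> x) = r g x"
    proof eventually_elim
      case (elim x)
      have "(\<lambda>n. norm (d g n - g)) \<longlonglongrightarrow> norm (g - g)" by (intro tendsto_intros dlim)
      then have lim0: "(\<lambda>n. norm (d g n - g)) \<longlonglongrightarrow> 0" by simp
      have "\<forall>\<^sub>F n in sequentially. norm (r (d g n) x - r g x) \<le> norm (d g n - g)"
        using elim(1) by (intro always_eventually) auto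
      then have "(\<lambda>n. r (d g n) x - r g x) \<longlonglongrightarrow> 0" using lim0 by (rule Lim_null_comparison)
      then have "(\<lambda>n. r (d g n) x) \<longlonglongrightarrow> r g x" by (simp add: LIM_zero_iff)
      with conv[OF goodN[OF elim(2)], of g] have "Lx x g = r g x" by (metis LIMSEQ_unique)
      then show ?case using \<kappa>L[OF elim(2)] by simp
    qed
    then have "(\<integral>x. indicator A x * (\<integral>y. apply_bcontfun g y \<partial>\<kappa> x) \<partial>\<mu>) = (\<integral>x. indicator A x * r g x \<partial>\<mu>)"
      using A meas rm by (intro integral_cong_AE) (auto cong: measurable_cong_sets)
    with rA[OF A] show ?thesis by simp
  qed
  have \<kappa>int: "\<bar>\<integral>y. open_approx U n y \<partial>\<kappa> x\<bar> \<le> 1" and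
    \<kappa>lim: "open U \<Longrightarrow> (\<lambda>n. \<integral>y. open_approx U n y \<partial>\<kappa> x) \<longlonglongrightarrow> measure (\<kappa> x) U" for U :: "'b set" and n x
  proof -
    interpret K: prob_space "\<kappa> x" using \<kappa>P by (simp add: Prob_iff)
    have sK[measurable_cong]: "sets (\<kappa> x) = sets borel" using \<kappa>P by (simp add: Prob_iff)
    have [measurable]: "open_approx U n \<in> borel_measurable borel" for n
      by (intro borel_measurable_continuous_onI continuous_intros)
    have "(\<integral>y. open_approx U n y \<partial>\<kappa> x) \<le> (\<integral>y. 1 \<partial>\<kappa> x)"
      using open_approx_range[of U n]
      by (intro integral_mono integrable_Prob_bounded[OF \<kappa>P, of _ 1]) (auto simp: abs_le_iff intro: order_trans[OF _ zero_le_one] order_trans[of _ 0])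
    moreover have "0 \<le> (\<integral>y. open_approx U n y \<partial>\<kappa> x)"
      using open_approx_range[of U n] by (intro Bochner_Integration.integral_nonneg) auto
    ultimately show "\<bar>\<integral>y. open_approx U n y \<partial>\<kappa> x\<bar> \<le> 1" by (simp add: K.prob_space)
    assume U: "open U"
    have [measurable]: "U \<in> sets borel" using U by simp
    have "(\<lambda>n. \<integral>y. open_approx U n y \<partial>\<kappa> x) \<longlonglongrightarrow> (\<integral>y. indicator U y \<partial>\<kappa> x)"
      by (rule integral_dominated_convergence[where w="\<lambda>_. 1"])
         (auto simp: open_approx_range intro!: open_approx_tendsto[OF U])
    then show "(\<lambda>n. \<integral>y. open_approx U n y \<partial>\<kappa> x) \<longlonglongrightarrow> measure (\<kappa> x) U"
      using sets_eq_imp_space_eq[OF sK] by simp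
  qed
  have oa: "\<exists>f :: 'b \<Rightarrow>\<^sub>C real. apply_bcontfun f = open_approx U n" for U :: "'b set" and n
    using bcontfun_compact[OF Y continuous_open_approx] Bcontfun_inverse by blast
  have mU: "(\<lambda>x. measure (\<kappa> x) U) \<in> borel_measurable borel" if U: "open U" for U
  proof (rule borel_measurable_LIMSEQ_real)
    show "(\<lambda>n. \<integral>y. open_approx U n y \<partial>\<kappa> x) \<longlonglongrightarrow> measure (\<kappa> x) U" for x by (rule \<kappa>lim[OF U])
    show "(\<lambda>x. \<integral>y. open_approx U n y \<partial>\<kappa> x) \<in> borel_measurable borel" for n
      using meas oa[of U n] by metis
  qed
  have em: "emeasure (\<kappa> x) B = ennreal (measure (\<kappa> x) B)" for x B
    using \<kappa>P[of x] by (simp add: Prob_iff finite_measure.emeasure_eq_measure prob_space.finite_measure)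
  have \<kappa>: "\<kappa> \<in> borel \<rightarrow>\<^sub>M prob_algebra borel"
  proof (rule measurable_prob_algebra_generated[where G="{S. open S}" and \<Omega>=UNIV])
    show "sets borel = sigma_sets UNIV {S :: 'b set. open S}" by (simp add: borel_def)
    show "Int_stable {S :: 'b set. open S}" by (auto simp: Int_stable_def)
    fix a :: 'a show "prob_space (\<kappa> a)" "sets (\<kappa> a) = sets borel" using \<kappa>P[of a] by (auto simp: Prob_iff)
  next
    fix U :: "'b set" assume "U \<in> {S. open S}"
    then show "(\<lambda>a. emeasure (\<kappa> a) U) \<in> borel_measurable borel" unfolding em using mU by simp
  qed simp
  have mB: "(\<lambda>x. measure (\<kappa> x) B) \<in> borel_measurable borel" if "B \<in> sets borel" for B
    using measurable_compose[OF measurable_prob_algebraD[OF \<kappa>] measurable_measure_subprob_algebra[OF that]] .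
  \<comment> \<open>From test functions to open \<open>B\<close> through \<open>open_approx\<close>,
    then to Borel \<open>B\<close> by Dynkin induction with \<open>A\<close> fixed.\<close>
  have AB: "measure \<pi> (A \<times> B) = (\<integral>x. indicator A x * measure (\<kappa> x) B \<partial>\<mu>)"
    if A: "A \<in> sets borel" and B: "B \<in> sets borel" for A B
  proof -
    have [measurable]: "A \<in> sets borel" by fact
    have intB: "integrable \<mu> (\<lambda>x. indicator A x * measure (\<kappa> x) B)" if "B \<in> sets borel" for B
    proof (rule integrable_Prob_bounded[OF \<mu>])
      have [measurable]: "(\<lambda>x. measure (\<kappa> x) B) \<in> borel_measurable borel" by (rule mB[OF that])
      show "(\<lambda>x. indicator A x * measure (\<kappa> x) B) \<in> borel_measurable borel" by measurable
      show "\<bar>indicator A x * measure (\<kappa> x) B\<bar> \<le> 1" for x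
        using \<kappa>P[of x] by (auto simp: indicator_def Prob_iff intro: prob_space.prob_le_1)
    qed
    have open_case: "measure \<pi> (A \<times> U) = (\<integral>x. indicator A x * measure (\<kappa> x) U \<partial>\<mu>)" if U: "open U" for U
    proof -
      have [measurable]: "U \<in> sets borel" using U by simp
      have [measurable]: "open_approx U n \<in> borel_measurable borel" for n
        by (intro borel_measurable_continuous_onI continuous_intros)
      have [measurable]: "(\<lambda>x. \<integral>y. open_approx U n y \<partial>\<kappa> x) \<in> borel_measurable borel" for n
        using meas oa[of U n] by metis
      have [measurable]: "(\<lambda>x. measure (\<kappa> x) U) \<in> borel_measurable borel" by (rule mU[OF U])
      have "(\<lambda>n. \<integral>x. indicator A x * (\<integral>y. open_approx U n y \<partial>\<kappa> x) \<partial>\<mu>) \<longlonglongrightarrow> (\<integral>x. indicator A x * measure (\<kappa> x) U \<partial>\<mu>)"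
      proof (rule integral_dominated_convergence[where w="\<lambda>_. 1"])
        show "AE x in \<mu>. (\<lambda>n. indicator A x * (\<integral>y. open_approx U n y \<partial>\<kappa> x)) \<longlonglongrightarrow> indicator A x * measure (\<kappa> x) U"
          by (intro AE_I2 tendsto_mult tendsto_const \<kappa>lim U)
        show "AE x in \<mu>. norm (indicator A x * (\<integral>y. open_approx U n y \<partial>\<kappa> x)) \<le> 1" for n
          using \<kappa>int by (intro AE_I2) (auto simp: indicator_def)
      qed auto
      moreover have "(\<lambda>n. \<integral>z. indicator A (fst z) * open_approx U n (snd z) \<partial>\<pi>) \<longlonglongrightarrow> (\<integral>z. indicator A (fst z) * indicator U (snd z) \<partial>\<pi>)"
      proof (rule integral_dominated_convergence[where w="\<lambda>_. 1"])
        show "AE z in \<pi>. (\<lambda>n. indicator A (fst z) * open_approx U n (snd z)) \<longlonglongrightarrow> indicator A (fst z) * indicator U (snd z)"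
          by (intro AE_I2 tendsto_mult tendsto_const open_approx_tendsto U)
        show "AE z in \<pi>. norm (indicator A (fst z) * open_approx U n (snd z)) \<le> 1" for n
          using open_approx_range[of U n] by (intro AE_I2) (auto simp: indicator_def)
      qed auto
      moreover have "(\<integral>x. indicator A x * (\<integral>y. open_approx U n y \<partial>\<kappa> x) \<partial>\<mu>) = (\<integral>z. indicator A (fst z) * open_approx U n (snd z) \<partial>\<pi>)" for n
        using formula[OF A] oa[of U n] by metis
      moreover have "(\<integral>z. indicator A (fst z) * indicator U (snd z) \<partial>\<pi>) = measure \<pi> (A \<times> U)"
      proof -
        have "(\<integral>z. indicator A (fst z) * indicator U (snd z) \<partial>\<pi>) = (\<integral>z. (indicator (A \<times> U) z :: real) \<partial>\<pi>)"
          by (intro Bochner_Integration.integral_cong) (auto simp: indicator_def)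
        then show ?thesis using sets_eq_imp_space_eq[OF sets_eq] by simp
      qed
      ultimately show ?thesis by (simp add: LIMSEQ_unique)
    qed
    have "B \<in> sigma_sets UNIV {S. open S}" using B by (simp add: borel_def)
    have "Int_stable {S :: 'b set. open S}" "{S :: 'b set. open S} \<subseteq> Pow UNIV" by (auto simp: Int_stable_def)
    then show ?thesis using \<open>B \<in> sigma_sets UNIV {S. open S}\<close>
    proof (induction rule: sigma_sets_induct_disjoint)
      case (basic U) then show ?case using open_case by simp
    next
      case empty show ?case by simp
    next
      case (compl B)
      have B: "B \<in> sets borel" using compl(1) by (simp add: borel_def)
      have "measure \<pi> (A \<times> (UNIV - B)) = measure \<pi> (A \<times> UNIV) - measure \<pi> (A \<times> B)"
        using Times_borel[OF A B] Times_borel[OF A, of UNIV]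
        by (subst \<pi>.finite_measure_Diff[symmetric]) (auto simp: sets_eq intro!: arg_cong[where f="measure \<pi>"])
      also have "\<dots> = (\<integral>x. indicator A x * measure (\<kappa> x) UNIV - indicator A x * measure (\<kappa> x) B \<partial>\<mu>)"
        using intB[OF B] intB[of UNIV] by (simp add: open_case compl.IH)
      also have "\<dots> = (\<integral>x. indicator A x * measure (\<kappa> x) (UNIV - B) \<partial>\<mu>)"
      proof (intro Bochner_Integration.integral_cong refl)
        fix x
        interpret K: prob_space "\<kappa> x" using \<kappa>P by (simp add: Prob_iff)
        have "sets (\<kappa> x) = sets borel" using \<kappa>P by (simp add: Prob_iff)
        then have "measure (\<kappa> x) (UNIV - B) = measure (\<kappa> x) UNIV - measure (\<kappa> x) B"
          using B by (intro K.finite_measure_Diff) auto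
        then show "indicator A x * measure (\<kappa> x) UNIV - indicator A x * measure (\<kappa> x) B = indicator A x * measure (\<kappa> x) (UNIV - B)"
          by (simp only: right_diff_distrib)
      qed
      finally show ?case .
    next
      case (union B)
      have B: "B i \<in> sets borel" for i using union(2) by (auto simp: borel_def)
      have un: "(\<Union>i. A \<times> B i) = A \<times> (\<Union>i. B i)" by auto
      have "(\<lambda>i. measure \<pi> (A \<times> B i)) sums measure \<pi> (\<Union>i. A \<times> B i)"
        using union(1) Times_borel[OF A B] by (intro \<pi>.finite_measure_UNION) (auto simp: sets_eq disjoint_family_on_def)
      then have s: "(\<lambda>i. measure \<pi> (A \<times> B i)) sums measure \<pi> (A \<times> (\<Union>i. B i))"
        by (simp only: un)
      have sk: "(\<lambda>i. indicator A x * measure (\<kappa> x) (B i)) sums (indicator A x * measure (\<kappa> x) (\<Union>i. B i))" for x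
      proof -
        interpret K: prob_space "\<kappa> x" using \<kappa>P by (simp add: Prob_iff)
        have "sets (\<kappa> x) = sets borel" using \<kappa>P by (simp add: Prob_iff)
        then show ?thesis using B union(1) by (intro sums_mult K.finite_measure_UNION) auto
      qed
      have "(\<lambda>i. \<integral>x. indicator A x * measure (\<kappa> x) (B i) \<partial>\<mu>) sums (\<integral>x. (\<Sum>i. indicator A x * measure (\<kappa> x) (B i)) \<partial>\<mu>)"
      proof (rule sums_integral)
        show "integrable \<mu> (\<lambda>x. indicator A x * measure (\<kappa> x) (B i))" for i by (rule intB[OF B])
        show "AE x in \<mu>. summable (\<lambda>i. norm (indicator A x * measure (\<kappa> x) (B i)))"
          using sk by (intro AE_I2) (auto simp: sums_iff abs_mult)
        show "summable (\<lambda>i. \<integral>x. norm (indicator A x * measure (\<kappa> x) (B i)) \<partial>\<mu>)"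
          using s union.IH by (auto simp: sums_iff abs_mult)
      qed
      moreover have "(\<Sum>i. indicator A x * measure (\<kappa> x) (B i)) = indicator A x * measure (\<kappa> x) (\<Union>i. B i)" for x
        using sk[of x] by (simp add: sums_iff)
      ultimately show ?case using s union.IH by (simp add: sums_unique2)
    qed
  qed
  have "disintegration \<pi> \<mu> \<kappa>" unfolding disintegration_def
  proof (intro conjI ballI \<kappa>)
    fix A :: "'a set" and B :: "'b set" assume A: "A \<in> sets borel" and B: "B \<in> sets borel"
    have [measurable]: "A \<in> sets borel" "(\<lambda>x. measure (\<kappa> x) B) \<in> borel_measurable borel" using A mB[OF B] by auto
    have int: "integrable \<mu> (\<lambda>x. indicator A x * measure (\<kappa> x) B)"
    proof (rule integrable_Prob_bounded[OF \<mu>])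
      show "\<bar>indicator A x * measure (\<kappa> x) B\<bar> \<le> 1" for x
        using \<kappa>P[of x] by (auto simp: indicator_def Prob_iff intro: prob_space.prob_le_1)
    qed measurable
    have "emeasure \<pi> (A \<times> B) = ennreal (\<integral>x. indicator A x * measure (\<kappa> x) B \<partial>\<mu>)"
      by (simp add: \<pi>.emeasure_eq_measure AB[OF A B])
    also have "\<dots> = (\<integral>\<^sup>+x. ennreal (indicator A x * measure (\<kappa> x) B) \<partial>\<mu>)"
      by (rule nn_integral_eq_integral[OF int, symmetric]) simp
    also have "\<dots> = (\<integral>\<^sup>+x\<in>A. emeasure (\<kappa> x) B \<partial>\<mu>)"
      by (intro nn_integral_cong) (auto simp: em indicator_def)
    finally show "emeasure \<pi> (A \<times> B) = (\<integral>\<^sup>+x\<in>A. emeasure (\<kappa> x) B \<partial>\<mu>)" .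
  qed
  then show ?thesis unfolding \<mu>_def[symmetric] using formula by blast
qed

section \<open>Strassen's theorem\<close>

lemma coupling_bind:
  fixes \<pi> :: "('a::metric_space \<times> 'b::metric_space) measure"
  assumes \<pi>: "\<pi> \<in> couplings \<mu> \<nu>" and \<mu>: "\<mu> \<in> Prob" and \<nu>: "\<nu> \<in> Prob" and d: "disintegration \<pi> \<mu> \<kappa>"
  shows "\<nu> = \<mu> \<bind> \<kappa>"
proof (rule measure_eqI)
  have \<kappa>: "\<kappa> \<in> borel \<rightarrow>\<^sub>M prob_algebra borel" using d by (simp add: disintegration_def)
  show "sets \<nu> = sets (\<mu> \<bind> \<kappa>)" using \<nu> bind_Prob[OF \<mu> \<kappa>] by (simp add: Prob_iff)
  fix B assume "B \<in> sets \<nu>"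
  then have B: "B \<in> sets borel" using \<nu> by (simp add: Prob_iff)
  have sets_eq[measurable_cong]: "sets \<pi> = sets borel" using \<pi> by (simp add: couplings_def Prob_iff)
  have "emeasure \<nu> B = emeasure (distr \<pi> borel snd) B" using \<pi> by (simp add: couplings_def)
  also have "\<dots> = emeasure \<pi> (UNIV \<times> B)"
    using B sets_eq_imp_space_eq[OF sets_eq] by (subst emeasure_distr) (auto intro!: arg_cong[where f="emeasure \<pi>"])
  also have "\<dots> = (\<integral>\<^sup>+x. emeasure (\<kappa> x) B \<partial>\<mu>)" using d B by (auto simp: disintegration_def)
  also have "\<dots> = emeasure (\<mu> \<bind> \<kappa>) B"
    using emeasure_bind_prob_algebra[OF \<mu> \<kappa> B] by simp
  finally show "emeasure \<nu> B = emeasure (\<mu> \<bind> \<kappa>) B" .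
qed

lemma coupling_dominated:
  fixes t :: "('b::metric_space \<Rightarrow>\<^sub>C real) \<Rightarrow> 'a::metric_space \<Rightarrow> real"
  assumes t: "sublinear_operator t" and \<mu>: "\<mu> \<in> Prob" and \<nu>: "\<nu> \<in> Prob"
    and \<pi>: "\<pi> \<in> couplings \<mu> \<nu>" and d: "disintegration \<pi> \<mu> \<kappa>"
    and AE: "AE x in \<mu>. (return borel x, \<kappa> x) \<in> dominated_pairs t"
  shows "(\<mu>, \<nu>) \<in> dominated_pairs t"
proof -
  have \<kappa>: "\<kappa> \<in> borel \<rightarrow>\<^sub>M prob_algebra borel" using d by (simp add: disintegration_def)
  have "\<kappa> x \<in> Prob" for x using measurable_space[OF \<kappa>] by simp
  have "dominated t \<mu> \<nu>" unfolding dominated_def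
  proof
    fix g :: "'b \<Rightarrow>\<^sub>C real"
    note I = integral_bind_Prob[OF \<mu> \<kappa> bcontfun_measurable abs_bcontfun_le, of g]
    have "integrable \<mu> (\<lambda>x. \<integral>y. apply_bcontfun g y \<partial>\<kappa> x)"
      by (rule integrable_Prob_bounded[OF \<mu> I(1) abs_integral_bcontfun_le]) fact
    moreover have "AE x in \<mu>. (\<integral>y. apply_bcontfun g y \<partial>\<kappa> x) \<le> t g x"
      using AE by eventually_elim (simp add: dominated_pairs_iff dominated_return[OF t])
    ultimately have "(\<integral>x. \<integral>y. apply_bcontfun g y \<partial>\<kappa> x \<partial>\<mu>) \<le> (\<integral>x. t g x \<partial>\<mu>)"
      by (intro integral_mono_AE operator_integrable[OF t \<mu>])
    then show "(\<integral>y. apply_bcontfun g y \<partial>\<nu>) \<le> (\<integral>x. t g x \<partial>\<mu>)"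
      unfolding coupling_bind[OF \<pi> \<mu> \<nu> d] I(2) .
  qed
  with \<mu> \<nu> show ?thesis by (simp add: dominated_pairs_iff)
qed

lemma mult_le_abs_bound:
  fixes a b c :: real
  assumes "\<bar>b\<bar> \<le> c"
  shows "a * b \<le> \<bar>a\<bar> * c"
proof -
  have "a * b \<le> \<bar>a\<bar> * \<bar>b\<bar>" using abs_ge_self[of "a * b"] by (simp add: abs_mult)
  also have "\<dots> \<le> \<bar>a\<bar> * c" using assms by (intro mult_left_mono) auto
  finally show ?thesis .
qed

text \<open>Hahn--Banach for the functional \<open>f \<mapsto> \<integral> T(f(x, \<cdot>))(x) d\<mu>\<close> on the product, with the second marginal
  prescribed, produces the coupling.\<close>

theorem Strassen:
  fixes t :: "('b::metric_space \<Rightarrow>\<^sub>C real) \<Rightarrow> 'a::metric_space \<Rightarrow> real"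
  assumes X: "compact (UNIV :: 'a set)" and Y: "compact (UNIV :: 'b set)" and t: "sublinear_operator t"
    and dom: "(\<mu>, \<nu>) \<in> dominated_pairs t"
  shows "\<exists>\<pi>\<in>couplings \<mu> \<nu>. \<exists>\<kappa>. disintegration \<pi> \<mu> \<kappa> \<and> (AE x in \<mu>. (return borel x, \<kappa> x) \<in> dominated_pairs t)"
proof -
  have \<mu>: "\<mu> \<in> Prob" and \<nu>: "\<nu> \<in> Prob" and dom': "dominated t \<mu> \<nu>" using dom by (auto simp: dominated_pairs_iff)
  have XY: "compact (UNIV :: ('a \<times> 'b) set)" using compact_Times[OF X Y] by simp
  define V where "V = (continuous_functions :: ('a \<times> 'b \<Rightarrow> real) set)"
  have V: "function_space V" unfolding V_def by (rule function_space_continuous)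
  define slice where "slice f x = Bcontfun (\<lambda>y. f (x, y))" for f :: "'a \<times> 'b \<Rightarrow> real" and x
  have cs: "continuous_on UNIV (\<lambda>y. f (x, y))" if "f \<in> V" for f x
  proof -
    have "continuous_on UNIV f" using that by (simp add: V_def)
    from continuous_on_compose2[OF this continuous_on_Pair[OF continuous_on_const continuous_on_id] subset_UNIV]
    show ?thesis .
  qed
  have ap: "apply_bcontfun (slice f x) = (\<lambda>y. f (x, y))" if "f \<in> V" for f x
    unfolding slice_def by (rule Bcontfun_simps(1)[OF Y cs[OF that]])
  have sadd: "slice (\<lambda>z. f z + g z) x = slice f x + slice g x" if "f \<in> V" "g \<in> V" for f g x
    using that function_spaceD(2)[OF V that] by (intro bcontfun_eqI) (simp add: ap)
  have sscale: "slice (\<lambda>z. c * f z) x = c *\<^sub>R slice f x" if "f \<in> V" for f c x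
    using that function_spaceD(3)[OF V that, of c] by (intro bcontfun_eqI) (simp add: ap)
  define T where "T f x = t (slice f x) x" for f x
  have Tle: "T f x \<le> c" if "f \<in> V" "\<And>y. f (x, y) \<le> c" for f x c
    unfolding T_def using that by (intro operator_le_const[OF t]) (simp add: ap)
  have Tge: "c \<le> T f x" if "f \<in> V" "\<And>y. c \<le> f (x, y)" for f x c
    unfolding T_def using that by (intro operator_ge_const[OF t]) (simp add: ap)
  \<comment> \<open>The point \<open>x\<close> occurs twice, as the argument of the operator and in
    the slice. Freezing the slice at \<open>x0\<close> costs less than \<open>a - b\<close> by
    uniform continuity of \<open>f\<close>, and \<open>t\<close> passes on the translation by a
    constant.\<close>
  have Topen: "open {x. T f x < a}" if f: "f \<in> V" for f a
  proof (subst open_subopen, intro ballI)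
    fix x0 assume "x0 \<in> {x. T f x < a}"
    then obtain b where b: "T f x0 < b" "b < a" using dense by auto
    have "uniformly_continuous_on UNIV f"
      using f by (intro compact_uniformly_continuous XY) (simp add: V_def)
    then obtain e where e: "e > 0" "\<And>z z'. dist z z' < e \<Longrightarrow> dist (f z) (f z') < a - b"
      unfolding uniformly_continuous_on_def using b(2) by (metis UNIV_I diff_gt_0_iff_gt)
    define W where "W = {x. t (slice f x0) x < b} \<inter> ball x0 e"
    have "open W" unfolding W_def by (intro open_Int operator_open[OF t] open_ball)
    moreover have "x0 \<in> W" using b(1) e(1) by (simp add: W_def T_def)
    moreover have "W \<subseteq> {x. T f x < a}"
    proof
      fix x assume "x \<in> W"
      then have x: "t (slice f x0) x < b" "dist x x0 < e" by (auto simp: W_def dist_commute)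
      have "T f x \<le> t (slice f x0 + const_bcontfun (a - b)) x"
        unfolding T_def
      proof (rule operator_mono[OF t])
        fix y :: 'b
        have "dist (x, y) (x0, y) < e" using x(2) by (simp add: dist_Pair_Pair)
        from e(2)[OF this] have "f (x, y) \<le> f (x0, y) + (a - b)" by (simp add: dist_real_def abs_less_iff)
        then show "apply_bcontfun (slice f x) y \<le> apply_bcontfun (slice f x0 + const_bcontfun (a - b)) y"
          using f by (simp add: ap)
      qed
      also have "\<dots> < a" using x(1) by (simp add: operator_add_const[OF t])
      finally show "x \<in> {x. T f x < a}" by simp
    qed
    ultimately show "\<exists>W. open W \<and> x0 \<in> W \<and> W \<subseteq> {x. T f x < a}" by blast
  qed
  have Tm: "T f \<in> borel_measurable borel" if "f \<in> V" for f
    unfolding borel_measurable_iff_less using Topen[OF that] by (auto intro: borel_open)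
  have Tint: "integrable \<mu> (T f)" if f: "f \<in> V" for f
  proof -
    have "f \<in> bcontfun" using f by (intro bcontfun_compact[OF XY]) (simp add: V_def)
    then have *: "\<bar>f z\<bar> \<le> norm (Bcontfun f)" for z using abs_bcontfun_le[of "Bcontfun f" z] by (simp add: Bcontfun_inverse)
    have "f (x, y) \<le> norm (Bcontfun f)" "- norm (Bcontfun f) \<le> f (x, y)" for x y
      using *[of "(x, y)"] by auto
    then have "T f x \<le> norm (Bcontfun f)" "- norm (Bcontfun f) \<le> T f x" for x
      using f by (auto intro!: Tle Tge)
    then have "\<bar>T f x\<bar> \<le> norm (Bcontfun f)" for x by (metis abs_le_iff minus_le_iff)
    then show ?thesis by (rule integrable_Prob_bounded[OF \<mu> Tm[OF f]])
  qed
  define p where "p f = (\<integral>x. T f x \<partial>\<mu>)" for f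
  have p: "sublinear_on V p"
    unfolding sublinear_on_def
  proof (intro conjI ballI allI impI)
    fix f h assume fh: "f \<in> V" "h \<in> V"
    have "p (\<lambda>x. f x + h x) \<le> (\<integral>x. T f x + T h x \<partial>\<mu>)"
      unfolding p_def using fh function_spaceD(2)[OF V fh]
      by (intro integral_mono Bochner_Integration.integrable_add Tint) (auto simp: T_def sadd operator_add[OF t])
    then show "p (\<lambda>x. f x + h x) \<le> p f + p h" using fh by (simp add: p_def Tint)
  next
    fix f and c :: real assume "f \<in> V" "0 \<le> c"
    then show "p (\<lambda>x. c * f x) = c * p f" by (simp add: p_def T_def sscale operator_scale[OF t])
  qed
  have cfst: "continuous_on UNIV (fst :: 'a \<times> 'b \<Rightarrow> 'a)" and csnd: "continuous_on UNIV (snd :: 'a \<times> 'b \<Rightarrow> 'b)"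
    by (simp_all add: continuous_on_fst continuous_on_snd)
  have sndV: "(\<lambda>z. apply_bcontfun g (snd z)) \<in> V" for g :: "'b \<Rightarrow>\<^sub>C real"
    unfolding V_def mem_Collect_eq
    by (rule continuous_on_compose2[OF continuous_on_apply_bcontfun csnd subset_UNIV])
  have fstV: "(\<lambda>z. apply_bcontfun g (fst z)) \<in> V" for g :: "'a \<Rightarrow>\<^sub>C real"
    unfolding V_def mem_Collect_eq
    by (rule continuous_on_compose2[OF continuous_on_apply_bcontfun cfst subset_UNIV])
  have ssnd: "slice (\<lambda>z. apply_bcontfun g (snd z)) x = g" for g x
    using sndV by (intro bcontfun_eqI) (simp add: ap)
  \<comment> \<open>With \<open>g\<close> the set also contains \<open>- g\<close>, so these demands
    fix the second marginal exactly. Their compatibility with \<open>p\<close> is the assumed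
    domination, because every slice of \<open>g (snd z)\<close> is \<open>g\<close>.\<close>
  define C where "C = {((\<lambda>z :: 'a \<times> 'b. apply_bcontfun g (snd z)), \<integral>y. apply_bcontfun g y \<partial>\<nu>) | g :: 'b \<Rightarrow>\<^sub>C real. True}"
  have C1: "bound_cone C" unfolding bound_cone_def
  proof (intro conjI allI impI)
    show "(\<lambda>_. 0, 0) \<in> C" unfolding C_def by (intro CollectI exI[of _ 0]) auto
  next
    fix v b w d assume "(v, b) \<in> C" "(w, d) \<in> C"
    then obtain g h where "v = (\<lambda>z. apply_bcontfun g (snd z))" "b = (\<integral>y. apply_bcontfun g y \<partial>\<nu>)"
      "w = (\<lambda>z. apply_bcontfun h (snd z))" "d = (\<integral>y. apply_bcontfun h y \<partial>\<nu>)" by (auto simp: C_def)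
    then show "(\<lambda>x. v x + w x, b + d) \<in> C"
      unfolding C_def using integrable_bcontfun[OF \<nu>] by (intro CollectI exI[of _ "g + h"]) auto
  next
    fix v b and c :: real assume "c \<ge> 0" "(v, b) \<in> C"
    then obtain g where "v = (\<lambda>z. apply_bcontfun g (snd z))" "b = (\<integral>y. apply_bcontfun g y \<partial>\<nu>)" by (auto simp: C_def)
    then show "(\<lambda>x. c * v x, c * b) \<in> C" unfolding C_def by (intro CollectI exI[of _ "c *\<^sub>R g"]) auto
  qed
  have C2: "\<forall>v b. (v, b) \<in> C \<longrightarrow> v \<in> V \<and> b \<le> p v"
    using sndV dom' by (auto simp: C_def p_def T_def ssnd dominated_def)
  obtain L where L: "linear_functional_on V L" "\<forall>f\<in>V. L f \<le> p f" "\<forall>v b. (v, b) \<in> C \<longrightarrow> b \<le> L v"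
    using Mazur_Orlicz[OF V p C1 C2] by blast
  have L_le: "L f \<le> c" if f: "f \<in> V" and fc: "\<And>z. f z \<le> c" for f c
  proof -
    interpret prob_space \<mu> using \<mu> by (simp add: Prob_iff)
    have "L f \<le> p f" using L(2) f by blast
    also have "p f \<le> (\<integral>x. c \<partial>\<mu>)" unfolding p_def using f fc by (intro integral_mono Tint Tle) auto
    finally show ?thesis by (simp add: prob_space)
  qed
  have nonneg: "0 \<le> L f" if "continuous_on UNIV f" "\<And>x. 0 \<le> f x" for f
    using L_le[of "\<lambda>x. - f x" 0] linear_functional_onD(3)[OF L(1), of f] that
    by (simp add: V_def continuous_on_minus)
  have "L (\<lambda>_. 1) \<le> 1" "L (\<lambda>_. - 1) \<le> - 1" using L_le by (auto simp: V_def)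
  then have one: "L (\<lambda>_. 1) = 1" using linear_functional_onD(3)[OF L(1), of "\<lambda>_. 1"] by (simp add: V_def)
  obtain \<pi> where \<pi>: "\<pi> \<in> Prob" and \<pi>L: "\<And>f. continuous_on UNIV f \<Longrightarrow> (\<integral>x. f x \<partial>\<pi>) = L f"
    using Riesz_representation[OF XY L(1)[unfolded V_def] nonneg one] by blast
  have \<pi>V: "(\<integral>z. f z \<partial>\<pi>) = L f" if "f \<in> V" for f using \<pi>L that by (simp add: V_def)
  have sets_eq[measurable_cong]: "sets \<pi> = sets borel" using \<pi> by (simp add: Prob_iff)
  interpret \<pi>: prob_space \<pi> using \<pi> by (simp add: Prob_iff)
  have P: "distr \<pi> borel fst \<in> Prob" "distr \<pi> borel snd \<in> Prob"
    by (auto simp: Prob_iff intro!: \<pi>.prob_space_distr)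
  have snd: "distr \<pi> borel snd = \<nu>"
  proof (rule Prob_eqI_bcontfun[OF P(2) \<nu>])
    fix g :: "'b \<Rightarrow>\<^sub>C real"
    have ge: "(\<integral>y. apply_bcontfun h y \<partial>\<nu>) \<le> (\<integral>z. apply_bcontfun h (snd z) \<partial>\<pi>)" for h :: "'b \<Rightarrow>\<^sub>C real"
      unfolding \<pi>V[OF sndV] using L(3) by (auto simp: C_def)
    have "(\<integral>y. apply_bcontfun g y \<partial>\<nu>) = (\<integral>z. apply_bcontfun g (snd z) \<partial>\<pi>)"
      using ge[of g] ge[of "- g"] by simp
    then show "(\<integral>y. apply_bcontfun g y \<partial>distr \<pi> borel snd) = (\<integral>y. apply_bcontfun g y \<partial>\<nu>)"
      by (subst integral_distr) auto
  qed
  have fst: "distr \<pi> borel fst = \<mu>"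
  proof (rule Prob_eqI_bcontfun[OF P(1) \<mu>])
    fix g :: "'a \<Rightarrow>\<^sub>C real"
    have le: "(\<integral>z. apply_bcontfun h (fst z) \<partial>\<pi>) \<le> (\<integral>x. apply_bcontfun h x \<partial>\<mu>)" for h :: "'a \<Rightarrow>\<^sub>C real"
    proof -
      \<comment> \<open>A function of the first coordinate has constant slices, which
        \<open>t\<close> preserves; thus \<open>p\<close> itself fixes the first marginal.\<close>
      have "T (\<lambda>z. apply_bcontfun h (fst z)) x = apply_bcontfun h x" for x
        by (intro antisym Tle Tge fstV) auto
      then have "p (\<lambda>z. apply_bcontfun h (fst z)) = (\<integral>x. apply_bcontfun h x \<partial>\<mu>)" by (simp add: p_def)
      then show ?thesis unfolding \<pi>V[OF fstV] using L(2) fstV by metis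
    qed
    have "(\<integral>z. apply_bcontfun g (fst z) \<partial>\<pi>) = (\<integral>x. apply_bcontfun g x \<partial>\<mu>)"
      using le[of g] le[of "- g"] by simp
    then show "(\<integral>x. apply_bcontfun g x \<partial>distr \<pi> borel fst) = (\<integral>x. apply_bcontfun g x \<partial>\<mu>)"
      by (subst integral_distr) auto
  qed
  obtain \<kappa> where d: "disintegration \<pi> \<mu> \<kappa>" and \<kappa>: "\<And>(g :: 'b \<Rightarrow>\<^sub>C real) A. A \<in> sets borel \<Longrightarrow>
      (\<integral>x. indicator A x * (\<integral>y. apply_bcontfun g y \<partial>\<kappa> x) \<partial>\<mu>) = (\<integral>z. indicator A (fst z) * apply_bcontfun g (snd z) \<partial>\<pi>)"
    using disintegration_exists[OF Y \<pi>] unfolding fst by blast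
  have \<kappa>m: "\<kappa> \<in> borel \<rightarrow>\<^sub>M prob_algebra borel" using d by (simp add: disintegration_def)
  have \<kappa>P: "\<kappa> x \<in> Prob" for x using measurable_space[OF \<kappa>m] by simp
  have sets_\<mu>[measurable_cong]: "sets \<mu> = sets borel" using \<mu> by (simp add: Prob_iff)
  have le: "AE x in \<mu>. (\<integral>y. apply_bcontfun g y \<partial>\<kappa> x) \<le> t g x" for g
  proof (rule AE_le_if_integral_le)
    show "integrable \<mu> (\<lambda>x. \<integral>y. apply_bcontfun g y \<partial>\<kappa> x)"
      by (rule integrable_Prob_bounded[OF \<mu> integral_bind_Prob(1)[OF \<mu> \<kappa>m bcontfun_measurable abs_bcontfun_le]
          abs_integral_bcontfun_le[OF \<kappa>P]])
    show "integrable \<mu> (t g)" by (rule operator_integrable[OF t \<mu>])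
    fix A assume "A \<in> sets \<mu>"
    then have A[measurable]: "A \<in> sets borel" by (simp add: sets_\<mu>)
    have tm[measurable]: "t g \<in> borel_measurable borel" by (rule operator_measurable[OF t])
    show "(\<integral>x. indicator A x * (\<integral>y. apply_bcontfun g y \<partial>\<kappa> x) \<partial>\<mu>) \<le> (\<integral>x. indicator A x * t g x \<partial>\<mu>)"
      unfolding \<kappa>[OF A]
    proof (rule field_le_epsilon)
      fix e :: real assume e: "0 < e"
      \<comment> \<open>The indicator of \<open>A\<close> is exchanged with a continuous
        \<open>h\<close> once under \<open>\<pi>\<close> and once under \<open>\<mu>\<close>, each
        time at cost at most \<open>norm g * c\<close>; adding 1 to the norm covers
        \<open>g = 0\<close>.\<close>
      define c where "c = e / (2 * (norm g + 1))"
      have gp: "norm g + 1 > 0" by (simp add: add_nonneg_pos)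
      have c: "c > 0" "2 * (norm g * c) \<le> e" using e gp by (auto simp: c_def field_simps)
      obtain h where h: "continuous_on UNIV h" "\<And>x. 0 \<le> h x \<and> h x \<le> 1" "(\<integral>x. \<bar>h x - indicator A x\<bar> \<partial>\<mu>) < c"
        using indicator_approx_continuous[OF \<mu> A c(1)] by blast
      have [measurable]: "h \<in> borel_measurable borel" using h(1) by (rule borel_measurable_continuous_onI)
      have h1: "\<bar>h x\<bar> \<le> 1" "\<bar>h x - indicator A x\<bar> \<le> 1" for x
        using h(2)[of x] by (auto simp: indicator_def)
      define k where "k z = h (fst z) * apply_bcontfun g (snd z)" for z
      have "continuous_on UNIV (\<lambda>z :: 'a \<times> 'b. h (fst z))"
        by (rule continuous_on_compose2[OF h(1) cfst subset_UNIV])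
      then have kV: "k \<in> V" using sndV[of g] unfolding V_def k_def by (simp add: continuous_on_mult)
      \<comment> \<open>Here \<open>h \<ge> 0\<close> matters: only a non-negative factor can be
        pulled out of \<open>t\<close>.\<close>
      have Tk: "T k x = h x * t g x" for x
      proof -
        have "slice k x = h x *\<^sub>R g" using kV by (intro bcontfun_eqI) (simp add: ap k_def)
        then show ?thesis using h(2) by (simp add: T_def operator_scale[OF t])
      qed
      have i1: "integrable \<pi> (\<lambda>z. indicator A (fst z) * apply_bcontfun g (snd z))" "integrable \<pi> k"
        "integrable \<pi> (\<lambda>z. norm g * \<bar>h (fst z) - indicator A (fst z)\<bar>)"
      proof -
        show "integrable \<pi> (\<lambda>z. indicator A (fst z) * apply_bcontfun g (snd z))"
          using abs_bcontfun_le[of g]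
          by (intro integrable_Prob_bounded[OF \<pi>, of _ "norm g"]) (auto simp: indicator_def)
        show "integrable \<pi> k"
        proof (rule integrable_Prob_bounded[OF \<pi>])
          show "k \<in> borel_measurable borel" unfolding k_def by measurable
          show "\<bar>k z\<bar> \<le> 1 * norm g" for z
            unfolding k_def abs_mult by (intro mult_mono h1 abs_bcontfun_le) auto
        qed
        show "integrable \<pi> (\<lambda>z. norm g * \<bar>h (fst z) - indicator A (fst z)\<bar>)"
          using h1(2) by (intro integrable_mult_right integrable_Prob_bounded[OF \<pi>, of _ 1]) auto
      qed
      have i2: "integrable \<mu> (\<lambda>x. indicator A x * t g x)" "integrable \<mu> (\<lambda>x. h x * t g x)"
        "integrable \<mu> (\<lambda>x. norm g * \<bar>h x - indicator A x\<bar>)"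
      proof -
        show "integrable \<mu> (\<lambda>x. indicator A x * t g x)"
          using operator_abs_le[OF t, of g]
          by (intro integrable_Prob_bounded[OF \<mu>, of _ "norm g"]) (auto simp: indicator_def)
        show "integrable \<mu> (\<lambda>x. h x * t g x)" using Tint[OF kV] by (simp add: Tk[abs_def])
        show "integrable \<mu> (\<lambda>x. norm g * \<bar>h x - indicator A x\<bar>)"
          using h1(2) by (intro integrable_mult_right integrable_Prob_bounded[OF \<mu>, of _ 1]) auto
      qed
      have "(\<integral>z. indicator A (fst z) * apply_bcontfun g (snd z) \<partial>\<pi>) \<le> (\<integral>z. k z + norm g * \<bar>h (fst z) - indicator A (fst z)\<bar> \<partial>\<pi>)"
      proof (rule integral_mono[OF i1(1) Bochner_Integration.integrable_add[OF i1(2,3)]])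
        fix z
        have "(indicator A (fst z) - h (fst z)) * apply_bcontfun g (snd z) \<le> \<bar>h (fst z) - indicator A (fst z)\<bar> * norm g"
          using mult_le_abs_bound[OF abs_bcontfun_le[of g "snd z"], of "indicator A (fst z) - h (fst z)"]
          by (simp only: abs_minus_commute)
        then show "indicator A (fst z) * apply_bcontfun g (snd z) \<le> k z + norm g * \<bar>h (fst z) - indicator A (fst z)\<bar>"
          by (simp add: k_def algebra_simps)
      qed
      also have "\<dots> = L k + norm g * (\<integral>z. \<bar>h (fst z) - indicator A (fst z)\<bar> \<partial>\<pi>)"
        using i1 by (simp add: \<pi>V[OF kV])
      also have "(\<integral>z. \<bar>h (fst z) - indicator A (fst z)\<bar> \<partial>\<pi>) = (\<integral>x. \<bar>h x - indicator A x\<bar> \<partial>\<mu>)"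
        unfolding fst[symmetric] by (rule integral_distr[symmetric]) auto
      also have "L k \<le> (\<integral>x. h x * t g x \<partial>\<mu>)" using L(2) kV by (auto simp: p_def Tk)
      also have "(\<integral>x. h x * t g x \<partial>\<mu>) \<le> (\<integral>x. indicator A x * t g x + norm g * \<bar>h x - indicator A x\<bar> \<partial>\<mu>)"
      proof (rule integral_mono[OF i2(2) Bochner_Integration.integrable_add[OF i2(1,3)]])
        fix x
        have "(h x - indicator A x) * t g x \<le> \<bar>h x - indicator A x\<bar> * norm g"
          by (rule mult_le_abs_bound[OF operator_abs_le[OF t]])
        then show "h x * t g x \<le> indicator A x * t g x + norm g * \<bar>h x - indicator A x\<bar>"
          by (simp add: algebra_simps)
      qed
      also have "\<dots> = (\<integral>x. indicator A x * t g x \<partial>\<mu>) + norm g * (\<integral>x. \<bar>h x - indicator A x\<bar> \<partial>\<mu>)"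
        using i2 by simp
      finally have "(\<integral>z. indicator A (fst z) * apply_bcontfun g (snd z) \<partial>\<pi>) \<le>
          (\<integral>x. indicator A x * t g x \<partial>\<mu>) + 2 * (norm g * (\<integral>x. \<bar>h x - indicator A x\<bar> \<partial>\<mu>))" by simp
      also have "norm g * (\<integral>x. \<bar>h x - indicator A x\<bar> \<partial>\<mu>) \<le> norm g * c"
        using h(3) by (intro mult_left_mono) auto
      finally show "(\<integral>z. indicator A (fst z) * apply_bcontfun g (snd z) \<partial>\<pi>) \<le> (\<integral>x. indicator A x * t g x \<partial>\<mu>) + e"
        using c(2) by simp
    qed
  qed
  obtain D :: "('b \<Rightarrow>\<^sub>C real) set" where D: "countable D" "\<And>f e. e > 0 \<Longrightarrow> \<exists>d\<in>D. norm (d - f) < e"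
    using separable_bcontfun[OF Y] by blast
  \<comment> \<open>A countable dense set gives one null set for all test functions; both sides
    being 1-Lipschitz in \<open>g\<close>, the inequality extends to every \<open>g\<close>.\<close>
  have "AE x in \<mu>. \<forall>g\<in>D. (\<integral>y. apply_bcontfun g y \<partial>\<kappa> x) \<le> t g x"
    using le by (simp add: AE_ball_countable[OF D(1)])
  then have "AE x in \<mu>. (return borel x, \<kappa> x) \<in> dominated_pairs t"
  proof eventually_elim
    case (elim x)
    have "(\<integral>y. apply_bcontfun g y \<partial>\<kappa> x) \<le> t g x" for g
    proof (rule field_le_epsilon)
      fix e :: real assume "0 < e"
      then obtain d where d: "d \<in> D" "norm (d - g) < e / 2" using D(2)[of "e / 2" g] by auto
      have "(\<integral>y. apply_bcontfun g y \<partial>\<kappa> x) - (\<integral>y. apply_bcontfun d y \<partial>\<kappa> x) = (\<integral>y. apply_bcontfun (g - d) y \<partial>\<kappa> x)"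
        using integrable_bcontfun[OF \<kappa>P[of x]] by simp
      also have "\<dots> \<le> norm (d - g)" using abs_integral_bcontfun_le[OF \<kappa>P[of x], of "g - d"] by (simp add: norm_minus_commute)
      finally have "(\<integral>y. apply_bcontfun g y \<partial>\<kappa> x) \<le> (\<integral>y. apply_bcontfun d y \<partial>\<kappa> x) + norm (d - g)" by simp
      also have "(\<integral>y. apply_bcontfun d y \<partial>\<kappa> x) \<le> t d x" using elim d(1) by blast
      also have "t d x \<le> t g x + norm (d - g)" by (rule operator_lipschitz[OF t])
      finally show "(\<integral>y. apply_bcontfun g y \<partial>\<kappa> x) \<le> t g x + e" using d(2) by simp
    qed
    then show ?case using \<kappa>P by (simp add: dominated_pairs_iff return_Prob dominated_return[OF t])
  qed
  moreover have "\<pi> \<in> couplings \<mu> \<nu>" using \<pi> fst snd by (simp add: couplings_def)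
  ultimately show ?thesis using d by blast
qed

section \<open>The balayage cone of an operator\<close>

definition real_lsc :: "('a::topological_space \<Rightarrow> real) \<Rightarrow> bool" where
  "real_lsc f \<longleftrightarrow> (\<forall>a. open {x. a < f x})"

lemma real_lscI:
  assumes "\<And>x a. a < f x \<Longrightarrow> \<exists>W. open W \<and> x \<in> W \<and> (\<forall>z\<in>W. a < f z)"
  shows "real_lsc f"
  unfolding real_lsc_def
proof
  fix a show "open {x. a < f x}"
  proof (subst open_subopen, intro ballI)
    fix x assume "x \<in> {x. a < f x}"
    then obtain W where "open W" "x \<in> W" "\<forall>z\<in>W. a < f z" using assms[of a x] by auto
    then show "\<exists>T. open T \<and> x \<in> T \<and> T \<subseteq> {x. a < f x}" by (intro exI[of _ W]) auto
  qed
qed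

lemma real_lsc_add:
  assumes "real_lsc f" "real_lsc g"
  shows "real_lsc (\<lambda>x. f x + g x)"
proof (rule real_lscI)
  fix x a assume a: "a < f x + g x"
  define e where "e = (f x + g x - a) / 2"
  have e: "e > 0" "a = f x - e + (g x - e)" using a by (auto simp: e_def field_simps)
  have "open ({z. f x - e < f z} \<inter> {z. g x - e < g z})" using assms by (auto simp: real_lsc_def)
  then show "\<exists>W. open W \<and> x \<in> W \<and> (\<forall>z\<in>W. a < f z + g z)"
    using e(1) unfolding e(2) by (intro exI conjI ballI) (auto intro: add_strict_mono)
qed

lemma real_lsc_cmult:
  assumes "real_lsc f" "0 \<le> c"
  shows "real_lsc (\<lambda>x. c * f x)"
proof (cases "c = 0")
  case False
  with assms(2) have "{x. a < c * f x} = {x. a / c < f x}" for a by (auto simp: field_simps)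
  with assms(1) show ?thesis by (simp add: real_lsc_def)
qed (simp add: real_lsc_def)

lemma real_lsc_max:
  assumes "real_lsc f" "real_lsc g"
  shows "real_lsc (\<lambda>x. max (f x) (g x))"
proof -
  have "{x. a < max (f x) (g x)} = {x. a < f x} \<union> {x. a < g x}" for a by auto
  with assms show ?thesis by (auto simp: real_lsc_def intro!: open_Un)
qed

lemma real_lsc_uniform_limit:
  assumes "\<And>e. e > 0 \<Longrightarrow> \<exists>h. real_lsc h \<and> (\<forall>x. \<bar>f x - h x\<bar> \<le> e)"
  shows "real_lsc f"
proof (rule real_lscI)
  fix x a assume a: "a < f x"
  define e where "e = (f x - a) / 3"
  have e: "e > 0" using a by (simp add: e_def)
  obtain h where h: "real_lsc h" "\<And>x. \<bar>f x - h x\<bar> \<le> e" using assms[OF e] by blast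
  have "a + e < h x" 
  proof -
    have "e * 3 = f x - a" using nonzero_eq_divide_eq[of 3 e "f x - a"] by (simp add: e_def)
    moreover have "f x - h x \<le> e" using h(2)[of x] by (simp add: abs_le_iff)
    ultimately show ?thesis using e by linarith
  qed
  moreover have "a < f z" if "a + e < h z" for z using h(2)[of z] that by (simp add: abs_le_iff)
  ultimately show "\<exists>W. open W \<and> x \<in> W \<and> (\<forall>z\<in>W. a < f z)"
    using h(1) by (intro exI[of _ "{z. a + e < h z}"]) (auto simp: real_lsc_def)
qed

lemma real_lsc_measurable: "real_lsc f \<Longrightarrow> f \<in> borel_measurable borel"
  unfolding borel_measurable_iff_greater by (auto simp: real_lsc_def intro: borel_open)

lemma continuous_real_lsc: "continuous_on UNIV f \<Longrightarrow> real_lsc f"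
  by (auto simp: real_lsc_def intro!: open_Collect_less)

text \<open>Superlinear conjugate of \<open>t\<close>. For the hull operator and continuous
  \<open>g\<close> it is the infimum of the integrals of \<open>g\<close> over the fibre.\<close>

definition dual_operator :: "(('b::metric_space \<Rightarrow>\<^sub>C real) \<Rightarrow> 'a::metric_space \<Rightarrow> real) \<Rightarrow> ('b \<Rightarrow> real) \<Rightarrow> 'a \<Rightarrow> real" where
  "dual_operator t g x = - t (Bcontfun (\<lambda>y. - g y)) x"

text \<open>An inequality between \<open>f\<close> and the conjugate, not an equation: the conjugate
  is only superadditive, and the conjugate of a maximum may exceed the maximum of the conjugates, so
  an equation would not be stable under sums and maxima.\<close>

definition operator_cone ::
    "(('b::metric_space \<Rightarrow>\<^sub>C real) \<Rightarrow> 'a::metric_space \<Rightarrow> real) \<Rightarrow> ('a + 'b \<Rightarrow> ereal) set" where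
  "operator_cone t = {case_sum (\<lambda>x. ereal (f x)) (\<lambda>y. ereal (g y)) | f g.
     continuous_on UNIV g \<and> real_lsc f \<and> (\<exists>c. \<forall>x. c \<le> f x) \<and> (\<forall>x. f x \<le> dual_operator t g x)}"

context
  fixes t :: "('b::metric_space \<Rightarrow>\<^sub>C real) \<Rightarrow> 'a::metric_space \<Rightarrow> real"
  assumes Y: "compact (UNIV :: 'b set)" and t: "sublinear_operator t"
begin

lemma Bcontfun_ap: "continuous_on UNIV f \<Longrightarrow> apply_bcontfun (Bcontfun f) = (f :: 'b \<Rightarrow> real)"
  by (rule Bcontfun_simps(1)[OF Y])

lemma dual_mono_eps:
  assumes "continuous_on UNIV g" "continuous_on UNIV h" "\<And>y. g y \<le> h y + e"
  shows "dual_operator t g x \<le> dual_operator t h x + e"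
proof -
  have "t (Bcontfun (\<lambda>y. - h y)) x \<le> t (Bcontfun (\<lambda>y. - g y) + const_bcontfun e) x"
    using assms by (intro operator_mono[OF t]) (simp add: Bcontfun_ap continuous_on_minus algebra_simps)
  then show ?thesis by (simp add: dual_operator_def operator_add_const[OF t])
qed

lemma dual_mono: "continuous_on UNIV g \<Longrightarrow> continuous_on UNIV h \<Longrightarrow> (\<And>y. g y \<le> h y) \<Longrightarrow> dual_operator t g x \<le> dual_operator t h x"
  using dual_mono_eps[of g h 0 x] by simp

lemma dual_add:
  assumes "continuous_on UNIV g" "continuous_on UNIV h"
  shows "dual_operator t g x + dual_operator t h x \<le> dual_operator t (\<lambda>y. g y + h y) x"
proof -
  have "Bcontfun (\<lambda>y. - (g y + h y)) = Bcontfun (\<lambda>y. - g y) + Bcontfun (\<lambda>y. - h y)"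
    using assms by (intro bcontfun_eqI) (simp add: Bcontfun_ap continuous_intros)
  then show ?thesis using operator_add[OF t, of "Bcontfun (\<lambda>y. - g y)" "Bcontfun (\<lambda>y. - h y)" x] by (simp add: dual_operator_def)
qed

lemma dual_cmult:
  assumes "continuous_on UNIV g" "0 \<le> c"
  shows "dual_operator t (\<lambda>y. c * g y) x = c * dual_operator t g x"
proof -
  have "Bcontfun (\<lambda>y. - (c * g y)) = c *\<^sub>R Bcontfun (\<lambda>y. - g y)"
    using assms by (intro bcontfun_eqI) (simp add: Bcontfun_ap continuous_intros)
  then show ?thesis using operator_scale[OF t assms(2)] by (simp add: dual_operator_def)
qed

lemma dual_const: "dual_operator t (\<lambda>_. c) x = c"
proof -
  have "Bcontfun (\<lambda>_ :: 'b. - c) = const_bcontfun (- c)" by (rule bcontfun_eqI) (simp add: Bcontfun_ap)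
  then show ?thesis using operator_const[OF t] by (simp add: dual_operator_def)
qed

lemma dual_lsc: "real_lsc (dual_operator t g)"
proof -
  have "{x. a < dual_operator t g x} = {x. t (Bcontfun (\<lambda>y. - g y)) x < - a}" for a
    by (auto simp: dual_operator_def)
  then show ?thesis using operator_open[OF t] by (simp add: real_lsc_def)
qed

lemma abs_dual_le: "\<bar>dual_operator t g x\<bar> \<le> norm (Bcontfun (\<lambda>y. - g y))"
  using operator_abs_le[OF t] by (simp add: dual_operator_def)

lemma operator_coneI:
  assumes "continuous_on UNIV g" "real_lsc f" "\<And>x. c \<le> f x" "\<And>x. f x \<le> dual_operator t g x"
    and "\<And>x. \<phi> (Inl x) = ereal (f x)" "\<And>y. \<phi> (Inr y) = ereal (g y)"
  shows "\<phi> \<in> operator_cone t"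
proof -
  have "\<phi> z = case_sum (\<lambda>x. ereal (f x)) (\<lambda>y. ereal (g y)) z" for z using assms(5,6) by (cases z) auto
  then have "\<phi> = case_sum (\<lambda>x. ereal (f x)) (\<lambda>y. ereal (g y))" by auto
  with assms show ?thesis unfolding operator_cone_def by blast
qed

lemma operator_coneD:
  assumes "\<phi> \<in> operator_cone t"
  shows "\<exists>f g c. continuous_on UNIV g \<and> real_lsc f \<and> (\<forall>x. c \<le> f x) \<and> (\<forall>x. f x \<le> dual_operator t g x) \<and>
    (\<forall>x. \<phi> (Inl x) = ereal (f x)) \<and> (\<forall>y. \<phi> (Inr y) = ereal (g y))"
proof -
  obtain f g c where *: "\<phi> = case_sum (\<lambda>x. ereal (f x)) (\<lambda>y. ereal (g y))" "continuous_on UNIV g" "real_lsc f"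
    "\<forall>x. c \<le> f x" "\<forall>x. f x \<le> dual_operator t g x"
    using assms unfolding operator_cone_def by blast
  then show ?thesis by (intro exI[of _ f] exI[of _ g] exI[of _ c]) simp
qed

lemma operator_cone_uniform_limit:
  assumes \<phi>: "\<And>n. \<phi> n \<in> operator_cone t" and lim: "euniform_limit UNIV \<phi> l"
  shows "l \<in> operator_cone t"
proof -
  have "\<forall>n. \<exists>f g c. continuous_on UNIV g \<and> real_lsc f \<and> (\<forall>x. c \<le> f x) \<and> (\<forall>x. f x \<le> dual_operator t g x) \<and>
    (\<forall>x. \<phi> n (Inl x) = ereal (f x)) \<and> (\<forall>y. \<phi> n (Inr y) = ereal (g y))"
    using operator_coneD[OF \<phi>] by blast
  then obtain f g c where fg: "\<And>n. continuous_on UNIV (g n)" "\<And>n. real_lsc (f n)" "\<And>n x. c n \<le> f n x"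
    "\<And>n x. f n x \<le> dual_operator t (g n) x" "\<And>n x. \<phi> n (Inl x) = ereal (f n x)" "\<And>n y. \<phi> n (Inr y) = ereal (g n y)"
    by metis
  define F where "F x = real_of_ereal (l (Inl x))" for x
  define G where "G y = real_of_ereal (l (Inr y))" for y
  have near: "\<exists>n. \<forall>z. \<phi> n z \<le> l z + ereal e \<and> l z \<le> \<phi> n z + ereal e" if "e > 0" for e
    using lim that unfolding euniform_limit_def eventually_sequentially by blast
  \<comment> \<open>The additive form of uniform convergence keeps a limit of real-valued functions
    real-valued.\<close>
  have fin: "\<bar>l z\<bar> \<noteq> \<infinity>" for z
  proof -
    obtain n where n: "\<phi> n z \<le> l z + ereal 1" "l z \<le> \<phi> n z + ereal 1" using near[of 1] by auto
    have "\<exists>r. \<phi> n z = ereal r" using fg(5,6) by (cases z) auto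
    with n show ?thesis by (cases "l z") auto
  qed
  have lF: "l (Inl x) = ereal (F x)" and lG: "l (Inr y) = ereal (G y)" for x y
    using fin by (simp_all add: F_def G_def ereal_real)
  have nearFG: "\<exists>n. (\<forall>x. \<bar>F x - f n x\<bar> \<le> e) \<and> (\<forall>y. \<bar>G y - g n y\<bar> \<le> e)" if e: "e > 0" for e
  proof -
    obtain n where n: "\<And>z. \<phi> n z \<le> l z + ereal e \<and> l z \<le> \<phi> n z + ereal e" using near[OF e] by blast
    have "\<bar>F x - f n x\<bar> \<le> e" for x using n[of "Inl x"] by (simp add: fg(5) lF abs_le_iff)
    moreover have "\<bar>G y - g n y\<bar> \<le> e" for y using n[of "Inr y"] by (simp add: fg(6) lG abs_le_iff)
    ultimately show ?thesis by blast
  qed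
  have cG: "continuous_on UNIV G"
  proof -
    have "\<exists>n. \<forall>y. dist (g n y) (G y) < e" if "e > 0" for e
    proof -
      obtain n where "\<forall>y. \<bar>G y - g n y\<bar> \<le> e / 2" using nearFG[of "e / 2"] \<open>e > 0\<close> by auto
      then have "dist (g n y) (G y) < e" for y
        using \<open>e > 0\<close> by (auto simp: dist_real_def abs_minus_commute intro: le_less_trans[of _ "e / 2"])
      then show ?thesis by blast
    qed
    \<comment> \<open>Only some index is available for each error; choosing one for every
      \<open>1 / (m + 1)\<close> produces a uniformly convergent sequence of continuous
      functions.\<close>
    then have "\<forall>m. \<exists>n. \<forall>y. dist (g n y) (G y) < inverse (real (Suc m))" by simp
    then obtain k where k: "\<And>m y. dist (g (k m) y) (G y) < inverse (real (Suc m))" by metis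
    have "uniform_limit UNIV (\<lambda>m. g (k m)) G sequentially"
    proof (rule uniform_limitI)
      fix e :: real assume "e > 0"
      then obtain N where N: "inverse (real (Suc N)) < e" using reals_Archimedean by blast
      have "dist (g (k m) y) (G y) < e" if "N \<le> m" for m y
      proof -
        have "inverse (real (Suc m)) \<le> inverse (real (Suc N))" using that by (simp add: le_imp_inverse_le)
        with k[of m y] N show ?thesis by linarith
      qed
      then show "\<forall>\<^sub>F m in sequentially. \<forall>y\<in>UNIV. dist (g (k m) y) (G y) < e"
        unfolding eventually_sequentially by blast
    qed
    then show ?thesis by (rule uniform_limit_theorem[rotated]) (auto simp: fg)
  qed
  obtain n1 where n1: "\<forall>x. \<bar>F x - f n1 x\<bar> \<le> 1" using nearFG[of 1] by auto
  show ?thesis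
  proof (rule operator_coneI[OF cG _ _ _ lF lG])
    show "real_lsc F" using nearFG fg(2) by (intro real_lsc_uniform_limit) blast
    show "c n1 - 1 \<le> F x" for x using n1[rule_format, of x] fg(3)[of n1 x] by (simp add: abs_le_iff)
    show "F x \<le> dual_operator t G x" for x
    proof (rule field_le_epsilon)
      fix e :: real assume "0 < e"
      then obtain n where n: "\<forall>x. \<bar>F x - f n x\<bar> \<le> e / 2" "\<forall>y. \<bar>G y - g n y\<bar> \<le> e / 2"
        using nearFG[of "e / 2"] by auto
      have "F x \<le> f n x + e / 2" using n(1)[rule_format, of x] by linarith
      also have "f n x \<le> dual_operator t (g n) x" by (rule fg)
      also have "dual_operator t (g n) x \<le> dual_operator t G x + e / 2"
      proof (intro dual_mono_eps fg cG)
        show "g n y \<le> G y + e / 2" for y using n(2)[rule_format, of y] by linarith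
      qed
      finally show "F x \<le> dual_operator t G x + e" by simp
    qed
  qed
qed

lemma operator_cone_balayage: "balayage_cone disjoint_union_topology (operator_cone t)"
  unfolding balayage_cone_def topspace_disjoint_union_topology
proof (intro conjI ballI allI impI)
  show "operator_cone t \<subseteq> LSC disjoint_union_topology"
  proof
    fix \<phi> :: "'a + 'b \<Rightarrow> ereal" assume "\<phi> \<in> operator_cone t"
    then obtain f g c where fg: "continuous_on UNIV g" "real_lsc f" "\<And>x. c \<le> f x" "\<And>x. f x \<le> dual_operator t g x"
      "\<And>x. \<phi> (Inl x) = ereal (f x)" "\<And>y. \<phi> (Inr y) = ereal (g y)" using operator_coneD[of \<phi>] by blast
    have "ereal (min c (- norm (Bcontfun g))) \<le> \<phi> z" for z
    proof (cases z)
      case (Inl x) then show ?thesis using fg(3)[of x] by (simp add: fg(5) min_le_iff_disj)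
    next
      case (Inr y) then show ?thesis using abs_bcontfun_le[of "Bcontfun g" y] by (simp add: fg(6) Bcontfun_ap[OF fg(1)] abs_le_iff min_le_iff_disj)
    qed
    then have "\<exists>c. \<forall>z. ereal c \<le> \<phi> z" by blast
    moreover have "\<bar>\<phi> z\<bar> \<noteq> \<infinity>" for z by (cases z) (simp_all add: fg(5,6))
    moreover have "open (Inl -` {z. a < \<phi> z})" "open (Inr -` {z. a < \<phi> z})" for a
    proof -
      show "open (Inl -` {z. a < \<phi> z})" using fg(2) by (cases a) (auto simp: fg(5) real_lsc_def)
      show "open (Inr -` {z. a < \<phi> z})" using continuous_real_lsc[OF fg(1)] by (cases a) (auto simp: fg(6) real_lsc_def)
    qed
    then have "lsc disjoint_union_topology \<phi>" by (simp add: lsc_def openin_disjoint_union_topology)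
    ultimately show "\<phi> \<in> LSC disjoint_union_topology" by (auto simp: LSC_def)
  qed
next
  fix \<phi> l assume "(\<forall>n. \<phi> n \<in> operator_cone t) \<and> euniform_limit UNIV \<phi> l"
  then show "l \<in> operator_cone t" by (blast intro: operator_cone_uniform_limit)
next
  fix \<phi> \<psi> :: "'a + 'b \<Rightarrow> ereal" assume "\<phi> \<in> operator_cone t" "\<psi> \<in> operator_cone t"
  then obtain f g c f' g' c' where fg: "continuous_on UNIV g" "real_lsc f" "\<And>x. c \<le> f x" "\<And>x. f x \<le> dual_operator t g x"
    "\<And>x. \<phi> (Inl x) = ereal (f x)" "\<And>y. \<phi> (Inr y) = ereal (g y)"
    "continuous_on UNIV g'" "real_lsc f'" "\<And>x. c' \<le> f' x" "\<And>x. f' x \<le> dual_operator t g' x"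
    "\<And>x. \<psi> (Inl x) = ereal (f' x)" "\<And>y. \<psi> (Inr y) = ereal (g' y)"
    using operator_coneD[of \<phi>] operator_coneD[of \<psi>] by blast
  show "(\<lambda>x. \<phi> x + \<psi> x) \<in> operator_cone t"
  proof (rule operator_coneI)
    show "continuous_on UNIV (\<lambda>y. g y + g' y)" "real_lsc (\<lambda>x. f x + f' x)" "c + c' \<le> f x + f' x" for x
      using fg by (auto intro!: continuous_intros real_lsc_add add_mono)
    show "f x + f' x \<le> dual_operator t (\<lambda>y. g y + g' y) x" for x
      using dual_add[OF fg(1,7), of x] fg(4)[of x] fg(10)[of x] by simp
  qed (auto simp: fg)
  show "(\<lambda>x. max (\<phi> x) (\<psi> x)) \<in> operator_cone t"
  proof (rule operator_coneI)
    show cm: "continuous_on UNIV (\<lambda>y. max (g y) (g' y))" and "real_lsc (\<lambda>x. max (f x) (f' x))"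
      "c \<le> max (f x) (f' x)" for x
      using fg by (auto intro!: continuous_intros real_lsc_max simp: le_max_iff_disj)
    show "max (f x) (f' x) \<le> dual_operator t (\<lambda>y. max (g y) (g' y)) x" for x
      using dual_mono[OF fg(1) cm, of x] dual_mono[OF fg(7) cm, of x] fg(4)[of x] fg(10)[of x] by simp
  qed (auto simp: fg max_def)
next
  fix \<phi> :: "'a + 'b \<Rightarrow> ereal" and a :: real assume "\<phi> \<in> operator_cone t" and a: "0 \<le> a"
  then obtain f g c where fg: "continuous_on UNIV g" "real_lsc f" "\<And>x. c \<le> f x" "\<And>x. f x \<le> dual_operator t g x"
    "\<And>x. \<phi> (Inl x) = ereal (f x)" "\<And>y. \<phi> (Inr y) = ereal (g y)" using operator_coneD[of \<phi>] by blast
  show "(\<lambda>x. ereal a * \<phi> x) \<in> operator_cone t"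
  proof (rule operator_coneI)
    show "continuous_on UNIV (\<lambda>y. a * g y)" "real_lsc (\<lambda>x. a * f x)" "a * c \<le> a * f x" for x
      using fg a by (auto intro!: continuous_intros real_lsc_cmult mult_left_mono)
    show "a * f x \<le> dual_operator t (\<lambda>y. a * g y) x" for x
      using fg(4)[of x] a by (simp add: dual_cmult[OF fg(1) a] mult_left_mono)
  qed (auto simp: fg)
next
  fix c :: real
  show "(\<lambda>x. ereal c) \<in> operator_cone t"
    by (rule operator_coneI[where f="\<lambda>_. c" and g="\<lambda>_. c" and c=c]) (auto simp: dual_const real_lsc_def)
qed

text \<open>The members with \<open>f = dual_operator t g\<close> are extremal: tested with
  \<open>g = - h\<close> they give domination, and any other member lies below one of them on
  \<open>X\<close> and agrees with it on \<open>Y\<close>.\<close>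

lemma operator_cone_order:
  assumes \<mu>: "\<mu> \<in> Prob" and \<nu>: "\<nu> \<in> Prob"
  shows "balayage_order (operator_cone t) \<mu> \<nu> \<longleftrightarrow> dominated t \<mu> \<nu>"
proof -
  have intY: "integrable \<nu> g" if "continuous_on UNIV g" for g :: "'b \<Rightarrow> real"
    using integrable_bcontfun[OF \<nu>, of "Bcontfun g"] by (simp add: Bcontfun_ap that)
  have intd: "integrable \<mu> (dual_operator t g)" for g
    by (rule integrable_Prob_bounded[OF \<mu> real_lsc_measurable[OF dual_lsc] abs_dual_le])
  show ?thesis
  proof
    assume ord: "balayage_order (operator_cone t) \<mu> \<nu>"
    show "dominated t \<mu> \<nu>" unfolding dominated_def
    proof
      fix h :: "'b \<Rightarrow>\<^sub>C real"
      define g where "g y = - apply_bcontfun h y" for y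
      have g: "continuous_on UNIV g" unfolding g_def by (intro continuous_intros) simp
      have dg: "dual_operator t g x = - t h x" for x by (simp add: dual_operator_def g_def apply_bcontfun_inverse)
      have "- norm (Bcontfun (\<lambda>y. - g y)) \<le> dual_operator t g x" for x using abs_dual_le[of g x] by (simp add: abs_le_iff)
      then have "case_sum (\<lambda>x. ereal (dual_operator t g x)) (\<lambda>y. ereal (g y)) \<in> operator_cone t"
        by (intro operator_coneI[OF g dual_lsc]) auto
      with ord have "eintegral \<mu> (\<lambda>x. ereal (dual_operator t g x)) \<le> eintegral \<nu> (\<lambda>y. ereal (g y))"
        unfolding balayage_order_def by fastforce
      then have "(\<integral>x. dual_operator t g x \<partial>\<mu>) \<le> (\<integral>y. g y \<partial>\<nu>)"
        by (simp add: eintegral_ereal intd intY g)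
      then show "(\<integral>y. apply_bcontfun h y \<partial>\<nu>) \<le> (\<integral>x. t h x \<partial>\<mu>)" by (simp add: dg) (simp add: g_def)
    qed
  next
    assume dom: "dominated t \<mu> \<nu>"
    show "balayage_order (operator_cone t) \<mu> \<nu>" unfolding balayage_order_def
    proof
      fix \<phi> :: "'a + 'b \<Rightarrow> ereal" assume "\<phi> \<in> operator_cone t"
      then obtain f g c where fg: "continuous_on UNIV g" "real_lsc f" "\<And>x. c \<le> f x" "\<And>x. f x \<le> dual_operator t g x"
        "\<And>x. \<phi> (Inl x) = ereal (f x)" "\<And>y. \<phi> (Inr y) = ereal (g y)" using operator_coneD[of \<phi>] by blast
      have "\<bar>f x\<bar> \<le> \<bar>c\<bar> + norm (Bcontfun (\<lambda>y. - g y))" for x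
        using fg(3,4)[of x] abs_dual_le[of g x] by linarith
      then have intf: "integrable \<mu> f" by (rule integrable_Prob_bounded[OF \<mu> real_lsc_measurable[OF fg(2)]])
      have "(\<integral>x. f x \<partial>\<mu>) \<le> (\<integral>x. dual_operator t g x \<partial>\<mu>)" by (intro integral_mono intf intd fg)
      also have "\<dots> = - (\<integral>x. t (Bcontfun (\<lambda>y. - g y)) x \<partial>\<mu>)" by (simp add: dual_operator_def)
      also have "\<dots> \<le> - (\<integral>y. apply_bcontfun (Bcontfun (\<lambda>y. - g y)) y \<partial>\<nu>)"
        using dom unfolding dominated_def by simp
      also have "\<dots> = (\<integral>y. g y \<partial>\<nu>)" using fg(1) by (simp add: Bcontfun_ap continuous_on_minus)
      finally show "eintegral \<mu> (\<lambda>x. \<phi> (Inl x)) \<le> eintegral \<nu> (\<lambda>y. \<phi> (Inr y))"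
        by (simp add: fg eintegral_ereal intf intY)
    qed
  qed
qed

end

section \<open>Reduction to non-negative functions\<close>

text \<open>Reduces a function bounded below to integrals with values in [0, \<infinity>]. The
  pointwise identity between \<open>f + c\<close>, \<open>c\<close> and the two parts of
  \<open>f\<close> is integrated as an identity of sums, so nothing infinite is subtracted before
  the negative part is known to be finite.\<close>

lemma eintegral_shift:
  fixes f :: "'a::topological_space \<Rightarrow> ereal"
  assumes \<mu>: "\<mu> \<in> Prob" and f[measurable]: "f \<in> borel_measurable borel" and c: "0 \<le> c" "\<And>x. - ereal c \<le> f x"
  shows "eintegral \<mu> f = enn2ereal (\<integral>\<^sup>+x. e2ennreal (f x + ereal c) \<partial>\<mu>) - ereal c"
proof -
  interpret prob_space \<mu> using \<mu> by (simp add: Prob_iff)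
  have [measurable_cong]: "sets \<mu> = sets borel" using \<mu> by (simp add: Prob_iff)
  have pt: "e2ennreal (f x + ereal c) + e2ennreal (- f x) = e2ennreal (f x) + ennreal c" for x
  proof (cases "f x")
    case (real r)
    then have "- c \<le> r" using c(2)[of x] by simp
    then show ?thesis using real c(1) by (cases "0 \<le> r") (auto simp: e2ennreal_ereal ennreal_neg ennreal_plus[symmetric] simp del: ennreal_plus)
  qed (use c(2)[of x] in \<open>auto simp: e2ennreal_neg\<close>)
  let ?P = "\<integral>\<^sup>+x. e2ennreal (f x) \<partial>\<mu>" and ?N = "\<integral>\<^sup>+x. e2ennreal (- f x) \<partial>\<mu>" and ?Q = "\<integral>\<^sup>+x. e2ennreal (f x + ereal c) \<partial>\<mu>"
  have "?Q + ?N = (\<integral>\<^sup>+x. e2ennreal (f x + ereal c) + e2ennreal (- f x) \<partial>\<mu>)" by (rule nn_integral_add[symmetric]) auto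
  also have "\<dots> = ?P + ennreal c" unfolding pt by (subst nn_integral_add) (auto simp: emeasure_space_1)
  finally have eq: "?Q + ?N = ?P + ennreal c" .
  have "?N \<le> (\<integral>\<^sup>+x. ennreal c \<partial>\<mu>)"
  proof (rule nn_integral_mono)
    fix x
    have "- f x \<le> ereal c" using c(2)[of x] by (simp add: ereal_uminus_le_reorder)
    then show "e2ennreal (- f x) \<le> ennreal c" using e2ennreal_mono[of "- f x" "ereal c"] by (simp add: e2ennreal_ereal)
  qed
  then have "?N \<le> ennreal c" by (simp add: emeasure_space_1)
  then obtain n where n: "?N = ennreal n" "0 \<le> n" by (cases ?N rule: ennreal_cases) (auto simp: top_unique)
  show ?thesis
  proof (cases ?P rule: ennreal_cases)
    case (real p)
    then have "?Q \<noteq> top" using eq n c(1) by (auto simp: ennreal_plus[symmetric] simp del: ennreal_plus)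
    then obtain q where q: "?Q = ennreal q" "0 \<le> q" by (cases ?Q rule: ennreal_cases) auto
    have "q + n = p + c" using eq real n q c(1) by (simp add: ennreal_plus[symmetric] del: ennreal_plus)
    then have "p - n = q - c" by simp
    then show ?thesis unfolding eintegral_def using real n q by simp
  next
    case top
    then have "?Q = top" using eq n by (cases ?Q rule: ennreal_cases) (auto simp: ennreal_plus[symmetric] simp del: ennreal_plus)
    with top show ?thesis unfolding eintegral_def using n by (simp add: top_ennreal.rep_eq)
  qed
qed

lemma enn2ereal_minus_le_iff: "enn2ereal a - ereal c \<le> enn2ereal b - ereal c \<longleftrightarrow> a \<le> b"
  by (simp add: less_eq_ennreal.rep_eq minus_ereal_def ereal_add_le_add_iff2)

text \<open>Integrals of non-negative members lie in [0, \<infinity>], where they can be restricted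
  to cells, mixed and disintegrated without any \<open>\<infinity> - \<infinity>\<close>.\<close>

definition positive_part_order ::
    "('a::metric_space + 'b::metric_space \<Rightarrow> ereal) set \<Rightarrow> 'a measure \<Rightarrow> 'b measure \<Rightarrow> bool" where
  "positive_part_order A \<mu> \<nu> \<longleftrightarrow> (\<forall>\<phi>\<in>A. (\<forall>z. 0 \<le> \<phi> z) \<longrightarrow>
     (\<integral>\<^sup>+x. e2ennreal (\<phi> (Inl x)) \<partial>\<mu>) \<le> (\<integral>\<^sup>+y. e2ennreal (\<phi> (Inr y)) \<partial>\<nu>))"

lemma LSC_measurable:
  assumes "\<phi> \<in> LSC disjoint_union_topology"
  shows "(\<lambda>x. \<phi> (Inl x)) \<in> borel_measurable borel" "(\<lambda>y. \<phi> (Inr y)) \<in> borel_measurable borel"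
proof -
  have "open (Inl -` {z. a < \<phi> z})" "open (Inr -` {z. a < \<phi> z})" for a
    using assms by (auto simp: LSC_def lsc_def openin_disjoint_union_topology)
  then show "(\<lambda>x. \<phi> (Inl x)) \<in> borel_measurable borel" "(\<lambda>y. \<phi> (Inr y)) \<in> borel_measurable borel"
    by (auto intro!: borel_measurableI_greater borel_open simp: vimage_def)
qed

lemma balayage_coneD:
  assumes "balayage_cone W A"
  shows "A \<subseteq> LSC W"
    and "\<phi> \<in> A \<Longrightarrow> \<psi> \<in> A \<Longrightarrow> (\<lambda>z. \<phi> z + \<psi> z) \<in> A"
    and "\<phi> \<in> A \<Longrightarrow> 0 \<le> c \<Longrightarrow> (\<lambda>z. ereal c * \<phi> z) \<in> A"
    and "\<phi> \<in> A \<Longrightarrow> \<psi> \<in> A \<Longrightarrow> (\<lambda>z. max (\<phi> z) (\<psi> z)) \<in> A"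
    and "0 \<le> c \<Longrightarrow> (\<lambda>_. ereal c) \<in> A"
  using assms unfolding balayage_cone_def by simp_all

text \<open>Members are bounded below and non-negative constants belong to the cone, so adding a
  constant produces a non-negative member; the constant has the same integral against both
  probability measures.\<close>

lemma balayage_order_iff_positive:
  assumes A: "balayage_cone disjoint_union_topology A" and \<mu>: "\<mu> \<in> Prob" and \<nu>: "\<nu> \<in> Prob"
  shows "balayage_order A \<mu> \<nu> \<longleftrightarrow> positive_part_order A \<mu> \<nu>"
proof
  have ALSC: "A \<subseteq> LSC disjoint_union_topology" using A by (simp add: balayage_cone_def)
  note meas = LSC_measurable[OF subsetD[OF ALSC]]
  assume ord: "balayage_order A \<mu> \<nu>"
  show "positive_part_order A \<mu> \<nu>" unfolding positive_part_order_def
  proof (intro ballI impI)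
    fix \<phi> assume \<phi>: "\<phi> \<in> A" "\<forall>z. 0 \<le> \<phi> z"
    have z: "- ereal 0 \<le> \<phi> z" for z using \<phi>(2) by (simp add: zero_ereal_def[symmetric])
    have "eintegral \<mu> (\<lambda>x. \<phi> (Inl x)) \<le> eintegral \<nu> (\<lambda>y. \<phi> (Inr y))" using ord \<phi>(1) by (simp add: balayage_order_def)
    then show "(\<integral>\<^sup>+x. e2ennreal (\<phi> (Inl x)) \<partial>\<mu>) \<le> (\<integral>\<^sup>+y. e2ennreal (\<phi> (Inr y)) \<partial>\<nu>)"
      using eintegral_shift[OF \<mu> meas(1)[OF \<phi>(1)] order_refl z] eintegral_shift[OF \<nu> meas(2)[OF \<phi>(1)] order_refl z]
        enn2ereal_minus_le_iff[of _ 0] by simp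
  qed
next
  have ALSC: "A \<subseteq> LSC disjoint_union_topology" using A by (simp add: balayage_cone_def)
  note meas = LSC_measurable[OF subsetD[OF ALSC]]
  assume ord: "positive_part_order A \<mu> \<nu>"
  show "balayage_order A \<mu> \<nu>" unfolding balayage_order_def
  proof
    fix \<phi> assume \<phi>: "\<phi> \<in> A"
    obtain b :: real where b: "\<And>z. ereal b \<le> \<phi> z" using ALSC \<phi> by (auto simp: LSC_def)
    define c where "c = \<bar>b\<bar>"
    have c: "0 \<le> c" "- ereal c \<le> \<phi> z" for z
      using order_trans[OF _ b[of z], of "- ereal c"] by (auto simp: c_def)
    have mem: "(\<lambda>z. \<phi> z + ereal c) \<in> A"
      using balayage_coneD(2)[OF A \<phi> balayage_coneD(5)[OF A c(1)]] .
    have "0 \<le> \<phi> z + ereal c" for z using c(2)[of z] by (cases "\<phi> z") auto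
    then have nn: "\<forall>z. 0 \<le> \<phi> z + ereal c" ..
    have "(\<integral>\<^sup>+x. e2ennreal (\<phi> (Inl x) + ereal c) \<partial>\<mu>) \<le> (\<integral>\<^sup>+y. e2ennreal (\<phi> (Inr y) + ereal c) \<partial>\<nu>)"
      by (rule ord[unfolded positive_part_order_def, THEN bspec, OF mem, THEN mp, OF nn])
    then show "eintegral \<mu> (\<lambda>x. \<phi> (Inl x)) \<le> eintegral \<nu> (\<lambda>y. \<phi> (Inr y))"
      using eintegral_shift[OF \<mu> meas(1)[OF \<phi>] c(1) c(2)] eintegral_shift[OF \<nu> meas(2)[OF \<phi>] c(1) c(2)]
      by (simp add: enn2ereal_minus_le_iff)
  qed
qed

text \<open>Together with Strassen's theorem this puts every pair dominated by the hull operator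
  into a set defined by a balayage cone.\<close>

lemma kernel_positive_part_order:
  assumes ALSC: "A \<subseteq> LSC disjoint_union_topology" and \<mu>: "\<mu> \<in> Prob" and \<kappa>: "\<kappa> \<in> borel \<rightarrow>\<^sub>M prob_algebra borel"
    and AE: "AE x in \<mu>. positive_part_order A (return borel x) (\<kappa> x)"
  shows "positive_part_order A \<mu> (\<mu> \<bind> \<kappa>)"
  unfolding positive_part_order_def
proof (intro ballI impI)
  fix \<phi> assume \<phi>: "\<phi> \<in> A" "\<forall>z. 0 \<le> \<phi> z"
  note [measurable] = LSC_measurable[OF subsetD[OF ALSC \<phi>(1)]]
  have "(\<integral>\<^sup>+x. e2ennreal (\<phi> (Inl x)) \<partial>\<mu>) \<le> (\<integral>\<^sup>+x. \<integral>\<^sup>+y. e2ennreal (\<phi> (Inr y)) \<partial>\<kappa> x \<partial>\<mu>)"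
  proof (rule nn_integral_mono_AE)
    show "AE x in \<mu>. e2ennreal (\<phi> (Inl x)) \<le> (\<integral>\<^sup>+y. e2ennreal (\<phi> (Inr y)) \<partial>\<kappa> x)"
      using AE
    proof eventually_elim
      case (elim x)
      have "(\<integral>\<^sup>+z. e2ennreal (\<phi> (Inl z)) \<partial>return borel x) \<le> (\<integral>\<^sup>+y. e2ennreal (\<phi> (Inr y)) \<partial>\<kappa> x)"
        by (rule elim[unfolded positive_part_order_def, THEN bspec, OF \<phi>(1), THEN mp, OF \<phi>(2)])
      then show ?case by (subst (asm) nn_integral_return) auto
    qed
  qed
  also have "\<dots> = (\<integral>\<^sup>+y. e2ennreal (\<phi> (Inr y)) \<partial>(\<mu> \<bind> \<kappa>))"
    by (rule nn_integral_bind_Prob[OF \<mu> \<kappa>, symmetric]) simp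
  finally show "(\<integral>\<^sup>+x. e2ennreal (\<phi> (Inl x)) \<partial>\<mu>) \<le> (\<integral>\<^sup>+y. e2ennreal (\<phi> (Inr y)) \<partial>(\<mu> \<bind> \<kappa>))" .
qed

section \<open>Splitting along a finite partition\<close>

text \<open>Countable additivity is borrowed from \<open>M\<close>: by
  \<open>\<bar>l f\<bar> \<le> \<integral> \<bar>f\<bar> dM\<close> the error after finitely many
  sets is at most the \<open>M\<close>-measure of the rest. The functional acts on integrable
  functions because members of a balayage cone need not be continuous.\<close>

lemma L1_functional_measure:
  fixes M :: "'b measure"
  assumes M: "finite_measure M" "space M = UNIV"
    and lin: "linear_functional_on {f. integrable M f} l"
    and bound: "\<And>f. integrable M f \<Longrightarrow> (\<And>x. 0 \<le> f x) \<Longrightarrow> 0 \<le> l f \<and> l f \<le> (\<integral>x. f x \<partial>M)"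
  shows "\<exists>N. sets N = sets M \<and> finite_measure N \<and> (\<forall>f. integrable M f \<longrightarrow> integrable N f \<and> (\<integral>x. f x \<partial>N) = l f)"
proof -
  interpret finite_measure M by fact
  have V: "function_space {f. integrable M f}" by (auto simp: function_space_def)
  have l_add: "l (\<lambda>x. f x + g x) = l f + l g" if "integrable M f" "integrable M g" for f g
    using linear_functional_onD(1)[OF lin] that by simp
  have l_cmult: "l (\<lambda>x. c * f x) = c * l f" if "integrable M f" for f c
    using linear_functional_onD(2)[OF lin] that by simp
  have l_diff: "l (\<lambda>x. f x - g x) = l f - l g" if "integrable M f" "integrable M g" for f g
    using linear_functional_on_diff[OF V lin] that by simp
  have l_abs: "\<bar>l f\<bar> \<le> (\<integral>x. \<bar>f x\<bar> \<partial>M)" if f: "integrable M f" for f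
  proof -
    have a: "integrable M (\<lambda>x. \<bar>f x\<bar>)" using f by simp
    have "0 \<le> l (\<lambda>x. \<bar>f x\<bar> - f x)" "0 \<le> l (\<lambda>x. \<bar>f x\<bar> + f x)"
      using bound[of "\<lambda>x. \<bar>f x\<bar> - f x"] bound[of "\<lambda>x. \<bar>f x\<bar> + f x"] f a by (auto simp: abs_ge_minus_self)
    then have "\<bar>l f\<bar> \<le> l (\<lambda>x. \<bar>f x\<bar>)" using l_diff[OF a f] l_add[OF a f] by (simp add: abs_le_iff)
    also have "\<dots> \<le> (\<integral>x. \<bar>f x\<bar> \<partial>M)" using bound[OF a] by simp
    finally show ?thesis .
  qed
  have int_ind: "integrable M (indicator B :: 'b \<Rightarrow> real)" if "B \<in> sets M" for B
    by (rule integrable_real_indicator[OF that]) (simp add: less_top[symmetric])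
  have l_ind: "0 \<le> l (indicator B)" "l (indicator B) \<le> measure M B" if "B \<in> sets M" for B
    using bound[OF int_ind[OF that]] that M(2) by auto
  define N where "N = measure_of UNIV (sets M) (\<lambda>B. ennreal (l (indicator B)))"
  have sa: "sigma_algebra UNIV (sets M)" using sets.sigma_algebra_axioms[of M] M(2) by simp
  have sets_N: "sets N = sets M" unfolding N_def by (rule sigma_algebra.sets_measure_of_eq[OF sa])
  have em: "emeasure N B = ennreal (l (indicator B))" if "B \<in> sets M" for B
    unfolding N_def
  proof (rule emeasure_measure_of_sigma[OF sa _ _ that])
    have "l (indicator {}) = 0" using l_ind[of "{}"] by simp
    then show "positive (sets M) (\<lambda>B. ennreal (l (indicator B)))" by (simp add: positive_def)
    show "countably_additive (sets M) (\<lambda>B. ennreal (l (indicator B)))"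
    proof (rule countably_additiveI)
      fix B :: "nat \<Rightarrow> 'b set" assume B: "range B \<subseteq> sets M" "disjoint_family B" "(\<Union>i. B i) \<in> sets M"
      have Bi: "B i \<in> sets M" for i using B(1) by auto
      have int_sum: "integrable M (\<lambda>x. \<Sum>i<n. indicator (B i) x :: real)" for n using int_ind[OF Bi] by simp
      have l_sum: "l (\<lambda>x. \<Sum>i<n. indicator (B i) x) = (\<Sum>i<n. l (indicator (B i)))" for n
      proof (induction n)
        case 0 show ?case using l_cmult[of "\<lambda>_. 0" 0] by simp
      next
        case (Suc n) then show ?case using l_add[OF int_sum int_ind[OF Bi]] by simp
      qed
      have "\<bar>l (indicator (\<Union>i. B i)) - (\<Sum>i<n. l (indicator (B i)))\<bar> \<le> measure M (\<Union>i. B i) - (\<Sum>i<n. measure M (B i))" for n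
      proof -
        have le: "(\<Sum>i<n. indicator (B i) x) \<le> (indicator (\<Union>i. B i) x :: real)" for x
        proof -
          have "(\<Sum>i<n. indicator (B i) x) = (indicator (\<Union>i<n. B i) x :: real)"
            using disjoint_family_on_mono[OF _ B(2), of "{..<n}"] by (intro indicator_UN_disjoint[symmetric]) auto
          also have "\<dots> \<le> indicator (\<Union>i. B i) x" by (intro indicator_leI) auto
          finally show ?thesis .
        qed
        have "\<bar>l (\<lambda>x. indicator (\<Union>i. B i) x - (\<Sum>i<n. indicator (B i) x))\<bar> \<le> (\<integral>x. \<bar>indicator (\<Union>i. B i) x - (\<Sum>i<n. indicator (B i) x)\<bar> \<partial>M)"
          by (intro l_abs Bochner_Integration.integrable_diff int_sum int_ind B(3))
        also have "\<dots> = (\<integral>x. indicator (\<Union>i. B i) x - (\<Sum>i<n. indicator (B i) x) \<partial>M)" using le by simp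
        also have "\<dots> = measure M (\<Union>i. B i) - (\<Sum>i<n. measure M (B i))"
          using int_sum int_ind[OF Bi] int_ind[OF B(3)] M(2) by simp
        finally show ?thesis using l_diff[OF int_ind[OF B(3)] int_sum] by (simp add: l_sum)
      qed
      then have "\<forall>\<^sub>F n in sequentially. norm ((\<Sum>i<n. l (indicator (B i))) - l (indicator (\<Union>i. B i)))
          \<le> measure M (\<Union>i. B i) - (\<Sum>i<n. measure M (B i))"
        by (intro always_eventually allI) (simp only: real_norm_def abs_minus_commute)
      moreover have "(\<lambda>n. measure M (\<Union>i. B i) - (\<Sum>i<n. measure M (B i))) \<longlonglongrightarrow> measure M (\<Union>i. B i) - measure M (\<Union>i. B i)"
        using finite_measure_UNION[OF B(1,2)] by (intro tendsto_intros) (simp add: sums_def)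
      then have "(\<lambda>n. measure M (\<Union>i. B i) - (\<Sum>i<n. measure M (B i))) \<longlonglongrightarrow> 0" by simp
      ultimately have "(\<lambda>n. (\<Sum>i<n. l (indicator (B i))) - l (indicator (\<Union>i. B i))) \<longlonglongrightarrow> 0"
        by (rule Lim_null_comparison)
      then have "(\<lambda>i. l (indicator (B i))) sums l (indicator (\<Union>i. B i))"
        unfolding sums_def by (rule LIM_zero_cancel)
      then show "(\<Sum>i. ennreal (l (indicator (B i)))) = ennreal (l (indicator (\<Union>i. B i)))"
        using l_ind(1)[OF Bi] by (intro suminf_ennreal_eq) auto
    qed
  qed
  have le: "N \<le> M"
    unfolding le_measure[OF sets_N] using l_ind by (auto simp: em sets_N emeasure_eq_measure intro!: ennreal_leI)
  have fin: "finite_measure N"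
    using em[of UNIV] M(2) sets_eq_imp_space_eq[OF sets_N] sets.top[of M] by (intro finite_measureI) auto
  have int: "integrable N f" if f: "integrable M f" for f :: "'b \<Rightarrow> real"
  proof (rule integrableI_bounded)
    show "f \<in> borel_measurable N" using borel_measurable_integrable[OF f] by (simp add: measurable_cong_sets[OF sets_N refl])
    have "(\<integral>\<^sup>+x. ennreal (norm (f x)) \<partial>N) \<le> (\<integral>\<^sup>+x. ennreal (norm (f x)) \<partial>M)"
      using sets_N le by (rule nn_integral_mono_measure)
    also have "\<dots> < \<infinity>" using f by (simp add: integrable_iff_bounded)
    finally show "(\<integral>\<^sup>+x. ennreal (norm (f x)) \<partial>N) < \<infinity>" .
  qed
  have "(\<integral>x. f x \<partial>N) = l f" if "integrable M f" for f
    using that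
  proof (induction rule: integrable_induct)
    case (base A c)
    have "(\<integral>x. indicator A x *\<^sub>R c \<partial>N) = c * measure N A"
      using base(1) int[OF int_ind[OF base(1)]] sets_eq_imp_space_eq[OF sets_N] M(2) by (simp add: mult.commute)
    also have "measure N A = l (indicator A)" using em[OF base(1)] l_ind[OF base(1)] by (simp add: measure_def)
    also have "c * l (indicator A) = l (\<lambda>x. indicator A x *\<^sub>R c)" using l_cmult[OF int_ind[OF base(1)], of c] by (simp add: mult.commute)
    finally show ?case .
  next
    case (add f g)
    then show ?case by (simp add: int l_add)
  next
    case (lim f s)
    have [measurable]: "f \<in> borel_measurable M" "s i \<in> borel_measurable M" for i using lim by auto
    have dom: "integrable M (\<lambda>x. 2 * norm (f x))" using lim(4) by simp
    have "(\<lambda>i. \<integral>x. s i x \<partial>N) \<longlonglongrightarrow> (\<integral>x. f x \<partial>N)"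
      by (rule integral_dominated_convergence[where w="\<lambda>x. 2 * norm (f x)"])
         (use lim(2,3) int[OF dom] M(2) in \<open>auto simp: measurable_cong_sets[OF sets_N refl]\<close>)
    moreover have "(\<lambda>i. \<integral>x. s i x \<partial>N) \<longlonglongrightarrow> l f"
    proof -
      have "(\<lambda>i. \<integral>x. \<bar>s i x - f x\<bar> \<partial>M) \<longlonglongrightarrow> (\<integral>x. 0 \<partial>M)"
      proof (rule integral_dominated_convergence[where w="\<lambda>x. 3 * norm (f x)"])
        show "AE x in M. (\<lambda>i. \<bar>s i x - f x\<bar>) \<longlonglongrightarrow> 0"
          using lim(2) M(2) by (auto intro!: tendsto_rabs_zero simp: LIM_zero_iff)
        show "AE x in M. norm \<bar>s i x - f x\<bar> \<le> 3 * norm (f x)" for i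
        proof (rule AE_I2)
          fix x assume "x \<in> space M"
          then have "\<bar>s i x\<bar> \<le> 2 * \<bar>f x\<bar>" using lim(3) by simp
          then show "norm \<bar>s i x - f x\<bar> \<le> 3 * norm (f x)" using abs_triangle_ineq4[of "s i x" "f x"] by simp
        qed
      qed (use lim(4) in auto)
      then have "(\<lambda>i. \<integral>x. \<bar>s i x - f x\<bar> \<partial>M) \<longlonglongrightarrow> 0" by simp
      moreover have "\<forall>\<^sub>F i in sequentially. norm (l (s i) - l f) \<le> (\<integral>x. \<bar>s i x - f x\<bar> \<partial>M)"
        using l_abs[of "\<lambda>x. s _ x - f x"] l_diff[OF lim(1) lim(4)] lim(1,4) by (intro always_eventually) auto
      ultimately have "(\<lambda>i. l (s i) - l f) \<longlonglongrightarrow> 0" by (rule Lim_null_comparison[rotated])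
      then show ?thesis by (simp add: LIM_zero_iff lim(5))
    qed
    ultimately show ?case by (rule LIMSEQ_unique)
  qed
  with sets_N fin int show ?thesis by blast
qed

lemma integrable_Max:
  fixes f :: "'i \<Rightarrow> 'b \<Rightarrow> real"
  assumes "finite I" "I \<noteq> {}" "\<And>i. i \<in> I \<Longrightarrow> integrable M (f i)"
  shows "integrable M (\<lambda>y. Max ((\<lambda>i. f i y) ` I))"
  using assms
proof (induction rule: finite_ne_induct)
  case (insert i I)
  then show ?case by (simp add: integrable_max)
qed simp

text \<open>\<open>enn2real\<close> is monotone only below \<open>top\<close>, which it sends to
  0.\<close>

lemma enn2real_Max:
  assumes I: "finite I" "I \<noteq> {}" and fin: "\<And>i. i \<in> I \<Longrightarrow> v i < (top :: ennreal)"
  shows "Max ((\<lambda>i. enn2real (v i)) ` I) = enn2real (Max (v ` I))"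
proof (rule antisym)
  have fv: "finite (v ` I)" "v ` I \<noteq> {}" using I by auto
  have "Max (v ` I) \<in> v ` I" using fv by (rule Max_in)
  then obtain j where j: "j \<in> I" "Max (v ` I) = v j" by auto
  show "Max ((\<lambda>i. enn2real (v i)) ` I) \<le> enn2real (Max (v ` I))"
    using I fin[OF j(1)] Max_ge[OF fv(1)] by (auto simp: j(2)[symmetric] intro!: enn2real_mono) (simp add: j)
  show "enn2real (Max (v ` I)) \<le> Max ((\<lambda>i. enn2real (v i)) ` I)"
    using I j by (auto intro!: Max_ge)
qed

text \<open>The pairs of \<open>Q\<close> being stable under maxima makes the sublinear functional
  \<open>f \<mapsto> \<integral> max\<^sub>i f\<^sub>i dN\<close> dominate the constraints \<open>\<Sum>\<^sub>i \<integral>\<^sub>E\<^sub>i u\<^sub>i dM\<close>.\<close>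

lemma cone_splitting:
  fixes M :: "'a measure" and N :: "'b measure" and I :: "nat set" and Q :: "(('a \<Rightarrow> ennreal) \<times> ('b \<Rightarrow> ennreal)) set"
  assumes sp: "space M = UNIV" "space N = UNIV" and N: "finite_measure N"
    and I: "finite I" "I \<noteq> {}"
    and E: "\<And>i. i \<in> I \<Longrightarrow> E i \<in> sets M" "disjoint_family_on E I" "(\<Union>i\<in>I. E i) = UNIV"
    and Qm: "\<And>u v. (u, v) \<in> Q \<Longrightarrow> u \<in> borel_measurable M" "\<And>u v. (u, v) \<in> Q \<Longrightarrow> v \<in> borel_measurable N"
    and Qle: "\<And>u v. (u, v) \<in> Q \<Longrightarrow> (\<integral>\<^sup>+x. u x \<partial>M) \<le> (\<integral>\<^sup>+y. v y \<partial>N)"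
    and Qfin: "\<And>u v. (u, v) \<in> Q \<Longrightarrow> (\<integral>\<^sup>+y. v y \<partial>N) < top"
    and Qadd: "\<And>u v u' v'. (u, v) \<in> Q \<Longrightarrow> (u', v') \<in> Q \<Longrightarrow> ((\<lambda>x. u x + u' x), (\<lambda>y. v y + v' y)) \<in> Q"
    and Qmul: "\<And>u v c. (u, v) \<in> Q \<Longrightarrow> 0 \<le> c \<Longrightarrow> ((\<lambda>x. ennreal c * u x), (\<lambda>y. ennreal c * v y)) \<in> Q"
    and Qmax: "\<And>u v u' v'. (u, v) \<in> Q \<Longrightarrow> (u', v') \<in> Q \<Longrightarrow> ((\<lambda>x. max (u x) (u' x)), (\<lambda>y. max (v y) (v' y))) \<in> Q"
    and Q0: "((\<lambda>_. 0), (\<lambda>_. 0)) \<in> Q"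
  shows "\<exists>n. (\<forall>i\<in>I. sets (n i) = sets N \<and> finite_measure (n i) \<and>
      (\<forall>u v. (u, v) \<in> Q \<longrightarrow> (\<integral>\<^sup>+x\<in>E i. u x \<partial>M) \<le> (\<integral>\<^sup>+y. v y \<partial>n i))) \<and>
    (\<forall>f :: 'b \<Rightarrow> real. integrable N f \<longrightarrow> (\<Sum>i\<in>I. \<integral>y. f y \<partial>n i) = (\<integral>y. f y \<partial>N))"
proof -
  interpret N: finite_measure N by fact
  \<comment> \<open>A function on pairs encodes a family of integrands, one for each piece of
    \<open>N\<close> to be constructed.\<close>
  define V where "V = {f :: nat \<times> 'b \<Rightarrow> real. \<forall>i\<in>I. integrable N (\<lambda>y. f (i, y))}"
  have V: "function_space V" by (auto simp: function_space_def V_def)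
  define mx where "mx f y = Max ((\<lambda>i. f (i, y)) ` I)" for f :: "nat \<times> 'b \<Rightarrow> real" and y
  have mx_int: "integrable N (mx f)" if "f \<in> V" for f
    unfolding mx_def using that by (intro integrable_Max I) (auto simp: V_def)
  have mx_le: "mx f y \<le> c" if "\<And>i. i \<in> I \<Longrightarrow> f (i, y) \<le> c" for f y c
    unfolding mx_def using that I by (subst Max_le_iff) auto
  have mx_ge: "f (i, y) \<le> mx f y" if "i \<in> I" for f i y
    unfolding mx_def using that I by (intro Max_ge) auto
  define p where "p f = (\<integral>y. mx f y \<partial>N)" for f
  have p: "sublinear_on V p" unfolding sublinear_on_def
  proof (intro conjI ballI allI impI)
    fix f g assume fg: "f \<in> V" "g \<in> V"
    have "p (\<lambda>x. f x + g x) \<le> (\<integral>y. mx f y + mx g y \<partial>N)" unfolding p_def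
      using fg function_spaceD(2)[OF V fg]
      by (intro integral_mono Bochner_Integration.integrable_add mx_int) (auto intro!: mx_le add_mono mx_ge)
    then show "p (\<lambda>x. f x + g x) \<le> p f + p g" using fg by (simp add: p_def mx_int)
  next
    fix f and c :: real assume f: "f \<in> V" and c: "0 \<le> c"
    have "mx (\<lambda>x. c * f x) y = c * mx f y" for y
    proof (rule antisym)
      show "mx (\<lambda>x. c * f x) y \<le> c * mx f y" using c by (intro mx_le mult_left_mono mx_ge)
      have "mx f y \<in> (\<lambda>i. f (i, y)) ` I" unfolding mx_def using I by (intro Max_in) auto
      then obtain i where "i \<in> I" "mx f y = f (i, y)" by auto
      with mx_ge[of i "\<lambda>x. c * f x" y] show "c * mx f y \<le> mx (\<lambda>x. c * f x) y" by simp
    qed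
    then show "p (\<lambda>x. c * f x) = c * p f" by (simp add: p_def)
  qed
  have Qfin': "(\<integral>\<^sup>+x\<in>E i. u x \<partial>M) < top" if "(u, v) \<in> Q" for u v i
  proof -
    have "(\<integral>\<^sup>+x\<in>E i. u x \<partial>M) \<le> (\<integral>\<^sup>+x. u x \<partial>M)" by (intro nn_integral_mono) (auto simp: indicator_def)
    also have "\<dots> < top" using Qle[OF that] Qfin[OF that] by (rule le_less_trans)
    finally show ?thesis .
  qed
  have Qae: "AE y in N. v y < top" if "(u, v) \<in> Q" for u v
    using nn_integral_PInf_AE[OF Qm(2)[OF that]] Qfin[OF that] by (auto simp: less_top)
  \<comment> \<open>The second components of \<open>Q\<close> are finite only almost everywhere, so
    a real-valued \<open>w\<close> represents them through \<open>enn2real\<close> and up to null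
    sets.\<close>
  define rel where "rel w \<phi> \<longleftrightarrow> (\<forall>i\<in>I. (fst (\<phi> i), snd (\<phi> i)) \<in> Q) \<and> (\<forall>i\<in>I. AE y in N. w (i, y) = enn2real (snd (\<phi> i) y))"
    for w :: "nat \<times> 'b \<Rightarrow> real" and \<phi> :: "nat \<Rightarrow> ('a \<Rightarrow> ennreal) \<times> ('b \<Rightarrow> ennreal)"
  define val where "val \<phi> = (\<Sum>i\<in>I. enn2real (\<integral>\<^sup>+x\<in>E i. fst (\<phi> i) x \<partial>M))"
    for \<phi> :: "nat \<Rightarrow> ('a \<Rightarrow> ennreal) \<times> ('b \<Rightarrow> ennreal)"
  define C where "C = {(w, val \<phi>) | w \<phi>. w \<in> V \<and> rel w \<phi>}"
  have C1: "bound_cone C" unfolding bound_cone_def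
  proof (intro conjI allI impI)
    have "rel (\<lambda>_. 0) (\<lambda>_. (\<lambda>_. 0, \<lambda>_. 0))" using Q0 by (simp add: rel_def)
    then show "(\<lambda>_. 0, 0) \<in> C" unfolding C_def
      by (intro CollectI exI[of _ "\<lambda>_. 0"] exI[of _ "\<lambda>_. (\<lambda>_. 0, \<lambda>_. 0)"]) (auto simp: val_def V_def)
  next
    fix w b w' b' assume "(w, b) \<in> C" "(w', b') \<in> C"
    then obtain \<phi> \<phi>' where w: "w \<in> V" "rel w \<phi>" "b = val \<phi>" and w': "w' \<in> V" "rel w' \<phi>'" "b' = val \<phi>'" by (auto simp: C_def)
    define \<psi> where "\<psi> i = ((\<lambda>x. fst (\<phi> i) x + fst (\<phi>' i) x), (\<lambda>y. snd (\<phi> i) y + snd (\<phi>' i) y))" for i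
    have "rel (\<lambda>x. w x + w' x) \<psi>" unfolding rel_def
    proof (intro conjI ballI)
      fix i assume i: "i \<in> I"
      have q: "(fst (\<phi> i), snd (\<phi> i)) \<in> Q" "(fst (\<phi>' i), snd (\<phi>' i)) \<in> Q" using w w' i by (auto simp: rel_def)
      show "(fst (\<psi> i), snd (\<psi> i)) \<in> Q" using Qadd[OF q] by (simp add: \<psi>_def)
      have "AE y in N. w (i, y) = enn2real (snd (\<phi> i) y)" "AE y in N. w' (i, y) = enn2real (snd (\<phi>' i) y)"
        using w w' i by (auto simp: rel_def)
      with Qae[OF q(1)] Qae[OF q(2)] show "AE y in N. w (i, y) + w' (i, y) = enn2real (snd (\<psi> i) y)"
        by eventually_elim (simp add: \<psi>_def enn2real_plus)
    qed
    moreover have "val \<psi> = b + b'" unfolding w w' val_def sum.distrib[symmetric]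
    proof (intro sum.cong refl)
      fix i assume i: "i \<in> I"
      have q: "(fst (\<phi> i), snd (\<phi> i)) \<in> Q" "(fst (\<phi>' i), snd (\<phi>' i)) \<in> Q" using w w' i by (auto simp: rel_def)
      note [measurable] = Qm(1)[OF q(1)] Qm(1)[OF q(2)] E(1)[OF i]
      have "(\<integral>\<^sup>+x\<in>E i. fst (\<psi> i) x \<partial>M) = (\<integral>\<^sup>+x\<in>E i. fst (\<phi> i) x \<partial>M) + (\<integral>\<^sup>+x\<in>E i. fst (\<phi>' i) x \<partial>M)"
        by (subst nn_integral_add[symmetric]) (auto simp: \<psi>_def distrib_right)
      then show "enn2real (\<integral>\<^sup>+x\<in>E i. fst (\<psi> i) x \<partial>M) = enn2real (\<integral>\<^sup>+x\<in>E i. fst (\<phi> i) x \<partial>M) + enn2real (\<integral>\<^sup>+x\<in>E i. fst (\<phi>' i) x \<partial>M)"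
        using Qfin'[OF q(1)] Qfin'[OF q(2)] by (simp add: enn2real_plus)
    qed
    ultimately show "(\<lambda>x. w x + w' x, b + b') \<in> C"
      unfolding C_def using function_spaceD(2)[OF V w(1) w'(1)]
      by (intro CollectI exI[of _ "\<lambda>x. w x + w' x"] exI[of _ \<psi>]) auto
  next
    fix w b and c :: real assume c: "c \<ge> 0" and "(w, b) \<in> C"
    then obtain \<phi> where w: "w \<in> V" "rel w \<phi>" "b = val \<phi>" by (auto simp: C_def)
    define \<psi> where "\<psi> i = ((\<lambda>x. ennreal c * fst (\<phi> i) x), (\<lambda>y. ennreal c * snd (\<phi> i) y))" for i
    have "rel (\<lambda>x. c * w x) \<psi>" unfolding rel_def
    proof (intro conjI ballI)
      fix i assume i: "i \<in> I"
      have q: "(fst (\<phi> i), snd (\<phi> i)) \<in> Q" using w i by (auto simp: rel_def)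
      show "(fst (\<psi> i), snd (\<psi> i)) \<in> Q" using Qmul[OF q c] by (simp add: \<psi>_def)
      have "AE y in N. w (i, y) = enn2real (snd (\<phi> i) y)" using w i by (auto simp: rel_def)
      then show "AE y in N. c * w (i, y) = enn2real (snd (\<psi> i) y)"
        by eventually_elim (simp add: \<psi>_def enn2real_mult c)
    qed
    moreover have "val \<psi> = c * b" unfolding w val_def sum_distrib_left
    proof (intro sum.cong refl)
      fix i assume i: "i \<in> I"
      have q: "(fst (\<phi> i), snd (\<phi> i)) \<in> Q" using w i by (auto simp: rel_def)
      note [measurable] = Qm(1)[OF q] E(1)[OF i]
      have "(\<integral>\<^sup>+x\<in>E i. fst (\<psi> i) x \<partial>M) = ennreal c * (\<integral>\<^sup>+x\<in>E i. fst (\<phi> i) x \<partial>M)"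
        by (subst nn_integral_cmult[symmetric]) (auto simp: \<psi>_def mult.assoc)
      then show "enn2real (\<integral>\<^sup>+x\<in>E i. fst (\<psi> i) x \<partial>M) = c * enn2real (\<integral>\<^sup>+x\<in>E i. fst (\<phi> i) x \<partial>M)"
        using c by (simp add: enn2real_mult)
    qed
    ultimately show "(\<lambda>x. c * w x, c * b) \<in> C"
      unfolding C_def using function_spaceD(3)[OF V w(1), of c]
      by (intro CollectI exI[of _ "\<lambda>x. c * w x"] exI[of _ \<psi>]) auto
  qed
  have QMax: "((\<lambda>x. Max ((\<lambda>i. fst (\<phi> i) x) ` J)), (\<lambda>y. Max ((\<lambda>i. snd (\<phi> i) y) ` J))) \<in> Q"
    if "finite J" "J \<noteq> {}" "\<And>i. i \<in> J \<Longrightarrow> (fst (\<phi> i), snd (\<phi> i)) \<in> Q" for J \<phi>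
    using that
  proof (induction rule: finite_ne_induct)
    case (insert i J)
    then show ?case using Qmax[of "fst (\<phi> i)" "snd (\<phi> i)"] by simp
  qed simp
  \<comment> \<open>On \<open>E i\<close> the i-th first component is at most the maximum of all of
    them, and the cells partition the space, so the demands add up to at most the
    \<open>M\<close>-integral of the maximum. The componentwise maximum is again in
    \<open>Q\<close>, which bounds this by the \<open>N\<close>-integral of the maximum of the
    second components, the value of \<open>p\<close>.\<close>
  have C2: "\<forall>w b. (w, b) \<in> C \<longrightarrow> w \<in> V \<and> b \<le> p w"
  proof (intro allI impI)
    fix w b assume "(w, b) \<in> C"
    then obtain \<phi> where w: "w \<in> V" "rel w \<phi>" "b = val \<phi>" by (auto simp: C_def)
    have q: "(fst (\<phi> i), snd (\<phi> i)) \<in> Q" if "i \<in> I" for i using w that by (auto simp: rel_def)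
    define m1 where "m1 x = Max ((\<lambda>i. fst (\<phi> i) x) ` I)" for x
    define m2 where "m2 y = Max ((\<lambda>i. snd (\<phi> i) y) ` I)" for y
    have m: "(m1, m2) \<in> Q" unfolding m1_def m2_def using QMax[OF I q] .
    note [measurable] = Qm[OF m]
    have "(\<Sum>i\<in>I. \<integral>\<^sup>+x\<in>E i. fst (\<phi> i) x \<partial>M) \<le> (\<Sum>i\<in>I. \<integral>\<^sup>+x\<in>E i. m1 x \<partial>M)"
      using I by (intro sum_mono nn_integral_mono mult_right_mono) (auto simp: m1_def)
    also have "\<dots> = (\<integral>\<^sup>+x. (\<Sum>i\<in>I. m1 x * indicator (E i) x) \<partial>M)"
      by (rule nn_integral_sum[symmetric]) (use E(1) in auto)
    also have "\<dots> = (\<integral>\<^sup>+x. m1 x \<partial>M)"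
    proof (intro nn_integral_cong)
      fix x
      have "(\<Sum>i\<in>I. indicator (E i) x) = (indicator (\<Union>i\<in>I. E i) x :: ennreal)"
        using I(1) E(2) by (rule indicator_UN_disjoint[symmetric])
      then show "(\<Sum>i\<in>I. m1 x * indicator (E i) x) = m1 x" using E(3) by (simp add: sum_distrib_left[symmetric])
    qed
    also have "\<dots> \<le> (\<integral>\<^sup>+y. m2 y \<partial>N)" by (rule Qle[OF m])
    finally have le: "(\<Sum>i\<in>I. \<integral>\<^sup>+x\<in>E i. fst (\<phi> i) x \<partial>M) \<le> (\<integral>\<^sup>+y. m2 y \<partial>N)" .
    have "b = enn2real (\<Sum>i\<in>I. \<integral>\<^sup>+x\<in>E i. fst (\<phi> i) x \<partial>M)"
      unfolding w val_def using Qfin'[OF q] by (simp add: enn2real_sum)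
    also have "\<dots> \<le> enn2real (\<integral>\<^sup>+y. m2 y \<partial>N)" using le Qfin[OF m] by (rule enn2real_mono)
    also have "\<dots> = enn2real (\<integral>\<^sup>+y. ennreal (enn2real (m2 y)) \<partial>N)"
      using Qae[OF m] by (intro arg_cong[where f=enn2real] nn_integral_cong_AE) (auto elim!: eventually_mono)
    also have "\<dots> = (\<integral>y. enn2real (m2 y) \<partial>N)" by (rule integral_eq_nn_integral[symmetric]) auto
    also have "\<dots> = p w" unfolding p_def
    proof (rule integral_cong_AE)
      have "AE y in N. \<forall>i\<in>I. w (i, y) = enn2real (snd (\<phi> i) y)" using w I(1) by (intro AE_finite_allI) (auto simp: rel_def)
      moreover have "AE y in N. \<forall>i\<in>I. snd (\<phi> i) y < top" using I(1) Qae[OF q] by (intro AE_finite_allI) auto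
      ultimately show "AE y in N. enn2real (m2 y) = mx w y"
      proof eventually_elim
        case (elim y)
        have "mx w y = Max ((\<lambda>i. enn2real (snd (\<phi> i) y)) ` I)" unfolding mx_def using elim(1) by (intro arg_cong[where f=Max] image_cong) auto
        also have "\<dots> = enn2real (m2 y)" unfolding m2_def using elim(2) by (intro enn2real_Max I) auto
        finally show ?case by simp
      qed
    qed (use mx_int[OF w(1)] in auto)
    finally show "w \<in> V \<and> b \<le> p w" using w(1) by simp
  qed
  obtain L where L: "linear_functional_on V L" "\<forall>f\<in>V. L f \<le> p f" "\<forall>v b. (v, b) \<in> C \<longrightarrow> b \<le> L v"
    using Mazur_Orlicz[OF V p C1 C2] by blast
  define ins where "ins i f = (\<lambda>(j, y). if j = i then f y else 0 :: real)" for i :: nat and f :: "'b \<Rightarrow> real"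
  have insV: "ins i f \<in> V" if "integrable N f" for i f
  proof -
    have "integrable N (\<lambda>y. ins i f (j, y))" for j using that by (cases "j = i") (auto simp: ins_def)
    then show ?thesis by (simp add: V_def)
  qed
  have ins_add: "ins i (\<lambda>y. f y + g y) = (\<lambda>z. ins i f z + ins i g z)" for i f g by (auto simp: ins_def)
  have ins_mul: "ins i (\<lambda>y. c * f y) = (\<lambda>z. c * ins i f z)" for i f c by (auto simp: ins_def)
  define l where "l i f = L (ins i f)" for i f
  have L_nonpos: "L f \<le> 0" if "f \<in> V" "\<And>z. f z \<le> 0" for f
  proof -
    have "L f \<le> p f" using L(2) that(1) by blast
    also have "p f \<le> (\<integral>y. 0 \<partial>N)" unfolding p_def using that by (intro integral_mono mx_int mx_le) auto
    finally show ?thesis by simp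
  qed
  have l_nonneg: "0 \<le> l i f" if f: "integrable N f" "\<And>y. 0 \<le> f y" for i f
  proof -
    have "L (\<lambda>z. - ins i f z) \<le> 0"
      using f function_spaceD(4)[OF V insV[OF f(1)]] by (intro L_nonpos) (auto simp: ins_def)
    then show ?thesis using linear_functional_onD(3)[OF L(1) insV[OF f(1)]] by (simp add: l_def)
  qed
  have l_sum: "(\<Sum>i\<in>I. l i f) = (\<integral>y. f y \<partial>N)" if f: "integrable N f" for f :: "'b \<Rightarrow> real"
  proof -
    have sumV: "(\<lambda>z. \<Sum>i\<in>J. ins i g z) \<in> V \<and> (\<Sum>i\<in>J. l i g) = L (\<lambda>z. \<Sum>i\<in>J. ins i g z)" if "finite J" "integrable N g" for J g
      using that
    proof (induction J rule: finite_induct)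
      case empty
      then show ?case using linear_functional_onD(2)[OF L(1) function_spaceD(1)[OF V], of 0] function_spaceD(1)[OF V] by simp
    next
      case (insert i J)
      then show ?case
        using function_spaceD(2)[OF V insV[OF insert.prems, of i], of "\<lambda>z. \<Sum>i\<in>J. ins i g z"]
          linear_functional_onD(1)[OF L(1) insV[OF insert.prems, of i], of "\<lambda>z. \<Sum>i\<in>J. ins i g z"]
        by (simp add: l_def)
    qed
    \<comment> \<open>With the same \<open>g\<close> in every coordinate the maximum is
      \<open>g\<close> itself, so the pieces sum to at most the integral against \<open>N\<close>;
      the function \<open>- f\<close> supplies the reverse inequality.\<close>
    have le: "(\<Sum>i\<in>I. l i g) \<le> (\<integral>y. g y \<partial>N)" if g: "integrable N g" for g
    proof -
      have "(\<Sum>i\<in>I. l i g) = L (\<lambda>z. \<Sum>i\<in>I. ins i g z)" using sumV[OF I(1) g] by simp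
      also have "\<dots> \<le> p (\<lambda>z. \<Sum>i\<in>I. ins i g z)" using L(2) sumV[OF I(1) g] by blast
      also have "\<dots> \<le> (\<integral>y. g y \<partial>N)" unfolding p_def
      proof (intro integral_mono mx_int mx_le g)
        show "(\<lambda>z. \<Sum>i\<in>I. ins i g z) \<in> V" using sumV[OF I(1) g] by simp
        show "(\<Sum>i\<in>I. ins i g (j, y)) \<le> g y" if "j \<in> I" for j y
          using that I(1) by (simp add: ins_def)
      qed
      finally show ?thesis .
    qed
    have "l i (\<lambda>y. - f y) = - l i f" for i
      using linear_functional_onD(2)[OF L(1) insV[OF f], of "- 1" i] ins_mul[of i "- 1" f] by (simp add: l_def)
    then have "- (\<Sum>i\<in>I. l i f) \<le> - (\<integral>y. f y \<partial>N)" using le[of "\<lambda>y. - f y"] f by (simp add: sum_negf)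
    with le[OF f] show ?thesis by simp
  qed
  have "\<exists>n. sets n = sets N \<and> finite_measure n \<and> (\<forall>f :: 'b \<Rightarrow> real. integrable N f \<longrightarrow> integrable n f \<and> (\<integral>y. f y \<partial>n) = l i f)" if i: "i \<in> I" for i
  proof (rule L1_functional_measure[OF N sp(2)])
    show "linear_functional_on {f. integrable N f} (l i)"
      unfolding linear_functional_on_def l_def ins_add ins_mul
      using linear_functional_onD(1,2)[OF L(1)] insV by auto
    fix f :: "'b \<Rightarrow> real" assume f: "integrable N f" "\<And>y. 0 \<le> f y"
    have "l i f \<le> (\<Sum>i\<in>I. l i f)" using i I(1) l_nonneg[OF f] by (intro member_le_sum) auto
    with l_nonneg[OF f] l_sum[OF f(1)] show "0 \<le> l i f \<and> l i f \<le> (\<integral>y. f y \<partial>N)" by simp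
  qed
  then obtain n where n: "\<And>i. i \<in> I \<Longrightarrow> sets (n i) = sets N" "\<And>i. i \<in> I \<Longrightarrow> finite_measure (n i)"
    "\<And>i f. i \<in> I \<Longrightarrow> integrable N f \<Longrightarrow> integrable (n i) f \<and> (\<integral>y. f y \<partial>n i) = l i f" by metis
  have "(\<integral>\<^sup>+x\<in>E i. u x \<partial>M) \<le> (\<integral>\<^sup>+y. v y \<partial>n i)" if i: "i \<in> I" and uv: "(u, v) \<in> Q" for i u v
  proof -
    note [measurable] = Qm(2)[OF uv]
    define f where "f y = enn2real (v y)" for y
    have f0: "0 \<le> f y" for y by (simp add: f_def)
    have f: "integrable N f"
    proof (rule integrableI_bounded)
      have "(\<integral>\<^sup>+y. ennreal (norm (f y)) \<partial>N) \<le> (\<integral>\<^sup>+y. v y \<partial>N)"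
        by (intro nn_integral_mono) (simp add: f_def ennreal_enn2real_if)
      also have "\<dots> < \<infinity>" using Qfin[OF uv] by simp
      finally show "(\<integral>\<^sup>+y. ennreal (norm (f y)) \<partial>N) < \<infinity>" .
    qed (simp add: f_def[abs_def])
    define \<phi> where "\<phi> j = (if j = i then (u, v) else (\<lambda>_. 0, \<lambda>_. 0))" for j
    have "rel (ins i f) \<phi>" using uv Q0 by (auto simp: rel_def \<phi>_def ins_def f_def)
    moreover have "val \<phi> = enn2real (\<integral>\<^sup>+x\<in>E i. u x \<partial>M)"
    proof -
      have "val \<phi> = (\<Sum>j\<in>I. if j = i then enn2real (\<integral>\<^sup>+x\<in>E i. u x \<partial>M) else 0)"
        unfolding val_def by (intro sum.cong) (auto simp: \<phi>_def)
      then show ?thesis using i I(1) by simp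
    qed
    ultimately have "(ins i f, enn2real (\<integral>\<^sup>+x\<in>E i. u x \<partial>M)) \<in> C"
      unfolding C_def using insV[OF f, of i] by (intro CollectI exI[of _ "ins i f"] exI[of _ \<phi>]) auto
    then have "enn2real (\<integral>\<^sup>+x\<in>E i. u x \<partial>M) \<le> (\<integral>y. f y \<partial>n i)" using L(3) n(3)[OF i f] by (auto simp: l_def)
    then have "(\<integral>\<^sup>+x\<in>E i. u x \<partial>M) \<le> ennreal (\<integral>y. f y \<partial>n i)"
      using Qfin'[OF uv, of i] by (metis ennreal_enn2real ennreal_leI)
    also have "\<dots> = (\<integral>\<^sup>+y. ennreal (f y) \<partial>n i)"
      using n(3)[OF i f] f0 by (intro nn_integral_eq_integral[symmetric]) auto
    also have "\<dots> \<le> (\<integral>\<^sup>+y. v y \<partial>n i)"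
      by (intro nn_integral_mono) (simp add: f_def ennreal_enn2real_if)
    finally show ?thesis .
  qed
  moreover have "(\<Sum>i\<in>I. \<integral>y. f y \<partial>n i) = (\<integral>y. f y \<partial>N)" if f: "integrable N f" for f :: "'b \<Rightarrow> real"
    using n(3)[OF _ f] l_sum[OF f] by simp
  ultimately show ?thesis using n(1,2) by (intro exI[of _ n]) blast
qed

section \<open>Balayage orders are generated by the Dirac fibres\<close>

lemma e2ennreal_add:
  assumes "0 \<le> a" "0 \<le> b"
  shows "e2ennreal (a + b) = e2ennreal a + e2ennreal b"
  using assms by (cases a; cases b) (auto simp: e2ennreal_ereal)

lemma e2ennreal_cmult:
  assumes "0 \<le> a" "0 \<le> c"
  shows "e2ennreal (ereal c * a) = ennreal c * e2ennreal a"
  using assms by (cases a; cases "c = 0") (auto simp: e2ennreal_ereal ennreal_mult ennreal_mult_top)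

lemma e2ennreal_max: "e2ennreal (max a b) = max (e2ennreal a) (e2ennreal b)"
  by (rule max_of_mono[symmetric]) (auto intro: monoI e2ennreal_mono)

text \<open>Balls of radius \<open>r / 2\<close> made disjoint; the cells are numbered to fit the
  index set of \<open>cone_splitting\<close>.\<close>

lemma finite_fine_partition:
  assumes X: "compact (UNIV :: 'a::metric_space set)" and r: "r > 0"
  shows "\<exists>(I :: nat set) (E :: nat \<Rightarrow> 'a set). finite I \<and> I \<noteq> {} \<and> (\<forall>i. E i \<in> sets borel) \<and> disjoint_family E \<and>
    (\<Union>i\<in>I. E i) = UNIV \<and> (\<forall>i. \<forall>x\<in>E i. \<forall>y\<in>E i. dist x y \<le> r)"
proof -
  have "r / 2 > 0" using r by simp
  then obtain K :: "'a set" where K: "finite K" "UNIV \<subseteq> (\<Union>x\<in>K. ball x (r / 2))"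
    using seq_compact_imp_totally_bounded[OF compact_imp_seq_compact[OF X]] by blast
  obtain xs where xs: "set xs = K" using finite_list[OF K(1)] by blast
  define B where "B i = (if i < length xs then ball (xs ! i) (r / 2) else {})" for i
  define E where "E = disjointed B"
  have EB: "E i \<subseteq> B i" for i unfolding E_def by (rule disjointed_subset)
  have "range B \<subseteq> sets borel" by (auto simp: B_def)
  then have "range E \<subseteq> sets borel" unfolding E_def by (rule sets.range_disjointed_sets)
  then have "E i \<in> sets borel" for i by blast
  moreover have "disjoint_family E" unfolding E_def by (rule disjoint_family_disjointed)
  moreover have "(\<Union>i\<in>{..<length xs}. E i) = UNIV"
  proof -
    have "x \<in> (\<Union>i\<in>{..<length xs}. E i)" for x
    proof -
      have "x \<in> (\<Union>y\<in>set xs. ball y (r / 2))" using K(2) xs by blast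
      then obtain y where "y \<in> set xs" "x \<in> ball y (r / 2)" by blast
      then obtain j where "j < length xs" "x \<in> ball (xs ! j) (r / 2)" by (metis in_set_conv_nth)
      then have "x \<in> B j" by (simp add: B_def)
      then have "x \<in> (\<Union>i. E i)" unfolding E_def UN_disjointed_eq by blast
      then obtain i where i: "x \<in> E i" by blast
      then have "x \<in> B i" using EB by blast
      then have "i < length xs" by (auto simp: B_def split: if_splits)
      with i show ?thesis by blast
    qed
    then show ?thesis by blast
  qed
  moreover have "\<forall>x\<in>E i. \<forall>y\<in>E i. dist x y \<le> r" for i
  proof (intro ballI)
    fix x y assume "x \<in> E i" "y \<in> E i"
    then have "x \<in> B i" "y \<in> B i" using EB by auto
    then have "dist (xs ! i) x < r / 2" "dist (xs ! i) y < r / 2" by (auto simp: B_def split: if_splits)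
    then show "dist x y \<le> r" using dist_triangle[of x y "xs ! i"] by (simp add: dist_commute)
  qed
  moreover have "{..<length xs} \<noteq> {}"
  proof -
    have "K \<noteq> {}" using K(2) by auto
    then show ?thesis using xs by auto
  qed
  ultimately show ?thesis by (intro exI[of _ "{..<length xs}"] exI[of _ E]) auto
qed

text \<open>On a cell of positive measure, \<open>m\<close> is the normalised restriction of
  \<open>\<mu>\<close> and \<open>s\<close> the normalised piece of \<open>\<nu>\<close> that the
  splitting assigns to the cell; \<open>F\<close> is constant there with value
  \<open>\<integral> g ds\<close>. Summing over cells, \<open>F\<close> integrates against
  \<open>\<mu>\<close> as \<open>g\<close> does against \<open>\<nu>\<close>, while each of its
  values belongs to a first marginal concentrated near the point.\<close>

lemma balayage_local_pairs:
  fixes A :: "('a::metric_space + 'b::metric_space \<Rightarrow> ereal) set" and g :: "'b \<Rightarrow>\<^sub>C real"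
  assumes X: "compact (UNIV :: 'a set)" and A: "balayage_cone disjoint_union_topology A"
    and \<mu>: "\<mu> \<in> Prob" and \<nu>: "\<nu> \<in> Prob" and ord: "positive_part_order A \<mu> \<nu>" and r: "r > 0"
  shows "\<exists>F. F \<in> borel_measurable borel \<and> (\<forall>x. \<bar>F x\<bar> \<le> norm g) \<and> (\<integral>x. F x \<partial>\<mu>) = (\<integral>y. apply_bcontfun g y \<partial>\<nu>) \<and>
    (\<forall>x. F x = - norm g \<or> (\<exists>m s. m \<in> Prob \<and> s \<in> Prob \<and> F x = (\<integral>y. apply_bcontfun g y \<partial>s) \<and> (\<integral>y. dist x y \<partial>m) \<le> r \<and>
      (\<forall>e. 0 < e \<longrightarrow> e \<le> 1 \<longrightarrow> positive_part_order A (mixture e m \<mu>) (mixture e s \<nu>))))"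
proof -
  interpret \<mu>: prob_space \<mu> using \<mu> by (simp add: Prob_iff)
  interpret \<nu>: prob_space \<nu> using \<nu> by (simp add: Prob_iff)
  have s\<mu>[measurable_cong]: "sets \<mu> = sets borel" and s\<nu>[measurable_cong]: "sets \<nu> = sets borel"
    using \<mu> \<nu> by (auto simp: Prob_iff)
  have sp: "space \<mu> = UNIV" "space \<nu> = UNIV" using sets_eq_imp_space_eq[OF s\<mu>] sets_eq_imp_space_eq[OF s\<nu>] by auto
  obtain I :: "nat set" and E :: "nat \<Rightarrow> 'a set" where IE: "finite I \<and> I \<noteq> {} \<and> (\<forall>i. E i \<in> sets borel) \<and>
      disjoint_family E \<and> (\<Union>i\<in>I. E i) = UNIV \<and> (\<forall>i. \<forall>x\<in>E i. \<forall>y\<in>E i. dist x y \<le> r)"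
    using finite_fine_partition[OF X r] by (elim exE)
  have I: "finite I" "I \<noteq> {}" and E[measurable]: "E i \<in> sets borel" and dj: "disjoint_family E"
    and cov: "(\<Union>i\<in>I. E i) = UNIV" and diam: "x \<in> E i \<Longrightarrow> y \<in> E i \<Longrightarrow> dist x y \<le> r" for i x y
    using IE by simp_all
  define U where "U \<phi> x = e2ennreal (\<phi> (Inl x))" for \<phi> :: "'a + 'b \<Rightarrow> ereal" and x
  define W where "W \<phi> y = e2ennreal (\<phi> (Inr y))" for \<phi> :: "'a + 'b \<Rightarrow> ereal" and y
  define P where "P = {\<phi> \<in> A. \<forall>z. 0 \<le> \<phi> z}"
  have Um: "U \<phi> \<in> borel_measurable borel" and Wm: "W \<phi> \<in> borel_measurable borel" if "\<phi> \<in> P" for \<phi>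
    using LSC_measurable[OF subsetD[OF balayage_coneD(1)[OF A]], of \<phi>] that unfolding U_def W_def P_def by auto
  \<comment> \<open>The splitting works with integrable functions only; the members left out here
    return in \<open>mixed\<close>.\<close>
  define Q where "Q = {(U \<phi>, W \<phi>) | \<phi>. \<phi> \<in> P \<and> (\<integral>\<^sup>+y. W \<phi> y \<partial>\<nu>) < top}"
  have ordP: "(\<integral>\<^sup>+x. U \<phi> x \<partial>\<mu>) \<le> (\<integral>\<^sup>+y. W \<phi> y \<partial>\<nu>)" if "\<phi> \<in> P" for \<phi>
    using ord that unfolding positive_part_order_def U_def W_def P_def by blast
  have const: "(\<lambda>_. ereal c) \<in> P" if "0 \<le> c" for c
    using balayage_coneD(5)[OF A that] that by (simp add: P_def)
  have "\<exists>n. (\<forall>i\<in>I. sets (n i) = sets \<nu> \<and> finite_measure (n i) \<and>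
      (\<forall>u v. (u, v) \<in> Q \<longrightarrow> (\<integral>\<^sup>+x\<in>E i. u x \<partial>\<mu>) \<le> (\<integral>\<^sup>+y. v y \<partial>n i))) \<and>
    (\<forall>f :: 'b \<Rightarrow> real. integrable \<nu> f \<longrightarrow> (\<Sum>i\<in>I. \<integral>y. f y \<partial>n i) = (\<integral>y. f y \<partial>\<nu>))"
  proof (rule cone_splitting[OF sp \<nu>.finite_measure_axioms I _ _ cov])
    show "E i \<in> sets \<mu>" for i by (simp add: s\<mu>)
    show "disjoint_family_on E I" using dj by (rule disjoint_family_on_mono[rotated]) simp
    fix u :: "'a \<Rightarrow> ennreal" and v :: "'b \<Rightarrow> ennreal" assume "(u, v) \<in> Q"
    then obtain \<phi> where \<phi>: "u = U \<phi>" "v = W \<phi>" "\<phi> \<in> P" "(\<integral>\<^sup>+y. W \<phi> y \<partial>\<nu>) < top" by (auto simp: Q_def)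
    note [measurable] = Um[OF \<phi>(3)] Wm[OF \<phi>(3)]
    show "u \<in> borel_measurable \<mu>" "v \<in> borel_measurable \<nu>" by (simp_all add: \<phi>)
    show "(\<integral>\<^sup>+x. u x \<partial>\<mu>) \<le> (\<integral>\<^sup>+y. v y \<partial>\<nu>)" "(\<integral>\<^sup>+y. v y \<partial>\<nu>) < top" using ordP[OF \<phi>(3)] \<phi> by auto
    show "((\<lambda>x. ennreal c * u x), (\<lambda>y. ennreal c * v y)) \<in> Q" if c: "0 \<le> c" for c
    proof -
      define \<eta> where "\<eta> z = ereal c * \<phi> z" for z
      have \<eta>: "\<eta> \<in> P" using balayage_coneD(3)[OF A _ c, of \<phi>] \<phi>(3) c by (auto simp: P_def \<eta>_def[abs_def])
      have U\<eta>: "U \<eta> = (\<lambda>x. ennreal c * u x)" and W\<eta>: "W \<eta> = (\<lambda>y. ennreal c * v y)"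
        using \<phi>(3) c by (auto simp: U_def W_def \<eta>_def \<phi>(1,2) P_def e2ennreal_cmult fun_eq_iff)
      have "(\<integral>\<^sup>+y. W \<eta> y \<partial>\<nu>) < top" unfolding W\<eta> \<phi>(2) using \<phi>(4)
        by (subst nn_integral_cmult) (auto simp: ennreal_mult_less_top)
      with \<eta> show ?thesis unfolding Q_def U\<eta>[symmetric] W\<eta>[symmetric] by blast
    qed
    fix u' :: "'a \<Rightarrow> ennreal" and v' :: "'b \<Rightarrow> ennreal" assume "(u', v') \<in> Q"
    then obtain \<psi> where \<psi>: "u' = U \<psi>" "v' = W \<psi>" "\<psi> \<in> P" "(\<integral>\<^sup>+y. W \<psi> y \<partial>\<nu>) < top" by (auto simp: Q_def)
    note [measurable] = Um[OF \<psi>(3)] Wm[OF \<psi>(3)]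
    have fin: "(\<integral>\<^sup>+y. v y + v' y \<partial>\<nu>) < top" unfolding \<phi>(2) \<psi>(2)
      using \<phi>(4) \<psi>(4) by (subst nn_integral_add) (auto simp: ennreal_add_less_top)
    show "((\<lambda>x. u x + u' x), (\<lambda>y. v y + v' y)) \<in> Q"
    proof -
      define \<eta> where "\<eta> z = \<phi> z + \<psi> z" for z
      have \<eta>: "\<eta> \<in> P" using balayage_coneD(2)[OF A, of \<phi> \<psi>] \<phi>(3) \<psi>(3) by (auto simp: P_def \<eta>_def[abs_def])
      have U\<eta>: "U \<eta> = (\<lambda>x. u x + u' x)" and W\<eta>: "W \<eta> = (\<lambda>y. v y + v' y)"
        using \<phi>(3) \<psi>(3) by (auto simp: U_def W_def \<eta>_def \<phi>(1,2) \<psi>(1,2) P_def e2ennreal_add fun_eq_iff)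
      have "(\<integral>\<^sup>+y. W \<eta> y \<partial>\<nu>) < top" unfolding W\<eta> by (rule fin)
      with \<eta> show ?thesis unfolding Q_def U\<eta>[symmetric] W\<eta>[symmetric] by blast
    qed
    show "((\<lambda>x. max (u x) (u' x)), (\<lambda>y. max (v y) (v' y))) \<in> Q"
    proof -
      define \<eta> where "\<eta> z = max (\<phi> z) (\<psi> z)" for z
      have \<eta>: "\<eta> \<in> P" using balayage_coneD(4)[OF A, of \<phi> \<psi>] \<phi>(3) \<psi>(3) by (auto simp: P_def \<eta>_def[abs_def] le_max_iff_disj)
      have U\<eta>: "U \<eta> = (\<lambda>x. max (u x) (u' x))" and W\<eta>: "W \<eta> = (\<lambda>y. max (v y) (v' y))"
        by (auto simp: U_def W_def \<eta>_def \<phi>(1,2) \<psi>(1,2) e2ennreal_max fun_eq_iff)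
      have "(\<integral>\<^sup>+y. W \<eta> y \<partial>\<nu>) \<le> (\<integral>\<^sup>+y. v y + v' y \<partial>\<nu>)" unfolding W\<eta>
        by (intro nn_integral_mono) (auto simp: max_def)
      then have "(\<integral>\<^sup>+y. W \<eta> y \<partial>\<nu>) < top" using fin by (rule le_less_trans)
      with \<eta> show ?thesis unfolding Q_def U\<eta>[symmetric] W\<eta>[symmetric] by blast
    qed
  next
    have e: "U (\<lambda>_. ereal 0) = (\<lambda>_. 0)" "W (\<lambda>_. ereal 0) = (\<lambda>_. 0)" by (auto simp: U_def W_def e2ennreal_ereal)
    have "(U (\<lambda>_. ereal 0), W (\<lambda>_. ereal 0)) \<in> Q"
      unfolding Q_def using const[of 0] e(2) by (intro CollectI exI[of _ "\<lambda>_. ereal 0"]) (simp add: e)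
    then show "((\<lambda>_. 0), (\<lambda>_. 0)) \<in> Q" by (simp only: e)
  qed
  then obtain n where n0: "(\<forall>i\<in>I. sets (n i) = sets \<nu> \<and> finite_measure (n i) \<and>
      (\<forall>u v. (u, v) \<in> Q \<longrightarrow> (\<integral>\<^sup>+x\<in>E i. u x \<partial>\<mu>) \<le> (\<integral>\<^sup>+y. v y \<partial>n i))) \<and>
    (\<forall>f :: 'b \<Rightarrow> real. integrable \<nu> f \<longrightarrow> (\<Sum>i\<in>I. \<integral>y. f y \<partial>n i) = (\<integral>y. f y \<partial>\<nu>))" by (elim exE)
  have n: "i \<in> I \<Longrightarrow> sets (n i) = sets \<nu>" "i \<in> I \<Longrightarrow> finite_measure (n i)"
    "i \<in> I \<Longrightarrow> (u, v) \<in> Q \<Longrightarrow> (\<integral>\<^sup>+x\<in>E i. u x \<partial>\<mu>) \<le> (\<integral>\<^sup>+y. v y \<partial>n i)"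
    "integrable \<nu> f \<Longrightarrow> (\<Sum>i\<in>I. \<integral>y. f y \<partial>n i) = (\<integral>y. f y \<partial>\<nu>)" for i u v and f :: "'b \<Rightarrow> real"
    using n0 by simp_all
  have spn: "space (n i) = UNIV" if "i \<in> I" for i using sets_eq_imp_space_eq[OF n(1)[OF that]] sp by simp
  have snb: "sets (n i) = sets borel" if "i \<in> I" for i using n(1)[OF that] s\<nu> by simp
  define a where "a i = measure \<mu> (E i)" for i
  \<comment> \<open>The constant 1 gives each piece at least the mass of its cell. Both families
    have total mass 1, so the masses agree one by one.\<close>
  have mass: "measure (n i) UNIV = a i" if i: "i \<in> I" for i
  proof -
    have le: "a i \<le> measure (n i) UNIV" if i: "i \<in> I" for i
    proof -
      have e: "U (\<lambda>_. ereal 1) = (\<lambda>_. 1)" "W (\<lambda>_. ereal 1) = (\<lambda>_. 1)" by (auto simp: U_def W_def e2ennreal_ereal)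
      have "(U (\<lambda>_. ereal 1), W (\<lambda>_. ereal 1)) \<in> Q"
        unfolding Q_def using const[of 1] e(2) \<nu>.emeasure_space_1 by (intro CollectI exI[of _ "\<lambda>_. ereal 1"]) simp
      from n(3)[OF i this] have "emeasure \<mu> (E i) \<le> emeasure (n i) UNIV"
        using spn[OF i] by (simp add: e s\<mu>)
      then show ?thesis
        using finite_measure.emeasure_eq_measure[OF n(2)[OF i]] by (simp add: a_def \<mu>.emeasure_eq_measure)
    qed
    have "(\<Sum>i\<in>I. a i) = measure \<mu> (\<Union>i\<in>I. E i)" unfolding a_def
      using I(1) disjoint_family_on_mono[OF subset_UNIV dj] by (intro \<mu>.finite_measure_finite_Union[symmetric]) (auto simp: s\<mu>)
    then have sa: "(\<Sum>i\<in>I. a i) = 1" using cov \<mu>.prob_space sp by simp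
    have "(\<Sum>i\<in>I. measure (n i) UNIV) = (\<Sum>i\<in>I. \<integral>y. 1 \<partial>n i)" using spn by (intro sum.cong) auto
    also have "\<dots> = 1" using n(4)[of "\<lambda>_. 1"] \<nu>.prob_space by simp
    finally have "(\<Sum>i\<in>I. measure (n i) UNIV - a i) = 0" using sa by (simp add: sum_subtractf)
    then have "\<forall>i\<in>I. measure (n i) UNIV - a i = 0" using le I(1) by (subst (asm) sum_nonneg_eq_0_iff) auto
    with i show ?thesis by simp
  qed
  define m where "m i = density \<mu> (\<lambda>x. ennreal (indicator (E i) x / a i))" for i
  define s where "s i = density (n i) (\<lambda>_. ennreal (1 / a i))" for i
  have a0: "0 \<le> a i" for i by (simp add: a_def)
  have mP: "m i \<in> Prob" if "a i \<noteq> 0" for i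
  proof -
    have "emeasure (m i) UNIV = (\<integral>\<^sup>+x. ennreal (1 / a i) * indicator (E i) x \<partial>\<mu>)"
      unfolding m_def using sp by (subst emeasure_density) (auto intro!: nn_integral_cong simp: indicator_def)
    also have "\<dots> = ennreal (1 / a i) * ennreal (a i)"
      by (subst nn_integral_cmult_indicator) (auto simp: a_def \<mu>.emeasure_eq_measure s\<mu>)
    also have "\<dots> = 1" using that a0[of i] by (simp add: ennreal_mult[symmetric])
    finally show ?thesis using sp by (auto simp: Prob_iff m_def s\<mu> intro!: prob_spaceI)
  qed
  have sP: "s i \<in> Prob" if i: "i \<in> I" "a i \<noteq> 0" for i
  proof -
    have "emeasure (s i) UNIV = ennreal (1 / a i) * emeasure (n i) UNIV"
      unfolding s_def using spn[OF i(1)] sets.top[of "n i"] by (subst emeasure_density) auto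
    also have "\<dots> = 1" using finite_measure.emeasure_eq_measure[OF n(2)[OF i(1)]] mass[OF i(1)] i(2) a0[of i]
      by (simp add: ennreal_mult[symmetric])
    finally show ?thesis using spn[OF i(1)] snb[OF i(1)] by (auto simp: Prob_iff s_def intro!: prob_spaceI)
  qed
  have gm: "apply_bcontfun g \<in> borel_measurable (n i)" if "i \<in> I" for i
    using snb[OF that] bcontfun_measurable[of g] by (simp cong: measurable_cong_sets)
  have sg: "(\<integral>y. apply_bcontfun g y \<partial>s i) = (\<integral>y. apply_bcontfun g y \<partial>n i) / a i" if i: "i \<in> I" "a i \<noteq> 0" for i
    unfolding s_def using a0[of i] gm[OF i(1)] by (subst integral_density) auto
  have dm: "(\<integral>y. dist x y \<partial>m i) \<le> r" if i: "a i \<noteq> 0" "x \<in> E i" for i x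
  proof -
    interpret M: prob_space "m i" using mP[OF i(1)] by (simp add: Prob_iff)
    have [measurable]: "dist x \<in> borel_measurable borel" by (intro borel_measurable_continuous_onI continuous_intros)
    have AE: "AE y in m i. y \<in> E i" unfolding m_def by (subst AE_density) (auto simp: indicator_def)
    have AEr: "AE y in m i. dist x y \<le> r" using AE by eventually_elim (rule diam[OF i(2)])
    have "dist x \<in> bcontfun" by (intro bcontfun_compact[OF X] continuous_intros)
    then have "integrable (m i) (dist x)" using integrable_bcontfun[OF mP[OF i(1)], of "Bcontfun (dist x)"] by (simp add: Bcontfun_inverse)
    then have "(\<integral>y. dist x y \<partial>m i) \<le> (\<integral>y. r \<partial>m i)" using AEr by (intro integral_mono_AE) auto
    then show ?thesis by (simp add: M.prob_space)
  qed
  have mixed: "positive_part_order A (mixture e (m i) \<mu>) (mixture e (s i) \<nu>)" if i: "i \<in> I" "a i \<noteq> 0" and e: "0 < e" "e \<le> 1" for i e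
    unfolding positive_part_order_def
  proof (intro ballI impI)
    fix \<phi> assume "\<phi> \<in> A" "\<forall>z. 0 \<le> \<phi> z"
    then have \<phi>: "\<phi> \<in> P" by (simp add: P_def)
    note [measurable] = Um[OF \<phi>] Wm[OF \<phi>]
    have "(\<integral>\<^sup>+x. U \<phi> x \<partial>mixture e (m i) \<mu>) \<le> (\<integral>\<^sup>+y. W \<phi> y \<partial>mixture e (s i) \<nu>)"
    proof (cases "(\<integral>\<^sup>+y. W \<phi> y \<partial>\<nu>) < top")
      case True
      then have mem: "(U \<phi>, W \<phi>) \<in> Q" using \<phi> by (auto simp: Q_def)
      have "(\<integral>\<^sup>+x. U \<phi> x \<partial>m i) = ennreal (1 / a i) * (\<integral>\<^sup>+x\<in>E i. U \<phi> x \<partial>\<mu>)"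
        unfolding m_def
        by (subst nn_integral_density) (auto simp: nn_integral_cmult[symmetric] indicator_def intro!: nn_integral_cong)
      also have "\<dots> \<le> ennreal (1 / a i) * (\<integral>\<^sup>+y. W \<phi> y \<partial>n i)"
        by (intro mult_left_mono n(3)[OF i(1) mem]) simp
      also have "\<dots> = (\<integral>\<^sup>+y. W \<phi> y \<partial>s i)"
        unfolding s_def using snb[OF i(1)] Wm[OF \<phi>]
        by (subst nn_integral_density) (auto simp: nn_integral_cmult cong: measurable_cong_sets)
      finally have le: "(\<integral>\<^sup>+x. U \<phi> x \<partial>m i) \<le> (\<integral>\<^sup>+y. W \<phi> y \<partial>s i)" .
      show ?thesis
        using e le ordP[OF \<phi>] mP[OF i(2)] sP[OF i] \<mu> \<nu>
        by (simp add: nn_integral_mixture add_mono mult_left_mono)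
    next
      \<comment> \<open>The positive weight on \<open>\<nu>\<close> makes the right-hand side
        infinite.\<close>
      case False
      then have "(\<integral>\<^sup>+y. W \<phi> y \<partial>\<nu>) = top" by (simp add: not_less top_unique)
      then show ?thesis
        using e sP[OF i] \<nu> by (simp add: nn_integral_mixture ennreal_mult_top)
    qed
    then show "(\<integral>\<^sup>+x. e2ennreal (\<phi> (Inl x)) \<partial>mixture e (m i) \<mu>) \<le> (\<integral>\<^sup>+y. e2ennreal (\<phi> (Inr y)) \<partial>mixture e (s i) \<nu>)"
      by (simp add: U_def W_def)
  qed
  \<comment> \<open>A null cell carries no normalised pair. The default \<open>- norm g\<close>
    bounds all integrals of \<open>g\<close> from below, hence also the hull operator, so it cannot
    disturb an upper estimate of \<open>F\<close>.\<close>
  define c where "c i = (if a i = 0 then - norm g else (\<integral>y. apply_bcontfun g y \<partial>s i))" for i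
  define F where "F x = (\<Sum>i\<in>I. indicator (E i) x * c i)" for x
  have FE: "F x = c i" if i: "i \<in> I" "x \<in> E i" for x i
  proof -
    have "F x = (\<Sum>j\<in>I. if j = i then c i else 0)" unfolding F_def
      using dj i(2) by (intro sum.cong) (auto simp: disjoint_family_on_def indicator_def)
    then show ?thesis using i(1) I(1) by simp
  qed
  have ex: "\<exists>i\<in>I. x \<in> E i" for x using cov by auto
  show ?thesis
  proof (intro exI[of _ F] conjI allI)
    show "F \<in> borel_measurable borel" unfolding F_def by measurable
    show "\<bar>F x\<bar> \<le> norm g" for x
    proof -
      obtain i where i: "i \<in> I" "x \<in> E i" using ex by blast
      show ?thesis using abs_integral_bcontfun_le[OF sP[OF i(1)], of g] by (cases "a i = 0") (auto simp: FE[OF i] c_def)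
    qed
    have "(\<integral>x. F x \<partial>\<mu>) = (\<Sum>i\<in>I. a i * c i)"
      unfolding F_def a_def using sp by (subst Bochner_Integration.integral_sum) (auto simp: s\<mu> less_top[symmetric])
    also have "\<dots> = (\<Sum>i\<in>I. \<integral>y. apply_bcontfun g y \<partial>n i)"
    proof (intro sum.cong refl)
      fix i assume i: "i \<in> I"
      show "a i * c i = (\<integral>y. apply_bcontfun g y \<partial>n i)"
      proof (cases "a i = 0")
        case True
        then have "emeasure (n i) UNIV = 0"
          using mass[OF i] finite_measure.emeasure_eq_measure[OF n(2)[OF i], of UNIV] by simp
        then have "AE y in n i. apply_bcontfun g y = 0"
          using spn[OF i] sets.top[of "n i"] by (intro AE_I[of _ _ UNIV]) auto
        then have "(\<integral>y. apply_bcontfun g y \<partial>n i) = (\<integral>y. 0 \<partial>n i)" using gm[OF i] by (intro integral_cong_AE) auto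
        then show ?thesis using True by simp
      next
        case False
        then show ?thesis by (simp add: c_def sg[OF i])
      qed
    qed
    also have "\<dots> = (\<integral>y. apply_bcontfun g y \<partial>\<nu>)" by (rule n(4)[OF integrable_bcontfun[OF \<nu>]])
    finally show "(\<integral>x. F x \<partial>\<mu>) = (\<integral>y. apply_bcontfun g y \<partial>\<nu>)" .
    show "F x = - norm g \<or> (\<exists>m s. m \<in> Prob \<and> s \<in> Prob \<and> F x = (\<integral>y. apply_bcontfun g y \<partial>s) \<and> (\<integral>y. dist x y \<partial>m) \<le> r \<and>
      (\<forall>e. 0 < e \<longrightarrow> e \<le> 1 \<longrightarrow> positive_part_order A (mixture e m \<mu>) (mixture e s \<nu>)))" for x
    proof -
      obtain i where i: "i \<in> I" "x \<in> E i" using ex by blast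
      show ?thesis
      proof (cases "a i = 0")
        case True then show ?thesis by (simp add: FE[OF i] c_def)
      next
        case False
        then show ?thesis using mP[OF False] sP[OF i(1) False] dm[OF False i(2)] mixed[OF i(1) False]
          by (intro disjI2 exI[of _ "m i"] exI[of _ "s i"]) (simp add: FE[OF i] c_def)
      qed
    qed
  qed
qed

text \<open>Partitions of mesh \<open>1 / (n + 1)\<close> give functions \<open>F n\<close> whose
  \<open>\<mu>\<close>-integral is \<open>\<integral> g d\<nu>\<close>. The pairs behind
  \<open>F n x\<close> approach the fibre over \<open>x\<close>, which bounds the limit superior of
  \<open>F n x\<close> by the hull operator; dominated convergence then gives the inequality of
  integrals.\<close>

lemma balayage_pairs_dominated:
  fixes S :: "('a::metric_space measure \<times> 'b::metric_space measure) set"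
  assumes X: "compact (UNIV :: 'a set)" and S: "compactin (prod_topology weak_star weak_star) S"
    and std: "standard_set S" and A: "balayage_cone disjoint_union_topology A"
    and SA: "S = {(\<mu>, \<nu>) \<in> Prob \<times> Prob. balayage_order A \<mu> \<nu>}"
    and mem: "(\<mu>, \<nu>) \<in> S"
  shows "dominated (hull_operator S) \<mu> \<nu>"
  unfolding dominated_def
proof
  fix g :: "'b \<Rightarrow>\<^sub>C real"
  have SP: "S \<subseteq> Prob \<times> Prob" by (auto simp: SA)
  have memS: "(m, s) \<in> S" if "m \<in> Prob" "s \<in> Prob" "positive_part_order A m s" for m s
    using that balayage_order_iff_positive[OF A] by (auto simp: SA)
  have \<mu>: "\<mu> \<in> Prob" and \<nu>: "\<nu> \<in> Prob" and ord: "positive_part_order A \<mu> \<nu>"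
    using mem balayage_order_iff_positive[OF A] by (auto simp: SA)
  interpret \<mu>: prob_space \<mu> using \<mu> by (simp add: Prob_iff)
  have s\<mu>[measurable_cong]: "sets \<mu> = sets borel" using \<mu> by (simp add: Prob_iff)
  note h = sublinear_operator_hull[OF SP std X S]
  let ?h = "hull_operator S g"
  have "\<exists>F. F \<in> borel_measurable borel \<and> (\<forall>x. \<bar>F x\<bar> \<le> norm g) \<and> (\<integral>x. F x \<partial>\<mu>) = (\<integral>y. apply_bcontfun g y \<partial>\<nu>) \<and>
    (\<forall>x. F x = - norm g \<or> (\<exists>m s. m \<in> Prob \<and> s \<in> Prob \<and> F x = (\<integral>y. apply_bcontfun g y \<partial>s) \<and> (\<integral>y. dist x y \<partial>m) \<le> inverse (real (Suc n)) \<and>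
      (\<forall>e. 0 < e \<longrightarrow> e \<le> 1 \<longrightarrow> positive_part_order A (mixture e m \<mu>) (mixture e s \<nu>))))" for n
    by (rule balayage_local_pairs[OF X A \<mu> \<nu> ord]) simp
  then obtain F where Fm[measurable]: "\<And>n. F n \<in> borel_measurable borel" and Fb: "\<And>n x. \<bar>F n x\<bar> \<le> norm g"
    and FI: "\<And>n. (\<integral>x. F n x \<partial>\<mu>) = (\<integral>y. apply_bcontfun g y \<partial>\<nu>)"
    and Floc: "\<And>n x. F n x = - norm g \<or> (\<exists>m s. m \<in> Prob \<and> s \<in> Prob \<and> F n x = (\<integral>y. apply_bcontfun g y \<partial>s) \<and> (\<integral>y. dist x y \<partial>m) \<le> inverse (real (Suc n)) \<and>
      (\<forall>e. 0 < e \<longrightarrow> e \<le> 1 \<longrightarrow> positive_part_order A (mixture e m \<mu>) (mixture e s \<nu>)))"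
    by metis
  have [measurable]: "?h \<in> borel_measurable borel" by (rule operator_measurable[OF h])
  have hb: "\<bar>?h x\<bar> \<le> norm g" for x by (rule operator_abs_le[OF h])
  have upper: "\<forall>\<^sub>F n in sequentially. F n x \<le> b" if b: "?h x < b" for x b
  proof -
    have "(\<integral>y. apply_bcontfun g y \<partial>\<sigma>) < b" if "(return borel x, \<sigma>) \<in> S" for \<sigma>
      using hull_upper[OF SP std that, of g] b by simp
    from near_dirac[OF X SP S this] obtain e0 where e0: "e0 > 0"
      "\<And>m s. (m, s) \<in> S \<Longrightarrow> (\<integral>y. dist x y \<partial>m) \<le> e0 \<Longrightarrow> (\<integral>y. apply_bcontfun g y \<partial>s) < b" by blast
    \<comment> \<open>One half of the radius \<open>e0\<close> is for the mesh of the partition, the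
      other half for the share of \<open>\<mu>\<close> that is mixed in.\<close>
    obtain N where N: "inverse (real (Suc N)) < e0 / 2" using reals_Archimedean[of "e0 / 2"] e0(1) by auto
    have "F n x \<le> b" if n: "N \<le> n" for n
      using Floc[of n x]
    proof
      assume "F n x = - norm g"
      with hb[of x] b show ?thesis by (simp add: abs_le_iff)
    next
      assume "\<exists>m s. m \<in> Prob \<and> s \<in> Prob \<and> F n x = (\<integral>y. apply_bcontfun g y \<partial>s) \<and> (\<integral>y. dist x y \<partial>m) \<le> inverse (real (Suc n)) \<and>
        (\<forall>e. 0 < e \<longrightarrow> e \<le> 1 \<longrightarrow> positive_part_order A (mixture e m \<mu>) (mixture e s \<nu>))"
      then obtain m s where ms: "m \<in> Prob" "s \<in> Prob" "F n x = (\<integral>y. apply_bcontfun g y \<partial>s)"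
        "(\<integral>y. dist x y \<partial>m) \<le> inverse (real (Suc n))"
        "\<And>e. 0 < e \<Longrightarrow> e \<le> 1 \<Longrightarrow> positive_part_order A (mixture e m \<mu>) (mixture e s \<nu>)" by blast
      have "inverse (real (Suc n)) \<le> inverse (real (Suc N))" using n by (simp add: le_imp_inverse_le)
      then have dm: "(\<integral>y. dist x y \<partial>m) \<le> e0 / 2" using ms(4) N by linarith
      have dx: "dist x \<in> bcontfun" by (intro bcontfun_compact[OF X] continuous_intros)
      define d where "d = Bcontfun (dist x)"
      have ad: "apply_bcontfun d = dist x" unfolding d_def by (rule Bcontfun_inverse[OF dx])
      define k where "k = (\<integral>y. dist x y \<partial>\<mu>)"
      have k0: "0 \<le> k" unfolding k_def by (rule Bochner_Integration.integral_nonneg) simp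
      have lt: "(1 - e) * F n x + e * (\<integral>y. apply_bcontfun g y \<partial>\<nu>) < b" if e: "0 < e" "e \<le> 1" "e * k \<le> e0 / 2" for e
      proof -
        have "(mixture e m \<mu>, mixture e s \<nu>) \<in> S"
          using e ms \<mu> \<nu> by (intro memS mixture_Prob) auto
        moreover have "(\<integral>y. dist x y \<partial>mixture e m \<mu>) \<le> e0"
        proof -
          have "(\<integral>y. dist x y \<partial>mixture e m \<mu>) = (1 - e) * (\<integral>y. dist x y \<partial>m) + e * k"
            using integral_mixture[OF ms(1) \<mu> _ e(2) bcontfun_measurable abs_bcontfun_le, of d] e(1) by (simp add: ad k_def)
          also have "(1 - e) * (\<integral>y. dist x y \<partial>m) \<le> 1 * (\<integral>y. dist x y \<partial>m)"
            using e by (intro mult_right_mono Bochner_Integration.integral_nonneg) auto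
          finally show ?thesis using dm e(3) by simp
        qed
        ultimately have "(\<integral>y. apply_bcontfun g y \<partial>mixture e s \<nu>) < b" by (rule e0(2))
        then show ?thesis
          using integral_mixture[OF ms(2) \<nu> _ e(2) bcontfun_measurable abs_bcontfun_le, of g] e(1) by (simp add: ms(3))
      qed
      \<comment> \<open>Only the mixed pairs are known to belong to \<open>S\<close>, so the bound
        for \<open>F n x\<close> itself is reached by letting the weight \<open>e\<close> tend to
        0.\<close>
      show "F n x \<le> b"
      proof (rule tendsto_upperbound)
        have "((\<lambda>e. (1 - e) * F n x + e * (\<integral>y. apply_bcontfun g y \<partial>\<nu>)) \<longlongrightarrow> (1 - 0) * F n x + 0 * (\<integral>y. apply_bcontfun g y \<partial>\<nu>)) (at_right 0)"
          by (intro tendsto_intros)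
        then show "((\<lambda>e. (1 - e) * F n x + e * (\<integral>y. apply_bcontfun g y \<partial>\<nu>)) \<longlongrightarrow> F n x) (at_right 0)" by simp
        \<comment> \<open>Ensures \<open>e * k \<le> e0 / 2\<close> for \<open>e < e1\<close>;
          adding 1 covers \<open>k = 0\<close>.\<close>
        define e1 where "e1 = min 1 (e0 / (2 * (k + 1)))"
        have e1: "0 < e1" "e1 \<le> 1" using e0(1) k0 by (auto simp: e1_def)
        have "\<forall>\<^sub>F e in at_right 0. e \<in> {0<..<e1}" using e1(1) by (rule eventually_at_right_real)
        then show "\<forall>\<^sub>F e in at_right 0. (1 - e) * F n x + e * (\<integral>y. apply_bcontfun g y \<partial>\<nu>) \<le> b"
        proof eventually_elim
          case (elim e)
          have "e * k \<le> e0 / (2 * (k + 1)) * (k + 1)"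
            using elim k0 by (intro mult_mono) (auto simp: e1_def)
          also have "\<dots> = e0 / 2" using k0 by (simp add: field_simps)
          finally have "e * k \<le> e0 / 2" .
          then show ?case using elim e1(2) by (intro less_imp_le[OF lt]) auto
        qed
      qed simp
    qed
    then show ?thesis by (auto simp: eventually_sequentially)
  qed
  \<comment> \<open>\<open>F n\<close> is controlled from above only and need not converge. Its
    maximum with the hull operator converges and still dominates it.\<close>
  have lim: "(\<lambda>n. max (F n x) (?h x)) \<longlonglongrightarrow> ?h x" for x
  proof (rule order_tendstoI)
    fix b assume "b < ?h x"
    then show "\<forall>\<^sub>F n in sequentially. b < max (F n x) (?h x)" by (intro always_eventually) (simp add: less_max_iff_disj)
  next
    fix b assume b: "?h x < b"
    then obtain c where c: "?h x < c" "c < b" using dense by blast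
    from upper[OF c(1)] show "\<forall>\<^sub>F n in sequentially. max (F n x) (?h x) < b"
      by eventually_elim (use c in auto)
  qed
  have mb: "\<bar>max (F n x) (?h x)\<bar> \<le> norm g" for n x
    using Fb[of n x] hb[of x] by (auto simp: max_def)
  have "(\<lambda>n. \<integral>x. max (F n x) (?h x) \<partial>\<mu>) \<longlonglongrightarrow> (\<integral>x. ?h x \<partial>\<mu>)"
    by (rule integral_dominated_convergence[where w="\<lambda>_. norm g"]) (auto intro!: lim simp: mb)
  moreover have "(\<integral>y. apply_bcontfun g y \<partial>\<nu>) \<le> (\<integral>x. max (F n x) (?h x) \<partial>\<mu>)" for n
    unfolding FI[of n, symmetric]
    by (intro integral_mono integrable_Prob_bounded[OF \<mu> _ Fb] integrable_Prob_bounded[OF \<mu> _ mb]) auto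
  ultimately show "(\<integral>y. apply_bcontfun g y \<partial>\<nu>) \<le> (\<integral>x. ?h x \<partial>\<mu>)"
    by (intro LIMSEQ_le_const) auto
qed

section \<open>The equivalences\<close>

theorem theorem1p5:
  fixes S :: "('a::metric_space measure \<times> 'b::metric_space measure) set"
  assumes "compact (UNIV :: 'a set)" and "compact (UNIV :: 'b set)"
    and "S \<subseteq> Prob \<times> Prob"
    and "compactin (prod_topology weak_star weak_star) S"
    and "convex_measures S"
  shows "(gambling_house S \<longleftrightarrow>
            standard_set S \<and> backward_transfer_set S) \<and>
         (gambling_house S \<longleftrightarrow>
            standard_set S \<and>
            (\<exists>A. balayage_cone disjoint_union_topology A \<and>
                 S = {(\<mu>, \<nu>) \<in> Prob \<times> Prob. balayage_order A \<mu> \<nu>})) \<and>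
         (gambling_house S \<longleftrightarrow>
            standard_set S \<and>
            (\<forall>\<mu>\<in>Prob. \<forall>\<nu>\<in>Prob. (\<mu>, \<nu>) \<in> S \<longleftrightarrow>
               (\<exists>\<pi>\<in>couplings \<mu> \<nu>. \<exists>\<kappa>. disintegration \<pi> \<mu> \<kappa> \<and>
                  (AE x in \<mu>. (return borel x, \<kappa> x) \<in> S)))) \<and>
         (gambling_house S \<longleftrightarrow>
            (\<exists>T. backward_Kantorovich_operator T \<and> positively_1_homogenous T \<and>
                 S = {(\<mu>, \<nu>) \<in> Prob \<times> Prob. dominated_by_push T \<mu> \<nu>}))"
proof -
  note X = assms(1) and Y = assms(2) and SP = assms(3) and S = assms(4,5)
  \<comment> \<open>The hub of the equivalences; the cone and the disintegration conditions are each
    compared with it.\<close>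
  let ?op = "\<exists>t. sublinear_operator t \<and> S = dominated_pairs t"
  have from_op: "gambling_house S" if "sublinear_operator t" "S = dominated_pairs t" for t
    by (rule dominated_pairs_gambling_house[OF Y that S])
  have hull: "sublinear_operator (hull_operator S)" if "standard_set S"
    by (rule sublinear_operator_hull[OF SP that X S(1)])
  have house: "gambling_house S \<longleftrightarrow> ?op"
    using from_op gambling_house_dominated_pairs[OF X SP S] hull unfolding gambling_house_def by blast
  \<comment> \<open>For a standard compact convex set the hull operator is the natural candidate,
    and it always reproduces the fibres over Dirac measures; what remains in each case is to pass
    from these fibres to all pairs.\<close>
  have fibres: "(return borel x, \<sigma>) \<in> S \<longleftrightarrow> (return borel x, \<sigma>) \<in> dominated_pairs (hull_operator S)" if "standard_set S" for x \<sigma>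
    using dominated_hull_return[OF SP that X S] SP by (auto simp: dominated_pairs_iff return_Prob)
  have strassen: "(\<mu>, \<nu>) \<in> dominated_pairs t \<longleftrightarrow> (\<exists>\<pi>\<in>couplings \<mu> \<nu>. \<exists>\<kappa>. disintegration \<pi> \<mu> \<kappa> \<and>
      (AE x in \<mu>. (return borel x, \<kappa> x) \<in> dominated_pairs t))"
    if "sublinear_operator t" "\<mu> \<in> Prob" "\<nu> \<in> Prob" for \<mu> :: "'a measure" and \<nu> :: "'b measure" and t
    using Strassen[OF X Y that(1)] coupling_dominated[OF that] by blast
  have balayage: "gambling_house S \<longleftrightarrow> standard_set S \<and> (\<exists>A. balayage_cone disjoint_union_topology A \<and>
      S = {(\<mu>, \<nu>) \<in> Prob \<times> Prob. balayage_order A \<mu> \<nu>})"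
  proof
    assume gh: "gambling_house S"
    then obtain t where t: "sublinear_operator t" "S = dominated_pairs t" using house by blast
    have "S = {(\<mu>, \<nu>) \<in> Prob \<times> Prob. balayage_order (operator_cone t) \<mu> \<nu>}"
      unfolding t(2) dominated_pairs_def using operator_cone_order[OF Y t(1)] by auto
    then show "standard_set S \<and> (\<exists>A. balayage_cone disjoint_union_topology A \<and>
      S = {(\<mu>, \<nu>) \<in> Prob \<times> Prob. balayage_order A \<mu> \<nu>})"
      using gh operator_cone_balayage[OF Y t(1)] unfolding gambling_house_def by blast
  next
    assume "standard_set S \<and> (\<exists>A. balayage_cone disjoint_union_topology A \<and>
      S = {(\<mu>, \<nu>) \<in> Prob \<times> Prob. balayage_order A \<mu> \<nu>})"
    then obtain A where std: "standard_set S" and A: "balayage_cone disjoint_union_topology A"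
      and SA: "S = {(\<mu>, \<nu>) \<in> Prob \<times> Prob. balayage_order A \<mu> \<nu>}" by blast
    have mem: "(\<mu>, \<nu>) \<in> S \<longleftrightarrow> positive_part_order A \<mu> \<nu>" if "\<mu> \<in> Prob" "\<nu> \<in> Prob" for \<mu> \<nu>
    proof -
      have "(\<mu>, \<nu>) \<in> S \<longleftrightarrow> balayage_order A \<mu> \<nu>" by (subst SA) (use that in simp)
      then show ?thesis using balayage_order_iff_positive[OF A that] by simp
    qed
    \<comment> \<open>A dominated pair has a kernel with values in the Dirac fibres of
      \<open>S\<close>. These respect the cone, and so does the pair obtained by integrating the
      kernel.\<close>
    have "(\<mu>, \<nu>) \<in> S" if dom: "(\<mu>, \<nu>) \<in> dominated_pairs (hull_operator S)" for \<mu> \<nu>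
    proof -
      have P: "\<mu> \<in> Prob" "\<nu> \<in> Prob" using dom by (auto simp: dominated_pairs_iff)
      obtain \<pi> \<kappa> where \<pi>: "\<pi> \<in> couplings \<mu> \<nu>" "disintegration \<pi> \<mu> \<kappa>"
        "AE x in \<mu>. (return borel x, \<kappa> x) \<in> dominated_pairs (hull_operator S)"
        using Strassen[OF X Y hull[OF std] dom] by blast
      have \<kappa>: "\<kappa> \<in> borel \<rightarrow>\<^sub>M prob_algebra borel" using \<pi>(2) by (simp add: disintegration_def)
      have "AE x in \<mu>. positive_part_order A (return borel x) (\<kappa> x)"
        using \<pi>(3)
      proof eventually_elim
        case (elim x)
        then have "(return borel x, \<kappa> x) \<in> S" using fibres[OF std] by blast
        then show ?case using mem[OF return_Prob measurable_space[OF \<kappa>]] by simp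
      qed
      then have "positive_part_order A \<mu> (\<mu> \<bind> \<kappa>)"
        by (rule kernel_positive_part_order[OF balayage_coneD(1)[OF A] P(1) \<kappa>])
      then show ?thesis using mem[OF P] coupling_bind[OF \<pi>(1) P \<pi>(2)] by simp
    qed
    moreover have "(\<mu>, \<nu>) \<in> dominated_pairs (hull_operator S)" if "(\<mu>, \<nu>) \<in> S" for \<mu> \<nu>
      using balayage_pairs_dominated[OF X S(1) std A SA that] that SP by (auto simp: dominated_pairs_iff)
    ultimately have "S = dominated_pairs (hull_operator S)" by auto
    then show "gambling_house S" using hull[OF std] from_op by blast
  qed
  have disint: "gambling_house S \<longleftrightarrow> standard_set S \<and>
      (\<forall>\<mu>\<in>Prob. \<forall>\<nu>\<in>Prob. (\<mu>, \<nu>) \<in> S \<longleftrightarrow>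
         (\<exists>\<pi>\<in>couplings \<mu> \<nu>. \<exists>\<kappa>. disintegration \<pi> \<mu> \<kappa> \<and> (AE x in \<mu>. (return borel x, \<kappa> x) \<in> S)))"
    (is "_ \<longleftrightarrow> _ \<and> ?dis")
  proof
    assume gh: "gambling_house S"
    then obtain t where t: "sublinear_operator t" "S = dominated_pairs t" using house by blast
    have ?dis using strassen[OF t(1)] unfolding t(2) by blast
    with gh show "standard_set S \<and> ?dis" by (simp add: gambling_house_def)
  next
    assume *: "standard_set S \<and> ?dis"
    then have std: "standard_set S" and dis: ?dis by blast+
    \<comment> \<open>Both sets are generated by their Dirac fibres, \<open>S\<close> by assumption
      and the dominated pairs by Strassen's theorem, and the fibres coincide.\<close>
    have "(\<mu>, \<nu>) \<in> S \<longleftrightarrow> (\<mu>, \<nu>) \<in> dominated_pairs (hull_operator S)" if P: "\<mu> \<in> Prob" "\<nu> \<in> Prob" for \<mu> \<nu>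
      unfolding dis[rule_format, OF P] strassen[OF hull[OF std] P] fibres[OF std] ..
    then have "S = dominated_pairs (hull_operator S)"
      using SP by (auto simp: dominated_pairs_iff)
    then show "gambling_house S" using hull[OF std] from_op by blast
  qed
  show ?thesis
    unfolding Kantorovich_pairs_iff using balayage disint house by (auto simp: gambling_house_def)
qed

end
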